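(* Let $L,T>0$, let $\bar\mu_\pm\in\mathcal M^+(Q_L)$ with $\bar\mu_+(Q_L)=\bar\mu_-(Q_L)$, and let $\mu$ be a minimizer of $I$ among all $\nu\in\mathcal A^*_{L,T}$ with $\nu_{\pm T}=\bar\mu_\pm$. Let $\bar x_3\in(-T,T)$, and let $x_1=(X_1,\bar x_3)$, $x_2=(X_2,\bar x_3)$ be two points in the plane $\{x_3=\bar x_3\}$. Let $\mu_1$ and $\mu_2$ be subsystems of $\mu$ emanating from $x_1$ and $x_2$ respectively. Let $x_+=(X_+,z_+)$ and $x_-=(X_-,z_-)$ be points with $-T\le z_-<\bar x_3<z_+\le T$, such that the slices $\mu_{1,z_+}$ and $\mu_{2,z_+}$ both have Diracs at $X_+$ (with nonzero mass), and $\mu_{1,z_-}$ and $\mu_{2,z_-}$ both have Diracs at $X_-$ (with nonzero mass). Then $X_1=X_2$.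
   Context: Notation. $Q_L:=(-\frac L2,\frac L2)^2$, $Q_{L,T}:=Q_L\times(-T,T)$, $x=(x',x_3)$. Everything is $Q_L$-periodic in $x'$, i.e. $Q_L$ is identified with the torus $\mathbb R^2/L\mathbb Z^2$. $\mathcal M^+$ denotes finite positive Radon measures and $\mathcal M(\cdot;\mathbb R^2)$ finite vector-valued Radon measures. Differential equations for measures are understood distributionally in $Q_{L,T}$, periodically in $x'$. $\mathcal A_{L,T}$ is the set of pairs $\mu\in\mathcal M^+(Q_{L,T})$, $m\in\mathcal M(Q_{L,T};\mathbb R^2)$ with $m\ll\mu$, $\partial_3\mu+\mathrm{div}'m=0$ in $Q_{L,T}$, and $\mu=\mu_{x_3}\otimes dx_3$ where for a.e. $x_3\in(-T,T)$, $\mu_{x_3}=\sum_i\varphi_i\delta_{X_i}$ (at most countable, $\varphi_i>0$, $X_i\in Q_L$). $\mathcal A^*_{L,T}:=\{\mu:\exists m,\ (\mu,m)\in\mathcal A_{L,T}\}$. With $K_*:=\frac{8\sqrt\pi}3$ and $\mu_{x_3}(x'):=\mu_{x_3}(\{x'\})$, $$I(\mu,m):=\frac{K_*}{L^2}\int_{-T}^T\sum_{x'\in Q_L}(\mu_{x_3}(x'))^{1/2}dx_3+\frac1{L^2}\int_{Q_{L,T}}\left|\frac{dm}{d\mu}\right|^2d\mu,\qquad I(\mu):=\min\{I(\mu,m):\ m\ll\mu,\ \partial_3\mu+\mathrm{div}'m=0\}.$$ The infimum of $I$ under the given boundary conditions is finite. When $I(\mu)<\infty$ the minimizing $m$ is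 unique and the map $x_3\mapsto\mu_{x_3}$ has a weakly continuous representative on $[-T,T]$ (likewise for subsystems), which is always used; slices $\mu_{x_3}$ and traces $\mu_{\pm T}$ are thus defined. Subsystem: if $I(\mu)<\infty$ and $m$ is the optimal measure for $\mu$, a subsystem of $\mu$ emanating from $(X,\bar x_3)$ is a measure $\tilde\mu\in\mathcal A^*_{L,T}$ such that $\mu-\tilde\mu$ is a positive measure, $\tilde\mu_{\bar x_3}=a\,\delta_X$ with $a=\mu_{\bar x_3}(X)$, and $\partial_3\tilde\mu+\mathrm{div}'\big(\frac{dm}{d\mu}\tilde\mu\big)=0$. *)

theory Defs
  imports "HOL-Probability.Probability"
begin

section \<open>The cylinder over the flat torus\<close>

text \<open>The torus \<open>\<real>\<^sup>2 / L\<int>\<^sup>2\<close> is represented by the half-open square, a set of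
  representatives; its Borel sets are those of the torus. Functions on the torus are
  \<open>L\<close>-periodic functions on \<open>\<real>\<^sup>2\<close>; only here does the topology of the torus enter
  (test functions below are required to be periodic, not to vanish near the boundary of the square).\<close>

definition QL :: "real \<Rightarrow> (real^2) set" where
  "QL L = {x. \<forall>i. - L / 2 \<le> x $ i \<and> x $ i < L / 2}"

definition QLT :: "real \<Rightarrow> real \<Rightarrow> ((real^2) \<times> real) set" where
  "QLT L T = QL L \<times> {-T<..<T}"

definition periodic :: "real \<Rightarrow> (real^2 \<Rightarrow> 'b) \<Rightarrow> bool" where
  "periodic L f \<longleftrightarrow> (\<forall>x i. f (x + axis i L) = f x)"


section \<open>Measures\<close>

definition pos_measure_on :: "'a::topological_space set \<Rightarrow> 'a measure \<Rightarrow> bool" where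
  "pos_measure_on S M \<longleftrightarrow> sets M = sets (restrict_space borel S) \<and> finite_measure M"

text \<open>Vector measures are countably additive set functions on the Borel sets of \<open>S\<close>; the junk
  value outside the \<open>\<sigma>\<close>-algebra is fixed to be 0, so that equality of vector measures is
  equality of functions.\<close>

definition vector_measure_on ::
    "'a::topological_space set \<Rightarrow> ('a set \<Rightarrow> 'b::real_normed_vector) \<Rightarrow> bool" where
  "vector_measure_on S m \<longleftrightarrow>
     (\<forall>A. range A \<subseteq> sets (restrict_space borel S) \<longrightarrow> disjoint_family A \<longrightarrow>
        (\<lambda>n. m (A n)) sums m (\<Union>n::nat. A n)) \<and>
     (\<forall>A. A \<notin> sets (restrict_space borel S) \<longrightarrow> m A = 0)"

definition vabs_continuous :: "('a set \<Rightarrow> 'b::zero) \<Rightarrow> 'a measure \<Rightarrow> bool" where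
  "vabs_continuous m \<mu> \<longleftrightarrow> (\<forall>A\<in>null_sets \<mu>. m A = 0)"

text \<open>The Radon--Nikodym derivative \<open>dm/d\<mu>\<close>, determined up to \<open>\<mu>\<close>-null sets when \<open>m \<ll> \<mu>\<close>.\<close>

definition vderiv ::
    "('a set \<Rightarrow> 'b::{banach, second_countable_topology}) \<Rightarrow> 'a measure \<Rightarrow> 'a \<Rightarrow> 'b" where
  "vderiv m \<mu> = (SOME g. integrable \<mu> g \<and> (\<forall>A\<in>sets \<mu>. m A = (LINT x:A|\<mu>. g x)))"


section \<open>The continuity equation\<close>

text \<open>On a Euclidean space this is the class \<open>C\<^sup>k\<close>.\<close>

primrec cont_diff :: "nat \<Rightarrow> ('a::euclidean_space \<Rightarrow> real) \<Rightarrow> bool" where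
  "cont_diff 0 f \<longleftrightarrow> continuous_on UNIV f"
| "cont_diff (Suc k) f \<longleftrightarrow> (\<forall>x. f differentiable (at x)) \<and>
     (\<forall>v. cont_diff k (\<lambda>x. frechet_derivative f (at x) v))"

definition test_function :: "real \<Rightarrow> real \<Rightarrow> ((real^2) \<times> real \<Rightarrow> real) \<Rightarrow> bool" where
  "test_function L T \<phi> \<longleftrightarrow> (\<forall>k. cont_diff k \<phi>) \<and> (\<forall>t. periodic L (\<lambda>x. \<phi> (x, t))) \<and>
     (\<exists>r<T. \<forall>x t. r < \<bar>t\<bar> \<longrightarrow> \<phi> (x, t) = 0)"

text \<open>\<open>\<partial>\<^sub>3\<mu> + div'(v \<mu>) = 0\<close>, tested with \<open>\<phi>\<close>: the integrand is
  \<open>\<partial>\<^sub>3\<phi> + v \<cdot> \<nabla>'\<phi>\<close>. For a vector measure \<open>m \<ll> \<mu>\<close> one has \<open>m = (dm/d\<mu>) \<mu>\<close>, so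
  \<open>\<partial>\<^sub>3\<mu> + div' m = 0\<close> is this equation with \<open>v = dm/d\<mu>\<close>.\<close>

definition continuity_eq ::
    "real \<Rightarrow> real \<Rightarrow> ((real^2) \<times> real) measure \<Rightarrow> ((real^2) \<times> real \<Rightarrow> real^2) \<Rightarrow> bool" where
  "continuity_eq L T \<mu> v \<longleftrightarrow> (\<forall>\<phi>. test_function L T \<phi> \<longrightarrow>
     (LINT x|\<mu>. frechet_derivative \<phi> (at x) (0, 1) + frechet_derivative \<phi> (at x) (v x, 0)) = 0)"

definition flux ::
    "real \<Rightarrow> real \<Rightarrow> ((real^2) \<times> real) measure \<Rightarrow> (((real^2) \<times> real) set \<Rightarrow> real^2) \<Rightarrow> bool" where
  "flux L T \<mu> m \<longleftrightarrow> vector_measure_on (QLT L T) m \<and> vabs_continuous m \<mu> \<and>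
     continuity_eq L T \<mu> (vderiv m \<mu>)"


section \<open>Slices and the admissible class\<close>

text \<open>\<open>\<mu> = \<nu>\<^sub>t \<otimes> dt\<close> on \<open>Q\<^sub>L\<^sub>,\<^sub>T\<close>; values of \<open>\<nu>\<close> outside \<open>(-T,T)\<close> are irrelevant here.\<close>

definition disintegrates ::
    "real \<Rightarrow> real \<Rightarrow> ((real^2) \<times> real) measure \<Rightarrow> (real \<Rightarrow> (real^2) measure) \<Rightarrow> bool" where
  "disintegrates L T \<mu> \<nu> \<longleftrightarrow>
     (\<forall>t\<in>{-T<..<T}. pos_measure_on (QL L) (\<nu> t)) \<and>
     (\<forall>B\<in>sets (restrict_space borel (QL L)).
        (\<lambda>t. emeasure (\<nu> t) B) \<in> borel_measurable (restrict_space borel {-T<..<T})) \<and>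
     (\<forall>A\<in>sets \<mu>. emeasure \<mu> A =
        (\<integral>\<^sup>+t\<in>{-T<..<T}. emeasure (\<nu> t) {x. (x, t) \<in> A} \<partial>lborel))"

definition purely_atomic :: "real \<Rightarrow> (real^2) measure \<Rightarrow> bool" where
  "purely_atomic L M \<longleftrightarrow> (\<exists>S \<phi>. countable S \<and> S \<subseteq> QL L \<and> (\<forall>X\<in>S. \<phi> X > (0::real)) \<and>
     (\<forall>A\<in>sets M. emeasure M A = (\<integral>\<^sup>+X. ennreal (\<phi> X) * indicator A X \<partial>count_space S)))"

definition admissible_pair ::
    "real \<Rightarrow> real \<Rightarrow> ((real^2) \<times> real) measure \<Rightarrow> (((real^2) \<times> real) set \<Rightarrow> real^2) \<Rightarrow> bool" where
  "admissible_pair L T \<mu> m \<longleftrightarrow> pos_measure_on (QLT L T) \<mu> \<and> flux L T \<mu> m \<and>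
     (\<exists>\<nu>. disintegrates L T \<mu> \<nu> \<and> (AE t in lborel. t \<in> {-T<..<T} \<longrightarrow> purely_atomic L (\<nu> t)))"

definition admissible :: "real \<Rightarrow> real \<Rightarrow> ((real^2) \<times> real) measure \<Rightarrow> bool" where
  "admissible L T \<mu> \<longleftrightarrow> (\<exists>m. admissible_pair L T \<mu> m)"

text \<open>The weakly continuous representative of \<open>t \<mapsto> \<mu>\<^sub>t\<close> on the closed interval. It is unique
  on \<open>[-T,T]\<close> whenever it exists.\<close>

definition weakly_continuous_slicing ::
    "real \<Rightarrow> real \<Rightarrow> ((real^2) \<times> real) measure \<Rightarrow> (real \<Rightarrow> (real^2) measure) \<Rightarrow> bool" where
  "weakly_continuous_slicing L T \<mu> \<nu> \<longleftrightarrow> disintegrates L T \<mu> \<nu> \<and>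
     (\<forall>t\<in>{-T..T}. pos_measure_on (QL L) (\<nu> t)) \<and>
     (\<forall>\<psi>::real^2 \<Rightarrow> real. continuous_on UNIV \<psi> \<longrightarrow> periodic L \<psi> \<longrightarrow>
        continuous_on {-T..T} (\<lambda>t. LINT x|\<nu> t. \<psi> x))"

definition is_slice ::
    "real \<Rightarrow> real \<Rightarrow> ((real^2) \<times> real) measure \<Rightarrow> real \<Rightarrow> (real^2) measure \<Rightarrow> bool" where
  "is_slice L T \<mu> t M \<longleftrightarrow> (\<exists>\<nu>. weakly_continuous_slicing L T \<mu> \<nu> \<and> \<nu> t = M)"

text \<open>Meaningful for \<open>t \<in> [-T,T]\<close> and \<open>\<mu>\<close> having a weakly continuous representative.\<close>

definition slice ::
    "real \<Rightarrow> real \<Rightarrow> ((real^2) \<times> real) measure \<Rightarrow> real \<Rightarrow> (real^2) measure" where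
  "slice L T \<mu> t = (THE M. is_slice L T \<mu> t M)"


section \<open>The functional\<close>

definition Kstar :: real where "Kstar = 8 * sqrt pi / 3"

text \<open>Disintegrations agree for a.e. \<open>t\<close>, so the choice does not affect the integral. Weak
  continuity is not required here: measures of infinite energy need not have such a representative.\<close>

definition disintegration ::
    "real \<Rightarrow> real \<Rightarrow> ((real^2) \<times> real) measure \<Rightarrow> real \<Rightarrow> (real^2) measure" where
  "disintegration L T \<mu> = (SOME \<nu>. disintegrates L T \<mu> \<nu>)"

definition energy_pair ::
    "real \<Rightarrow> real \<Rightarrow> ((real^2) \<times> real) measure \<Rightarrow> (((real^2) \<times> real) set \<Rightarrow> real^2) \<Rightarrow> ennreal" where
  "energy_pair L T \<mu> m =
     ennreal (Kstar / L^2) *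
       (\<integral>\<^sup>+t\<in>{-T<..<T}. (\<integral>\<^sup>+X. ennreal (sqrt (measure (disintegration L T \<mu> t) {X}))
          \<partial>count_space (QL L)) \<partial>lborel) +
     ennreal (1 / L^2) * (\<integral>\<^sup>+x. ennreal ((norm (vderiv m \<mu> x))^2) \<partial>\<mu>)"

definition energy :: "real \<Rightarrow> real \<Rightarrow> ((real^2) \<times> real) measure \<Rightarrow> ennreal" where
  "energy L T \<mu> = (INF m\<in>{m. flux L T \<mu> m}. energy_pair L T \<mu> m)"

definition optimal_flux ::
    "real \<Rightarrow> real \<Rightarrow> ((real^2) \<times> real) measure \<Rightarrow> (((real^2) \<times> real) set \<Rightarrow> real^2) \<Rightarrow> bool" where
  "optimal_flux L T \<mu> m \<longleftrightarrow> flux L T \<mu> m \<and> energy_pair L T \<mu> m = energy L T \<mu>"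

definition competitor ::
    "real \<Rightarrow> real \<Rightarrow> (real^2) measure \<Rightarrow> (real^2) measure \<Rightarrow> ((real^2) \<times> real) measure \<Rightarrow> bool" where
  "competitor L T \<mu>m \<mu>p \<nu> \<longleftrightarrow> admissible L T \<nu> \<and> is_slice L T \<nu> (-T) \<mu>m \<and> is_slice L T \<nu> T \<mu>p"

definition minimizer ::
    "real \<Rightarrow> real \<Rightarrow> (real^2) measure \<Rightarrow> (real^2) measure \<Rightarrow> ((real^2) \<times> real) measure \<Rightarrow> bool" where
  "minimizer L T \<mu>m \<mu>p \<mu> \<longleftrightarrow> competitor L T \<mu>m \<mu>p \<mu> \<and>
     (\<forall>\<nu>. competitor L T \<mu>m \<mu>p \<nu> \<longrightarrow> energy L T \<mu> \<le> energy L T \<nu>)"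


section \<open>Subsystems\<close>

text \<open>For finite energy the optimal flux is unique, so the existential quantifier over \<open>m\<close>
  merely names it.\<close>

definition subsystem ::
    "real \<Rightarrow> real \<Rightarrow> ((real^2) \<times> real) measure \<Rightarrow> real^2 \<Rightarrow> real \<Rightarrow> ((real^2) \<times> real) measure \<Rightarrow> bool" where
  "subsystem L T \<mu> X s \<mu>' \<longleftrightarrow> energy L T \<mu> < \<infinity> \<and> admissible L T \<mu>' \<and>
     (\<forall>A\<in>sets \<mu>. emeasure \<mu>' A \<le> emeasure \<mu> A) \<and>
     is_slice L T \<mu>' s
       (scale_measure (emeasure (slice L T \<mu> s) {X}) (return (restrict_space borel (QL L)) X)) \<and>
     (\<exists>m. optimal_flux L T \<mu> m \<and> continuity_eq L T \<mu>' (vderiv m \<mu>))"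

end

theory Submission
  imports Defs
begin

text \<open>
  Suppose \<open>X1 \<noteq> X2\<close>. The two subsystems then enclose a loop: both can carry mass from \<open>(Xm, zm)\<close> to \<open>(Xp, zp)\<close>,
  one through \<open>(X1, s)\<close> and the other through \<open>(X2, s)\<close>. Shifting a little mass from one side of the loop to
  the other, in either direction, gives competitors that carry their mass with the velocity of \<open>\<mu>\<close>. On averaging the two directions the
  kinetic energies cancel, while the branching energy, a sum of square roots of masses, strictly decreases by
  concavity. This contradicts minimality.

  To make sense of the two sides of the loop without any structure theory of \<open>\<mu>\<close>, let \<open>v\<close> be the optimal
  velocity. A unit flow inside \<open>\<mu>\<^sub>i\<close> from \<open>(Xm, zm)\<close> to \<open>(Xp, zp)\<close> is a measure \<open>f \<mu>\<^sub>i\<close> with a bounded density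
  \<open>f \<ge> 0\<close> whose transport by \<open>v\<close> has a unit source at \<open>(Xm, zm)\<close> and a unit sink at \<open>(Xp, zp)\<close>. It exists by
  duality between flows and cuts: by the Hahn--Banach theorem (\<open>dominated_graph.density_exists\<close>) it is enough that
  \<open>\<phi> (Xp, zp) - \<phi> (Xm, zm) \<le> C \<integral> (\<partial>\<^sub>3\<phi> + v \<cdot> \<nabla>'\<phi>)\<^sup>+ d\<mu>\<^sub>i\<close> for smooth \<open>\<phi>\<close>, the integral being restricted to heights
  between \<open>zm\<close> and \<open>zp\<close>. Since the whole of \<open>\<mu>\<^sub>i\<close> passes through the single point \<open>(X\<^sub>i, s)\<close>, one may normalise
  \<open>\<phi> (X\<^sub>i, s) = 0\<close> and test the continuity equation with the positive part of \<open>\<phi>\<close> above \<open>s\<close> and with its negative part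
  below \<open>s\<close> (\<open>flow_from_point.cut_bound\<close>).

  As densities with respect to \<open>\<mu>\<close>, the two unit flows \<open>g1\<close> and \<open>g2\<close> differ by a function that \<open>v\<close> transports without
  source or sink. After scaling, \<open>(1 \<plusminus> g) \<mu>\<close> are competitors; this requires their weakly continuous slices, which are
  built from the continuity equation, again through the duality lemma (locale \<open>perturbation\<close>). Then \<open>minimizer_rigid\<close>
  gives \<open>g1 = g2\<close> almost everywhere. But near height \<open>s\<close> the flow \<open>g1\<close> concentrates at \<open>X1\<close>, the flow \<open>g2\<close> at
  \<open>X2\<close>, and both carry unit mass. Hence \<open>X1 = X2\<close>.

  The rest supplies the measure theory: test functions on the torus and cylinder, uniqueness of disintegrations and
  of weakly continuous slices, densities of vector measures, the continuity equation on slabs, and the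
  uniqueness of the optimal velocity, by which the velocity given with each subsystem is \<open>v\<close>.
\<close>

section \<open>Smooth functions\<close>

definition smooth :: "('a::euclidean_space \<Rightarrow> real) \<Rightarrow> bool" where
  "smooth f \<longleftrightarrow> (\<forall>k. cont_diff k f)"

lemma cont_diff_SucD: "cont_diff (Suc k) f \<Longrightarrow> cont_diff k f"
proof (induction k arbitrary: f)
  case 0
  then show ?case
    by (auto intro!: differentiable_imp_continuous_within simp: continuous_on_eq_continuous_within)
next
  case (Suc k)
  then show ?case by (metis cont_diff.simps(2))
qed

lemma smooth_differentiable: "smooth f \<Longrightarrow> f differentiable (at x)"
  unfolding smooth_def by (metis cont_diff.simps(2))

lemma smooth_deriv: "smooth f \<Longrightarrow> smooth (\<lambda>x. frechet_derivative f (at x) v)"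
  unfolding smooth_def by (metis cont_diff.simps(2))

lemma smooth_continuous: "smooth f \<Longrightarrow> continuous_on S f"
  unfolding smooth_def by (metis cont_diff.simps(1) continuous_on_subset subset_UNIV)

lemma smooth_has_derivative: "smooth f \<Longrightarrow> (f has_derivative frechet_derivative f (at x)) (at x)"
  using smooth_differentiable frechet_derivative_works by blast

lemma cont_diff_SucI:
  assumes "\<And>x. (f has_derivative f' x) (at x)" and "\<And>v. cont_diff k (\<lambda>x. f' x v)"
  shows "cont_diff (Suc k) f"
proof -
  have "frechet_derivative f (at x) = f' x" for x
    using assms(1) frechet_derivative_at by metis
  then show ?thesis using assms by (auto simp: differentiable_def)
qed

lemma cont_diff_const [simp]: "cont_diff k (\<lambda>x. c)"
  by (induction k arbitrary: c) auto

lemma cont_diff_add: "cont_diff k f \<Longrightarrow> cont_diff k g \<Longrightarrow> cont_diff k (\<lambda>x. f x + g x)"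
proof (induction k arbitrary: f g)
  case 0
  then show ?case by (auto intro: continuous_intros)
next
  case (Suc k)
  show ?case
    by (rule cont_diff_SucI[where f' = "\<lambda>x v. frechet_derivative f (at x) v + frechet_derivative g (at x) v"])
      (use Suc in \<open>auto intro!: has_derivative_add simp: frechet_derivative_works[symmetric]\<close>)
qed

lemma cont_diff_mult: "cont_diff k f \<Longrightarrow> cont_diff k g \<Longrightarrow> cont_diff k (\<lambda>x. f x * g x)"
proof (induction k arbitrary: f g)
  case 0
  then show ?case by (auto intro: continuous_intros)
next
  case (Suc k)
  show ?case
  proof (rule cont_diff_SucI[where f' = "\<lambda>x v. f x * frechet_derivative g (at x) v + frechet_derivative f (at x) v * g x"])
    show "((\<lambda>x. f x * g x) has_derivative
         (\<lambda>v. f x * frechet_derivative g (at x) v + frechet_derivative f (at x) v * g x)) (at x)" for x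
      using Suc.prems by (intro has_derivative_mult) (auto simp: frechet_derivative_works[symmetric])
    show "cont_diff k (\<lambda>x. f x * frechet_derivative g (at x) v + frechet_derivative f (at x) v * g x)" for v
      using Suc.prems cont_diff_SucD by (intro cont_diff_add Suc.IH) auto
  qed
qed

lemma cont_diff_compose:
  fixes g :: "real \<Rightarrow> real"
  shows "cont_diff k g \<Longrightarrow> cont_diff k f \<Longrightarrow> cont_diff k (\<lambda>x. g (f x))"
proof (induction k arbitrary: f g)
  case 0
  then show ?case by (auto intro: continuous_on_compose2)
next
  case (Suc k)
  show ?case
  proof (rule cont_diff_SucI[where f' = "\<lambda>x v. frechet_derivative g (at (f x)) 1 * frechet_derivative f (at x) v"])
    fix x
    have g: "(g has_derivative frechet_derivative g (at (f x))) (at (f x))"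
      using Suc.prems by (auto simp: frechet_derivative_works[symmetric])
    have f: "(f has_derivative frechet_derivative f (at x)) (at x)"
      using Suc.prems by (auto simp: frechet_derivative_works[symmetric])
    have lin: "frechet_derivative g (at (f x)) y = frechet_derivative g (at (f x)) 1 * y" for y
      using linear_scale[OF has_derivative_linear[OF g], of y 1] by (simp add: mult.commute)
    show "((\<lambda>x. g (f x)) has_derivative
         (\<lambda>v. frechet_derivative g (at (f x)) 1 * frechet_derivative f (at x) v)) (at x)"
      using has_derivative_compose[OF f g] unfolding lin[of "frechet_derivative f (at x) _"] .
    show "cont_diff k (\<lambda>x. frechet_derivative g (at (f x)) 1 * frechet_derivative f (at x) v)" for v
      using Suc.prems cont_diff_SucD
      by (intro cont_diff_mult Suc.IH[of "\<lambda>y. frechet_derivative g (at y) 1" f]) auto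
  qed
qed

lemma cont_diff_compose_linear:
  fixes A :: "'b::euclidean_space \<Rightarrow> 'a::euclidean_space"
  assumes A: "bounded_linear A"
  shows "cont_diff k f \<Longrightarrow> cont_diff k (\<lambda>x. f (A x))"
proof (induction k arbitrary: f)
  case 0
  then show ?case
    using continuous_on_compose2[of UNIV f UNIV A] linear_continuous_on[OF A] by auto
next
  case (Suc k)
  show ?case
  proof (rule cont_diff_SucI[where f' = "\<lambda>x v. frechet_derivative f (at (A x)) (A v)"])
    fix x
    have f: "(f has_derivative frechet_derivative f (at (A x))) (at (A x))"
      using Suc.prems by (auto simp: frechet_derivative_works[symmetric])
    show "((\<lambda>x. f (A x)) has_derivative (\<lambda>v. frechet_derivative f (at (A x)) (A v))) (at x)"
      using has_derivative_compose[OF bounded_linear_imp_has_derivative[OF A] f] .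
    show "cont_diff k (\<lambda>x. frechet_derivative f (at (A x)) (A v))" for v
      using Suc by auto
  qed
qed

lemma cont_diff_linear:
  assumes "bounded_linear A"
  shows "cont_diff k A"
proof (cases k)
  case 0
  then show ?thesis using assms by (auto intro: linear_continuous_on)
next
  case (Suc n)
  have "cont_diff (Suc n) A"
    by (rule cont_diff_SucI[where f' = "\<lambda>x. A"]) (use assms in \<open>auto intro: bounded_linear_imp_has_derivative\<close>)
  then show ?thesis using Suc by simp
qed

lemma cont_diff_real_SucI:
  fixes f :: "real \<Rightarrow> real"
  assumes "\<And>x. (f has_real_derivative f' x) (at x)" and "cont_diff k f'"
  shows "cont_diff (Suc k) f"
proof (rule cont_diff_SucI[where f' = "\<lambda>x v. f' x * v"])
  show "(f has_derivative (*) (f' x)) (at x)" for x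
    using assms(1) by (simp add: has_field_derivative_def)
  show "cont_diff k (\<lambda>x. f' x * v)" for v
    using assms(2) by (intro cont_diff_mult) auto
qed

lemma smooth_const: "smooth (\<lambda>x. c)"
  and smooth_add: "smooth f \<Longrightarrow> smooth g \<Longrightarrow> smooth (\<lambda>x. f x + g x)"
  and smooth_mult: "smooth f \<Longrightarrow> smooth g \<Longrightarrow> smooth (\<lambda>x. f x * g x)"
  and smooth_compose: "smooth h \<Longrightarrow> smooth f \<Longrightarrow> smooth (\<lambda>x. h (f x))"
  and smooth_compose_linear: "bounded_linear A \<Longrightarrow> smooth k \<Longrightarrow> smooth (\<lambda>x. k (A x))"
  and smooth_linear: "bounded_linear B \<Longrightarrow> smooth B"
  unfolding smooth_def
  by (auto intro: cont_diff_add cont_diff_mult cont_diff_compose cont_diff_compose_linear cont_diff_linear)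

lemma smooth_cmult: "smooth f \<Longrightarrow> smooth (\<lambda>x. c * f x)"
  by (intro smooth_mult smooth_const)

lemma smooth_diff: "smooth f \<Longrightarrow> smooth g \<Longrightarrow> smooth (\<lambda>x. f x - g x)"
  using smooth_add[of f "\<lambda>x. - 1 * g x"] smooth_cmult[of g "-1"] by simp

lemma smooth_affine: "smooth f \<Longrightarrow> smooth (\<lambda>x. f ((x - a) / c))" for f :: "real \<Rightarrow> real"
proof -
  assume f: "smooth f"
  have "smooth (\<lambda>x::real. x * (1/c) + (- a / c))"
    by (intro smooth_add smooth_const smooth_linear bounded_linear_mult_left)
  from smooth_compose[OF f this] show ?thesis by (simp add: diff_divide_distrib)
qed

lemma smooth_realI:
  fixes f :: "real \<Rightarrow> real"
  assumes "\<And>x. (f has_real_derivative f' x) (at x)" and "smooth f'"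
  shows "smooth f"
  using assms cont_diff_SucD[OF cont_diff_real_SucI[OF assms(1)]] by (auto simp: smooth_def)

lemma smooth_antiderivative:
  fixes w :: "real \<Rightarrow> real"
  assumes "smooth w"
  shows "\<exists>W. smooth W \<and> (\<forall>x. (W has_real_derivative w x) (at x))"
proof -
  have "isCont w x" for x
    using smooth_continuous[OF assms, of UNIV] by (auto simp: continuous_on_eq_continuous_at)
  then obtain W where "\<And>x. (W has_vector_derivative w x) (at x)"
    using einterval_antiderivative[of "-\<infinity>" \<infinity> w] by auto
  then have "\<And>x. (W has_real_derivative w x) (at x)"
    by (simp add: has_real_derivative_iff_has_vector_derivative)
  then show ?thesis using smooth_realI assms by blast
qed

lemma smooth_trig:
  "smooth (\<lambda>x::real. sin x)" "smooth (\<lambda>x::real. cos x)"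
proof -
  have "cont_diff k (\<lambda>x::real. sin x) \<and> cont_diff k (\<lambda>x::real. cos x)" for k
  proof (induction k)
    case 0
    show ?case by (auto intro: continuous_intros)
  next
    case (Suc k)
    have "cont_diff k (\<lambda>x. - 1 * sin x)" by (intro cont_diff_mult) (use Suc in auto)
    then show ?case
      using Suc by (auto intro!: cont_diff_real_SucI simp del: cont_diff.simps
          intro: derivative_eq_intros)
  qed
  then show "smooth (\<lambda>x::real. sin x)" "smooth (\<lambda>x::real. cos x)"
    by (auto simp: smooth_def)
qed

text \<open>A smooth approximation of the positive part, uniform with error \<open>\<epsilon> ln 2\<close>. Its derivative takes values in
  \<open>(0, 1)\<close>, so that composing a test function with it can only decrease the positive part of the derivative along a flow.\<close>

definition softplus :: "real \<Rightarrow> real \<Rightarrow> real" where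
  "softplus \<epsilon> x = \<epsilon> * ln (1 + exp (x / \<epsilon>))"

definition logistic :: "real \<Rightarrow> real" where
  "logistic x = 1 / (1 + exp (- x))"

lemma logistic_bounds: "0 < logistic x" "logistic x < 1"
  by (auto simp: logistic_def field_simps add_pos_pos)

lemma smooth_logistic: "smooth logistic"
proof -
  have D: "(logistic has_real_derivative logistic x * (1 + - 1 * logistic x)) (at x)" for x
  proof -
    have "1 + exp (- x) > 0" by (simp add: add_pos_pos)
    then show ?thesis
      unfolding logistic_def by (auto intro!: derivative_eq_intros simp: field_simps power2_eq_square)
  qed
  have "cont_diff k logistic" for k
  proof (induction k)
    case 0
    show ?case
      using D by (auto simp: continuous_on_eq_continuous_at intro: DERIV_isCont)
  next
    case (Suc k)
    show ?case
      by (rule cont_diff_real_SucI[OF D]) (intro cont_diff_mult cont_diff_add Suc cont_diff_const)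
  qed
  then show ?thesis by (simp add: smooth_def)
qed

lemma softplus_deriv:
  assumes "\<epsilon> > 0"
  shows "(softplus \<epsilon> has_real_derivative logistic (x / \<epsilon>)) (at x)"
proof -
  have "1 + exp (x / \<epsilon>) > 0" by (simp add: add_pos_pos)
  then have "(softplus \<epsilon> has_real_derivative \<epsilon> * (exp (x / \<epsilon>) * (1 / \<epsilon>) / (1 + exp (x / \<epsilon>)))) (at x)"
    unfolding softplus_def[abs_def] by (auto intro!: derivative_eq_intros)
  moreover have "\<epsilon> * (exp (x / \<epsilon>) * (1 / \<epsilon>) / (1 + exp (x / \<epsilon>))) = logistic (x / \<epsilon>)"
  proof -
    have "E / (1 + E) = 1 / (1 + inverse E)" if "E > 0" for E :: real
      using that by (simp add: divide_simps)
    from this[of "exp (x / \<epsilon>)"] show ?thesis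
      using assms by (simp add: logistic_def exp_minus)
  qed
  ultimately show ?thesis by simp
qed

lemma smooth_softplus:
  assumes "\<epsilon> > 0"
  shows "smooth (softplus \<epsilon>)"
  by (rule smooth_realI[OF softplus_deriv[OF assms]])
     (use smooth_affine[OF smooth_logistic, of 0 \<epsilon>] in simp)

lemma softplus_ge:
  assumes "\<epsilon> > 0"
  shows "softplus \<epsilon> x \<ge> 0" "softplus \<epsilon> x \<ge> x" "softplus \<epsilon> 0 = \<epsilon> * ln 2"
proof -
  show "softplus \<epsilon> x \<ge> 0"
    unfolding softplus_def using assms by simp
  have "x = \<epsilon> * ln (exp (x / \<epsilon>))" using assms by simp
  also have "\<dots> \<le> softplus \<epsilon> x"
    unfolding softplus_def using assms by (intro mult_left_mono) (auto simp: add_pos_pos ln_ge_iff)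
  finally show "softplus \<epsilon> x \<ge> x" .
qed (simp add: softplus_def)

text \<open>The classical functions vanishing to infinite order at 0. The powers in the denominator make the family closed
  under differentiation, up to linear combinations.\<close>

definition flat :: "nat \<Rightarrow> real \<Rightarrow> real" where
  "flat n x = (if x \<le> 0 then 0 else exp (- (1 / x)) / x ^ n)"

lemma flat_deriv: "(flat n has_real_derivative flat (n + 2) x + (- real n) * flat (n + 1) x) (at x)"
proof (cases x "0::real" rule: linorder_cases)
  case less
  have "(flat n has_real_derivative 0) (at x)"
    by (rule has_field_derivative_transform_within[of "\<lambda>x. 0" 0 x UNIV "-x" "flat n"])
       (use less in \<open>auto simp: flat_def dist_real_def\<close>)
  then show ?thesis using less by (simp add: flat_def)
next
  case greater
  have "((\<lambda>x. exp (- (1 / x)) / x ^ n) has_real_derivative flat (n + 2) x + (- real n) * flat (n + 1) x) (at x)"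
    by (cases n) (use greater in \<open>auto intro!: derivative_eq_intros simp: flat_def field_simps power2_eq_square,
        (metis One_nat_def power_eq_if)?\<close>)
  then show ?thesis
    by (rule has_field_derivative_transform_within[where d = x]) (use greater in \<open>auto simp: flat_def dist_real_def\<close>)
next
  case equal
  have "((\<lambda>h. (flat n (0 + h) - flat n 0) / h) \<longlongrightarrow> 0) (at 0)"
  proof (rule filterlim_split_at_real)
    show "((\<lambda>h. (flat n (0 + h) - flat n 0) / h) \<longlongrightarrow> 0) (at_left 0)"
      by (rule Lim_transform_eventually[OF tendsto_const])
         (auto simp: flat_def eventually_at_filter)
    have "((\<lambda>h::real. inverse h ^ (n + 1) / exp (inverse h)) \<longlongrightarrow> 0) (at_right 0)"
      by (rule filterlim_compose[OF tendsto_power_div_exp_0 filterlim_inverse_at_top_right])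
    then have "((\<lambda>h::real. exp (- (1 / h)) / h ^ n / h) \<longlongrightarrow> 0) (at_right 0)"
      by (simp add: divide_simps exp_minus ac_simps)
    then show "((\<lambda>h. (flat n (0 + h) - flat n 0) / h) \<longlongrightarrow> 0) (at_right 0)"
      by (rule Lim_transform_eventually) (auto simp: flat_def eventually_at_filter)
  qed
  then have "(flat n has_real_derivative 0) (at 0)"
    by (simp add: DERIV_def)
  then show ?thesis using equal by (simp add: flat_def)
qed

lemma smooth_flat: "smooth (flat n)"
proof -
  have "cont_diff k (flat n)" for k
  proof (induction k arbitrary: n)
    case 0
    show ?case
      using flat_deriv by (auto simp: continuous_on_eq_continuous_at intro: DERIV_isCont)
  next
    case (Suc k)
    show ?case
      by (rule cont_diff_real_SucI[OF flat_deriv]) (intro cont_diff_mult cont_diff_add Suc cont_diff_const)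
  qed
  then show ?thesis by (simp add: smooth_def)
qed

text \<open>A smooth step; its derivative is a bump of unit mass.\<close>

lemma smooth_step_ex:
  "\<exists>S b. smooth S \<and> smooth b \<and> (\<forall>x::real. (S has_real_derivative b x) (at x)) \<and>
     (\<forall>x\<le>0. S x = 0) \<and> (\<forall>x\<ge>1. S x = 1) \<and> (\<forall>x. 0 \<le> b x) \<and> (\<forall>x. x \<notin> {0<..<1} \<longrightarrow> b x = (0::real))"
proof -
  define c where "c = (\<lambda>x. flat 0 x * flat 0 (- (x - 1)))"
  have fr: "smooth (\<lambda>x. flat 0 (- (x - 1)))"
    using smooth_affine[OF smooth_flat, of 0 1 "-1"] by simp
  have c: "smooth c"
    unfolding c_def by (intro smooth_mult smooth_flat fr)
  have c0: "c x \<ge> 0" "x \<notin> {0<..<1} \<Longrightarrow> c x = 0" "x \<in> {0<..<1} \<Longrightarrow> c x > 0" for x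
    by (auto simp: c_def flat_def)
  obtain F where F: "smooth F" "\<And>x. (F has_real_derivative c x) (at x)"
    using smooth_antiderivative[OF c] by blast
  have pos: "F 0 < F 1"
    by (rule DERIV_pos_imp_increasing_open[of 0 1 F])
       (use F(2) c0(3) in \<open>auto intro!: continuous_at_imp_continuous_on intro: DERIV_isCont\<close>)
  have low: "F x = F 0" if "x \<le> 0" for x
  proof (cases "x = 0")
    case False
    then have "x < 0" using that by simp
    have "F 0 = F x"
      by (rule DERIV_isconst2[of x 0 F]) (use \<open>x < 0\<close> F(2) c0(2) in
        \<open>auto intro!: continuous_at_imp_continuous_on intro: DERIV_isCont, metis greaterThanLessThan_iff less_asym\<close>)
    then show ?thesis by simp
  qed simp
  have high: "F x = F 1" if "x \<ge> 1" for x
  proof (cases "x = 1")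
    case False
    then have "x > 1" using that by simp
    show ?thesis
      by (rule DERIV_isconst2[of 1 x F]) (use \<open>x > 1\<close> F(2) c0(2) in
        \<open>auto intro!: continuous_at_imp_continuous_on intro: DERIV_isCont, metis greaterThanLessThan_iff less_asym\<close>)
  qed simp
  define M where "M = F 1 - F 0"
  have M: "M > 0" using pos by (simp add: M_def)
  show ?thesis
  proof (rule exI[of _ "\<lambda>x. (1/M) * (F x - F 0)"], rule exI[of _ "\<lambda>x. (1/M) * c x"],
      intro conjI allI impI)
    show "smooth (\<lambda>x. (1/M) * (F x - F 0))"
      by (intro smooth_cmult smooth_diff F smooth_const)
    show "smooth (\<lambda>x. (1/M) * c x)" by (intro smooth_cmult c)
    show "((\<lambda>x. (1/M) * (F x - F 0)) has_real_derivative (1/M) * c x) (at x)" for x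
      using F(2)[of x] M by (auto intro!: derivative_eq_intros)
    show "(1/M) * (F x - F 0) = 0" if "x \<le> 0" for x
      using low[OF that] by simp
    show "(1/M) * (F x - F 0) = 1" if "x \<ge> 1" for x
      using high[OF that] M by (simp add: M_def)
    show "0 \<le> (1/M) * c x" for x
      using M c0(1) by simp
    show "(1/M) * c x = 0" if "x \<notin> {0<..<1}" for x
      using c0(2)[OF that] by simp
  qed
qed

definition step :: "real \<Rightarrow> real" where
  "step = (SOME S. \<exists>b. smooth S \<and> smooth b \<and> (\<forall>x::real. (S has_real_derivative b x) (at x)) \<and>
     (\<forall>x\<le>0. S x = 0) \<and> (\<forall>x\<ge>1. S x = 1) \<and> (\<forall>x. 0 \<le> b x) \<and> (\<forall>x. x \<notin> {0<..<1} \<longrightarrow> b x = (0::real)))"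

definition bump :: "real \<Rightarrow> real" where "bump = deriv step"

lemma step_bump:
  shows smooth_step: "smooth step" and smooth_bump: "smooth bump"
    and step_deriv: "(step has_real_derivative bump x) (at x)"
    and step_0: "x \<le> 0 \<Longrightarrow> step x = 0" and step_1: "x \<ge> 1 \<Longrightarrow> step x = 1"
    and bump_nonneg: "0 \<le> bump x" and bump_0: "x \<notin> {0<..<1} \<Longrightarrow> bump x = 0"
proof -
  obtain b where b: "smooth step \<and> smooth b \<and> (\<forall>x::real. (step has_real_derivative b x) (at x)) \<and>
     (\<forall>x\<le>0. step x = 0) \<and> (\<forall>x\<ge>1. step x = 1) \<and> (\<forall>x. 0 \<le> b x) \<and> (\<forall>x. x \<notin> {0<..<1} \<longrightarrow> b x = (0::real))"
    using someI_ex[OF smooth_step_ex] unfolding step_def[symmetric] by (elim exE)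
  have "bump x = b x" for x unfolding bump_def using b DERIV_imp_deriv by metis
  then have "bump = b" by (rule ext)
  with b show "smooth step" "smooth bump" "(step has_real_derivative bump x) (at x)"
    "x \<le> 0 \<Longrightarrow> step x = 0" "x \<ge> 1 \<Longrightarrow> step x = 1" "0 \<le> bump x" "x \<notin> {0<..<1} \<Longrightarrow> bump x = 0"
    by auto
qed

lemma step_mono: "x \<le> y \<Longrightarrow> step x \<le> step y"
proof (rule DERIV_nonneg_imp_nondecreasing[of x y step])
  show "\<exists>y. (step has_real_derivative y) (at z) \<and> 0 \<le> y" for z
    by (intro exI[of _ "bump z"] conjI step_deriv bump_nonneg)
qed

lemma step_bounds: "0 \<le> step x" "step x \<le> 1"
proof -
  show "0 \<le> step x"
    using step_mono[of "min x 0" x] by (simp add: step_0)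
  show "step x \<le> 1"
    using step_mono[of x "max x 1"] by (simp add: step_1)
qed

lemma bump_has_integral: "has_bochner_integral lborel bump 1"
proof -
  have "has_bochner_integral lborel (\<lambda>x. bump x * indicator {0..1} x) (step 1 - step 0)"
  proof (rule has_bochner_integral_FTC_Icc_real[where F = step and f = bump and a = 0 and b = 1])
    show "isCont bump x" for x
      using smooth_continuous[OF smooth_bump, of UNIV] by (simp add: continuous_on_eq_continuous_at)
    show "(step has_real_derivative bump x) (at x)" for x
      by (rule step_deriv)
  qed simp
  moreover have "(\<lambda>x. bump x * indicator {0..1} x) = bump"
  proof
    show "bump x * indicator {0..1} x = bump x" for x
      using bump_0[of x] by (cases "x \<in> {0..1}") auto
  qed
  ultimately show ?thesis by (simp add: step_0 step_1)
qed

section \<open>Functions and measures on the torus\<close>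

text \<open>The torus as a compact subset of \<open>\<complex>\<^sup>2\<close>. Restricted to the square, this embedding has a Borel inverse, which is
  not continuous: closed subsets of the torus are not relatively closed in the square in general.\<close>

definition torus_map :: "real \<Rightarrow> real^2 \<Rightarrow> complex \<times> complex" where
  "torus_map L x = (cis (2 * pi * x $ 1 / L), cis (2 * pi * x $ 2 / L))"

text \<open>The branch of the argument with values in \<open>[-\<pi>, \<pi>)\<close>, matching the half-open square; \<open>Arg\<close> takes the value
  \<open>\<pi>\<close> on the negative axis.\<close>

definition angle :: "complex \<Rightarrow> real" where
  "angle z = indicator (- \<real>\<^sub>\<le>\<^sub>0) z *\<^sub>R Arg z + indicator \<real>\<^sub>\<le>\<^sub>0 z *\<^sub>R (- pi)"

definition torus_coord :: "real \<Rightarrow> complex \<times> complex \<Rightarrow> real^2" where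
  "torus_coord L p = (\<chi> i. L / (2 * pi) * angle (if i = 1 then fst p else snd p))"

lemma angle_cis:
  assumes "- pi \<le> t" "t < pi"
  shows "angle (cis t) = t"
proof (cases "t = - pi")
  case True
  then have "cis t = -1" by (simp add: complex_eq_iff)
  then have "cis t \<in> \<real>\<^sub>\<le>\<^sub>0" by simp
  then show ?thesis using True by (simp add: angle_def)
next
  case False
  then have A: "Arg (cis t) = t" using assms by (intro Arg_cis) auto
  have "cis t \<notin> \<real>\<^sub>\<le>\<^sub>0"
  proof
    assume "cis t \<in> \<real>\<^sub>\<le>\<^sub>0"
    then have "Im (cis t) = 0" "Re (cis t) \<le> 0" by (auto simp: complex_nonpos_Reals_iff)
    moreover have "Re (cis t) \<noteq> 0" using calculation by (metis cis_neq_zero complex_eq_iff zero_complex.simps)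
    ultimately have "Arg (cis t) = pi" by (subst Arg_eq_pi) auto
    then show False using A assms by simp
  qed
  then show ?thesis using A by (simp add: angle_def)
qed

lemma angle_measurable [measurable]: "angle \<in> borel_measurable borel"
  unfolding angle_def
  by (intro borel_measurable_add borel_measurable_continuous_on_indicator continuous_on_Arg continuous_on_const)
     (auto intro!: borel_closed borel_comp simp: closed_nonpos_Reals_complex)

lemma torus_map_continuous: "continuous_on S (torus_map L)"
  unfolding torus_map_def divide_inverse
  by (intro continuous_intros)

lemma torus_map_measurable [measurable]: "torus_map L \<in> borel_measurable borel"
  by (intro borel_measurable_continuous_onI torus_map_continuous)

lemma torus_coord_measurable [measurable]: "torus_coord L \<in> borel_measurable borel"
proof -
  have "(\<lambda>p. L / (2 * pi) * angle (if i = 1 then fst p else snd p)) \<in> borel_measurable borel" for i :: 2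
    by (cases "i = 1") (auto simp: borel_prod[symmetric])
  then show ?thesis
    unfolding torus_coord_def
    by (subst borel_measurable_euclidean_space) (auto simp: Basis_vec_def inner_axis)
qed

lemma torus_coord_map:
  assumes "L > 0" "x \<in> QL L"
  shows "torus_coord L (torus_map L x) = x"
proof -
  have "angle (cis (2 * pi * x $ i / L)) = 2 * pi * x $ i / L" for i
  proof (rule angle_cis)
    have "- L / 2 \<le> x $ i" "x $ i < L / 2" using assms by (auto simp: QL_def)
    then show "- pi \<le> 2 * pi * x $ i / L" "2 * pi * x $ i / L < pi"
      using assms(1) mult_left_mono[of "- L" "x $ i * 2" pi] by (auto simp: field_simps)
  qed
  then show ?thesis
    using assms(1) exhaust_2 unfolding torus_coord_def torus_map_def by (auto simp: vec_eq_iff)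
qed

lemma torus_map_inj:
  assumes "L > 0" "x \<in> QL L" "y \<in> QL L" "torus_map L x = torus_map L y"
  shows "x = y"
  using torus_coord_map assms by metis

lemma periodic_of_int:
  assumes "periodic L f"
  shows "f (x + axis i (L * of_int k)) = f x"
proof -
  have nat: "f (x + axis i (L * of_nat n)) = f x" for n x
  proof (induction n)
    case 0
    have "x + axis i (L * of_nat 0) = x" by (simp add: axis_def vec_eq_iff)
    then show ?case by (simp only:)
  next
    case (Suc n)
    have "x + axis i (L * of_nat (Suc n)) = (x + axis i (L * of_nat n)) + axis i L"
      by (auto simp: axis_def vec_eq_iff algebra_simps)
    then show ?case using assms Suc unfolding periodic_def by metis
  qed
  show ?thesis
  proof (cases "k \<ge> 0")
    case True
    then show ?thesis using nat[of x "nat k"] by simp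
  next
    case False
    have "x = (x + axis i (L * of_int k)) + axis i (L * of_nat (nat (- k)))"
      using False by (auto simp: axis_def vec_eq_iff)
    then show ?thesis using nat by metis
  qed
qed

lemma periodic_torus_map:
  assumes "L > 0"
  shows "periodic L (\<lambda>x. G (torus_map L x))"
proof -
  have "torus_map L (x + axis i L) = torus_map L x" for x i
  proof -
    have *: "cis (2 * pi * (a + L) / L) = cis (2 * pi * a / L)" for a
    proof -
      have "2 * pi * (a + L) / L = 2 * pi * a / L + 2 * pi" using assms by (simp add: field_simps)
      then show ?thesis by (simp add: cis.ctr)
    qed
    show ?thesis
      using exhaust_2[of i] * by (auto simp: torus_map_def axis_def)
  qed
  then show ?thesis by (simp add: periodic_def)
qed

definition reduce :: "real \<Rightarrow> real^2 \<Rightarrow> real^2" where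
  "reduce L x = (\<chi> i. x $ i - L * of_int \<lfloor>x $ i / L + 1/2\<rfloor>)"

lemma reduce_QL:
  assumes "L > 0"
  shows "reduce L x \<in> QL L"
proof -
  have "- L / 2 \<le> a - L * of_int \<lfloor>a / L + 1/2\<rfloor> \<and> a - L * of_int \<lfloor>a / L + 1/2\<rfloor> < L / 2" for a
  proof -
    define k where "k = real_of_int \<lfloor>a / L + 1/2\<rfloor>"
    have "k \<le> a / L + 1/2" "a / L + 1/2 < k + 1" unfolding k_def by linarith+
    then have "L * k \<le> L * (a / L + 1/2)" "L * (a / L + 1/2) < L * (k + 1)"
      using assms by simp_all
    then show ?thesis using assms unfolding k_def[symmetric] by (simp add: algebra_simps)
  qed
  then show ?thesis by (simp add: reduce_def QL_def)
qed

lemma periodic_reduce: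
  assumes "periodic L f"
  shows "f (reduce L x) = f x"
proof -
  have "reduce L x = (x + axis 1 (L * of_int (- \<lfloor>x $ 1 / L + 1/2\<rfloor>))) + axis 2 (L * of_int (- \<lfloor>x $ 2 / L + 1/2\<rfloor>))"
    using exhaust_2 by (auto simp: reduce_def vec_eq_iff axis_def)
  then show ?thesis by (simp only: periodic_of_int[OF assms])
qed

lemma periodic_factor:
  assumes "L > 0" "periodic L f"
  shows "f (torus_coord L (torus_map L x)) = f x"
proof -
  have "torus_map L (reduce L x) = torus_map L x"
    using periodic_reduce[OF periodic_torus_map[OF assms(1), of id]] by simp
  then have "torus_coord L (torus_map L x) = reduce L x"
    using torus_coord_map[OF assms(1) reduce_QL[OF assms(1)]] by metis
  then show ?thesis using periodic_reduce[OF assms(2)] by simp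
qed

lemma QL_bounded: "QL L \<subseteq> cbox (\<chi> i. - L / 2) (\<chi> i. L / 2)"
  by (auto simp: QL_def mem_box_cart less_imp_le)

lemma QL_borel [measurable]: "QL L \<in> sets borel"
proof -
  have "QL L = (\<Inter>i. {x. - L / 2 \<le> x $ i} \<inter> {x. x $ i < L / 2})"
    by (auto simp: QL_def)
  also have "\<dots> \<in> sets borel"
    by (intro sets.finite_INT sets.Int borel_closed borel_open closed_halfspace_component_ge_cart
        open_halfspace_component_lt_cart) auto
  finally show ?thesis .
qed

definition tcont :: "real \<Rightarrow> (real^2 \<Rightarrow> real) \<Rightarrow> bool" where
  "tcont L \<psi> \<longleftrightarrow> continuous_on UNIV \<psi> \<and> periodic L \<psi>"

definition tsmooth :: "real \<Rightarrow> (real^2 \<Rightarrow> real) \<Rightarrow> bool" where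
  "tsmooth L \<psi> \<longleftrightarrow> smooth \<psi> \<and> periodic L \<psi>"

lemma tsmooth_tcont: "tsmooth L \<psi> \<Longrightarrow> tcont L \<psi>"
  by (auto simp: tsmooth_def tcont_def smooth_continuous)

lemma tcont_compose: "tcont L \<psi> \<Longrightarrow> continuous_on UNIV h \<Longrightarrow> tcont L (\<lambda>x. h (\<psi> x))"
  by (auto simp: tcont_def periodic_def intro: continuous_on_compose2)

lemma tcont_torus_map:
  "L > 0 \<Longrightarrow> continuous_on UNIV G \<Longrightarrow> tcont L (\<lambda>x. G (torus_map L x))"
  by (auto simp: tcont_def periodic_torus_map intro: continuous_on_compose2[OF _ torus_map_continuous])

lemma tcont_bounded:
  assumes "tcont L \<psi>"
  shows "\<exists>B. \<forall>x\<in>QL L. \<bar>\<psi> x\<bar> \<le> B"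
proof -
  have "compact (\<psi> ` cbox (\<chi> i. - L / 2) (\<chi> i. L / 2))"
    using assms by (intro compact_continuous_image compact_cbox) (auto simp: tcont_def intro: continuous_on_subset)
  then have "bounded (\<psi> ` cbox (\<chi> i. - L / 2) (\<chi> i. L / 2))" by (rule compact_imp_bounded)
  then show ?thesis using QL_bounded[of L] by (fastforce simp: bounded_iff)
qed

lemma smooth_sin_cos_comp:
  "smooth (\<lambda>x::real^2. sin (2 * pi * x $ i / L))" "smooth (\<lambda>x::real^2. cos (2 * pi * x $ i / L))"
proof -
  have *: "smooth (\<lambda>x::real^2. 2 * pi / L * x $ i)"
    by (intro smooth_cmult smooth_linear bounded_linear_vec_nth)
  show "smooth (\<lambda>x::real^2. sin (2 * pi * x $ i / L))" "smooth (\<lambda>x::real^2. cos (2 * pi * x $ i / L))"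
    using smooth_compose[OF smooth_trig(1) *] smooth_compose[OF smooth_trig(2) *] by simp_all
qed

lemma smooth_polynomial_torus:
  "real_polynomial_function p \<Longrightarrow> smooth (\<lambda>x. p (torus_map L x))"
proof (induction rule: real_polynomial_function.induct)
  case (linear f)
  interpret f: bounded_linear f by fact
  have "f (torus_map L x) = f (1, 0) * cos (2 * pi * x $ 1 / L) + f (\<i>, 0) * sin (2 * pi * x $ 1 / L)
     + f (0, 1) * cos (2 * pi * x $ 2 / L) + f (0, \<i>) * sin (2 * pi * x $ 2 / L)" for x
  proof -
    have "torus_map L x = cos (2 * pi * x $ 1 / L) *\<^sub>R (1, 0) + sin (2 * pi * x $ 1 / L) *\<^sub>R (\<i>, 0)
       + cos (2 * pi * x $ 2 / L) *\<^sub>R (0, 1) + sin (2 * pi * x $ 2 / L) *\<^sub>R (0, \<i>)"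
      by (simp add: torus_map_def complex_eq_iff)
    then show ?thesis by (simp only: f.add f.scaleR real_scaleR_def mult.commute)
  qed
  then show ?case
    by (auto intro!: smooth_add smooth_cmult smooth_sin_cos_comp)
qed (auto intro: smooth_const smooth_add smooth_mult)

text \<open>Stone--Weierstrass on the image of the torus in \<open>\<complex>\<^sup>2\<close>: a continuous periodic function factors
  through a continuous function on this compact image, because the projection is closed.\<close>

lemma tsmooth_dense:
  assumes L: "L > 0" and \<psi>: "tcont L \<psi>" and e: "e > 0"
  shows "\<exists>\<psi>'. tsmooth L \<psi>' \<and> (\<forall>x. \<bar>\<psi> x - \<psi>' x\<bar> < e)"
proof -
  define K :: "(real^2) set" where "K = cbox (\<chi> i. - L / 2) (\<chi> i. L / 2)"
  define S where "S = torus_map L ` K"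
  have S: "compact S" unfolding S_def K_def by (intro compact_continuous_image torus_map_continuous compact_cbox)
  have inS: "torus_map L x \<in> S" for x
  proof -
    have "torus_map L (reduce L x) = torus_map L x"
      using periodic_reduce[OF periodic_torus_map[OF L, of id]] by simp
    moreover have "reduce L x \<in> K" using reduce_QL[OF L] QL_bounded[of L] by (auto simp: K_def)
    ultimately show ?thesis unfolding S_def by (metis imageI)
  qed
  define F where "F = (\<lambda>p. \<psi> (torus_coord L p))"
  have F: "F (torus_map L x) = \<psi> x" for x
    using periodic_factor[OF L, of \<psi>] \<psi> by (simp add: F_def tcont_def)
  have "continuous_on S F"
    unfolding continuous_on_closed_vimage[OF compact_imp_closed[OF S]]
  proof (intro allI impI)
    fix B :: "real set" assume B: "closed B"
    have "F -` B \<inter> S = torus_map L ` (K \<inter> \<psi> -` B)"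
      unfolding S_def using F by auto
    moreover have "closed (\<psi> -` B)"
      using \<psi> B by (auto simp: tcont_def intro: closed_vimage)
    then have "compact (K \<inter> \<psi> -` B)" unfolding K_def by (intro compact_Int_closed compact_cbox)
    then have "compact (torus_map L ` (K \<inter> \<psi> -` B))"
      by (intro compact_continuous_image torus_map_continuous)
    ultimately show "closed (F -` B \<inter> S)" by (simp add: compact_imp_closed)
  qed
  then obtain p where p: "real_polynomial_function p" "\<And>y. y \<in> S \<Longrightarrow> \<bar>F y - p y\<bar> < e"
    using Stone_Weierstrass_real_polynomial_function[OF S _ e] by blast
  show ?thesis
  proof (intro exI conjI allI)
    show "tsmooth L (\<lambda>x. p (torus_map L x))"
      unfolding tsmooth_def using smooth_polynomial_torus[OF p(1)] periodic_torus_map[OF L] by blast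
    show "\<bar>\<psi> x - p (torus_map L x)\<bar> < e" for x
      using p(2)[OF inS[of x]] F by simp
  qed
qed

subsection \<open>Measures on the torus are determined by continuous functions\<close>

lemma pos_measure_on_finite: "pos_measure_on S M \<Longrightarrow> finite_measure M"
  and pos_measure_on_sets: "pos_measure_on S M \<Longrightarrow> sets M = sets (restrict_space borel S)"
  by (auto simp: pos_measure_on_def)

lemma pos_measure_on_space: "pos_measure_on S M \<Longrightarrow> space M = S"
  using sets_eq_imp_space_eq[of M "restrict_space borel S"] by (auto simp: pos_measure_on_def space_restrict_space)

lemma pos_measure_on_measurable:
  assumes "pos_measure_on S M" "f \<in> borel_measurable borel"
  shows "f \<in> borel_measurable M"
proof -
  have "f \<in> borel_measurable (restrict_space borel S)"
    using assms(2) by (rule measurable_restrict_space1)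
  then show ?thesis using measurable_cong_sets[OF pos_measure_on_sets[OF assms(1)] refl, of borel] by blast
qed

lemma tcont_measurable: "tcont L \<psi> \<Longrightarrow> \<psi> \<in> borel_measurable borel"
  by (auto simp: tcont_def intro: borel_measurable_continuous_onI)

lemma pos_measure_on_integrable:
  assumes M: "pos_measure_on S M" and f: "f \<in> borel_measurable borel"
    and B: "\<And>x. x \<in> S \<Longrightarrow> \<bar>f x\<bar> \<le> (B::real)"
  shows "integrable M f"
proof -
  interpret finite_measure M using M by (rule pos_measure_on_finite)
  show ?thesis
    by (rule integrable_const_bound[of _ B])
       (use B pos_measure_on_measurable[OF M f] pos_measure_on_space[OF M] in auto)
qed

lemma tcont_integrable:
  assumes "pos_measure_on (QL L) M" "tcont L \<psi>"
  shows "integrable M \<psi>"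
  using pos_measure_on_integrable[OF assms(1) tcont_measurable[OF assms(2)]] tcont_bounded[OF assms(2)] by metis

text \<open>Continuous functions decreasing to the indicator of a closed set.\<close>

definition cutoff :: "('a::metric_space) set \<Rightarrow> nat \<Rightarrow> 'a \<Rightarrow> real" where
  "cutoff D n y = (if D = {} then 0 else max 0 (1 - real n * infdist y D))"

lemma cutoff_continuous: "continuous_on S (cutoff D n)"
proof (cases "D = {}")
  case False
  then show ?thesis unfolding cutoff_def by (auto intro!: continuous_intros)
qed (simp add: cutoff_def)

lemma cutoff_bounds: "0 \<le> cutoff D n y" "cutoff D n y \<le> 1"
  by (auto simp: cutoff_def infdist_nonneg)

lemma cutoff_limit:
  assumes "closed D"
  shows "(\<lambda>n. cutoff D n y) \<longlonglongrightarrow> indicator D y"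
proof (cases "y \<in> D")
  case True
  then have "cutoff D n y = 1" for n by (auto simp: cutoff_def)
  then show ?thesis using True by simp
next
  case False
  show ?thesis
  proof (cases "D = {}")
    case True
    then show ?thesis by (simp add: cutoff_def)
  next
    case ne: False
    then have d: "infdist y D > 0" using infdist_pos_not_in_closed[of D y] assms False by auto
    obtain N where N: "real N * infdist y D > 1" using reals_Archimedean3[OF d] by blast
    have "cutoff D n y = 0" if "n \<ge> N" for n
    proof -
      have "real n * infdist y D \<ge> real N * infdist y D" using that d by simp
      then show ?thesis using N ne by (simp add: cutoff_def)
    qed
    then have "(\<lambda>n. cutoff D n y) \<longlonglongrightarrow> 0"
      by (intro tendsto_eventually eventually_sequentiallyI)
    then show ?thesis using False by simp
  qed
qed

definition torus_closed :: "real \<Rightarrow> (real^2) set set" where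
  "torus_closed L = {torus_map L -` D \<inter> QL L |D. closed D}"

lemma torus_closed_Int: "Int_stable (torus_closed L)"
proof (rule Int_stableI)
  fix a b assume "a \<in> torus_closed L" "b \<in> torus_closed L"
  then obtain D D' where "a = torus_map L -` D \<inter> QL L" "closed D" "b = torus_map L -` D' \<inter> QL L" "closed D'"
    by (auto simp: torus_closed_def)
  then show "a \<inter> b \<in> torus_closed L"
    by (auto simp: torus_closed_def intro!: exI[of _ "D \<inter> D'"])
qed

lemma sets_torus_closed:
  assumes "L > 0"
  shows "sets (restrict_space borel (QL L)) = sigma_sets (QL L) (torus_closed L)"
proof -
  have "sets (borel :: (complex \<times> complex) measure) = sigma_sets UNIV (Collect closed)"
    using borel_eq_closed by (metis sets_measure_of top_greatest Pow_UNIV)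
  then have "sigma_sets (QL L) (torus_closed L) = {torus_map L -` A \<inter> QL L |A. A \<in> sets borel}"
    using sigma_sets_vimage_commute[of "torus_map L" "QL L" UNIV "Collect closed"]
    by (auto simp: torus_closed_def)
  moreover have "\<dots> = sets (restrict_space borel (QL L))"
  proof (intro set_eqI iffI)
    fix B assume "B \<in> {torus_map L -` A \<inter> QL L |A. A \<in> sets borel}"
    then obtain A where "B = torus_map L -` A \<inter> QL L" "A \<in> sets borel" by blast
    then show "B \<in> sets (restrict_space borel (QL L))"
      using measurable_sets[OF torus_map_measurable, of A L] by (auto simp: sets_restrict_space)
  next
    fix B assume "B \<in> sets (restrict_space borel (QL L))"
    then obtain C where C: "B = C \<inter> QL L" "C \<in> sets borel" by (auto simp: sets_restrict_space)
    have "x \<in> B \<longleftrightarrow> x \<in> torus_map L -` (torus_coord L -` C) \<inter> QL L" for x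
      using C torus_coord_map[OF assms, of x] by (cases "x \<in> QL L") simp_all
    then have "B = torus_map L -` (torus_coord L -` C) \<inter> QL L" by blast
    moreover have "torus_coord L -` C \<in> sets borel"
      using measurable_sets[OF torus_coord_measurable C(2)] by simp
    ultimately show "B \<in> {torus_map L -` A \<inter> QL L |A. A \<in> sets borel}" by blast
  qed
  ultimately show ?thesis by simp
qed

lemma torus_cutoff_limit:
  assumes L: "L > 0" and R: "pos_measure_on (QL L) R" and D: "closed D"
  shows "(\<lambda>n. LINT x|R. cutoff D n (torus_map L x)) \<longlonglongrightarrow> measure R (torus_map L -` D \<inter> QL L)"
proof -
  interpret R: finite_measure R using R by (rule pos_measure_on_finite)
  have "(\<lambda>n. LINT x|R. cutoff D n (torus_map L x)) \<longlonglongrightarrow> (LINT x|R. indicator (torus_map L -` D) x)"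
  proof (rule integral_dominated_convergence[where w = "\<lambda>_. 1"])
    show "(\<lambda>x. indicator (torus_map L -` D) x) \<in> borel_measurable R"
      using D by (intro pos_measure_on_measurable[OF R] borel_measurable_indicator)
        (auto intro: measurable_sets[OF torus_map_measurable, simplified] borel_closed)
    show "(\<lambda>x. cutoff D n (torus_map L x)) \<in> borel_measurable R" for n
      by (intro pos_measure_on_measurable[OF R] tcont_measurable[of L] tcont_torus_map L cutoff_continuous)
    show "AE x in R. (\<lambda>n. cutoff D n (torus_map L x)) \<longlonglongrightarrow> indicator (torus_map L -` D) x"
      using cutoff_limit[OF D] by (simp add: indicator_def)
  qed (auto simp: cutoff_bounds)
  also have "(LINT x|R. indicator (torus_map L -` D) x) = measure R (torus_map L -` D \<inter> QL L)"
    using pos_measure_on_space[OF R] by simp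
  finally show ?thesis .
qed

text \<open>By density, the integrals of smooth functions determine those of continuous functions on the torus, hence, through
  cutoffs, the masses of the closed subsets of the torus; these form an intersection-stable generator of the Borel sets of
  the square.\<close>

lemma torus_measure_eqI:
  assumes L: "L > 0" and M: "pos_measure_on (QL L) M" and N: "pos_measure_on (QL L) N"
    and eq: "\<And>\<psi>. tsmooth L \<psi> \<Longrightarrow> (LINT x|M. \<psi> x) = (LINT x|N. \<psi> x)"
  shows "M = N"
proof -
  interpret M: finite_measure M using M by (rule pos_measure_on_finite)
  interpret N: finite_measure N using N by (rule pos_measure_on_finite)
  have eqc: "(LINT x|M. \<psi> x) = (LINT x|N. \<psi> x)" if \<psi>: "tcont L \<psi>" for \<psi>
  proof -
    define c where "c = measure M (space M) + measure N (space N) + 1"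
    have c: "c > 0" unfolding c_def by (simp add: add_nonneg_pos)
    have "\<bar>(LINT x|M. \<psi> x) - (LINT x|N. \<psi> x)\<bar> \<le> e" if e: "e > 0" for e
    proof -
      obtain \<psi>' where \<psi>': "tsmooth L \<psi>'" "\<And>x. \<bar>\<psi> x - \<psi>' x\<bar> < e / c"
        using tsmooth_dense[OF L \<psi>, of "e / c"] e c by auto
      have close: "\<bar>(LINT x|R. \<psi> x) - (LINT x|R. \<psi>' x)\<bar> \<le> e / c * measure R (space R)"
        if R: "pos_measure_on (QL L) R" for R
      proof -
        interpret R: finite_measure R using R by (rule pos_measure_on_finite)
        have i: "integrable R \<psi>" "integrable R \<psi>'"
          using tcont_integrable[OF R] \<psi> tsmooth_tcont[OF \<psi>'(1)] by auto
        have "\<bar>(LINT x|R. \<psi> x) - (LINT x|R. \<psi>' x)\<bar> = \<bar>LINT x|R. \<psi> x - \<psi>' x\<bar>"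
          using i by simp
        also have "\<dots> \<le> (LINT x|R. e / c)"
          using i \<psi>'(2) by (intro integral_abs_bound_integral) (auto intro: less_imp_le)
        finally show ?thesis by (simp add: mult.commute)
      qed
      have "\<bar>(LINT x|M. \<psi> x) - (LINT x|N. \<psi> x)\<bar> \<le> e / c * measure M (space M) + e / c * measure N (space N)"
        using close[OF M] close[OF N] eq[OF \<psi>'(1)] by linarith
      also have "\<dots> = e / c * (measure M (space M) + measure N (space N))" by (simp add: distrib_left)
      also have "\<dots> \<le> e / c * c" using e c by (intro mult_left_mono) (auto simp: c_def)
      finally show ?thesis using c by simp
    qed
    then have "\<bar>(LINT x|M. \<psi> x) - (LINT x|N. \<psi> x)\<bar> \<le> 0" by (rule field_le_epsilon) simp
    then show ?thesis by simp
  qed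
  show ?thesis
  proof (rule measure_eqI_generator_eq[where E = "torus_closed L" and \<Omega> = "QL L" and A = "\<lambda>_. QL L"])
    fix X assume "X \<in> torus_closed L"
    then obtain D where D: "closed D" "X = torus_map L -` D \<inter> QL L" by (auto simp: torus_closed_def)
    have "(LINT x|M. cutoff D n (torus_map L x)) = (LINT x|N. cutoff D n (torus_map L x))" for n
      by (intro eqc tcont_torus_map L cutoff_continuous)
    then have "measure M X = measure N X"
      using torus_cutoff_limit[OF L M D(1)] torus_cutoff_limit[OF L N D(1)] LIMSEQ_unique D(2) by auto
    then show "emeasure M X = emeasure N X"
      by (simp add: M.emeasure_eq_measure N.emeasure_eq_measure)
  next
    have "QL L \<in> torus_closed L"
      unfolding torus_closed_def by (auto intro!: exI[of _ UNIV])
    then show "range (\<lambda>_. QL L) \<subseteq> torus_closed L" by auto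
  qed (use sets_torus_closed[OF L] pos_measure_on_sets[OF M] pos_measure_on_sets[OF N] torus_closed_Int
      in \<open>auto simp: torus_closed_def\<close>)
qed

section \<open>Disintegrations and slices\<close>

lemma QLT_borel [measurable]: "QLT L T \<in> sets borel"
  unfolding QLT_def borel_prod[symmetric] by simp

lemma section_borel: "A \<in> sets borel \<Longrightarrow> {x. (x, t) \<in> A} \<in> sets borel"
  for A :: "((real^2) \<times> real) set"
  using measurable_sets[of "\<lambda>x. (x, t)" borel borel A] by (auto simp: borel_prod[symmetric] vimage_def)

lemma section_measurable:
  fixes f :: "(real^2) \<times> real \<Rightarrow> 'b::topological_space"
  assumes "f \<in> borel_measurable borel"
  shows "(\<lambda>x. f (x, t)) \<in> borel_measurable borel"
  using assms by (auto simp: borel_prod[symmetric])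

text \<open>What a disintegration says about the slices alone. It is kept apart because measurability in \<open>t\<close> has to be
  settled before a family of slices can be compared with a measure on the cylinder.\<close>

definition kernel :: "real \<Rightarrow> real \<Rightarrow> (real \<Rightarrow> (real^2) measure) \<Rightarrow> bool" where
  "kernel L T \<nu> \<longleftrightarrow> (\<forall>t\<in>{-T<..<T}. pos_measure_on (QL L) (\<nu> t)) \<and>
     (\<forall>B\<in>sets (restrict_space borel (QL L)).
        (\<lambda>t. emeasure (\<nu> t) B) \<in> borel_measurable (restrict_space borel {-T<..<T}))"

lemma disintegrates_kernel: "disintegrates L T \<mu> \<nu> \<Longrightarrow> kernel L T \<nu>"
  by (simp add: disintegrates_def kernel_def)

lemma kernel_pos: "kernel L T \<nu> \<Longrightarrow> t \<in> {-T<..<T} \<Longrightarrow> pos_measure_on (QL L) (\<nu> t)"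
  by (simp add: kernel_def)

lemma kernel_set_measurable:
  assumes "kernel L T \<nu>" "B \<in> sets borel" "B \<subseteq> QL L"
  shows "(\<lambda>t. emeasure (\<nu> t) B * indicator {-T<..<T} t) \<in> borel_measurable borel"
proof -
  have "B \<in> sets (restrict_space borel (QL L))"
    using assms by (auto simp: sets_restrict_space_iff)
  then show ?thesis
    using assms(1) by (auto simp: kernel_def borel_measurable_restrict_space_iff_ennreal)
qed

lemma kernel_section_sets:
  assumes k: "kernel L T \<nu>" and C: "C \<in> sets borel" and t: "t \<in> {-T<..<T}"
  shows "{x\<in>QL L. (x, t) \<in> C} \<in> sets (\<nu> t)"
proof -
  have "{x\<in>QL L. (x, t) \<in> C} = QL L \<inter> {x. (x, t) \<in> C}" by auto
  then show ?thesis
    unfolding pos_measure_on_sets[OF kernel_pos[OF k t]] sets_restrict_space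
    using section_borel[OF C] by blast
qed

lemma kernel_section_emeasure_measurable:
  assumes k: "kernel L T \<nu>" and A: "A \<in> sets (borel \<Otimes>\<^sub>M borel)"
  shows "(\<lambda>t. emeasure (\<nu> t) {x\<in>QL L. (x, t) \<in> A} * indicator {-T<..<T} t) \<in> borel_measurable borel"
proof -
  note A' = A[unfolded sets_pair_measure]
  have meas: "{x\<in>QL L. (x, t) \<in> C} \<in> sets (\<nu> t)" if "C \<in> sets (borel \<Otimes>\<^sub>M borel)" "t \<in> {-T<..<T}" for C t
    using kernel_section_sets[OF k _ that(2), of C] that(1) unfolding borel_prod by blast
  from Int_stable_pair_measure_generator pair_measure_closed A' show ?thesis
  proof (induct rule: sigma_sets_induct_disjoint)
    case (basic A)
    then obtain a b where ab: "A = a \<times> b" "a \<in> sets borel" "b \<in> sets borel" by auto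
    have "(\<lambda>t. emeasure (\<nu> t) (a \<inter> QL L) * indicator {-T<..<T} t) \<in> borel_measurable borel"
      by (rule kernel_set_measurable[OF k]) (use ab in auto)
    then have "(\<lambda>t. (emeasure (\<nu> t) (a \<inter> QL L) * indicator {-T<..<T} t) * indicator b t) \<in> borel_measurable borel"
      using ab(3) by measurable
    moreover have "(emeasure (\<nu> t) (a \<inter> QL L) * indicator {-T<..<T} t) * indicator b t =
        emeasure (\<nu> t) {x\<in>QL L. (x, t) \<in> A} * indicator {-T<..<T} t" for t
    proof (cases "t \<in> b")
      case True
      then have "{x\<in>QL L. (x, t) \<in> A} = a \<inter> QL L" using ab by auto
      then show ?thesis using True by simp
    next
      case False
      then have "{x\<in>QL L. (x, t) \<in> A} = {}" using ab by auto
      then show ?thesis using False by (simp only: emeasure_empty indicator_simps) simp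
    qed
    ultimately show ?case by simp
  next
    case empty
    show ?case by simp
  next
    case (compl A)
    have A: "A \<in> sets (borel \<Otimes>\<^sub>M borel)" using compl(1) by (simp add: sets_pair_measure)
    have "emeasure (\<nu> t) {x\<in>QL L. (x, t) \<in> space borel \<times> space borel - A} * indicator {-T<..<T} t
      = emeasure (\<nu> t) (QL L) * indicator {-T<..<T} t - emeasure (\<nu> t) {x\<in>QL L. (x, t) \<in> A} * indicator {-T<..<T} t" for t
    proof (cases "t \<in> {-T<..<T}")
      case True
      interpret finite_measure "\<nu> t" using kernel_pos[OF k True] by (rule pos_measure_on_finite)
      have "{x\<in>QL L. (x, t) \<in> space borel \<times> space borel - A} = QL L - {x\<in>QL L. (x, t) \<in> A}" by auto
      moreover have "QL L \<in> sets (\<nu> t)"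
        using pos_measure_on_space[OF kernel_pos[OF k True]] sets.top by metis
      ultimately show ?thesis
        using True by (simp add: emeasure_Diff meas[OF A True])
    qed simp
    then show ?case
      using compl kernel_set_measurable[OF k QL_borel subset_refl] by simp
  next
    case (union A)
    have A: "A i \<in> sets (borel \<Otimes>\<^sub>M borel)" for i using union(2) by (auto simp: sets_pair_measure)
    have eq: "emeasure (\<nu> t) {x\<in>QL L. (x, t) \<in> (\<Union>i. A i)} * indicator {-T<..<T} t
      = (\<Sum>i. emeasure (\<nu> t) {x\<in>QL L. (x, t) \<in> A i} * indicator {-T<..<T} t)" for t
    proof (cases "t \<in> {-T<..<T}")
      case True
      have "{x\<in>QL L. (x, t) \<in> (\<Union>i. A i)} = (\<Union>i. {x\<in>QL L. (x, t) \<in> A i})" by auto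
      moreover have "disjoint_family (\<lambda>i. {x\<in>QL L. (x, t) \<in> A i})"
        using union(1) by (auto simp: disjoint_family_on_def)
      ultimately show ?thesis
        using True meas[OF A True] by (simp add: suminf_emeasure[symmetric] image_subset_iff)
    qed simp
    show ?case unfolding eq using union(3) by measurable
  qed
qed

lemma kernel_nn_integral_measurable:
  fixes f :: "(real^2) \<times> real \<Rightarrow> ennreal"
  assumes k: "kernel L T \<nu>" and f: "f \<in> borel_measurable borel"
  shows "(\<lambda>t. (\<integral>\<^sup>+x. f (x, t) \<partial>\<nu> t) * indicator {-T<..<T} t) \<in> borel_measurable borel"
proof -
  have m: "(\<lambda>x. u (x, t)) \<in> borel_measurable (\<nu> t)"
    if "u \<in> borel_measurable borel" "t \<in> {-T<..<T}" for u :: "(real^2) \<times> real \<Rightarrow> ennreal" and t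
    using pos_measure_on_measurable[OF kernel_pos[OF k that(2)] section_measurable[OF that(1)]] .
  from f show ?thesis
  proof (induct rule: borel_measurable_induct)
    case (cong f g)
    then show ?case by (simp add: fun_eq_iff)
  next
    case (set A)
    have "(\<integral>\<^sup>+x. indicator A (x, t) \<partial>\<nu> t) * indicator {-T<..<T} t =
        emeasure (\<nu> t) {x\<in>QL L. (x, t) \<in> A} * indicator {-T<..<T} t" for t
    proof (cases "t \<in> {-T<..<T}")
      case True
      have sp: "space (\<nu> t) = QL L" by (rule pos_measure_on_space[OF kernel_pos[OF k True]])
      have "(\<integral>\<^sup>+x. indicator A (x, t) \<partial>\<nu> t) = (\<integral>\<^sup>+x. indicator {x\<in>QL L. (x, t) \<in> A} x \<partial>\<nu> t)"
        by (intro nn_integral_cong) (auto simp: sp indicator_def)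
      also have "\<dots> = emeasure (\<nu> t) {x\<in>QL L. (x, t) \<in> A}"
        by (rule nn_integral_indicator[OF kernel_section_sets[OF k set True]])
      finally show ?thesis by simp
    qed simp
    then show ?case
      using kernel_section_emeasure_measurable[OF k, of A] set unfolding borel_prod by simp
  next
    case (mult u c)
    have "(\<integral>\<^sup>+x. c * u (x, t) \<partial>\<nu> t) * indicator {-T<..<T} t
        = c * ((\<integral>\<^sup>+x. u (x, t) \<partial>\<nu> t) * indicator {-T<..<T} t)" for t
      by (cases "t \<in> {-T<..<T}") (auto simp: nn_integral_cmult m mult)
    then show ?case using mult by simp
  next
    case (add u v)
    have "(\<integral>\<^sup>+x. v (x, t) + u (x, t) \<partial>\<nu> t) * indicator {-T<..<T} t
        = (\<integral>\<^sup>+x. v (x, t) \<partial>\<nu> t) * indicator {-T<..<T} t + (\<integral>\<^sup>+x. u (x, t) \<partial>\<nu> t) * indicator {-T<..<T} t" for t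
      by (cases "t \<in> {-T<..<T}") (auto simp: nn_integral_add m add)
    then show ?case using add by simp
  next
    case (seq U)
    have "(\<integral>\<^sup>+x. (SUP i. U i) (x, t) \<partial>\<nu> t) * indicator {-T<..<T} t
        = (SUP i. (\<integral>\<^sup>+x. U i (x, t) \<partial>\<nu> t) * indicator {-T<..<T} t)" for t
    proof (cases "t \<in> {-T<..<T}")
      case True
      have "(\<integral>\<^sup>+x. (SUP i. U i (x, t)) \<partial>\<nu> t) = (SUP i. (\<integral>\<^sup>+x. U i (x, t) \<partial>\<nu> t))"
        by (rule nn_integral_monotone_convergence_SUP)
           (use seq(4) m[OF seq(1) True] in \<open>auto simp: incseq_def le_fun_def\<close>)
      then show ?thesis using True by (simp add: image_comp)
    qed simp
    then show ?case using seq by simp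
  qed
qed

lemma disintegrates_nn_integral:
  fixes f :: "(real^2) \<times> real \<Rightarrow> ennreal"
  assumes d: "disintegrates L T \<mu> \<nu>" and \<mu>: "pos_measure_on (QLT L T) \<mu>" and f: "f \<in> borel_measurable borel"
  shows "(\<integral>\<^sup>+x. f x \<partial>\<mu>) = (\<integral>\<^sup>+t\<in>{-T<..<T}. (\<integral>\<^sup>+x. f (x, t) \<partial>\<nu> t) \<partial>lborel)"
proof -
  note k = disintegrates_kernel[OF d]
  have m: "(\<lambda>x. u (x, t)) \<in> borel_measurable (\<nu> t)"
    if "u \<in> borel_measurable borel" "t \<in> {-T<..<T}" for u :: "(real^2) \<times> real \<Rightarrow> ennreal" and t
    using pos_measure_on_measurable[OF kernel_pos[OF k that(2)] section_measurable[OF that(1)]] .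
  have m\<mu>: "u \<in> borel_measurable \<mu>" if "u \<in> borel_measurable borel" for u :: "(real^2) \<times> real \<Rightarrow> ennreal"
    using pos_measure_on_measurable[OF \<mu> that] .
  note km = kernel_nn_integral_measurable[OF k]
  from f show ?thesis
  proof (induct rule: borel_measurable_induct)
    case (cong f g)
    then show ?case by (simp add: fun_eq_iff)
  next
    case (set A)
    have "(\<integral>\<^sup>+x. indicator A x \<partial>\<mu>) = (\<integral>\<^sup>+x. indicator (A \<inter> QLT L T) x \<partial>\<mu>)"
      using pos_measure_on_space[OF \<mu>] by (intro nn_integral_cong) (auto simp: indicator_def)
    also have AQ: "A \<inter> QLT L T \<in> sets \<mu>"
      using set pos_measure_on_sets[OF \<mu>] by (auto simp: sets_restrict_space)
    then have "(\<integral>\<^sup>+x. indicator (A \<inter> QLT L T) x \<partial>\<mu>) = emeasure \<mu> (A \<inter> QLT L T)"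
      by (rule nn_integral_indicator)
    also have "\<dots> = (\<integral>\<^sup>+t\<in>{-T<..<T}. emeasure (\<nu> t) {x. (x, t) \<in> A \<inter> QLT L T} \<partial>lborel)"
      using d AQ by (auto simp: disintegrates_def)
    also have "\<dots> = (\<integral>\<^sup>+t\<in>{-T<..<T}. (\<integral>\<^sup>+x. indicator A (x, t) \<partial>\<nu> t) \<partial>lborel)"
    proof (intro nn_integral_cong)
      fix t
      show "emeasure (\<nu> t) {x. (x, t) \<in> A \<inter> QLT L T} * indicator {-T<..<T} t
        = (\<integral>\<^sup>+x. indicator A (x, t) \<partial>\<nu> t) * indicator {-T<..<T} t"
      proof (cases "t \<in> {-T<..<T}")
        case True
        have sp: "space (\<nu> t) = QL L" by (rule pos_measure_on_space[OF kernel_pos[OF k True]])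
        have "(\<integral>\<^sup>+x. indicator A (x, t) \<partial>\<nu> t) = (\<integral>\<^sup>+x. indicator {x. (x, t) \<in> A \<inter> QLT L T} x \<partial>\<nu> t)"
          using True by (intro nn_integral_cong) (auto simp: sp indicator_def QLT_def)
        also have "\<dots> = emeasure (\<nu> t) {x. (x, t) \<in> A \<inter> QLT L T}"
        proof (intro nn_integral_indicator)
          have "{x. (x, t) \<in> A \<inter> QLT L T} = {x\<in>QL L. (x, t) \<in> A}" using True by (auto simp: QLT_def)
          then show "{x. (x, t) \<in> A \<inter> QLT L T} \<in> sets (\<nu> t)"
            using kernel_section_sets[OF k set True] by simp
        qed
        finally show ?thesis by simp
      qed simp
    qed
    finally show ?case .
  next
    case (mult u c)
    have "(\<integral>\<^sup>+t\<in>{-T<..<T}. (\<integral>\<^sup>+x. c * u (x, t) \<partial>\<nu> t) \<partial>lborel)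
        = (\<integral>\<^sup>+t. c * ((\<integral>\<^sup>+x. u (x, t) \<partial>\<nu> t) * indicator {-T<..<T} t) \<partial>lborel)"
      by (intro nn_integral_cong) (auto simp: nn_integral_cmult m mult indicator_def)
    also have "\<dots> = c * (\<integral>\<^sup>+t\<in>{-T<..<T}. (\<integral>\<^sup>+x. u (x, t) \<partial>\<nu> t) \<partial>lborel)"
      using km[of u] mult by (intro nn_integral_cmult) simp
    also have "\<dots> = c * (\<integral>\<^sup>+x. u x \<partial>\<mu>)" using mult by simp
    also have "\<dots> = (\<integral>\<^sup>+x. c * u x \<partial>\<mu>)"
      by (rule nn_integral_cmult[symmetric]) (use m\<mu> mult in blast)
    finally show ?case by (rule sym)
  next
    case (add u v)
    have "(\<integral>\<^sup>+t\<in>{-T<..<T}. (\<integral>\<^sup>+x. v (x, t) + u (x, t) \<partial>\<nu> t) \<partial>lborel)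
        = (\<integral>\<^sup>+t. (\<integral>\<^sup>+x. v (x, t) \<partial>\<nu> t) * indicator {-T<..<T} t + (\<integral>\<^sup>+x. u (x, t) \<partial>\<nu> t) * indicator {-T<..<T} t \<partial>lborel)"
      by (intro nn_integral_cong) (auto simp: nn_integral_add m add indicator_def)
    also have "\<dots> = (\<integral>\<^sup>+t\<in>{-T<..<T}. (\<integral>\<^sup>+x. v (x, t) \<partial>\<nu> t) \<partial>lborel) + (\<integral>\<^sup>+t\<in>{-T<..<T}. (\<integral>\<^sup>+x. u (x, t) \<partial>\<nu> t) \<partial>lborel)"
      using km[of u] km[of v] add by (intro nn_integral_add) simp_all
    also have "\<dots> = (\<integral>\<^sup>+x. v x \<partial>\<mu>) + (\<integral>\<^sup>+x. u x \<partial>\<mu>)" using add by simp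
    also have "\<dots> = (\<integral>\<^sup>+x. v x + u x \<partial>\<mu>)"
      by (rule nn_integral_add[symmetric]) (use m\<mu> add in blast)+
    finally show ?case by (rule sym)
  next
    case (seq U)
    have "(\<integral>\<^sup>+t\<in>{-T<..<T}. (\<integral>\<^sup>+x. (SUP i. U i) (x, t) \<partial>\<nu> t) \<partial>lborel)
        = (\<integral>\<^sup>+t. (SUP i. (\<integral>\<^sup>+x. U i (x, t) \<partial>\<nu> t) * indicator {-T<..<T} t) \<partial>lborel)"
    proof (intro nn_integral_cong)
      fix t
      show "(\<integral>\<^sup>+x. (SUP i. U i) (x, t) \<partial>\<nu> t) * indicator {-T<..<T} t
        = (SUP i. (\<integral>\<^sup>+x. U i (x, t) \<partial>\<nu> t) * indicator {-T<..<T} t)"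
      proof (cases "t \<in> {-T<..<T}")
        case True
        have "(\<integral>\<^sup>+x. (SUP i. U i (x, t)) \<partial>\<nu> t) = (SUP i. (\<integral>\<^sup>+x. U i (x, t) \<partial>\<nu> t))"
          by (rule nn_integral_monotone_convergence_SUP)
             (use seq(4) m[OF seq(1) True] in \<open>auto simp: incseq_def le_fun_def\<close>)
        then show ?thesis using True by (simp add: image_comp)
      qed simp
    qed
    also have "\<dots> = (SUP i. \<integral>\<^sup>+t. (\<integral>\<^sup>+x. U i (x, t) \<partial>\<nu> t) * indicator {-T<..<T} t \<partial>lborel)"
      using km[OF seq(1)]
      by (intro nn_integral_monotone_convergence_SUP)
         (use seq(4) in \<open>auto simp: incseq_def le_fun_def intro!: mult_right_mono nn_integral_mono\<close>)
    also have "\<dots> = (SUP i. \<integral>\<^sup>+x. U i x \<partial>\<mu>)" using seq(3) by simp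
    also have "\<dots> = (\<integral>\<^sup>+x. (SUP i. U i x) \<partial>\<mu>)"
      by (rule nn_integral_monotone_convergence_SUP[symmetric]) (use seq(4) m\<mu>[OF seq(1)] in auto)
    finally show ?case by (simp add: image_comp)
  qed
qed

lemma disintegrates_integral_nonneg:
  fixes f :: "(real^2) \<times> real \<Rightarrow> real"
  assumes d: "disintegrates L T \<mu> \<nu>" and \<mu>: "pos_measure_on (QLT L T) \<mu>" and f: "f \<in> borel_measurable borel"
    and B: "\<And>x t. x \<in> QL L \<Longrightarrow> t \<in> {-T<..<T} \<Longrightarrow> 0 \<le> f (x, t) \<and> f (x, t) \<le> B"
  shows "has_bochner_integral lborel (\<lambda>t. indicator {-T<..<T} t * (LINT x|\<nu> t. f (x, t))) (LINT x|\<mu>. f x)"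
proof -
  note k = disintegrates_kernel[OF d]
  have i\<mu>: "integrable \<mu> f"
    by (rule pos_measure_on_integrable[OF \<mu> f, of B]) (use B in \<open>auto simp: QLT_def\<close>)
  have f0: "AE x in \<mu>. 0 \<le> f x"
    using B pos_measure_on_space[OF \<mu>] by (auto simp: QLT_def)
  have inn: "ennreal (indicator {-T<..<T} t * (LINT x|\<nu> t. f (x, t)))
      = (\<integral>\<^sup>+x. ennreal (f (x, t)) \<partial>\<nu> t) * indicator {-T<..<T} t" for t
  proof (cases "t \<in> {-T<..<T}")
    case True
    note p = kernel_pos[OF k True]
    have "integrable (\<nu> t) (\<lambda>x. f (x, t))"
      by (rule pos_measure_on_integrable[OF p section_measurable[OF f], where B = B]) (use B True in auto)
    moreover have "AE x in \<nu> t. 0 \<le> f (x, t)"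
      using B True pos_measure_on_space[OF p] by auto
    ultimately show ?thesis using True by (simp add: nn_integral_eq_integral)
  qed simp
  have "(\<lambda>t. ennreal (indicator {-T<..<T} t * (LINT x|\<nu> t. f (x, t)))) \<in> borel_measurable borel"
    unfolding inn by (rule kernel_nn_integral_measurable[OF k]) (use f in simp)
  moreover have nn: "0 \<le> indicator {-T<..<T} t * (LINT x|\<nu> t. f (x, t))" for t
  proof (cases "t \<in> {-T<..<T}")
    case True
    then show ?thesis
      using B pos_measure_on_space[OF kernel_pos[OF k True]] by (auto intro!: integral_nonneg_AE)
  qed simp
  ultimately have meas: "(\<lambda>t. indicator {-T<..<T} t * (LINT x|\<nu> t. f (x, t))) \<in> borel_measurable lborel"
    using measurable_compose[OF _ borel_measurable_enn2real, of "\<lambda>t. ennreal (indicator {-T<..<T} t * (LINT x|\<nu> t. f (x, t)))" borel]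
    by simp
  have "(\<integral>\<^sup>+t. ennreal (indicator {-T<..<T} t * (LINT x|\<nu> t. f (x, t))) \<partial>lborel) = (\<integral>\<^sup>+x. ennreal (f x) \<partial>\<mu>)"
    unfolding inn using f by (subst disintegrates_nn_integral[OF d \<mu>]) auto
  also have "\<dots> = ennreal (LINT x|\<mu>. f x)"
    by (rule nn_integral_eq_integral[OF i\<mu> f0])
  finally show ?thesis
    by (intro has_bochner_integral_nn_integral meas) (use nn f0 in \<open>auto intro!: integral_nonneg_AE\<close>)
qed

lemma disintegrates_integral:
  fixes f :: "(real^2) \<times> real \<Rightarrow> real"
  assumes d: "disintegrates L T \<mu> \<nu>" and \<mu>: "pos_measure_on (QLT L T) \<mu>" and f: "f \<in> borel_measurable borel"
    and B: "\<And>x t. x \<in> QL L \<Longrightarrow> t \<in> {-T<..<T} \<Longrightarrow> \<bar>f (x, t)\<bar> \<le> B"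
  shows "has_bochner_integral lborel (\<lambda>t. indicator {-T<..<T} t * (LINT x|\<nu> t. f (x, t))) (LINT x|\<mu>. f x)"
proof (cases "QL L = {} \<or> {-T<..<T} = {}")
  case True
  have 1: "indicator {-T<..<T} t * (LINT x|\<nu> t. f (x, t)) = 0" for t
  proof (cases "t \<in> {-T<..<T}")
    case t: True
    then have "space (\<nu> t) = {}"
      using True pos_measure_on_space[OF kernel_pos[OF disintegrates_kernel[OF d] t]] by auto
    then show ?thesis by (simp add: Bochner_Integration.integral_empty)
  qed simp
  have 2: "(LINT x|\<mu>. f x) = 0"
    using True pos_measure_on_space[OF \<mu>] by (intro Bochner_Integration.integral_empty) (auto simp: QLT_def)
  show ?thesis unfolding 1 2 by (rule has_bochner_integral_zero)
next
  case False
  then have "B \<ge> 0" using B by fastforce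
  note k = disintegrates_kernel[OF d]
  have *: "has_bochner_integral lborel (\<lambda>t. indicator {-T<..<T} t * (LINT x|\<nu> t. f (x, t) + B)) (LINT x|\<mu>. f x + B)"
    by (rule disintegrates_integral_nonneg[OF d \<mu>, of "\<lambda>x. f x + B" "2 * B"]) (use f B in fastforce)+
  have **: "has_bochner_integral lborel (\<lambda>t. indicator {-T<..<T} t * (LINT x|\<nu> t. B)) (LINT x|\<mu>. B)"
    by (rule disintegrates_integral_nonneg[OF d \<mu>, of "\<lambda>x. B" "B"]) (use \<open>B \<ge> 0\<close> in auto)
  interpret \<mu>: finite_measure \<mu> using \<mu> by (rule pos_measure_on_finite)
  have "integrable \<mu> f"
    by (rule pos_measure_on_integrable[OF \<mu> f, of B]) (use B in \<open>auto simp: QLT_def\<close>)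
  then have 1: "(LINT x|\<mu>. f x + B) - (LINT x|\<mu>. B) = (LINT x|\<mu>. f x)" by simp
  have 2: "indicator {-T<..<T} t * (LINT x|\<nu> t. f (x, t) + B) - indicator {-T<..<T} t * (LINT x|\<nu> t. B)
      = indicator {-T<..<T} t * (LINT x|\<nu> t. f (x, t))" for t
  proof (cases "t \<in> {-T<..<T}")
    case True
    note p = kernel_pos[OF k True]
    interpret \<nu>: finite_measure "\<nu> t" using p by (rule pos_measure_on_finite)
    have "integrable (\<nu> t) (\<lambda>x. f (x, t))"
      by (rule pos_measure_on_integrable[OF p section_measurable[OF f], where B = B]) (use B True in auto)
    then show ?thesis using True by simp
  qed simp
  show ?thesis using has_bochner_integral_diff[OF * **] unfolding 1 2 .
qed

subsection \<open>Uniqueness\<close>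

text \<open>Intersection stability makes the generator determine finite measures; countability allows equations that hold for
  almost every \<open>t\<close>, one for each generating set, to be combined.\<close>

lemma countable_Int_stable_generator:
  "\<exists>E :: 'a::second_countable_topology set set. countable E \<and> Int_stable E \<and> UNIV \<in> E \<and> sets borel = sigma_sets UNIV E"
proof -
  obtain B :: "'a set set" where B: "countable B" "topological_basis B"
    using ex_countable_basis by blast
  define E where "E = (\<lambda>F. \<Inter>F) ` {F. finite F \<and> F \<subseteq> B}"
  have op: "open X" if "X \<in> E" for X
    using that topological_basis_open[OF B(2)] by (auto simp: E_def intro!: open_Inter)
  have "countable E"
    unfolding E_def using B(1) by (intro countable_image countable_Collect_finite_subset)
  moreover have "Int_stable E"
  proof (rule Int_stableI)
    fix a b assume "a \<in> E" "b \<in> E"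
    then obtain F G where "finite F" "F \<subseteq> B" "a = \<Inter>F" "finite G" "G \<subseteq> B" "b = \<Inter>G" by (auto simp: E_def)
    then show "a \<inter> b \<in> E" unfolding E_def by (intro image_eqI[of _ _ "F \<union> G"]) auto
  qed
  moreover have "UNIV \<in> E" unfolding E_def by (intro image_eqI[of _ _ "{}"]) auto
  moreover have "sets (borel :: 'a measure) = sigma_sets UNIV E"
  proof -
    have BE: "B \<subseteq> E" unfolding E_def by (auto intro!: image_eqI[of _ _ "{_}"])
    have "sets (borel :: 'a measure) = sigma_sets UNIV B"
      by (subst borel_eq_countable_basis[OF B]) (rule sets_measure_of, simp)
    moreover have "sigma_sets UNIV B \<subseteq> sigma_sets UNIV E" by (rule sigma_sets_mono') fact
    moreover have "sigma_sets UNIV E \<subseteq> sets borel"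
      using op by (metis borel_open sets.sigma_sets_subset space_borel subsetI)
    ultimately show ?thesis by blast
  qed
  ultimately show ?thesis by blast
qed

text \<open>For a fixed Borel set \<open>G\<close>, both \<open>t \<mapsto> \<nu>\<^sub>t(G)\<close> and \<open>t \<mapsto> \<nu>'\<^sub>t(G)\<close> are Lebesgue densities of
  \<open>A \<mapsto> \<mu>(G \<times> A)\<close>, hence equal almost everywhere.\<close>

lemma disintegrates_unique:
  assumes d: "disintegrates L T \<mu> \<nu>" and d': "disintegrates L T \<mu> \<nu>'" and \<mu>: "pos_measure_on (QLT L T) \<mu>"
  shows "AE t in lborel. t \<in> {-T<..<T} \<longrightarrow> \<nu> t = \<nu>' t"
proof -
  obtain E :: "(real^2) set set" where E: "countable E" "Int_stable E" "UNIV \<in> E" "sets borel = sigma_sets UNIV E"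
    using countable_Int_stable_generator by blast
  have Eb: "G \<in> sets borel" if "G \<in> E" for G using that E(4) by auto
  have *: "AE t in lborel. emeasure (\<nu> t) (G \<inter> QL L) * indicator {-T<..<T} t = emeasure (\<nu>' t) (G \<inter> QL L) * indicator {-T<..<T} t"
    if G: "G \<in> E" for G
  proof (rule sigma_finite_measure.density_unique[OF sigma_finite_lborel])
    have m: "(\<lambda>t. emeasure (\<eta> t) (G \<inter> QL L) * indicator {-T<..<T} t) \<in> borel_measurable lborel"
      if "disintegrates L T \<mu> \<eta>" for \<eta>
      using kernel_set_measurable[OF disintegrates_kernel[OF that], of "G \<inter> QL L"] Eb[OF G] by simp
    show "(\<lambda>t. emeasure (\<nu> t) (G \<inter> QL L) * indicator {-T<..<T} t) \<in> borel_measurable lborel"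
      "(\<lambda>t. emeasure (\<nu>' t) (G \<inter> QL L) * indicator {-T<..<T} t) \<in> borel_measurable lborel"
      using m d d' by auto
    have ev: "emeasure (density lborel (\<lambda>t. emeasure (\<eta> t) (G \<inter> QL L) * indicator {-T<..<T} t)) A
       = emeasure \<mu> ((G \<times> A) \<inter> QLT L T)" if \<eta>: "disintegrates L T \<mu> \<eta>" and A: "A \<in> sets borel" for \<eta> A
    proof -
      have "(G \<times> A) \<inter> QLT L T \<in> sets \<mu>"
        using Eb[OF G] A unfolding pos_measure_on_sets[OF \<mu>]
        by (auto simp: sets_restrict_space borel_prod[symmetric] intro!: image_eqI[of _ _ "G \<times> A"])
      then have "emeasure \<mu> ((G \<times> A) \<inter> QLT L T) = (\<integral>\<^sup>+t\<in>{-T<..<T}. emeasure (\<eta> t) {x. (x, t) \<in> (G \<times> A) \<inter> QLT L T} \<partial>lborel)"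
        using \<eta> by (auto simp: disintegrates_def)
      also have "\<dots> = (\<integral>\<^sup>+t. (emeasure (\<eta> t) (G \<inter> QL L) * indicator {-T<..<T} t) * indicator A t \<partial>lborel)"
      proof (intro nn_integral_cong)
        fix t
        have "{x. (x, t) \<in> (G \<times> A) \<inter> QLT L T} = (if t \<in> A \<and> t \<in> {-T<..<T} then G \<inter> QL L else {})"
          by (auto simp: QLT_def)
        then show "emeasure (\<eta> t) {x. (x, t) \<in> (G \<times> A) \<inter> QLT L T} * indicator {-T<..<T} t =
            (emeasure (\<eta> t) (G \<inter> QL L) * indicator {-T<..<T} t) * indicator A t"
          by (auto simp: indicator_def)
      qed
      finally show ?thesis using m[OF \<eta>] A by (simp add: emeasure_density)
    qed
    show "density lborel (\<lambda>t. emeasure (\<nu> t) (G \<inter> QL L) * indicator {-T<..<T} t) =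
        density lborel (\<lambda>t. emeasure (\<nu>' t) (G \<inter> QL L) * indicator {-T<..<T} t)"
      by (rule measure_eqI) (auto simp: ev[OF d] ev[OF d'])
  qed
  have "AE t in lborel. \<forall>G\<in>E. emeasure (\<nu> t) (G \<inter> QL L) * indicator {-T<..<T} t = emeasure (\<nu>' t) (G \<inter> QL L) * indicator {-T<..<T} t"
    by (subst AE_ball_countable[OF E(1)]) (use * in blast)
  then show ?thesis
  proof (rule AE_mp, intro AE_I2 impI)
    fix t assume eq: "\<forall>G\<in>E. emeasure (\<nu> t) (G \<inter> QL L) * indicator {-T<..<T} t = emeasure (\<nu>' t) (G \<inter> QL L) * indicator {-T<..<T} t"
      and t: "t \<in> {-T<..<T}"
    note p = kernel_pos[OF disintegrates_kernel[OF d] t] and p' = kernel_pos[OF disintegrates_kernel[OF d'] t]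
    interpret finite_measure "\<nu> t" using p by (rule pos_measure_on_finite)
    have gen: "sets (restrict_space borel (QL L)) = sigma_sets (QL L) ((\<lambda>G. G \<inter> QL L) ` E)"
      using restricted_sigma[of "QL L" UNIV E] E(4) QL_borel[of L]
      by (simp add: sets_restrict_space Int_commute image_comp)
    show "\<nu> t = \<nu>' t"
    proof (rule measure_eqI_generator_eq[where E = "(\<lambda>G. G \<inter> QL L) ` E" and \<Omega> = "QL L" and A = "\<lambda>_. QL L"])
      show "Int_stable ((\<lambda>G. G \<inter> QL L) ` E)"
      proof (rule Int_stableI)
        fix a b assume "a \<in> (\<lambda>G. G \<inter> QL L) ` E" "b \<in> (\<lambda>G. G \<inter> QL L) ` E"
        then obtain G H where "a = G \<inter> QL L" "b = H \<inter> QL L" "G \<in> E" "H \<in> E" by blast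
        moreover from this have "G \<inter> H \<in> E" using E(2) by (auto simp: Int_stable_def)
        ultimately show "a \<inter> b \<in> (\<lambda>G. G \<inter> QL L) ` E" by (intro image_eqI[of _ _ "G \<inter> H"]) auto
      qed
      show "emeasure (\<nu> t) X = emeasure (\<nu>' t) X" if "X \<in> (\<lambda>G. G \<inter> QL L) ` E" for X
        using that eq t by auto
      show "range (\<lambda>_. QL L) \<subseteq> (\<lambda>G. G \<inter> QL L) ` E" using E(3) by auto
    qed (use pos_measure_on_sets[OF p] pos_measure_on_sets[OF p'] gen in auto)
  qed
qed

subsection \<open>The weakly continuous representative\<close>

definition cyl_cont :: "real \<Rightarrow> ((real^2) \<times> real \<Rightarrow> real) \<Rightarrow> bool" where
  "cyl_cont L \<phi> \<longleftrightarrow> continuous_on UNIV \<phi> \<and> (\<forall>t. periodic L (\<lambda>x. \<phi> (x, t)))"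

definition cyl_smooth :: "real \<Rightarrow> ((real^2) \<times> real \<Rightarrow> real) \<Rightarrow> bool" where
  "cyl_smooth L \<phi> \<longleftrightarrow> smooth \<phi> \<and> (\<forall>t. periodic L (\<lambda>x. \<phi> (x, t)))"

lemma cyl_smooth_cont: "cyl_smooth L \<phi> \<Longrightarrow> cyl_cont L \<phi>"
  by (auto simp: cyl_smooth_def cyl_cont_def smooth_continuous)

lemma cyl_cont_tcont: "cyl_cont L \<phi> \<Longrightarrow> tcont L (\<lambda>x. \<phi> (x, t))"
  by (auto simp: cyl_cont_def tcont_def intro!: continuous_intros elim!: continuous_on_compose2)

lemma continuous_bounded_cylinder:
  fixes \<phi> :: "(real^2) \<times> real \<Rightarrow> real"
  assumes "continuous_on UNIV \<phi>"
  shows "\<exists>B\<ge>0. \<forall>x\<in>QL L. \<forall>t\<in>{-T..T}. \<bar>\<phi> (x, t)\<bar> \<le> B"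
proof -
  define K :: "((real^2) \<times> real) set" where "K = cbox (\<chi> i. - L / 2) (\<chi> i. L / 2) \<times> {-T..T}"
  have "compact K" unfolding K_def by (intro compact_Times compact_cbox compact_Icc)
  then have "bounded (\<phi> ` K)"
    using assms by (intro compact_imp_bounded compact_continuous_image) (auto intro: continuous_on_subset)
  then obtain B where B: "\<And>y. y \<in> K \<Longrightarrow> \<bar>\<phi> y\<bar> \<le> B" by (auto simp: bounded_iff)
  show ?thesis
  proof (intro exI[of _ "max B 0"] conjI ballI)
    fix x t assume "x \<in> QL L" "t \<in> {-T..T}"
    then have "(x, t) \<in> K" using QL_bounded[of L] by (auto simp: K_def)
    then show "\<bar>\<phi> (x, t)\<bar> \<le> max B 0" using B by fastforce
  qed simp
qed

text \<open>An approximate identity to the right of \<open>c\<close>: the kernel has unit mass and is supported in \<open>[c, c + h]\<close>. Being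
  one-sided, it is the derivative of a step that vanishes up to \<open>c\<close> and equals 1 from \<open>c + h\<close> on.\<close>

definition kern :: "real \<Rightarrow> real \<Rightarrow> real \<Rightarrow> real" where
  "kern c h t = bump ((t - c) / h) / h"

lemma kern_nonneg: "h > 0 \<Longrightarrow> 0 \<le> kern c h t"
  by (simp add: kern_def bump_nonneg)

lemma kern_supp: "h > 0 \<Longrightarrow> t \<notin> {c<..<c + h} \<Longrightarrow> kern c h t = 0"
  by (auto simp: kern_def field_simps intro!: bump_0)

lemma kern_smooth: "smooth (kern c h)"
  unfolding kern_def[abs_def]
  using smooth_cmult[OF smooth_affine[OF smooth_bump], of "1 / h" c h] by simp

lemma kern_step: "h > 0 \<Longrightarrow> ((\<lambda>t. step ((t - c) / h)) has_real_derivative kern c h t) (at t)"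
proof -
  assume "h > 0"
  then have "((\<lambda>t. (t - c) / h) has_real_derivative 1 / h) (at t)"
    by (auto intro!: derivative_eq_intros)
  from DERIV_chain2[OF step_deriv this] show ?thesis by (simp add: kern_def)
qed

lemma kern_integral:
  assumes "h > 0"
  shows "has_bochner_integral lborel (kern c h) 1"
proof -
  have "has_bochner_integral lborel (\<lambda>x. bump (- c / h + 1 / h * x)) (1 /\<^sub>R \<bar>1 / h\<bar>)"
    using lborel_has_bochner_integral_real_affine_iff[of "1 / h" bump 1 "- c / h"] bump_has_integral assms by simp
  from has_bochner_integral_mult_right[OF this, of "1 / h"]
  have "has_bochner_integral lborel (\<lambda>x. 1 / h * bump (- c / h + 1 / h * x)) 1" using assms by simp
  moreover have "1 / h * bump (- c / h + 1 / h * x) = kern c h x" for x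
    using assms by (simp add: kern_def diff_divide_distrib algebra_simps)
  ultimately show ?thesis by simp
qed

text \<open>The position \<open>c n\<close> may move as the width shrinks, so that the end points \<open>\<plusminus>T\<close> are approached from inside the
  interval.\<close>

lemma kern_limit:
  fixes F :: "real \<Rightarrow> real"
  assumes F: "continuous_on {-T..T} F"
    and h: "\<And>n. h n > 0" "\<And>n. - T \<le> c n" "\<And>n. c n + h n \<le> T"
    and lim: "h \<longlonglongrightarrow> 0" "c \<longlonglongrightarrow> a"
  shows "(\<lambda>n. LINT t|lborel. indicator {-T<..<T} t * (kern (c n) (h n) t * F t)) \<longlonglongrightarrow> F a"
proof (rule LIMSEQ_I)
  fix e :: real assume e: "e > 0"
  have a: "a \<in> {-T..T}"
  proof -
    have "- T \<le> a" using h(2) lim(2) by (intro LIMSEQ_le_const[OF lim(2)]) auto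
    moreover have "(\<lambda>n. c n + h n) \<longlonglongrightarrow> a + 0" using lim by (intro tendsto_add)
    then have "a + 0 \<le> T" using h(3) by (intro LIMSEQ_le_const2) auto
    ultimately show ?thesis by simp
  qed
  obtain d where d: "d > 0" "\<And>t. t \<in> {-T..T} \<Longrightarrow> \<bar>t - a\<bar> < d \<Longrightarrow> \<bar>F t - F a\<bar> < e / 2"
    using F a e unfolding continuous_on_iff dist_real_def by (metis half_gt_zero)
  obtain N where N: "\<And>n. n \<ge> N \<Longrightarrow> \<bar>h n\<bar> < d / 2"
    using LIMSEQ_D[OF lim(1), of "d / 2"] d by auto
  obtain N' where N': "\<And>n. n \<ge> N' \<Longrightarrow> \<bar>c n - a\<bar> < d / 2"
    using LIMSEQ_D[OF lim(2), of "d / 2"] d by auto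
  have "norm ((LINT t|lborel. indicator {-T<..<T} t * (kern (c n) (h n) t * F t)) - F a) < e"
    if n: "n \<ge> max N N'" for n
  proof -
    let ?k = "kern (c n) (h n)"
    have supp: "t \<in> {-T<..<T}" "\<bar>t - a\<bar> < d" if "?k t \<noteq> 0" for t
    proof -
      have t: "t \<in> {c n<..<c n + h n}" using that kern_supp[OF h(1)] by blast
      then show "t \<in> {-T<..<T}" using h(2)[of n] h(3)[of n] by auto
      have "\<bar>h n\<bar> < d / 2" "\<bar>c n - a\<bar> < d / 2" "c n < t" "t < c n + h n"
        using t N[of n] N'[of n] n by auto
      then show "\<bar>t - a\<bar> < d" by linarith
    qed
    have ik: "integrable lborel ?k" "(LINT t|lborel. ?k t) = 1"
      using kern_integral[OF h(1)[of n], of "c n"] by (auto simp: has_bochner_integral_iff)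
    have Fm: "(\<lambda>t. indicator {-T<..<T} t *\<^sub>R F t) \<in> borel_measurable lborel"
    proof -
      have "continuous_on {-T<..<T} F" by (rule continuous_on_subset[OF F]) auto
      then show ?thesis using borel_measurable_continuous_on_indicator[of "{-T<..<T}" F] by simp
    qed
    have bd: "\<bar>indicator {-T<..<T} t * (?k t * (F t - F a))\<bar> \<le> ?k t * (e / 2)" for t
    proof (cases "?k t = 0")
      case False
      note supp[OF False]
      then have "\<bar>F t - F a\<bar> \<le> e / 2" using d(2)[of t] by auto
      then have "?k t * \<bar>F t - F a\<bar> \<le> ?k t * (e / 2)"
        using kern_nonneg[OF h(1)] by (intro mult_left_mono) auto
      then show ?thesis using supp[OF False] kern_nonneg[OF h(1)[of n], of "c n" t] by (simp add: abs_mult)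
    qed simp
    have meas: "(\<lambda>t. indicator {-T<..<T} t * (?k t * (F t - F a))) \<in> borel_measurable lborel"
    proof -
      have "(\<lambda>t. ?k t * (indicator {-T<..<T} t *\<^sub>R F t) - F a * (indicator {-T<..<T} t * ?k t)) \<in> borel_measurable lborel"
        using Fm borel_measurable_integrable[OF ik(1)] by measurable
      then show ?thesis by (simp add: algebra_simps)
    qed
    have int: "integrable lborel (\<lambda>t. indicator {-T<..<T} t * (?k t * (F t - F a)))"
    proof (rule Bochner_Integration.integrable_bound[OF _ meas])
      show "integrable lborel (\<lambda>t. ?k t * (e / 2))" using ik(1) by simp
      show "AE t in lborel. norm (indicator {-T<..<T} t * (?k t * (F t - F a))) \<le> norm (?k t * (e / 2))"
        using bd e kern_nonneg[OF h(1)] by (intro AE_I2) (auto simp: abs_mult)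
    qed
    have eq: "indicator {-T<..<T} t * (?k t * F t) = indicator {-T<..<T} t * (?k t * (F t - F a)) + F a * ?k t" for t
      using supp[of t] by (cases "?k t = 0") (auto simp: algebra_simps)
    have "(LINT t|lborel. indicator {-T<..<T} t * (?k t * F t)) =
        (LINT t|lborel. indicator {-T<..<T} t * (?k t * (F t - F a))) + (LINT t|lborel. F a * ?k t)"
      unfolding eq using int ik by (intro Bochner_Integration.integral_add) auto
    then have "(LINT t|lborel. indicator {-T<..<T} t * (?k t * F t)) - F a =
        (LINT t|lborel. indicator {-T<..<T} t * (?k t * (F t - F a)))"
      using ik by simp
    also have "\<bar>\<dots>\<bar> \<le> (LINT t|lborel. ?k t * (e / 2))"
      using int ik(1) bd by (intro integral_abs_bound_integral) auto
    also have "\<dots> = e / 2" using ik by simp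
    finally show ?thesis using e by simp
  qed
  then show "\<exists>no. \<forall>n\<ge>no. norm ((LINT t|lborel. indicator {-T<..<T} t * (kern (c n) (h n) t * F t)) - F a) < e"
    by blast
qed

lemma wcs_disintegrates: "weakly_continuous_slicing L T \<mu> \<nu> \<Longrightarrow> disintegrates L T \<mu> \<nu>"
  and wcs_pos: "weakly_continuous_slicing L T \<mu> \<nu> \<Longrightarrow> t \<in> {-T..T} \<Longrightarrow> pos_measure_on (QL L) (\<nu> t)"
  and wcs_continuous: "weakly_continuous_slicing L T \<mu> \<nu> \<Longrightarrow> tcont L \<psi> \<Longrightarrow>
     continuous_on {-T..T} (\<lambda>t. LINT x|\<nu> t. \<psi> x)"
  by (auto simp: weakly_continuous_slicing_def tcont_def)

text \<open>For a fixed test function this is weak continuity; the change of the test function in time is controlled by its uniform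
  continuity and a bound on the masses.\<close>

lemma wcs_continuous_cyl:
  assumes w: "weakly_continuous_slicing L T \<mu> \<nu>" and \<phi>: "cyl_cont L \<phi>"
  shows "continuous_on {-T..T} (\<lambda>t. LINT x|\<nu> t. \<phi> (x, t))"
  unfolding continuous_on_iff dist_real_def
proof (intro ballI allI impI)
  fix a e assume a: "a \<in> {-T..T}" and e: "(0::real) < e"
  have one: "tcont L (\<lambda>x. 1)" by (simp add: tcont_def periodic_def)
  have "compact ((\<lambda>t. LINT x|\<nu> t. 1 :: real) ` {-T..T})"
    by (intro compact_continuous_image wcs_continuous[OF w one] compact_Icc)
  then have "bounded ((\<lambda>t. LINT x|\<nu> t. 1 :: real) ` {-T..T})" by (rule compact_imp_bounded)
  then obtain M where "\<forall>y\<in>(\<lambda>t. LINT x|\<nu> t. 1 :: real) ` {-T..T}. norm y \<le> M"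
    unfolding bounded_iff by blast
  then have M: "\<bar>LINT x|\<nu> t. 1 :: real\<bar> \<le> M" if "t \<in> {-T..T}" for t
    using bspec[OF _ imageI[OF that], of "\<lambda>t. LINT x|\<nu> t. 1 :: real" "\<lambda>y. norm y \<le> M"]
    unfolding real_norm_def by blast
  have M0: "M \<ge> 0" using M[OF a] by linarith
  define K :: "((real^2) \<times> real) set" where "K = cbox (\<chi> i. - L / 2) (\<chi> i. L / 2) \<times> {-T..T}"
  have "compact K" unfolding K_def by (intro compact_Times compact_cbox compact_Icc)
  then have "uniformly_continuous_on K \<phi>"
    using \<phi> by (intro compact_uniformly_continuous) (auto simp: cyl_cont_def intro: continuous_on_subset)
  moreover have "e / (2 * (M + 1)) > 0" using e M0 by simp
  ultimately obtain d1 where d1: "d1 > 0"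
    "\<And>y y'. y \<in> K \<Longrightarrow> y' \<in> K \<Longrightarrow> dist y' y < d1 \<Longrightarrow> \<bar>\<phi> y' - \<phi> y\<bar> < e / (2 * (M + 1))"
    unfolding uniformly_continuous_on_def dist_real_def by meson
  obtain d2 where d2: "d2 > 0"
    "\<And>t. t \<in> {-T..T} \<Longrightarrow> \<bar>t - a\<bar> < d2 \<Longrightarrow> \<bar>(LINT x|\<nu> t. \<phi> (x, a)) - (LINT x|\<nu> a. \<phi> (x, a))\<bar> < e / 2"
    using wcs_continuous[OF w cyl_cont_tcont[OF \<phi>, of a]] a e unfolding continuous_on_iff dist_real_def
    by (metis half_gt_zero)
  show "\<exists>d>0. \<forall>t\<in>{-T..T}. \<bar>t - a\<bar> < d \<longrightarrow> \<bar>(LINT x|\<nu> t. \<phi> (x, t)) - (LINT x|\<nu> a. \<phi> (x, a))\<bar> < e"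
  proof (intro exI[of _ "min d1 d2"] conjI ballI impI)
    fix t assume t: "t \<in> {-T..T}" "\<bar>t - a\<bar> < min d1 d2"
    note p = wcs_pos[OF w t(1)]
    interpret finite_measure "\<nu> t" using p by (rule pos_measure_on_finite)
    have i: "integrable (\<nu> t) (\<lambda>x. \<phi> (x, b))" for b
      by (rule tcont_integrable[OF p cyl_cont_tcont[OF \<phi>]])
    have "\<bar>(LINT x|\<nu> t. \<phi> (x, t)) - (LINT x|\<nu> t. \<phi> (x, a))\<bar> = \<bar>LINT x|\<nu> t. \<phi> (x, t) - \<phi> (x, a)\<bar>"
      using i by simp
    also have "\<dots> \<le> (LINT x|\<nu> t. e / (2 * (M + 1)))"
    proof (rule integral_abs_bound_integral)
      fix x assume "x \<in> space (\<nu> t)"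
      then have "x \<in> cbox (\<chi> i. - L / 2) (\<chi> i. L / 2)"
        using pos_measure_on_space[OF p] QL_bounded[of L] by auto
      then show "\<bar>\<phi> (x, t) - \<phi> (x, a)\<bar> \<le> e / (2 * (M + 1))"
        using d1(2)[of "(x, a)" "(x, t)"] t a by (auto simp: K_def dist_Pair_Pair dist_real_def)
    qed (use i in auto)
    also have "\<dots> = e / (2 * (M + 1)) * measure (\<nu> t) (space (\<nu> t))" by simp
    also have "\<dots> \<le> e / (2 * (M + 1)) * (M + 1)"
      using M[OF t(1)] M0 e by (intro mult_left_mono) auto
    also have "\<dots> = e / 2" using M0 by (simp add: divide_simps)
    finally show "\<bar>(LINT x|\<nu> t. \<phi> (x, t)) - (LINT x|\<nu> a. \<phi> (x, a))\<bar> < e"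
      using d2(2)[OF t(1)] t(2) by linarith
  qed (use d1 d2 in auto)
qed

lemma continuous_cylinder_measurable: "continuous_on UNIV \<phi> \<Longrightarrow> \<phi> \<in> borel_measurable borel"
  for \<phi> :: "(real^2) \<times> real \<Rightarrow> real"
  by (rule borel_measurable_continuous_onI)

lemma smooth_time_weight: "smooth w \<Longrightarrow> smooth (\<lambda>x::(real^2) \<times> real. w (snd x))"
  by (rule smooth_compose_linear[OF bounded_linear_snd])

lemma smooth_space_weight: "smooth \<psi> \<Longrightarrow> smooth (\<lambda>x::(real^2) \<times> real. \<psi> (fst x))"
  by (rule smooth_compose_linear[OF bounded_linear_fst])

lemma cyl_time_measurable:
  fixes u :: "real \<Rightarrow> real"
  assumes \<mu>: "pos_measure_on (QLT L T) \<mu>" and u: "u \<in> borel_measurable borel"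
  shows "(\<lambda>x. u (snd x)) \<in> borel_measurable \<mu>"
  by (intro pos_measure_on_measurable[OF \<mu>] measurable_compose[OF _ u]) (simp add: borel_prod[symmetric])

text \<open>Averages over thin slabs recover the slice from \<open>\<mu>\<close> alone, which is why a weakly continuous slicing is unique at
  every height and not only at almost every height.\<close>

lemma slice_bump_limit:
  assumes w: "weakly_continuous_slicing L T \<mu> \<nu>" and \<mu>: "pos_measure_on (QLT L T) \<mu>" and \<phi>: "cyl_cont L \<phi>"
    and h: "\<And>n. h n > 0" "\<And>n. - T \<le> c n" "\<And>n. c n + h n \<le> T"
    and lim: "h \<longlonglongrightarrow> 0" "c \<longlonglongrightarrow> a"
  shows "(\<lambda>n. LINT x|\<mu>. kern (c n) (h n) (snd x) * \<phi> x) \<longlonglongrightarrow> (LINT x|\<nu> a. \<phi> (x, a))"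
proof -
  have "(LINT x|\<mu>. kern (c n) (h n) (snd x) * \<phi> x)
    = (LINT t|lborel. indicator {-T<..<T} t * (kern (c n) (h n) t * (LINT x|\<nu> t. \<phi> (x, t))))" for n
  proof -
    have c: "continuous_on UNIV (\<lambda>x. kern (c n) (h n) (snd x) * \<phi> x)"
      using \<phi> by (intro continuous_on_mult[OF smooth_continuous[OF smooth_time_weight[OF kern_smooth]]])
        (simp add: cyl_cont_def)
    obtain B where B: "\<forall>x\<in>QL L. \<forall>t\<in>{-T..T}. \<bar>kern (c n) (h n) (snd (x, t)) * \<phi> (x, t)\<bar> \<le> B"
      using continuous_bounded_cylinder[OF c] by blast
    have "has_bochner_integral lborel
      (\<lambda>t. indicator {-T<..<T} t * (LINT x|\<nu> t. kern (c n) (h n) (snd (x, t)) * \<phi> (x, t)))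
      (LINT x|\<mu>. kern (c n) (h n) (snd x) * \<phi> x)"
      by (rule disintegrates_integral[OF wcs_disintegrates[OF w] \<mu> continuous_cylinder_measurable[OF c], of B])
         (use B in auto)
    then show ?thesis by (simp add: has_bochner_integral_iff)
  qed
  then show ?thesis
    using kern_limit[OF wcs_continuous_cyl[OF w \<phi>] h lim] by simp
qed

text \<open>Every time in \<open>[-T,T]\<close>, the end points included, is the limit of bumps supported inside \<open>(-T,T)\<close>.\<close>

lemma bump_seq_exists:
  assumes "- T < T" "a \<in> {-T..T}"
  shows "\<exists>c h. (\<forall>n. h n > 0) \<and> (\<forall>n. - T \<le> c n) \<and> (\<forall>n. c n + h n \<le> T) \<and> h \<longlonglongrightarrow> 0 \<and> c \<longlonglongrightarrow> (a::real)"
proof -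
  have T: "T > 0" using assms(1) by simp
  have l: "(\<lambda>n. T * inverse (real (Suc n))) \<longlonglongrightarrow> 0"
    using tendsto_mult_right_zero[OF LIMSEQ_inverse_real_of_nat] by auto
  show ?thesis
  proof (cases "a < T")
    case True
    define h where "h = (\<lambda>n. (T - a) * inverse (real (Suc n)))"
    have "h \<longlonglongrightarrow> 0" unfolding h_def using tendsto_mult_right_zero[OF LIMSEQ_inverse_real_of_nat] by auto
    moreover have "h n > 0" "a + h n \<le> T" for n
    proof -
      show "h n > 0" using True by (simp add: h_def)
      have "(T - a) * inverse (real (Suc n)) \<le> (T - a) * 1"
        using True by (intro mult_left_mono) (auto simp: field_simps)
      then show "a + h n \<le> T" by (simp add: h_def)
    qed
    ultimately show ?thesis using assms by (rule_tac exI[of _ "\<lambda>_. a"], rule_tac exI[of _ h]) auto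
  next
    case False
    then have a: "a = T" using assms by simp
    define h where "h = (\<lambda>n. T * inverse (real (Suc n)))"
    have "(\<lambda>n. T - h n) \<longlonglongrightarrow> T - 0" using l unfolding h_def by (intro tendsto_intros)
    moreover have "h n > 0" "h n \<le> T" for n
    proof -
      show "h n > 0" using T by (simp add: h_def)
      have "T * inverse (real (Suc n)) \<le> T * 1"
        using T by (intro mult_left_mono) (auto simp: field_simps)
      then show "h n \<le> T" by (simp add: h_def)
    qed
    moreover have "h \<longlonglongrightarrow> 0" using l by (simp add: h_def)
    ultimately have fin: "(\<forall>n. h n > 0) \<and> (\<forall>n. - T \<le> T - h n) \<and> (\<forall>n. (T - h n) + h n \<le> T) \<and> h \<longlonglongrightarrow> 0
      \<and> (\<lambda>n. T - h n) \<longlonglongrightarrow> a"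
      using a T \<open>\<And>n. h n \<le> T\<close> by (auto intro: order_trans[of _ T])
    show ?thesis by (rule exI[of _ "\<lambda>n. T - h n"], rule exI[of _ h]) (rule fin)
  qed
qed

lemma wcs_unique:
  assumes L: "L > 0" and T: "T > 0" and \<mu>: "pos_measure_on (QLT L T) \<mu>"
    and w: "weakly_continuous_slicing L T \<mu> \<nu>" and w': "weakly_continuous_slicing L T \<mu> \<nu>'" and a: "a \<in> {-T..T}"
  shows "\<nu> a = \<nu>' a"
proof (rule torus_measure_eqI[OF L wcs_pos[OF w a] wcs_pos[OF w' a]])
  fix \<psi> assume "tsmooth L \<psi>"
  then have \<psi>: "cyl_cont L (\<lambda>x. \<psi> (fst x))"
    using tsmooth_tcont by (auto simp: cyl_cont_def tcont_def intro!: continuous_on_compose2[of UNIV \<psi> UNIV fst] continuous_on_fst continuous_on_id)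
  obtain c h where ch: "\<And>n. h n > 0" "\<And>n. - T \<le> c n" "\<And>n. c n + h n \<le> T" "h \<longlonglongrightarrow> 0" "c \<longlonglongrightarrow> a"
    using bump_seq_exists[OF _ a] T by auto
  show "(LINT x|\<nu> a. \<psi> x) = (LINT x|\<nu>' a. \<psi> x)"
    using LIMSEQ_unique[OF slice_bump_limit[OF w \<mu> \<psi> ch] slice_bump_limit[OF w' \<mu> \<psi> ch]] by simp
qed

lemma slice_eq:
  assumes L: "L > 0" and T: "T > 0" and \<mu>: "pos_measure_on (QLT L T) \<mu>"
    and w: "weakly_continuous_slicing L T \<mu> \<nu>" and a: "a \<in> {-T..T}"
  shows "slice L T \<mu> a = \<nu> a"
  unfolding slice_def is_slice_def
  by (rule the_equality) (use w wcs_unique[OF L T \<mu> _ w a] in blast)+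

section \<open>Densities from sublinear bounds\<close>

text \<open>The set \<open>G\<close> is the graph of a linear functional on a space of integrable functions, dominated by the sublinear functional
  \<open>w \<mapsto> C \<integral> w\<^sup>+\<close>. As graphs, extensions of functionals are ordered by inclusion, which suits Zorn's lemma;
  that \<open>G\<close> is single-valued follows from the bound.\<close>

locale dominated_graph = finite_measure M for M :: "'a measure" +
  fixes C :: real and G :: "(('a \<Rightarrow> real) \<times> real) set"
  assumes C: "C \<ge> 0"
    and zero: "(\<lambda>_. 0, 0) \<in> G"
    and integrable: "(w, r) \<in> G \<Longrightarrow> integrable M w"
    and add: "(w, r) \<in> G \<Longrightarrow> (w', r') \<in> G \<Longrightarrow> (\<lambda>x. w x + w' x, r + r') \<in> G"
    and scale: "(w, r) \<in> G \<Longrightarrow> (\<lambda>x. c * w x, c * r) \<in> G"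
    and bound: "(w, r) \<in> G \<Longrightarrow> r \<le> C * (LINT x|M. max 0 (w x))"
begin

lemma diff: "(w, r) \<in> G \<Longrightarrow> (w', r') \<in> G \<Longrightarrow> (\<lambda>x. w x - w' x, r - r') \<in> G"
  using add[OF _ scale[of w' r' "-1"], of w r] by simp

text \<open>The one-step extension in the Hahn--Banach theorem: the value at \<open>u\<close> is placed between the lower and the upper constraints
  imposed by domination, which are compatible by sublinearity.\<close>

lemma extension:
  assumes u: "integrable M u"
  shows "\<exists>c H. (u, c) \<in> H \<and> G \<subseteq> H \<and> dominated_graph M C H"
proof -
  define p where "p = (\<lambda>w. C * (LINT x|M. max 0 (w x)))"
  have max_int: "integrable M (\<lambda>x. max 0 (w x))" if "integrable M w" for w :: "'a \<Rightarrow> real"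
    using that by simp
  have p_sub: "p (\<lambda>x. w x + w' x) \<le> p w + p w'" if "integrable M w" "integrable M w'" for w w'
  proof -
    have "(LINT x|M. max 0 (w x + w' x)) \<le> (LINT x|M. max 0 (w x) + max 0 (w' x))"
      using that by (intro integral_mono) auto
    also have "\<dots> = (LINT x|M. max 0 (w x)) + (LINT x|M. max 0 (w' x))"
      using that by simp
    finally show ?thesis unfolding p_def using C by (simp add: distrib_left[symmetric] mult_left_mono)
  qed
  have p_scale: "p (\<lambda>x. c * w x) = c * p w" if "c > 0" for c w
  proof -
    have "max 0 (c * w x) = c * max 0 (w x)" for x
      using that by (simp add: max_def zero_le_mult_iff)
    then show ?thesis by (simp add: p_def)
  qed
  define S where "S = {r - p (\<lambda>x. w x - u x) |w r. (w, r) \<in> G}"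
  have le: "r - p (\<lambda>x. w x - u x) \<le> p (\<lambda>x. w' x + u x) - r'" if "(w, r) \<in> G" "(w', r') \<in> G" for w r w' r'
  proof -
    have "r + r' \<le> p (\<lambda>x. w x + w' x)" using bound[OF add[OF that]] by (simp add: p_def)
    also have "\<dots> = p (\<lambda>x. (w x - u x) + (w' x + u x))" by simp
    also have "\<dots> \<le> p (\<lambda>x. w x - u x) + p (\<lambda>x. w' x + u x)"
      using integrable[OF that(1)] integrable[OF that(2)] u by (intro p_sub) auto
    finally show ?thesis by simp
  qed
  have S: "S \<noteq> {}" "bdd_above S"
    using zero le[OF _ zero] by (auto simp: S_def intro!: bdd_aboveI)
  define c where "c = Sup S"
  have c1: "r - p (\<lambda>x. w x - u x) \<le> c" if "(w, r) \<in> G" for w r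
    unfolding c_def by (rule cSup_upper) (use that S in \<open>auto simp: S_def\<close>)
  have c2: "c \<le> p (\<lambda>x. w x + u x) - r" if "(w, r) \<in> G" for w r
    unfolding c_def by (rule cSup_least) (use le[OF _ that] S in \<open>auto simp: S_def\<close>)
  define H where "H = {(\<lambda>x. w x + t * u x, r + t * c) |w r t. (w, r) \<in> G}"
  have "dominated_graph M C H"
  proof
    show "C \<ge> 0" by (rule C)
    show "(\<lambda>_. 0, 0) \<in> H"
      unfolding H_def using zero by (auto intro!: exI[of _ "\<lambda>_. 0"] exI[of _ 0])
  next
    fix w r assume "(w, r) \<in> H"
    then obtain v q t where H: "w = (\<lambda>x. v x + t * u x)" "r = q + t * c" "(v, q) \<in> G" by (auto simp: H_def)
    show "integrable M w" using H integrable u by simp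
    show "(\<lambda>x. a * w x, a * r) \<in> H" for a
      unfolding H_def mem_Collect_eq
      by (rule exI[of _ "\<lambda>x. a * v x"], rule exI[of _ "a * q"], rule exI[of _ "a * t"])
         (use scale[OF H(3)] H in \<open>auto simp: algebra_simps\<close>)
    show "r \<le> C * (LINT x|M. max 0 (w x))"
    proof (cases t "0 :: real" rule: linorder_cases)
      case equal
      then show ?thesis using bound[OF H(3)] H by simp
    next
      case greater
      have "c \<le> p (\<lambda>x. 1 / t * v x + u x) - 1 / t * q" by (rule c2[OF scale[OF H(3)]])
      then have "t * c \<le> t * (p (\<lambda>x. 1 / t * v x + u x) - 1 / t * q)"
        using greater by (intro mult_left_mono) auto
      then have "t * c \<le> t * p (\<lambda>x. 1 / t * v x + u x) - q"
        using greater by (simp add: right_diff_distrib)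
      also have "t * p (\<lambda>x. 1 / t * v x + u x) = p (\<lambda>x. t * (1 / t * v x + u x))"
        using p_scale[OF greater] by metis
      also have "(\<lambda>x. t * (1 / t * v x + u x)) = w" using H greater by (auto simp: distrib_left)
      finally show ?thesis using H by (simp add: p_def)
    next
      case less
      define s where "s = - t"
      have s: "s > 0" using less by (simp add: s_def)
      have "1 / s * q - p (\<lambda>x. 1 / s * v x - u x) \<le> c" by (rule c1[OF scale[OF H(3)]])
      then have "s * (1 / s * q - p (\<lambda>x. 1 / s * v x - u x)) \<le> s * c"
        using s by (intro mult_left_mono) auto
      then have "q - s * p (\<lambda>x. 1 / s * v x - u x) \<le> s * c"
        using s by (simp add: right_diff_distrib)
      moreover have "s * p (\<lambda>x. 1 / s * v x - u x) = p (\<lambda>x. s * (1 / s * v x - u x))"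
        using p_scale[OF s] by metis
      moreover have "(\<lambda>x. s * (1 / s * v x - u x)) = w" using H s by (auto simp: right_diff_distrib s_def)
      ultimately have "q - p w \<le> s * c" by (simp only:)
      then have "r \<le> p w" using H(2) by (simp add: s_def)
      then show ?thesis by (simp add: p_def)
    qed
    fix w' r' assume "(w', r') \<in> H"
    then obtain v' q' t' where H': "w' = (\<lambda>x. v' x + t' * u x)" "r' = q' + t' * c" "(v', q') \<in> G" by (auto simp: H_def)
    show "(\<lambda>x. w x + w' x, r + r') \<in> H"
      unfolding H_def mem_Collect_eq
      by (rule exI[of _ "\<lambda>x. v x + v' x"], rule exI[of _ "q + q'"], rule exI[of _ "t + t'"])
         (use add[OF H(3) H'(3)] H H' in \<open>auto simp: algebra_simps\<close>)
  qed
  moreover have "(u, c) \<in> H"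
    unfolding H_def mem_Collect_eq
    by (rule exI[of _ "\<lambda>x. 0"], rule exI[of _ 0], rule exI[of _ 1]) (use zero in auto)
  moreover have "G \<subseteq> H"
  proof
    fix y assume y: "y \<in> G"
    show "y \<in> H"
      unfolding H_def mem_Collect_eq
      by (rule exI[of _ "fst y"], rule exI[of _ "snd y"], rule exI[of _ 0]) (use y in auto)
  qed
  ultimately show ?thesis by blast
qed

lemma total_extension:
  "\<exists>H. G \<subseteq> H \<and> dominated_graph M C H \<and> (\<forall>u. integrable M u \<longrightarrow> (\<exists>c. (u, c) \<in> H))"
proof -
  define A where "A = {H. G \<subseteq> H \<and> dominated_graph M C H}"
  have "\<exists>H\<in>A. \<forall>X\<in>A. H \<subseteq> X \<longrightarrow> X = H"
  proof (rule subset_Zorn_nonempty)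
    have "G \<in> A" using dominated_graph_axioms by (simp add: A_def)
    then show "A \<noteq> {}" by blast
  next
    fix K assume K: "K \<noteq> {}" "subset.chain A K"
    then have KA: "H \<in> A" if "H \<in> K" for H using that by (auto simp: subset.chain_def)
    have dg: "dominated_graph M C H" if "H \<in> K" for H using KA[OF that] by (simp add: A_def)
    have "G \<subseteq> \<Union>K" using K(1) KA by (auto simp: A_def)
    moreover have "dominated_graph M C (\<Union>K)"
    proof
      show "C \<ge> 0" by (rule C)
      show "(\<lambda>_. 0, 0) \<in> \<Union>K" using \<open>G \<subseteq> \<Union>K\<close> zero by blast
    next
      fix w r assume wr: "(w, r) \<in> \<Union>K"
      then obtain H where H: "H \<in> K" "(w, r) \<in> H" by blast
      interpret H: dominated_graph M C H using dg[OF H(1)] .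
      show "integrable M w" "r \<le> C * (LINT x|M. max 0 (w x))"
        using H.integrable H.bound H(2) by auto
      show "(\<lambda>x. c * w x, c * r) \<in> \<Union>K" for c using H.scale[OF H(2)] H(1) by blast
      fix w' r' assume "(w', r') \<in> \<Union>K"
      then obtain H' where H': "H' \<in> K" "(w', r') \<in> H'" by blast
      have "H \<subseteq> H' \<or> H' \<subseteq> H" using K(2) H(1) H'(1) by (auto simp: subset.chain_def)
      then obtain J where J: "J \<in> K" "(w, r) \<in> J" "(w', r') \<in> J" using H H' by blast
      interpret J: dominated_graph M C J using dg[OF J(1)] .
      show "(\<lambda>x. w x + w' x, r + r') \<in> \<Union>K" using J.add[OF J(2,3)] J(1) by blast
    qed
    ultimately show "\<Union>K \<in> A" by (simp add: A_def)
  qed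
  then obtain H where H: "H \<in> A" "\<And>X. X \<in> A \<Longrightarrow> H \<subseteq> X \<Longrightarrow> X = H" by blast
  interpret H: dominated_graph M C H using H(1) by (simp add: A_def)
  have "\<exists>c. (u, c) \<in> H" if u: "integrable M u" for u
  proof -
    obtain c X where X: "(u, c) \<in> X" "H \<subseteq> X" "dominated_graph M C X" using H.extension[OF u] by blast
    then have "X \<in> A" using H(1) by (auto simp: A_def)
    then show ?thesis using H(2) X by blast
  qed
  then show ?thesis using H(1) by (auto simp: A_def)
qed

lemma functional_unique:
  assumes "(w, r) \<in> G" "(w, r') \<in> G"
  shows "r = r'"
  using bound[OF diff[OF assms]] bound[OF diff[OF assms(2,1)]] by simp

lemma functional_abs_bound:
  assumes "(w, r) \<in> G"
  shows "\<bar>r\<bar> \<le> C * (LINT x|M. \<bar>w x\<bar>)"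
proof -
  have *: "q \<le> C * (LINT x|M. \<bar>w x\<bar>)" if "(v, q) \<in> G" "\<And>x. \<bar>v x\<bar> = \<bar>w x\<bar>" for v q
  proof -
    have "(LINT x|M. max 0 (v x)) \<le> (LINT x|M. \<bar>w x\<bar>)"
    proof (rule integral_mono)
      show "integrable M (\<lambda>x. max 0 (v x))" "integrable M (\<lambda>x. \<bar>w x\<bar>)"
        using integrable[OF that(1)] integrable[OF assms] by auto
      show "max 0 (v x) \<le> \<bar>w x\<bar>" for x using that(2)[of x] by linarith
    qed
    then have "C * (LINT x|M. max 0 (v x)) \<le> C * (LINT x|M. \<bar>w x\<bar>)" using C by (rule mult_left_mono)
    then show ?thesis using bound[OF that(1)] by linarith
  qed
  show ?thesis using *[OF assms] *[OF scale[OF assms, of "-1"]] by auto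
qed

text \<open>Domination forces the value on the indicator of \<open>A\<close> to lie between 0 and \<open>C M(A)\<close>. These values therefore form a
  measure with a density in \<open>[0, C]\<close>, and since domination also makes the functional continuous in \<open>L\<^sup>1\<close>, integration
  against this density agrees with it everywhere.\<close>

lemma density_of_total:
  assumes tot: "\<And>u. integrable M u \<Longrightarrow> \<exists>c. (u, c) \<in> G"
  shows "\<exists>f\<in>borel_measurable M. (\<forall>x. 0 \<le> f x \<and> f x \<le> C) \<and> (\<forall>w r. (w, r) \<in> G \<longrightarrow> (LINT x|M. f x * w x) = r)"
proof -
  define \<sigma> where "\<sigma> A = (SOME c. (indicat_real A, c) \<in> G)" for A
  have \<sigma>: "(indicat_real A, \<sigma> A) \<in> G" if "A \<in> sets M" for A
    unfolding \<sigma>_def by (rule someI_ex, rule tot) (use that in \<open>simp add: emeasure_eq_measure\<close>)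
  have \<sigma>_le: "\<sigma> A \<le> C * measure M A" if "A \<in> sets M" for A
    using bound[OF \<sigma>[OF that]] that by (simp add: max_absorb2 sets.Int_space_eq2)
  have \<sigma>_ge: "0 \<le> \<sigma> A" if "A \<in> sets M" for A
  proof -
    have "- 1 * \<sigma> A \<le> C * (LINT x|M. max 0 (- 1 * indicat_real A x))"
      by (rule bound[OF scale[OF \<sigma>[OF that]]])
    also have "\<dots> = 0" by (simp add: max_absorb1)
    finally show ?thesis by simp
  qed
  have \<sigma>_add: "\<sigma> (A \<union> B) = \<sigma> A + \<sigma> B" if "A \<in> sets M" "B \<in> sets M" "A \<inter> B = {}" for A B
  proof -
    have "(\<lambda>x. indicat_real A x + indicat_real B x) = indicat_real (A \<union> B)"
      using that(3) by (intro ext) (auto simp: indicator_def)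
    then have "(indicat_real (A \<union> B), \<sigma> A + \<sigma> B) \<in> G"
      using add[OF \<sigma>[OF that(1)] \<sigma>[OF that(2)]] by simp
    then show ?thesis using functional_unique[OF \<sigma>[of "A \<union> B"]] that(1,2) by blast
  qed
  have \<sigma>0: "\<sigma> {} = 0" using \<sigma>_le[of "{}"] \<sigma>_ge[of "{}"] by simp
  define N where "N = measure_of (space M) (sets M) (\<lambda>A. ennreal (\<sigma> A))"
  have sN: "sets N = sets M" "space N = space M" by (auto simp: N_def)
  have eN: "emeasure N A = ennreal (\<sigma> A)" if "A \<in> sets M" for A
    unfolding N_def
  proof (rule emeasure_measure_of_sigma)
    show "sigma_algebra (space M) (sets M)" ..
    show pos: "positive (sets M) (\<lambda>A. ennreal (\<sigma> A))" by (simp add: positive_def \<sigma>0)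
    show "countably_additive (sets M) (\<lambda>A. ennreal (\<sigma> A))"
    proof (rule sets.empty_continuous_imp_countably_additive)
      show "positive (sets M) (\<lambda>A. ennreal (\<sigma> A))" by (rule pos)
      show "additive (sets M) (\<lambda>A. ennreal (\<sigma> A))"
        using \<sigma>_add \<sigma>_ge by (auto simp: additive_def ennreal_plus)
      fix B assume B: "range B \<subseteq> sets M" "decseq B" "(\<Inter>i. B i) = {}"
      have "(\<lambda>i. C * measure M (B i)) \<longlonglongrightarrow> C * measure M (\<Inter>i. B i)"
        by (intro tendsto_mult tendsto_const finite_Lim_measure_decseq B)
      then have lim0: "(\<lambda>i. C * measure M (B i)) \<longlonglongrightarrow> 0" using B by simp
      have "(\<lambda>i. \<sigma> (B i)) \<longlonglongrightarrow> 0"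
        by (rule tendsto_sandwich[OF _ _ tendsto_const lim0]) (use B \<sigma>_le \<sigma>_ge in \<open>auto simp: range_subsetD\<close>)
      then show "(\<lambda>i. ennreal (\<sigma> (B i))) \<longlonglongrightarrow> 0"
        using tendsto_ennrealI by fastforce
    qed simp
  qed (rule that)
  have fN: "finite_measure N"
    by (rule finite_measureI) (use eN[OF sets.top] sN in simp)
  have ac: "absolutely_continuous M N"
    unfolding absolutely_continuous_def
  proof
    fix A assume "A \<in> null_sets M"
    then have "A \<in> sets M" "measure M A = 0" by (auto simp: measure_def)
    then show "A \<in> null_sets N" using \<sigma>_le[of A] \<sigma>_ge[of A] eN[of A] sN by auto
  qed
  obtain D where D: "D \<in> borel_measurable M" "AE x in M. RN_deriv M N x = ennreal (D x)" "\<And>x. 0 \<le> D x"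
    using real_RN_deriv[OF fN ac sN(1)] by metis
  have dN: "density M (\<lambda>x. ennreal (D x)) = N"
    using density_RN_deriv[OF ac sN(1)] D(2) density_cong[of "RN_deriv M N" M "\<lambda>x. ennreal (D x)"] D(1) by auto
  have nnD: "(\<integral>\<^sup>+x. ennreal (D x) * indicator A x \<partial>M) = ennreal (\<sigma> A)" if "A \<in> sets M" for A
    using eN[OF that] emeasure_density[of "\<lambda>x. ennreal (D x)" M A] D(1) that dN by simp
  have iD: "integrable M D"
  proof (rule integrableI_nonneg)
    have "(\<integral>\<^sup>+x. ennreal (D x) \<partial>M) = (\<integral>\<^sup>+x. ennreal (D x) * indicator (space M) x \<partial>M)"
      by (intro nn_integral_cong) simp
    then show "(\<integral>\<^sup>+x. ennreal (D x) \<partial>M) < \<infinity>" using nnD[OF sets.top] by simp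
  qed (use D in auto)
  have setD: "(LINT x:A|M. D x) = \<sigma> A" if A: "A \<in> sets M" for A
  proof -
    have "ennreal (LINT x|M. indicator A x * D x) = (\<integral>\<^sup>+x. ennreal (indicator A x * D x) \<partial>M)"
      using D(3) iD A by (intro nn_integral_eq_integral[symmetric]) (auto intro: integrable_real_mult_indicator simp: mult.commute)
    also have "\<dots> = (\<integral>\<^sup>+x. ennreal (D x) * indicator A x \<partial>M)"
      by (intro nn_integral_cong) (auto simp: indicator_def)
    also have "\<dots> = ennreal (\<sigma> A)" by (rule nnD[OF A])
    finally show ?thesis
      using \<sigma>_ge[OF A] D(3) by (simp add: set_lebesgue_integral_def integral_nonneg_AE)
  qed
  have Dle: "AE x in M. D x \<in> {0..C}"
  proof (rule averaging_theorem[OF iD])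
    fix A assume A: "A \<in> sets M" "0 < measure M A"
    then show "(1 / measure M A) *\<^sub>R (LINT x:A|M. D x) \<in> {0..C}"
      using setD[OF A(1)] \<sigma>_ge[OF A(1)] \<sigma>_le[OF A(1)] by (auto simp: field_simps)
  qed simp
  define f where "f x = max 0 (min C (D x))" for x
  have f: "f \<in> borel_measurable M" "\<And>x. 0 \<le> f x \<and> f x \<le> C"
    using D(1) C by (auto simp: f_def[abs_def])
  have fD: "AE x in M. f x = D x" using Dle by eventually_elim (auto simp: f_def)
  have fw_int: "integrable M (\<lambda>x. f x * w x)" if "integrable M w" for w
    by (rule Bochner_Integration.integrable_bound[of M "\<lambda>x. C * w x"])
       (use that f C in \<open>auto simp: abs_mult intro!: mult_right_mono\<close>)
  have in_G: "(w, LINT x|M. f x * w x) \<in> G" if "integrable M w" for w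
    using that
  proof (induction rule: integrable_induct)
    case (base A c)
    have "(LINT x|M. f x * (indicator A x *\<^sub>R c)) = c * (LINT x:A|M. f x)"
      by (simp add: set_lebesgue_integral_def mult_ac flip: integral_mult_right_zero)
    also have "(LINT x:A|M. f x) = (LINT x:A|M. D x)"
      unfolding set_lebesgue_integral_def
      by (rule integral_cong_AE) (use fD f D base in auto)
    finally have "(LINT x|M. f x * (indicator A x *\<^sub>R c)) = c * \<sigma> A" using setD[OF base(1)] by simp
    then show ?case using scale[OF \<sigma>[OF base(1)], of c] by (simp add: mult.commute)
  next
    case (add v w)
    have "(LINT x|M. f x * (v x + w x)) = (LINT x|M. f x * v x) + (LINT x|M. f x * w x)"
      using fw_int[OF add(1)] fw_int[OF add(2)] by (simp add: distrib_left)
    then show ?case using dominated_graph.add[OF dominated_graph_axioms add(3,4)] by simp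
  next
    case (lim w s)
    obtain r where r: "(w, r) \<in> G" using tot[OF lim(4)] by blast
    have l1: "(\<lambda>i. LINT x|M. f x * s i x) \<longlonglongrightarrow> (LINT x|M. f x * w x)"
    proof (rule integral_dominated_convergence[where w = "\<lambda>x. 2 * (C * \<bar>w x\<bar>)"])
      show "AE x in M. norm (f x * s i x) \<le> 2 * (C * \<bar>w x\<bar>)" for i
      proof (intro AE_I2)
        fix x assume "x \<in> space M"
        then have "\<bar>s i x\<bar> \<le> 2 * \<bar>w x\<bar>" using lim(3) by auto
        then have "f x * \<bar>s i x\<bar> \<le> C * (2 * \<bar>w x\<bar>)" using f(2)[of x] by (intro mult_mono) auto
        then show "norm (f x * s i x) \<le> 2 * (C * \<bar>w x\<bar>)" using f(2)[of x] by (simp add: abs_mult)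
      qed
    qed (use lim f in \<open>auto intro!: tendsto_mult\<close>)
    have l2: "(\<lambda>i. C * (LINT x|M. \<bar>w x - s i x\<bar>)) \<longlonglongrightarrow> C * (LINT x|M. 0)"
    proof (intro tendsto_mult tendsto_const integral_dominated_convergence[where w = "\<lambda>x. 3 * \<bar>w x\<bar>"])
      show "AE x in M. (\<lambda>i. \<bar>w x - s i x\<bar>) \<longlonglongrightarrow> 0"
      proof (intro AE_I2)
        fix x assume "x \<in> space M"
        from tendsto_rabs[OF tendsto_diff[OF tendsto_const[of "w x"] lim(2)[OF this]]]
        show "(\<lambda>i. \<bar>w x - s i x\<bar>) \<longlonglongrightarrow> 0" by simp
      qed
      show "AE x in M. norm \<bar>w x - s i x\<bar> \<le> 3 * \<bar>w x\<bar>" for i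
      proof (intro AE_I2)
        fix x assume "x \<in> space M"
        then have "\<bar>s i x\<bar> \<le> 2 * \<bar>w x\<bar>" using lim(3) by auto
        then show "norm \<bar>w x - s i x\<bar> \<le> 3 * \<bar>w x\<bar>" by simp
      qed
    qed (use lim in auto)
    have "(\<lambda>i. r - (LINT x|M. f x * s i x)) \<longlonglongrightarrow> 0"
    proof (rule Lim_null_comparison)
      show "\<forall>\<^sub>F i in sequentially. norm (r - (LINT x|M. f x * s i x)) \<le> C * (LINT x|M. \<bar>w x - s i x\<bar>)"
        using functional_abs_bound[OF diff[OF r lim(5)]] by simp
      show "(\<lambda>i. C * (LINT x|M. \<bar>w x - s i x\<bar>)) \<longlonglongrightarrow> 0" using l2 by simp
    qed
    from tendsto_diff[OF tendsto_const[of r] this]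
    have "(\<lambda>i. LINT x|M. f x * s i x) \<longlonglongrightarrow> r" by simp
    then have "(LINT x|M. f x * w x) = r" using l1 LIMSEQ_unique by blast
    then show ?case using r by simp
  qed
  show ?thesis
  proof (intro bexI[of _ f] conjI allI impI)
    show "(LINT x|M. f x * w x) = r" if "(w, r) \<in> G" for w r
      using functional_unique[OF in_G[OF integrable[OF that]] that] .
  qed (use f in auto)
qed

text \<open>The bound by \<open>C \<integral> w\<^sup>+\<close> is the dual description of a density with values in \<open>[0, C]\<close>. This one principle
  yields the density of a dominated measure, the slices of a perturbed measure, and flows between two points.\<close>

theorem density_exists:
  "\<exists>f\<in>borel_measurable M. (\<forall>x. 0 \<le> f x \<and> f x \<le> C) \<and> (\<forall>w r. (w, r) \<in> G \<longrightarrow> (LINT x|M. f x * w x) = r)"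
proof -
  obtain H where H: "G \<subseteq> H" "dominated_graph M C H" "\<And>u. integrable M u \<Longrightarrow> \<exists>c. (u, c) \<in> H"
    using total_extension by blast
  show ?thesis using dominated_graph.density_of_total[OF H(2) H(3)] H(1) by blast
qed

end

section \<open>Vector measures\<close>

locale signed_set_function = finite_measure M for M :: "'a measure" +
  fixes m :: "'a set \<Rightarrow> real"
  assumes sums: "range A \<subseteq> sets M \<Longrightarrow> disjoint_family A \<Longrightarrow> (\<lambda>n. m (A n)) sums m (\<Union>n::nat. A n)"
begin

lemma empty [simp]: "m {} = 0"
proof -
  have "(\<lambda>n::nat. m {}) sums m (\<Union>n::nat. {})"
    by (rule sums) (auto simp: disjoint_family_on_def)
  then have "(\<lambda>n::nat. m {}) \<longlonglongrightarrow> 0" by (intro summable_LIMSEQ_zero sums_summable)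
  then show ?thesis by (simp add: LIMSEQ_const_iff)
qed

lemma union_disjoint:
  assumes "A \<in> sets M" "B \<in> sets M" "A \<inter> B = {}"
  shows "m (A \<union> B) = m A + m B"
proof -
  have "(\<lambda>n. m (binaryset A B n)) sums m (\<Union>n. binaryset A B n)"
    using assms by (intro sums) (auto simp: disjoint_family_on_def binaryset_def)
  moreover have "(\<lambda>n. m (binaryset A B n)) sums (m A + m B)"
    by (rule binaryset_sums) simp
  ultimately show ?thesis using sums_unique2 by (metis UN_binaryset_eq)
qed

lemma diff:
  assumes "A \<in> sets M" "B \<in> sets M" "B \<subseteq> A"
  shows "m (A - B) = m A - m B"
proof -
  have "B \<union> (A - B) = A" using assms by blast
  then show ?thesis using union_disjoint[of B "A - B"] assms by auto
qed

lemma union_inter: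
  assumes "A \<in> sets M" "B \<in> sets M"
  shows "m (A \<union> B) + m (A \<inter> B) = m A + m B"
proof -
  have 1: "m (A \<union> B) = m A + m (B - A)"
    using union_disjoint[of A "B - A"] assms by auto
  have 2: "m B = m (A \<inter> B) + m (B - A)"
  proof -
    have "(A \<inter> B) \<union> (B - A) = B" "(A \<inter> B) \<inter> (B - A) = {}" by blast+
    then show ?thesis using union_disjoint[of "A \<inter> B" "B - A"] assms by auto
  qed
  show ?thesis using 1 2 by simp
qed

lemma incseq_limit:
  assumes A: "range A \<subseteq> sets M" "incseq A"
  shows "(\<lambda>n. m (A n)) \<longlonglongrightarrow> m (\<Union>n. A n)"
proof -
  have "(\<lambda>n. m (disjointed A n)) sums m (\<Union>n. disjointed A n)"
    using A by (intro sums sets.range_disjointed_sets disjoint_family_disjointed)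
  then have l: "(\<lambda>n. \<Sum>i<Suc n. m (disjointed A i)) \<longlonglongrightarrow> m (\<Union>n. A n)"
    unfolding UN_disjointed_eq sums_def by (rule LIMSEQ_Suc)
  have "(\<Sum>i<Suc n. m (disjointed A i)) = m (A n)" for n
  proof (induction n)
    case 0
    show ?case by (simp add: disjointed_def)
  next
    case (Suc n)
    have "m (disjointed A (Suc n)) = m (A (Suc n)) - m (A n)"
      using A by (subst disjointed_mono) (auto simp: mono_iff_le_Suc incseq_def intro!: diff)
    then show ?case using Suc by simp
  qed
  then show ?thesis using l by simp
qed

lemma decseq_limit:
  assumes A: "range A \<subseteq> sets M" "decseq A"
  shows "(\<lambda>n. m (A n)) \<longlonglongrightarrow> m (\<Inter>n. A n)"
proof -
  have As: "A n \<in> sets M" for n using A by auto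
  have sub: "A n \<subseteq> A 0" for n using A(2) by (auto simp: decseq_def)
  have "(\<lambda>n. m (A 0 - A n)) \<longlonglongrightarrow> m (\<Union>n. A 0 - A n)"
    using A by (intro incseq_limit) (auto simp: incseq_def decseq_def)
  moreover have "(\<Union>n. A 0 - A n) = A 0 - (\<Inter>n. A n)" by auto
  moreover have "m (A 0 - A n) = m (A 0) - m (A n)" for n by (rule diff) (use As sub in auto)
  moreover have "m (A 0 - (\<Inter>n. A n)) = m (A 0) - m (\<Inter>n. A n)"
    using As sub by (intro diff sets.countable_INT) auto
  ultimately have "(\<lambda>n. m (A 0) - m (A n)) \<longlonglongrightarrow> m (A 0) - m (\<Inter>n. A n)" by simp
  from tendsto_diff[OF tendsto_const[of "m (A 0)"] this] show ?thesis by simp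
qed

text \<open>An unbounded set splits into two parts of large mass, one of which is again unbounded; the
  intersection of the resulting decreasing sequence would have infinite mass.\<close>

lemma bounded_values: "\<exists>K. \<forall>B\<in>sets M. \<bar>m B\<bar> \<le> K"
proof (rule ccontr)
  define big where "big A \<longleftrightarrow> A \<in> sets M \<and> (\<forall>K. \<exists>B\<in>sets M. B \<subseteq> A \<and> \<bar>m B\<bar> > K)" for A
  assume "\<not> ?thesis"
  then have top: "big (space M)" unfolding big_def using sets.sets_into_space by (metis not_le sets.top)
  have split: "\<exists>B. big B \<and> B \<subseteq> A \<and> \<bar>m B\<bar> > K" if A: "big A" for A and K :: real
  proof -
    obtain B where B: "B \<in> sets M" "B \<subseteq> A" "\<bar>m B\<bar> > \<bar>m A\<bar> + \<bar>K\<bar>" using A unfolding big_def by blast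
    have As: "A \<in> sets M" using A by (simp add: big_def)
    have mB: "\<bar>m B\<bar> > K" "\<bar>m (A - B)\<bar> > K" using B(3) diff[OF As B(1,2)] by linarith+
    have "big B \<or> big (A - B)"
    proof (rule ccontr)
      assume "\<not> ?thesis"
      then obtain K1 K2 where K: "\<And>D. D \<in> sets M \<Longrightarrow> D \<subseteq> B \<Longrightarrow> \<bar>m D\<bar> \<le> K1" "\<And>D. D \<in> sets M \<Longrightarrow> D \<subseteq> A - B \<Longrightarrow> \<bar>m D\<bar> \<le> K2"
        using As B(1) unfolding big_def by (metis not_le sets.Diff)
      obtain D where D: "D \<in> sets M" "D \<subseteq> A" "\<bar>m D\<bar> > K1 + K2" using A unfolding big_def by blast
      have "m D = m (D \<inter> B) + m (D - B)"
        using union_disjoint[of "D \<inter> B" "D - B"] D B by (auto simp: Int_Diff_Un)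
      moreover have "\<bar>m (D \<inter> B)\<bar> \<le> K1" by (rule K(1)) (use D B in auto)
      moreover have "\<bar>m (D - B)\<bar> \<le> K2" by (rule K(2)) (use D B in auto)
      ultimately show False using D(3) by linarith
    qed
    then show ?thesis using mB B(2) by blast
  qed
  have "\<exists>f. \<forall>n. big (f n) \<and> f (Suc n) \<subseteq> f n \<and> \<bar>m (f (Suc n))\<bar> > real n"
    using dependent_nat_choice[of "\<lambda>_ A. big A" "\<lambda>n A B. B \<subseteq> A \<and> \<bar>m B\<bar> > real n"] top split by blast
  then obtain f where f: "\<And>n. big (f n)" "\<And>n. f (Suc n) \<subseteq> f n" "\<And>n. \<bar>m (f (Suc n))\<bar> > real n" by blast
  have "(\<lambda>n. m (f n)) \<longlonglongrightarrow> m (\<Inter>n. f n)"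
    using f(1,2) by (intro decseq_limit) (auto simp: big_def decseq_Suc_iff)
  then have "convergent (\<lambda>n. m (f n))" by (auto simp: convergent_def)
  then obtain K where K: "\<And>n. \<bar>m (f n)\<bar> \<le> K"
    using convergent_imp_Bseq by (metis BseqE real_norm_def)
  obtain n where "real n > K" using reals_Archimedean2 by blast
  then show False using f(3)[of n] K[of "Suc n"] by linarith
qed

text \<open>Sets whose value falls short of the supremum by at most \<open>2\<^sup>-\<^sup>n\<close> have a limit inferior that attains it, since
  intersecting two such sets adds up their defects. A set of maximal value splits the space.\<close>

lemma Hahn: "\<exists>P\<in>sets M. (\<forall>B\<in>sets M. B \<subseteq> P \<longrightarrow> 0 \<le> m B) \<and> (\<forall>B\<in>sets M. B \<inter> P = {} \<longrightarrow> m B \<le> 0)"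
proof -
  define S where "S = (SUP B\<in>sets M. m B)"
  obtain K where K: "\<And>B. B \<in> sets M \<Longrightarrow> \<bar>m B\<bar> \<le> K" using bounded_values by blast
  have bdd: "bdd_above (m ` sets M)" using K by (intro bdd_aboveI[of _ K]) (auto simp: abs_le_iff)
  have le: "m B \<le> S" if "B \<in> sets M" for B unfolding S_def by (rule cSUP_upper[OF that bdd])
  have "\<exists>A. A \<in> sets M \<and> S - (1/2) ^ n < m A" for n :: nat
  proof -
    have "S - (1/2) ^ n < S" by simp
    then show ?thesis unfolding S_def using less_cSUP_iff[OF _ bdd] by (metis empty_iff sets.top)
  qed
  then obtain A where A: "\<And>n. A n \<in> sets M" "\<And>n. S - (1/2) ^ n < m (A n)" by metis
  define D where "D k n = (\<Inter>i\<in>{k..k + n}. A i)" for k n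
  have Ds: "D k n \<in> sets M" for k n unfolding D_def using A by (intro sets.finite_INT) auto
  have Dm: "m (D k n) \<ge> S - 2 * (1/2) ^ k + (1/2) ^ (k + n)" for k n
  proof (induction n)
    case 0
    show ?case using A(2)[of k] by (simp add: D_def)
  next
    case (Suc n)
    have e: "D k (Suc n) = D k n \<inter> A (k + Suc n)" by (auto simp: D_def le_Suc_eq)
    have "m (D k n \<union> A (k + Suc n)) \<le> S" using Ds A by (intro le) auto
    moreover have "(1/2::real) ^ (k + Suc n) = (1/2) ^ (k + n) / 2" by simp
    ultimately show ?case using union_inter[OF Ds[of k n] A(1)[of "k + Suc n"]] Suc A(2)[of "k + Suc n"]
      unfolding e by linarith
  qed
  define E where "E k = (\<Inter>n. D k n)" for k
  have Es: "E k \<in> sets M" for k unfolding E_def using Ds by (intro sets.countable_INT) auto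
  have Em: "m (E k) \<ge> S - 2 * (1/2) ^ k" for k
  proof (rule LIMSEQ_le_const)
    show "(\<lambda>n. m (D k n)) \<longlonglongrightarrow> m (E k)"
      unfolding E_def using Ds by (intro decseq_limit) (auto simp: decseq_def D_def)
    show "\<exists>N. \<forall>n\<ge>N. S - 2 * (1/2) ^ k \<le> m (D k n)"
    proof (intro exI[of _ 0] allI impI)
      fix n show "S - 2 * (1/2) ^ k \<le> m (D k n)" using Dm[of k n] zero_le_power[of "1/2::real" "k + n"] by linarith
    qed
  qed
  define P where "P = (\<Union>k. E k)"
  have Ps: "P \<in> sets M" unfolding P_def using Es by auto
  have "incseq E"
    unfolding incseq_Suc_iff E_def D_def
  proof (intro allI subsetI)
    fix k x assume x: "x \<in> (\<Inter>n. \<Inter>i\<in>{k..k + n}. A i)"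
    have "x \<in> A i" if "i \<ge> k" for i using x that by (auto dest!: spec[of _ "i - k"] simp: INT_iff)
    then show "x \<in> (\<Inter>n. \<Inter>i\<in>{Suc k..Suc k + n}. A i)" by auto
  qed
  then have PE: "(\<lambda>k. m (E k)) \<longlonglongrightarrow> m P" unfolding P_def using Es by (intro incseq_limit) auto
  have "(\<lambda>k. S - 2 * (1/2) ^ k) \<longlonglongrightarrow> S - 2 * 0" by (intro tendsto_intros LIMSEQ_power_zero) simp
  then have "S - 2 * 0 \<le> m P" by (rule LIMSEQ_le[OF _ PE]) (use Em in auto)
  then have PS: "m P = S" using le[OF Ps] by simp
  show ?thesis
  proof (intro bexI[of _ P] conjI ballI impI)
    fix B assume B: "B \<in> sets M" "B \<subseteq> P"
    have "m (P - B) \<le> S" using Ps B by (intro le) auto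
    then show "0 \<le> m B" using diff[OF Ps B] PS by simp
  next
    fix B assume B: "B \<in> sets M" "B \<inter> P = {}"
    have "m (P \<union> B) \<le> S" using Ps B by (intro le) auto
    then show "m B \<le> 0" using union_disjoint[OF Ps B(1)] B(2) PS by (simp add: Int_commute)
  qed (rule Ps)
qed

end

lemma nonneg_Radon_Nikodym:
  assumes "signed_set_function M m" and ac: "\<And>A. A \<in> null_sets M \<Longrightarrow> m A = 0"
    and nn: "\<And>A. A \<in> sets M \<Longrightarrow> 0 \<le> m A"
  shows "\<exists>g. integrable M g \<and> (\<forall>A\<in>sets M. m A = (LINT x:A|M. g x))"
proof -
  interpret signed_set_function M m by fact
  define N where "N = measure_of (space M) (sets M) (\<lambda>A. ennreal (m A))"
  have sN: "sets N = sets M" "space N = space M" by (auto simp: N_def)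
  have eN: "emeasure N A = ennreal (m A)" if "A \<in> sets M" for A
    unfolding N_def
  proof (rule emeasure_measure_of_sigma)
    show "sigma_algebra (space M) (sets M)" ..
    show "positive (sets M) (\<lambda>A. ennreal (m A))" by (simp add: positive_def)
    show "countably_additive (sets M) (\<lambda>A. ennreal (m A))"
    proof (rule countably_additiveI)
      fix A :: "nat \<Rightarrow> 'a set" assume A: "range A \<subseteq> sets M" "disjoint_family A"
      have "(\<lambda>n. ennreal (m (A n))) sums ennreal (m (\<Union>i. A i))"
        using sums[OF A] nn A(1) by (subst sums_ennreal) auto
      then show "(\<Sum>i. ennreal (m (A i))) = ennreal (m (\<Union>i. A i))" by (rule sums_unique[symmetric])
    qed
  qed (rule that)
  have fN: "finite_measure N"
    by (rule finite_measureI) (use eN[OF sets.top] sN in simp)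
  have ac': "absolutely_continuous M N"
    unfolding absolutely_continuous_def
  proof
    fix A assume A: "A \<in> null_sets M"
    then have "A \<in> sets M" by auto
    then show "A \<in> null_sets N" using ac[OF A] eN[of A] sN by auto
  qed
  obtain D where D: "D \<in> borel_measurable M" "AE x in M. RN_deriv M N x = ennreal (D x)" "\<And>x. 0 \<le> D x"
    using real_RN_deriv[OF fN ac' sN(1)] by metis
  have dN: "density M (\<lambda>x. ennreal (D x)) = N"
    using density_RN_deriv[OF ac' sN(1)] D(2) density_cong[of "RN_deriv M N" M "\<lambda>x. ennreal (D x)"] D(1) by auto
  have nnD: "(\<integral>\<^sup>+x. ennreal (D x) * indicator A x \<partial>M) = ennreal (m A)" if "A \<in> sets M" for A
    using eN[OF that] emeasure_density[of "\<lambda>x. ennreal (D x)" M A] D(1) that dN by simp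
  have iD: "integrable M D"
  proof (rule integrableI_nonneg)
    have "(\<integral>\<^sup>+x. ennreal (D x) \<partial>M) = (\<integral>\<^sup>+x. ennreal (D x) * indicator (space M) x \<partial>M)"
      by (intro nn_integral_cong) simp
    then show "(\<integral>\<^sup>+x. ennreal (D x) \<partial>M) < \<infinity>" using nnD[OF sets.top] by simp
  qed (use D in auto)
  have "m A = (LINT x:A|M. D x)" if A: "A \<in> sets M" for A
  proof -
    have "ennreal (LINT x|M. indicator A x * D x) = (\<integral>\<^sup>+x. ennreal (indicator A x * D x) \<partial>M)"
      using D(3) iD A by (intro nn_integral_eq_integral[symmetric]) (auto intro: integrable_real_mult_indicator simp: mult.commute)
    also have "\<dots> = (\<integral>\<^sup>+x. ennreal (D x) * indicator A x \<partial>M)"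
      by (intro nn_integral_cong) (auto simp: indicator_def)
    also have "\<dots> = ennreal (m A)" by (rule nnD[OF A])
    finally show ?thesis
      using nn[OF A] D(3) by (simp add: set_lebesgue_integral_def integral_nonneg_AE)
  qed
  then show ?thesis using iD by blast
qed

text \<open>On the two parts of a Hahn decomposition, one of \<open>m\<close> and \<open>- m\<close> is a measure.\<close>

lemma signed_Radon_Nikodym:
  assumes "signed_set_function M m" and ac: "\<And>A. A \<in> null_sets M \<Longrightarrow> m A = 0"
  shows "\<exists>g. integrable M g \<and> (\<forall>A\<in>sets M. m A = (LINT x:A|M. g x))"
proof -
  interpret signed_set_function M m by fact
  obtain P where P: "P \<in> sets M" "\<forall>B\<in>sets M. B \<subseteq> P \<longrightarrow> 0 \<le> m B"
    "\<forall>B\<in>sets M. B \<inter> P = {} \<longrightarrow> m B \<le> 0"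
    using Hahn by (elim bexE conjE)
  have part: "\<exists>g. integrable M g \<and> (\<forall>A\<in>sets M. c * m (A \<inter> R) = (LINT x:A|M. g x))"
    if R: "R \<in> sets M" and nn: "\<And>A. A \<in> sets M \<Longrightarrow> 0 \<le> c * m (A \<inter> R)" for c R
  proof (rule nonneg_Radon_Nikodym)
    show "signed_set_function M (\<lambda>A. c * m (A \<inter> R))"
    proof
      fix A :: "nat \<Rightarrow> 'a set" assume A: "range A \<subseteq> sets M" "disjoint_family A"
      have "(\<lambda>n. m (A n \<inter> R)) sums m (\<Union>n. A n \<inter> R)"
        using A R by (intro sums) (auto simp: disjoint_family_on_def)
      from sums_mult[OF this, of c] show "(\<lambda>n. c * m (A n \<inter> R)) sums (c * m ((\<Union>n. A n) \<inter> R))"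
        by (simp add: Int_UN_distrib2)
    qed
    show "c * m (A \<inter> R) = 0" if "A \<in> null_sets M" for A
      using ac[OF null_set_Int2[OF that R]] by simp
  qed (rule nn)
  obtain g where g: "integrable M g" "\<And>A. A \<in> sets M \<Longrightarrow> 1 * m (A \<inter> P) = (LINT x:A|M. g x)"
  proof -
    have "0 \<le> 1 * m (A \<inter> P)" if "A \<in> sets M" for A using that P(1,2) by simp
    then show ?thesis using part[OF P(1), of 1] that by blast
  qed
  obtain h where h: "integrable M h" "\<And>A. A \<in> sets M \<Longrightarrow> (-1) * m (A \<inter> (space M - P)) = (LINT x:A|M. h x)"
  proof -
    have "0 \<le> (-1) * m (A \<inter> (space M - P))" if "A \<in> sets M" for A
    proof -
      have "A \<inter> (space M - P) \<in> sets M" "(A \<inter> (space M - P)) \<inter> P = {}" using that P(1) by auto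
      then have "m (A \<inter> (space M - P)) \<le> 0" using P(3) by blast
      then show ?thesis by simp
    qed
    moreover have "space M - P \<in> sets M" using P(1) by simp
    ultimately show ?thesis using part[of "space M - P" "-1"] that by blast
  qed
  have "m A = (LINT x:A|M. g x - h x)" if A: "A \<in> sets M" for A
  proof -
    have "A \<inter> (space M - P) = A - P" using sets.sets_into_space[OF A] by auto
    then have "m A = m (A \<inter> P) + m (A \<inter> (space M - P))"
      using union_disjoint[of "A \<inter> P" "A - P"] A P(1) by (auto simp: Int_Diff_Un)
    also have "\<dots> = (LINT x:A|M. g x) - (LINT x:A|M. h x)" using g(2)[OF A] h(2)[OF A] by simp
    also have "\<dots> = (LINT x:A|M. g x - h x)"
      unfolding set_lebesgue_integral_def
      using integrable_mult_indicator[OF A g(1)] integrable_mult_indicator[OF A h(1)]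
      by (simp add: right_diff_distrib)
    finally show ?thesis .
  qed
  then show ?thesis using g(1) h(1) by (intro exI[of _ "\<lambda>x. g x - h x"]) auto
qed

lemma vector_measure_density:
  fixes m :: "'a set \<Rightarrow> real^2"
  assumes fin: "finite_measure M"
    and sums: "\<And>A. range A \<subseteq> sets M \<Longrightarrow> disjoint_family A \<Longrightarrow> (\<lambda>n. m (A n)) sums m (\<Union>n::nat. A n)"
    and ac: "\<And>A. A \<in> null_sets M \<Longrightarrow> m A = 0"
  shows "\<exists>g. integrable M g \<and> (\<forall>A\<in>sets M. m A = (LINT x:A|M. g x))"
proof -
  have "\<exists>g. integrable M g \<and> (\<forall>A\<in>sets M. m A $ i = (LINT x:A|M. g x))" for i
  proof (rule signed_Radon_Nikodym)
    interpret finite_measure M by (rule fin)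
    show "signed_set_function M (\<lambda>A. m A $ i)"
      by unfold_locales (rule bounded_linear.sums[OF bounded_linear_vec_nth sums])
    show "m A $ i = 0" if "A \<in> null_sets M" for A using ac[OF that] by simp
  qed
  then obtain g where g: "\<And>i. integrable M (g i)" "\<And>i A. A \<in> sets M \<Longrightarrow> m A $ i = (LINT x:A|M. g i x)"
    by metis
  have vec: "x = x $ 1 *\<^sub>R axis 1 1 + x $ 2 *\<^sub>R axis 2 1" for x :: "real^2"
    using exhaust_2 by (auto simp: vec_eq_iff axis_def)
  have ind: "integrable M (\<lambda>x. indicator A x * g i x)" if "A \<in> sets M" for i A
    using integrable_mult_indicator[OF that g(1)[of i]] by simp
  define G where "G = (\<lambda>x. g 1 x *\<^sub>R (axis 1 1 :: real^2) + g 2 x *\<^sub>R axis 2 1)"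
  have "integrable M G" unfolding G_def using g(1) by simp
  moreover have "m A = (LINT x:A|M. G x)" if A: "A \<in> sets M" for A
  proof -
    have "(LINT x:A|M. G x) = (LINT x|M. (indicator A x * g 1 x) *\<^sub>R axis 1 1 + (indicator A x * g 2 x) *\<^sub>R axis 2 1)"
      unfolding set_lebesgue_integral_def G_def by (simp add: scaleR_add_right)
    also have "\<dots> = (LINT x|M. indicator A x * g 1 x) *\<^sub>R axis 1 1 + (LINT x|M. indicator A x * g 2 x) *\<^sub>R axis 2 1"
      using ind[OF A] by simp
    also have "\<dots> = m A $ 1 *\<^sub>R axis 1 1 + m A $ 2 *\<^sub>R axis 2 1"
      using g(2)[OF A] by (simp add: set_lebesgue_integral_def)
    finally show ?thesis using vec[of "m A"] by simp
  qed
  ultimately show ?thesis by blast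
qed

lemma vderiv_density:
  assumes "\<exists>g. integrable \<mu> g \<and> (\<forall>A\<in>sets \<mu>. m A = (LINT x:A|\<mu>. g x))"
  shows "integrable \<mu> (vderiv m \<mu>)" "\<And>A. A \<in> sets \<mu> \<Longrightarrow> m A = (LINT x:A|\<mu>. vderiv m \<mu> x)"
  using someI_ex[OF assms] unfolding vderiv_def by auto

text \<open>The derivative is a chosen density, hence only known up to null sets.\<close>

lemma vderiv_unique:
  assumes "finite_measure \<mu>" "integrable \<mu> g" "\<And>A. A \<in> sets \<mu> \<Longrightarrow> m A = (LINT x:A|\<mu>. g x)"
  shows "integrable \<mu> (vderiv m \<mu>)" "AE x in \<mu>. vderiv m \<mu> x = g x"
proof -
  interpret finite_measure \<mu> by fact
  have ex: "\<exists>g. integrable \<mu> g \<and> (\<forall>A\<in>sets \<mu>. m A = (LINT x:A|\<mu>. g x))" using assms by blast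
  show "integrable \<mu> (vderiv m \<mu>)" by (rule vderiv_density[OF ex])
  show "AE x in \<mu>. vderiv m \<mu> x = g x"
    by (rule density_unique_banach) (use vderiv_density[OF ex] assms in auto)
qed

lemma flux_density:
  assumes \<mu>: "pos_measure_on (QLT L T) \<mu>" and m: "flux L T \<mu> m"
  shows "integrable \<mu> (vderiv m \<mu>)" "\<And>A. A \<in> sets \<mu> \<Longrightarrow> m A = (LINT x:A|\<mu>. vderiv m \<mu> x)"
proof -
  have "\<exists>g. integrable \<mu> g \<and> (\<forall>A\<in>sets \<mu>. m A = (LINT x:A|\<mu>. g x))"
    by (rule vector_measure_density[OF pos_measure_on_finite[OF \<mu>]])
       (use m pos_measure_on_sets[OF \<mu>] in \<open>auto simp: flux_def vector_measure_on_def vabs_continuous_def\<close>)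
  then show "integrable \<mu> (vderiv m \<mu>)" "\<And>A. A \<in> sets \<mu> \<Longrightarrow> m A = (LINT x:A|\<mu>. vderiv m \<mu> x)"
    using vderiv_density by blast+
qed

section \<open>The continuity equation\<close>

text \<open>The derivative of \<open>\<phi>\<close> in the space-time direction \<open>(v, 1)\<close>, which is the integrand of the continuity equation.\<close>

definition along :: "((real^2) \<times> real \<Rightarrow> real) \<Rightarrow> ((real^2) \<times> real \<Rightarrow> real^2) \<Rightarrow> (real^2) \<times> real \<Rightarrow> real" where
  "along \<phi> v x = frechet_derivative \<phi> (at x) (0, 1) + frechet_derivative \<phi> (at x) (v x, 0)"

lemma along_expand:
  assumes "smooth \<phi>"
  shows "along \<phi> v x = frechet_derivative \<phi> (at x) (0, 1) + v x $ 1 * frechet_derivative \<phi> (at x) (axis 1 1, 0)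
     + v x $ 2 * frechet_derivative \<phi> (at x) (axis 2 1, 0)"
proof -
  interpret linear "frechet_derivative \<phi> (at x)"
    by (rule linear_frechet_derivative[OF smooth_differentiable[OF assms]])
  have "(v x, 0) = v x $ 1 *\<^sub>R (axis 1 1, 0::real) + v x $ 2 *\<^sub>R (axis 2 1, 0)"
    using exhaust_2 by (auto simp: vec_eq_iff axis_def)
  then have "frechet_derivative \<phi> (at x) (v x, 0) = v x $ 1 * frechet_derivative \<phi> (at x) (axis 1 1, 0)
     + v x $ 2 * frechet_derivative \<phi> (at x) (axis 2 1, 0)"
    by (simp only: add scale real_scaleR_def)
  then show ?thesis by (simp add: along_def)
qed

lemma along_has_derivative:
  assumes "smooth \<phi>" "(\<phi> has_derivative D) (at x)"
  shows "along \<phi> v x = D (0, 1) + D (v x, 0)"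
  using frechet_derivative_at[OF assms(2)] by (simp add: along_def)

lemma along_compose:
  assumes "smooth \<phi>" "(h has_real_derivative h') (at (\<phi> x))" "smooth h"
  shows "along (\<lambda>x. h (\<phi> x)) v x = h' * along \<phi> v x"
proof -
  have "((\<lambda>x. h (\<phi> x)) has_derivative (\<lambda>y. h' * frechet_derivative \<phi> (at x) y)) (at x)"
    using has_derivative_compose[OF smooth_has_derivative[OF assms(1)] assms(2)[unfolded has_field_derivative_def]] .
  from along_has_derivative[OF smooth_compose[OF assms(3,1)] this]
  show ?thesis by (simp add: along_def distrib_left)
qed

lemma along_time_mult:
  assumes "smooth \<phi>" "(w has_real_derivative w') (at (snd x))" "smooth w"
  shows "along (\<lambda>x. w (snd x) * \<phi> x) v x = w (snd x) * along \<phi> v x + w' * \<phi> x"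
proof -
  have w: "((\<lambda>x. w (snd x)) has_derivative (\<lambda>y. w' * snd y)) (at x)"
    using has_derivative_compose[OF bounded_linear_imp_has_derivative[OF bounded_linear_snd] assms(2)[unfolded has_field_derivative_def]] .
  from has_derivative_mult[OF w smooth_has_derivative[OF assms(1)]]
  have "((\<lambda>x. w (snd x) * \<phi> x) has_derivative (\<lambda>h. w (snd x) * frechet_derivative \<phi> (at x) h + w' * snd h * \<phi> x)) (at x)" .
  from along_has_derivative[OF smooth_mult[OF smooth_time_weight[OF assms(3)] assms(1)] this]
  show ?thesis by (simp add: along_def algebra_simps)
qed

lemma along_add: "smooth \<phi> \<Longrightarrow> smooth \<psi> \<Longrightarrow> along (\<lambda>x. \<phi> x + \<psi> x) v x = along \<phi> v x + along \<psi> v x"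
  using along_has_derivative[OF smooth_add has_derivative_add[OF smooth_has_derivative smooth_has_derivative], of \<phi> \<psi> v x]
  by (simp add: along_def)

lemma along_cmult:
  assumes "smooth \<phi>"
  shows "along (\<lambda>x. c * \<phi> x) v x = c * along \<phi> v x"
proof -
  have "((\<lambda>x. c * \<phi> x) has_derivative (\<lambda>h. c * frechet_derivative \<phi> (at x) h)) (at x)"
    using has_derivative_mult_right[OF smooth_has_derivative[OF assms]] .
  from along_has_derivative[OF smooth_cmult[OF assms] this] show ?thesis
    by (simp add: along_def distrib_left)
qed

lemma smooth_cyl_measurable: "smooth \<phi> \<Longrightarrow> \<phi> \<in> borel_measurable borel"
  for \<phi> :: "(real^2) \<times> real \<Rightarrow> real"
  by (intro borel_measurable_continuous_onI smooth_continuous)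

lemma along_measurable:
  assumes \<mu>: "pos_measure_on (QLT L T) \<mu>" and \<phi>: "smooth \<phi>" and v: "v \<in> borel_measurable \<mu>"
  shows "along \<phi> v \<in> borel_measurable \<mu>"
proof -
  have d: "(\<lambda>x. frechet_derivative \<phi> (at x) h) \<in> borel_measurable \<mu>" for h
    by (intro pos_measure_on_measurable[OF \<mu>] smooth_cyl_measurable smooth_deriv \<phi>)
  have c: "(\<lambda>x. v x $ i) \<in> borel_measurable \<mu>" for i
    using measurable_compose[OF v borel_measurable_continuous_onI[OF linear_continuous_on[OF bounded_linear_vec_nth]]] .
  have "along \<phi> v = (\<lambda>x. frechet_derivative \<phi> (at x) (0, 1) + v x $ 1 * frechet_derivative \<phi> (at x) (axis 1 1, 0)
     + v x $ 2 * frechet_derivative \<phi> (at x) (axis 2 1, 0))"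
    using along_expand[OF \<phi>] by blast
  then show ?thesis using c d by simp
qed

lemma along_bound:
  assumes \<phi>: "smooth \<phi>"
  shows "\<exists>B\<ge>0. \<forall>x\<in>QLT L T. \<bar>along \<phi> v x\<bar> \<le> B * (1 + norm (v x))"
proof -
  have "\<exists>B\<ge>0. \<forall>x\<in>QL L. \<forall>t\<in>{-T..T}. \<bar>frechet_derivative \<phi> (at (x, t)) h\<bar> \<le> B" for h
    using continuous_bounded_cylinder[OF smooth_continuous[OF smooth_deriv[OF \<phi>, of h]]] by auto
  then obtain B where B: "\<And>h. B h \<ge> 0" "\<And>h x t. x \<in> QL L \<Longrightarrow> t \<in> {-T..T} \<Longrightarrow> \<bar>frechet_derivative \<phi> (at (x, t)) h\<bar> \<le> B h"
    by metis
  define C where "C = B (0, 1) + B (axis 1 1, 0) + B (axis 2 1, 0)"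
  have "\<bar>along \<phi> v x\<bar> \<le> C * (1 + norm (v x))" if "x \<in> QLT L T" for x
  proof -
    have b: "\<bar>frechet_derivative \<phi> (at x) h\<bar> \<le> B h" for h
      using B(2)[of "fst x" "snd x" h] that by (auto simp: QLT_def)
    have n: "\<bar>v x $ i\<bar> \<le> norm (v x)" for i by (rule component_le_norm_cart)
    have "\<bar>along \<phi> v x\<bar> \<le> \<bar>frechet_derivative \<phi> (at x) (0, 1)\<bar> + \<bar>v x $ 1\<bar> * \<bar>frechet_derivative \<phi> (at x) (axis 1 1, 0)\<bar>
      + \<bar>v x $ 2\<bar> * \<bar>frechet_derivative \<phi> (at x) (axis 2 1, 0)\<bar>"
      unfolding along_expand[OF \<phi>] abs_mult[symmetric] by linarith
    also have "\<dots> \<le> B (0, 1) + norm (v x) * B (axis 1 1, 0) + norm (v x) * B (axis 2 1, 0)"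
      by (intro add_mono mult_mono b n) auto
    also have "\<dots> \<le> C * (1 + norm (v x))"
      unfolding C_def using B(1) by (simp add: algebra_simps)
    finally show ?thesis .
  qed
  moreover have "C \<ge> 0" unfolding C_def using B(1) by simp
  ultimately show ?thesis by blast
qed

lemma along_integrable:
  assumes \<mu>: "pos_measure_on (QLT L T) \<mu>" and \<phi>: "smooth \<phi>" and v: "integrable \<mu> v"
  shows "integrable \<mu> (along \<phi> v)"
proof -
  interpret finite_measure \<mu> using \<mu> by (rule pos_measure_on_finite)
  obtain B where B: "B \<ge> 0" "\<forall>x\<in>QLT L T. \<bar>along \<phi> v x\<bar> \<le> B * (1 + norm (v x))"
    using along_bound[OF \<phi>] by blast
  show ?thesis
  proof (rule Bochner_Integration.integrable_bound[of \<mu> "\<lambda>x. B * (1 + norm (v x))"])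
    show "integrable \<mu> (\<lambda>x. B * (1 + norm (v x)))" using v by simp
    show "AE x in \<mu>. norm (along \<phi> v x) \<le> norm (B * (1 + norm (v x)))"
      using B pos_measure_on_space[OF \<mu>] by (auto intro: order_trans[OF _ abs_ge_self])
  qed (use along_measurable[OF \<mu> \<phi>] v in auto)
qed

lemma test_function_smooth: "test_function L T \<phi> \<Longrightarrow> smooth \<phi>"
  by (simp add: test_function_def smooth_def)

lemma continuity_eq_along: "continuity_eq L T \<mu> v \<longleftrightarrow> (\<forall>\<phi>. test_function L T \<phi> \<longrightarrow> (LINT x|\<mu>. along \<phi> v x) = 0)"
  by (simp add: continuity_eq_def along_def)

lemma continuity_eq_cong_AE:
  assumes \<mu>: "pos_measure_on (QLT L T) \<mu>" and v: "v \<in> borel_measurable \<mu>" "v' \<in> borel_measurable \<mu>"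
    and eq: "AE x in \<mu>. v x = v' x" and c: "continuity_eq L T \<mu> v"
  shows "continuity_eq L T \<mu> v'"
  unfolding continuity_eq_along
proof (intro allI impI)
  fix \<phi> assume \<phi>: "test_function L T \<phi>"
  have "(LINT x|\<mu>. along \<phi> v' x) = (LINT x|\<mu>. along \<phi> v x)"
  proof (rule integral_cong_AE)
    show "along \<phi> v' \<in> borel_measurable \<mu>" "along \<phi> v \<in> borel_measurable \<mu>"
      using along_measurable[OF \<mu> test_function_smooth[OF \<phi>]] v by auto
    show "AE x in \<mu>. along \<phi> v' x = along \<phi> v x"
      using eq by eventually_elim (simp add: along_def)
  qed
  then show "(LINT x|\<mu>. along \<phi> v' x) = 0" using c \<phi> by (simp add: continuity_eq_along)
qed

definition density_flux :: "'a measure \<Rightarrow> ('a \<Rightarrow> real^2) \<Rightarrow> 'a set \<Rightarrow> real^2" where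
  "density_flux \<mu> v A = (if A \<in> sets \<mu> then LINT x:A|\<mu>. v x else 0)"

text \<open>Perturbations act on velocities rather than on vector measures; this turns a velocity solving the continuity equation
  back into an admissible flux.\<close>

lemma flux_of_density:
  assumes \<mu>: "pos_measure_on (QLT L T) \<mu>" and v: "integrable \<mu> v" and c: "continuity_eq L T \<mu> v"
  shows "flux L T \<mu> (density_flux \<mu> v)" "AE x in \<mu>. vderiv (density_flux \<mu> v) \<mu> x = v x"
proof -
  interpret finite_measure \<mu> using \<mu> by (rule pos_measure_on_finite)
  have vd: "integrable \<mu> (vderiv (density_flux \<mu> v) \<mu>)" "AE x in \<mu>. vderiv (density_flux \<mu> v) \<mu> x = v x"
    by (rule vderiv_unique[OF finite_measure_axioms v]; simp add: density_flux_def)+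
  show "AE x in \<mu>. vderiv (density_flux \<mu> v) \<mu> x = v x" by (rule vd)
  have si: "set_integrable \<mu> A v" if "A \<in> sets \<mu>" for A
    unfolding set_integrable_def using integrable_mult_indicator[OF that v] .
  show "flux L T \<mu> (density_flux \<mu> v)"
    unfolding flux_def
  proof (intro conjI)
    show "vector_measure_on (QLT L T) (density_flux \<mu> v)"
      unfolding vector_measure_on_def pos_measure_on_sets[OF \<mu>, symmetric]
    proof (intro conjI allI impI)
      fix A :: "nat \<Rightarrow> ((real^2) \<times> real) set" assume A: "range A \<subseteq> sets \<mu>" "disjoint_family A"
      have U: "(\<Union>n. A n) \<in> sets \<mu>" using A by auto
      have fin: "(\<Sum>i<n. LINT x:A i|\<mu>. v x) = (LINT x:(\<Union>i<n. A i)|\<mu>. v x)" for n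
        using A si by (subst set_integral_finite_Union) (auto simp: disjoint_family_on_def)
      have "(\<lambda>n. LINT x:(\<Union>i<n. A i)|\<mu>. v x) \<longlonglongrightarrow> (LINT x:(\<Union>n. \<Union>i<n. A i)|\<mu>. v x)"
      proof (rule set_integral_cont_up)
        show "incseq (\<lambda>n. \<Union>i<n. A i)" by (fastforce simp: incseq_def)
        have e: "(\<Union>n. \<Union>i<n. A i) = (\<Union>n. A n)" by auto
        show "set_integrable \<mu> (\<Union>n. \<Union>i<n. A i) v" unfolding e by (rule si[OF U])
        show "(\<Union>i<n. A i) \<in> sets \<mu>" for n using A by auto
      qed
      moreover have "(\<Union>n. \<Union>i<n. A i) = (\<Union>n. A n)" by auto
      ultimately have "(\<lambda>n. LINT x:A n|\<mu>. v x) sums (LINT x:(\<Union>n. A n)|\<mu>. v x)"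
        unfolding sums_def fin by simp
      then show "(\<lambda>n. density_flux \<mu> v (A n)) sums density_flux \<mu> v (\<Union>n. A n)"
        using A U by (simp add: density_flux_def range_subsetD)
    qed (simp add: density_flux_def)
    show "vabs_continuous (density_flux \<mu> v) \<mu>"
      unfolding vabs_continuous_def
    proof
      fix A assume A: "A \<in> null_sets \<mu>"
      have "(LINT x:A|\<mu>. v x) = (LINT x|\<mu>. 0)"
        unfolding set_lebesgue_integral_def
        by (rule integral_cong_AE)
           (use A v AE_not_in[OF A] in \<open>auto simp: indicator_def intro!: borel_measurable_scaleR borel_measurable_indicator\<close>)
      then show "density_flux \<mu> v A = 0" by (simp add: density_flux_def)
    qed
    show "continuity_eq L T \<mu> (vderiv (density_flux \<mu> v) \<mu>)"
      by (rule continuity_eq_cong_AE[OF \<mu> _ _ _ c]) (use v vd in auto)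
  qed
qed

lemma cyl_smooth_time_mult: "smooth w \<Longrightarrow> cyl_smooth L \<phi> \<Longrightarrow> cyl_smooth L (\<lambda>x. w (snd x) * \<phi> x)"
  by (auto simp: cyl_smooth_def periodic_def intro!: smooth_mult smooth_time_weight)

text \<open>On a slab the continuity equation holds for test functions without compact support, the slices
  supplying the boundary terms.\<close>

lemma slab_identity:
  assumes \<mu>: "pos_measure_on (QLT L T) \<mu>" and v: "integrable \<mu> v" and c: "continuity_eq L T \<mu> v"
    and w: "weakly_continuous_slicing L T \<mu> \<nu>" and \<phi>: "cyl_smooth L \<phi>"
    and ab: "- T \<le> a" "a < b" "b \<le> T"
  shows "(LINT x|\<mu>. indicator {a<..<b} (snd x) * along \<phi> v x) = (LINT x|\<nu> b. \<phi> (x, b)) - (LINT x|\<nu> a. \<phi> (x, a))"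
proof -
  have sm: "smooth \<phi>" using \<phi> by (simp add: cyl_smooth_def)
  define h where "h n = (b - a) / 4 * inverse (real (Suc n))" for n
  have h0: "h n > 0" for n using ab by (simp add: h_def)
  have h1: "4 * h n \<le> b - a" for n
  proof -
    have "(b - a) * inverse (real (Suc n)) \<le> (b - a) * 1"
      using ab by (intro mult_left_mono) (auto simp: field_simps)
    then show ?thesis by (simp add: h_def)
  qed
  have hl: "h \<longlonglongrightarrow> 0"
    unfolding h_def using tendsto_mult_right_zero[OF LIMSEQ_inverse_real_of_nat] by auto
  define c where "c n = a + h n" for n
  define d where "d n = b - 2 * h n" for n
  have cl: "c \<longlonglongrightarrow> a" using tendsto_add[OF tendsto_const[of a] hl] unfolding c_def by simp
  have dl: "d \<longlonglongrightarrow> b" using tendsto_diff[OF tendsto_const[of b] tendsto_mult[OF tendsto_const[of 2] hl]] unfolding d_def by simp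
  have cb: "- T \<le> c n" "c n + h n \<le> T" "- T \<le> d n" "d n + h n \<le> T" for n
    using h0[of n] h1[of n] ab by (auto simp: c_def d_def)
  \<comment> \<open>A smooth cutoff in time, rising over \<open>(a + h, a + 2h)\<close> and falling over \<open>(b - 2h, b - h)\<close>. Its derivative is a
       difference of two kernels, which converge to the slices at \<open>a\<close> and \<open>b\<close>.\<close>
  define \<xi> where "\<xi> n t = step ((t - c n) / h n) - step ((t - d n) / h n)" for n t
  have \<xi>0: "\<xi> n t = 0" if "t \<notin> {a<..<b} \<or> t \<le> a + h n \<or> b - h n \<le> t" for n t
  proof (cases "t \<le> a + h n")
    case True
    then have "t \<le> d n" using h0[of n] h1[of n] by (simp add: d_def)
    then show ?thesis using True h0[of n] by (simp add: \<xi>_def c_def step_0 divide_nonpos_pos)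
  next
    case False
    then have t: "b - h n \<le> t" using that h0[of n] by auto
    then have "(t - d n) / h n \<ge> 1" "(t - c n) / h n \<ge> 1"
      using h0[of n] h1[of n] by (auto simp: c_def d_def)
    then show ?thesis by (simp add: \<xi>_def step_1)
  qed
  have \<xi>sm: "smooth (\<xi> n)" for n
    unfolding \<xi>_def by (intro smooth_diff smooth_affine smooth_step)
  have \<xi>d: "(\<xi> n has_real_derivative kern (c n) (h n) t - kern (d n) (h n) t) (at t)" for n t
    unfolding \<xi>_def by (intro DERIV_diff kern_step h0)
  have test: "test_function L T (\<lambda>x. \<xi> n (snd x) * \<phi> x)" for n
    unfolding test_function_def
  proof (intro conjI allI)
    have cs: "cyl_smooth L (\<lambda>x. \<xi> n (snd x) * \<phi> x)" by (rule cyl_smooth_time_mult[OF \<xi>sm \<phi>])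
    then show "cont_diff k (\<lambda>x. \<xi> n (snd x) * \<phi> x)" for k by (simp add: cyl_smooth_def smooth_def)
    show "periodic L (\<lambda>x. \<xi> n (snd (x, t)) * \<phi> (x, t))" for t using cs by (simp add: cyl_smooth_def)
    show "\<exists>r<T. \<forall>x t. r < \<bar>t\<bar> \<longrightarrow> \<xi> n (snd (x, t)) * \<phi> (x, t) = 0"
      using h0[of n] ab by (intro exI[of _ "T - h n"]) (auto intro!: \<xi>0 simp: abs_if split: if_splits)
  qed
  have bdd: "\<bar>\<xi> n t\<bar> \<le> 1" for n t
    using step_bounds[of "(t - c n) / h n"] step_bounds[of "(t - d n) / h n"] by (auto simp: \<xi>_def)
  have al: "integrable \<mu> (along \<phi> v)" by (rule along_integrable[OF \<mu> sm v])
  have tm: "(\<lambda>x. u (snd x)) \<in> borel_measurable \<mu>" if "u \<in> borel_measurable borel" for u :: "real \<Rightarrow> real"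
    by (rule cyl_time_measurable[OF \<mu> that])
  have \<xi>m: "(\<lambda>x. \<xi> n (snd x)) \<in> borel_measurable \<mu>" for n
    by (intro tm borel_measurable_continuous_onI smooth_continuous \<xi>sm)
  have i1: "integrable \<mu> (\<lambda>x. \<xi> n (snd x) * along \<phi> v x)" for n
    by (rule Bochner_Integration.integrable_bound[OF al])
       (use \<xi>m al bdd in \<open>auto simp: abs_mult intro!: mult_left_le_one_le\<close>)
  have i2: "integrable \<mu> (\<lambda>x. kern e q (snd x) * \<phi> x)" for e q
  proof -
    have "smooth (\<lambda>x::(real^2) \<times> real. kern e q (snd x) * \<phi> x)"
      by (intro smooth_mult smooth_time_weight kern_smooth sm)
    note s = this
    obtain B where "\<forall>x\<in>QL L. \<forall>t\<in>{-T..T}. \<bar>kern e q (snd (x, t)) * \<phi> (x, t)\<bar> \<le> B"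
      using continuous_bounded_cylinder[OF smooth_continuous[OF s]] by blast
    then show ?thesis
      by (intro pos_measure_on_integrable[OF \<mu> smooth_cyl_measurable[OF s], of B]) (auto simp: QLT_def)
  qed
  have zero: "(LINT x|\<mu>. \<xi> n (snd x) * along \<phi> v x) + ((LINT x|\<mu>. kern (c n) (h n) (snd x) * \<phi> x)
      - (LINT x|\<mu>. kern (d n) (h n) (snd x) * \<phi> x)) = 0" for n
  proof -
    have "0 = (LINT x|\<mu>. along (\<lambda>x. \<xi> n (snd x) * \<phi> x) v x)"
      using assms(3) test[of n] by (simp add: continuity_eq_along)
    also have "\<dots> = (LINT x|\<mu>. \<xi> n (snd x) * along \<phi> v x + (kern (c n) (h n) (snd x) * \<phi> x - kern (d n) (h n) (snd x) * \<phi> x))"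
      unfolding along_time_mult[OF sm \<xi>d \<xi>sm] by (simp add: left_diff_distrib)
    also have "\<dots> = (LINT x|\<mu>. \<xi> n (snd x) * along \<phi> v x) + ((LINT x|\<mu>. kern (c n) (h n) (snd x) * \<phi> x)
      - (LINT x|\<mu>. kern (d n) (h n) (snd x) * \<phi> x))"
      using i1 i2 by simp
    finally show ?thesis by simp
  qed
  have l1: "(\<lambda>n. LINT x|\<mu>. \<xi> n (snd x) * along \<phi> v x) \<longlonglongrightarrow> (LINT x|\<mu>. indicator {a<..<b} (snd x) * along \<phi> v x)"
  proof (rule integral_dominated_convergence[where w = "\<lambda>x. \<bar>along \<phi> v x\<bar>"])
    show "(\<lambda>x. indicator {a<..<b} (snd x) * along \<phi> v x) \<in> borel_measurable \<mu>"
      using tm[of "indicator {a<..<b}"] al by simp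
    show "(\<lambda>x. \<xi> n (snd x) * along \<phi> v x) \<in> borel_measurable \<mu>" for n using i1 by simp
    show "integrable \<mu> (\<lambda>x. \<bar>along \<phi> v x\<bar>)" using al by simp
    show "AE x in \<mu>. norm (\<xi> n (snd x) * along \<phi> v x) \<le> \<bar>along \<phi> v x\<bar>" for n
      using bdd by (auto simp: abs_mult intro!: mult_left_le_one_le)
    show "AE x in \<mu>. (\<lambda>n. \<xi> n (snd x) * along \<phi> v x) \<longlonglongrightarrow> indicator {a<..<b} (snd x) * along \<phi> v x"
    proof (intro AE_I2 tendsto_mult tendsto_const)
      fix x :: "(real^2) \<times> real"
      define t where "t = snd x"
      show "(\<lambda>n. \<xi> n (snd x)) \<longlonglongrightarrow> indicator {a<..<b} (snd x)"
      proof (cases "t \<in> {a<..<b}")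
        case True
        define e where "e = min (t - a) (b - t)"
        have e: "e > 0" using True by (simp add: e_def)
        have ev: "\<forall>\<^sub>F n in sequentially. 2 * h n < e"
          using order_tendstoD(2)[OF tendsto_mult[OF tendsto_const[of 2] hl], of e] e by simp
        have "\<forall>\<^sub>F n in sequentially. \<xi> n t = 1"
          using ev
        proof eventually_elim
          case (elim n)
          then have "(t - c n) / h n \<ge> 1" "(t - d n) / h n \<le> 0"
            using h0[of n] by (auto simp: c_def d_def e_def divide_nonpos_pos)
          then show ?case by (simp add: \<xi>_def step_0 step_1)
        qed
        then show ?thesis using True unfolding t_def[symmetric] by (simp add: tendsto_eventually)
      next
        case False
        then show ?thesis using \<xi>0 unfolding t_def[symmetric] by simp
      qed
    qed
  qed
  have l2: "(\<lambda>n. LINT x|\<mu>. kern (c n) (h n) (snd x) * \<phi> x) \<longlonglongrightarrow> (LINT x|\<nu> a. \<phi> (x, a))"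
    by (rule slice_bump_limit[OF w \<mu> cyl_smooth_cont[OF \<phi>] h0 cb(1,2) hl cl])
  have l3: "(\<lambda>n. LINT x|\<mu>. kern (d n) (h n) (snd x) * \<phi> x) \<longlonglongrightarrow> (LINT x|\<nu> b. \<phi> (x, b))"
    by (rule slice_bump_limit[OF w \<mu> cyl_smooth_cont[OF \<phi>] h0 cb(3,4) hl dl])
  from tendsto_add[OF l1 tendsto_diff[OF l2 l3]]
  have "(\<lambda>n. 0) \<longlonglongrightarrow> (LINT x|\<mu>. indicator {a<..<b} (snd x) * along \<phi> v x) + ((LINT x|\<nu> a. \<phi> (x, a)) - (LINT x|\<nu> b. \<phi> (x, b)))"
    unfolding zero .
  then show ?thesis by (simp add: LIMSEQ_const_iff)
qed

subsection \<open>Uniqueness of the optimal flux\<close>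

text \<open>The mean of two optimal velocities solves the linear continuity equation as well, and by the parallelogram identity its
  kinetic energy is smaller by a quarter of the integral of \<open>\<bar>v1 - v2\<bar>\<^sup>2\<close>.\<close>

lemma optimal_flux_unique:
  assumes L: "L > 0" and \<mu>: "pos_measure_on (QLT L T) \<mu>" and fin: "energy L T \<mu> < \<infinity>"
    and m1: "optimal_flux L T \<mu> m1" and m2: "optimal_flux L T \<mu> m2"
  shows "AE x in \<mu>. vderiv m1 \<mu> x = vderiv m2 \<mu> x"
proof -
  define v1 where "v1 = vderiv m1 \<mu>"
  define v2 where "v2 = vderiv m2 \<mu>"
  have fl: "flux L T \<mu> m1" "flux L T \<mu> m2" using m1 m2 by (auto simp: optimal_flux_def)
  have vi: "integrable \<mu> v1" "integrable \<mu> v2"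
    using flux_density(1)[OF \<mu>] fl by (auto simp: v1_def v2_def)
  have ce: "continuity_eq L T \<mu> v1" "continuity_eq L T \<mu> v2"
    using fl by (auto simp: flux_def v1_def v2_def)
  define u where "u = (\<lambda>x. (1/2) *\<^sub>R (v1 x + v2 x))"
  have ui: "integrable \<mu> u" using vi by (simp add: u_def)
  have cu: "continuity_eq L T \<mu> u"
    unfolding continuity_eq_along
  proof (intro allI impI)
    fix \<phi> assume t: "test_function L T \<phi>"
    note s = test_function_smooth[OF t]
    have "along \<phi> u x = (1/2) * (along \<phi> v1 x + along \<phi> v2 x)" for x
      unfolding along_expand[OF s] u_def by (simp add: algebra_simps)
    then have "along \<phi> u = (\<lambda>x. (1/2) * (along \<phi> v1 x + along \<phi> v2 x))" by (rule ext)
    then show "(LINT x|\<mu>. along \<phi> u x) = 0"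
      using ce t along_integrable[OF \<mu> s] vi by (simp add: continuity_eq_along)
  qed
  note fu = flux_of_density[OF \<mu> ui cu]
  define K where "K w = (\<integral>\<^sup>+x. ennreal ((norm (w x))\<^sup>2) \<partial>\<mu>)" for w :: "(real^2) \<times> real \<Rightarrow> real^2"
  define A where "A = ennreal (Kstar / L^2) *
       (\<integral>\<^sup>+t\<in>{-T<..<T}. (\<integral>\<^sup>+X. ennreal (sqrt (measure (disintegration L T \<mu> t) {X}))
          \<partial>count_space (QL L)) \<partial>lborel)"
  have e1: "energy L T \<mu> = A + ennreal (1 / L^2) * K v1" "energy L T \<mu> = A + ennreal (1 / L^2) * K v2"
    using m1 m2 by (auto simp: optimal_flux_def energy_pair_def A_def K_def v1_def v2_def)
  have "energy L T \<mu> \<le> energy_pair L T \<mu> (density_flux \<mu> u)"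
    unfolding energy_def by (rule INF_lower) (use fu in simp)
  also have "\<dots> = A + ennreal (1 / L^2) * K u"
    unfolding energy_pair_def A_def K_def using fu(2)
    by (intro arg_cong2[where f = "(+)"] arg_cong2[where f = "(*)"] refl nn_integral_cong_AE) auto
  finally have e2: "energy L T \<mu> \<le> A + ennreal (1 / L^2) * K u" .
  have Af: "A < \<infinity>" using fin e1 by (auto simp: ennreal_add_eq_top less_top[symmetric])
  have le: "ennreal (1 / L^2) * K v1 \<le> ennreal (1 / L^2) * K u" "ennreal (1 / L^2) * K v2 \<le> ennreal (1 / L^2) * K u"
    using e1 e2 Af by (auto simp: ennreal_add_left_cancel_le)
  have pos: "ennreal (1 / L^2) > 0" using L by simp
  have Kf: "K w < \<infinity>" if "energy L T \<mu> = A + ennreal (1 / L^2) * K w" for w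
  proof (rule ccontr)
    assume "\<not> K w < \<infinity>"
    then have "K w = top" by (simp add: less_top[symmetric])
    then have "energy L T \<mu> = \<infinity>" using that L by (simp add: ennreal_mult_eq_top_iff)
    then show False using fin by simp
  qed
  have sq: "integrable \<mu> (\<lambda>x. (norm (v1 x))\<^sup>2)" "integrable \<mu> (\<lambda>x. (norm (v2 x))\<^sup>2)"
    using vi Kf[OF e1(1)] Kf[OF e1(2)] by (auto simp: K_def integrable_iff_bounded)
  have usq: "integrable \<mu> (\<lambda>x. (norm (u x))\<^sup>2)" and dsq: "integrable \<mu> (\<lambda>x. (norm (v1 x - v2 x))\<^sup>2)"
    and par: "(LINT x|\<mu>. (norm (u x))\<^sup>2) + (1/4) * (LINT x|\<mu>. (norm (v1 x - v2 x))\<^sup>2)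
      = (1/2) * ((LINT x|\<mu>. (norm (v1 x))\<^sup>2) + (LINT x|\<mu>. (norm (v2 x))\<^sup>2))"
  proof -
    have p: "(norm (u x))\<^sup>2 + (1/4) * (norm (v1 x - v2 x))\<^sup>2 = (1/2) * ((norm (v1 x))\<^sup>2 + (norm (v2 x))\<^sup>2)" for x
      unfolding u_def power2_norm_eq_inner by (simp add: inner_add inner_diff inner_commute field_simps)
    have i: "integrable \<mu> (\<lambda>x. (1/2) * ((norm (v1 x))\<^sup>2 + (norm (v2 x))\<^sup>2))" using sq by simp
    show 1: "integrable \<mu> (\<lambda>x. (norm (u x))\<^sup>2)"
    proof (rule Bochner_Integration.integrable_bound[OF i])
      show "AE x in \<mu>. norm ((norm (u x))\<^sup>2) \<le> norm ((1/2) * ((norm (v1 x))\<^sup>2 + (norm (v2 x))\<^sup>2))"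
        unfolding p[symmetric] by simp
    qed (use ui in simp)
    show 2: "integrable \<mu> (\<lambda>x. (norm (v1 x - v2 x))\<^sup>2)"
    proof (rule Bochner_Integration.integrable_bound[OF integrable_mult_right[OF i, of 4]])
      show "AE x in \<mu>. norm ((norm (v1 x - v2 x))\<^sup>2) \<le> norm (4 * ((1/2) * ((norm (v1 x))\<^sup>2 + (norm (v2 x))\<^sup>2)))"
        unfolding p[symmetric] by simp
    qed (use vi in simp)
    have "(LINT x|\<mu>. (norm (u x))\<^sup>2 + (1/4) * (norm (v1 x - v2 x))\<^sup>2) = (LINT x|\<mu>. (1/2) * ((norm (v1 x))\<^sup>2 + (norm (v2 x))\<^sup>2))"
      unfolding p ..
    then show "(LINT x|\<mu>. (norm (u x))\<^sup>2) + (1/4) * (LINT x|\<mu>. (norm (v1 x - v2 x))\<^sup>2)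
      = (1/2) * ((LINT x|\<mu>. (norm (v1 x))\<^sup>2) + (LINT x|\<mu>. (norm (v2 x))\<^sup>2))"
      using 1 2 sq by simp
  qed
  have Kr: "K w = ennreal (LINT x|\<mu>. (norm (w x))\<^sup>2)" if "integrable \<mu> (\<lambda>x. (norm (w x))\<^sup>2)" for w
    unfolding K_def by (rule nn_integral_eq_integral[OF that]) simp
  have "(LINT x|\<mu>. (norm (w x))\<^sup>2) \<le> (LINT x|\<mu>. (norm (u x))\<^sup>2)"
    if "ennreal (1 / L^2) * K w \<le> ennreal (1 / L^2) * K u" "integrable \<mu> (\<lambda>x. (norm (w x))\<^sup>2)" for w
  proof -
    have n: "0 \<le> (LINT x|\<mu>. (norm (y x))\<^sup>2)" for y :: "(real^2) \<times> real \<Rightarrow> real^2"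
      by (rule integral_nonneg_AE) simp
    have e: "ennreal (1 / L^2 * (LINT x|\<mu>. (norm (y x))\<^sup>2)) = ennreal (1 / L^2) * ennreal (LINT x|\<mu>. (norm (y x))\<^sup>2)"
      for y :: "(real^2) \<times> real \<Rightarrow> real^2"
      by (rule ennreal_mult) (use n in auto)
    have "ennreal (1 / L^2 * (LINT x|\<mu>. (norm (w x))\<^sup>2)) \<le> ennreal (1 / L^2 * (LINT x|\<mu>. (norm (u x))\<^sup>2))"
      unfolding e using that(1) unfolding Kr[OF that(2)] Kr[OF usq] .
    then have "1 / L^2 * (LINT x|\<mu>. (norm (w x))\<^sup>2) \<le> 1 / L^2 * (LINT x|\<mu>. (norm (u x))\<^sup>2)"
      using L by (subst (asm) ennreal_le_iff) (auto intro!: mult_nonneg_nonneg integral_nonneg_AE)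
    moreover have "0 < 1 / L^2" using L by simp
    ultimately show ?thesis using mult_le_cancel_left_pos by blast
  qed
  from this[OF le(1) sq(1)] this[OF le(2) sq(2)] par
  have "(LINT x|\<mu>. (norm (v1 x - v2 x))\<^sup>2) \<le> 0" by simp
  then have "(LINT x|\<mu>. (norm (v1 x - v2 x))\<^sup>2) = 0" by (intro antisym integral_nonneg_AE) auto
  then have "AE x in \<mu>. (norm (v1 x - v2 x))\<^sup>2 = 0"
    using integral_nonneg_eq_0_iff_AE[OF dsq] by simp
  then show ?thesis unfolding v1_def v2_def by eventually_elim simp
qed

section \<open>Recognising a disintegration\<close>

lemma smooth_interval_approx:
  "\<exists>w. (\<forall>n. smooth (w n)) \<and> (\<forall>n t. 0 \<le> w n t \<and> w n t \<le> 1) \<and>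
     (\<forall>t. (\<lambda>n::nat. w n t) \<longlonglongrightarrow> indicator {a<..<b} (t::real))"
proof -
  define h where "h n = inverse (real (Suc n))" for n
  have h: "h n > 0" for n by (simp add: h_def)
  have hl: "h \<longlonglongrightarrow> 0" unfolding h_def by (rule LIMSEQ_inverse_real_of_nat)
  define w where "w n t = step ((t - a) / h n) * step ((t - b) / (- h n))" for n t
  have "smooth (w n)" for n
    unfolding w_def by (intro smooth_mult smooth_affine smooth_step)
  moreover have "0 \<le> w n t \<and> w n t \<le> 1" for n t
    unfolding w_def using step_bounds by (auto intro!: mult_nonneg_nonneg mult_le_one)
  moreover have "(\<lambda>n. w n t) \<longlonglongrightarrow> indicator {a<..<b} t" for t
  proof (cases "t \<in> {a<..<b}")
    case True
    then have "min (t - a) (b - t) > 0" by simp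
    from order_tendstoD(2)[OF hl this]
    have "\<forall>\<^sub>F n in sequentially. w n t = 1"
    proof eventually_elim
      case (elim n)
      then have "(t - a) / h n \<ge> 1" "(t - b) / (- h n) \<ge> 1" using h[of n] by (auto simp: field_simps)
      then show ?case by (simp add: w_def step_1)
    qed
    then show ?thesis using True by (simp add: tendsto_eventually)
  next
    case False
    have "w n t = 0" for n
    proof (cases "t \<le> a")
      case True
      then have "(t - a) / h n \<le> 0" using h[of n] by (simp add: divide_nonpos_pos)
      then show ?thesis by (simp add: w_def step_0)
    next
      case nt: False
      then have "b \<le> t" using False by auto
      then have "(t - b) / (- h n) \<le> 0" using h[of n] by (simp add: divide_nonneg_neg)
      then show ?thesis by (simp add: w_def step_0)
    qed
    then show ?thesis using False by simp
  qed
  ultimately show ?thesis by blast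
qed

text \<open>A weakly continuous family of measures that agrees with \<open>\<rho>\<close> when tested with smooth products of a function of time and
  a function of space. Such a family is the weakly continuous slicing of \<open>\<rho>\<close>; measurability in time and the
  formula for arbitrary Borel sets have to be derived.\<close>

locale slice_family =
  fixes L T :: real and \<rho> :: "((real^2) \<times> real) measure" and N :: "real \<Rightarrow> (real^2) measure"
  assumes L: "L > 0" and T: "T > 0" and \<rho>: "pos_measure_on (QLT L T) \<rho>"
    and N: "t \<in> {-T..T} \<Longrightarrow> pos_measure_on (QL L) (N t)"
    and cont: "tcont L \<psi> \<Longrightarrow> continuous_on {-T..T} (\<lambda>t. LINT x|N t. \<psi> x)"
    and weak: "smooth w \<Longrightarrow> tsmooth L \<psi> \<Longrightarrow>
      (LINT t|lborel. indicator {-T<..<T} t * (w t * (LINT x|N t. \<psi> x))) = (LINT x|\<rho>. w (snd x) * \<psi> (fst x))"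
begin

lemma mass_bounded: "\<exists>M\<ge>0. \<forall>t\<in>{-T..T}. measure (N t) (space (N t)) \<le> M"
proof -
  have one: "tcont L (\<lambda>x. 1)" by (simp add: tcont_def periodic_def)
  have "compact ((\<lambda>t. LINT x|N t. 1 :: real) ` {-T..T})"
    by (intro compact_continuous_image cont[OF one] compact_Icc)
  then have "bounded ((\<lambda>t. LINT x|N t. 1 :: real) ` {-T..T})" by (rule compact_imp_bounded)
  then obtain M where M: "\<forall>y\<in>(\<lambda>t. LINT x|N t. 1 :: real) ` {-T..T}. norm y \<le> M"
    unfolding bounded_iff by blast
  have "measure (N t) (space (N t)) \<le> max M 0" if "t \<in> {-T..T}" for t
  proof -
    have "norm (LINT x|N t. 1 :: real) \<le> M" by (rule bspec[OF M imageI[OF that]])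
    then show ?thesis by simp
  qed
  then show ?thesis by (intro exI[of _ "max M 0"]) auto
qed

lemma integral_bound:
  assumes t: "t \<in> {-T..T}" and f: "f \<in> borel_measurable borel" and B: "\<And>x. x \<in> QL L \<Longrightarrow> \<bar>f x\<bar> \<le> B"
    and M: "measure (N t) (space (N t)) \<le> M" "B \<ge> 0"
  shows "\<bar>LINT x|N t. f x\<bar> \<le> B * M"
proof -
  interpret finite_measure "N t" by (rule pos_measure_on_finite[OF N[OF t]])
  have "\<bar>LINT x|N t. f x\<bar> \<le> (LINT x|N t. B)"
    using pos_measure_on_integrable[OF N[OF t] f B] B pos_measure_on_space[OF N[OF t]]
    by (intro integral_abs_bound_integral) auto
  also have "\<dots> = B * measure (N t) (space (N t))" by simp
  also have "\<dots> \<le> B * M" using M by (intro mult_left_mono) auto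
  finally show ?thesis .
qed

lemma indicator_measurable:
  fixes F :: "real \<Rightarrow> real"
  assumes "continuous_on {-T..T} F"
  shows "(\<lambda>t. indicator {-T<..<T} t * F t) \<in> borel_measurable lborel"
proof -
  have "continuous_on {-T<..<T} F" by (rule continuous_on_subset[OF assms]) auto
  then show ?thesis using borel_measurable_continuous_on_indicator[of "{-T<..<T}" F] by simp
qed

text \<open>The weak identity passes to bounded pointwise limits of the weights and of the spatial test functions.\<close>

lemma weak_limit:
  assumes w: "\<And>n. continuous_on UNIV (w n)" and \<psi>: "\<And>n. tcont L (\<psi> n)"
    and id: "\<And>n::nat. (LINT t|lborel. indicator {-T<..<T} t * (w n t * (LINT x|N t. \<psi> n x))) = (LINT x|\<rho>. w n (snd x) * \<psi> n (fst x))"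
    and wb: "\<And>n t. t \<in> {-T<..<T} \<Longrightarrow> \<bar>w n t\<bar> \<le> A" and \<psi>b: "\<And>n x. x \<in> QL L \<Longrightarrow> \<bar>\<psi> n x\<bar> \<le> B"
    and wl: "\<And>t. (\<lambda>n. w n t) \<longlonglongrightarrow> w' t" and \<psi>l: "\<And>x. x \<in> QL L \<Longrightarrow> (\<lambda>n. \<psi> n x) \<longlonglongrightarrow> \<psi>' x"
    and m: "w' \<in> borel_measurable borel" "\<psi>' \<in> borel_measurable borel"
  shows "has_bochner_integral lborel (\<lambda>t. indicator {-T<..<T} t * (w' t * (LINT x|N t. \<psi>' x))) (LINT x|\<rho>. w' (snd x) * \<psi>' (fst x))"
proof -
  have A: "A \<ge> 0" using wb[of 0 0] T by auto
  have "(0::real^2) \<in> QL L" using L by (simp add: QL_def)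
  then have B: "B \<ge> 0" using \<psi>b[of 0 0] by auto
  obtain M where M: "M \<ge> 0" "\<And>t. t \<in> {-T..T} \<Longrightarrow> measure (N t) (space (N t)) \<le> M" using mass_bounded by blast
  have Nl: "(\<lambda>n. LINT x|N t. \<psi> n x) \<longlonglongrightarrow> (LINT x|N t. \<psi>' x)" if t: "t \<in> {-T..T}" for t
  proof (rule integral_dominated_convergence[where w = "\<lambda>_. B"])
    interpret finite_measure "N t" by (rule pos_measure_on_finite[OF N[OF t]])
    show "integrable (N t) (\<lambda>_. B)" by simp
    show "AE x in N t. (\<lambda>n. \<psi> n x) \<longlonglongrightarrow> \<psi>' x" "AE x in N t. norm (\<psi> n x) \<le> B" for n
      using \<psi>l \<psi>b pos_measure_on_space[OF N[OF t]] by auto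
    show "\<psi>' \<in> borel_measurable (N t)" "\<psi> n \<in> borel_measurable (N t)" for n
      using pos_measure_on_measurable[OF N[OF t]] m tcont_measurable[OF \<psi>] by auto
  qed
  have F: "(\<lambda>t. indicator {-T<..<T} t * (w n t * (LINT x|N t. \<psi> n x))) \<in> borel_measurable lborel" for n
    by (intro indicator_measurable continuous_on_mult cont \<psi> continuous_on_subset[OF w]) simp
  have Fb: "\<bar>indicator {-T<..<T} t * (w n t * (LINT x|N t. \<psi> n x))\<bar> \<le> indicator {-T<..<T} t * (A * (B * M))" for n t
  proof (cases "t \<in> {-T<..<T}")
    case True
    then have "\<bar>LINT x|N t. \<psi> n x\<bar> \<le> B * M"
      by (intro integral_bound tcont_measurable[OF \<psi>] \<psi>b M B) auto
    then have "\<bar>w n t\<bar> * \<bar>LINT x|N t. \<psi> n x\<bar> \<le> A * (B * M)"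
      using wb[OF True] A by (intro mult_mono) auto
    then show ?thesis using True by (simp add: abs_mult)
  qed simp
  have Fl: "(\<lambda>n. indicator {-T<..<T} t * (w n t * (LINT x|N t. \<psi> n x))) \<longlonglongrightarrow> indicator {-T<..<T} t * (w' t * (LINT x|N t. \<psi>' x))" for t
  proof (cases "t \<in> {-T<..<T}")
    case True
    then show ?thesis using Nl[of t] by (intro tendsto_mult tendsto_const wl) auto
  qed simp
  have F': "(\<lambda>t. indicator {-T<..<T} t * (w' t * (LINT x|N t. \<psi>' x))) \<in> borel_measurable lborel"
    by (rule borel_measurable_LIMSEQ_real[OF Fl F])
  have dom: "integrable lborel (\<lambda>t. indicator {-T<..<T} t * (A * (B * M)))"
    using T by (intro integrable_mult_left integrable_real_indicator) (auto simp: emeasure_lborel_Ioo)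
  have 1: "(\<lambda>n. LINT t|lborel. indicator {-T<..<T} t * (w n t * (LINT x|N t. \<psi> n x))) \<longlonglongrightarrow>
      (LINT t|lborel. indicator {-T<..<T} t * (w' t * (LINT x|N t. \<psi>' x)))"
    by (rule integral_dominated_convergence[OF F' F dom]) (use Fl Fb in auto)
  have i: "integrable lborel (\<lambda>t. indicator {-T<..<T} t * (w' t * (LINT x|N t. \<psi>' x)))"
    by (rule integrable_dominated_convergence[where s = "\<lambda>n t. indicator {-T<..<T} t * (w n t * (LINT x|N t. \<psi> n x))",
          OF F' F dom]) (use Fl Fb in auto)
  interpret \<rho>: finite_measure \<rho> by (rule pos_measure_on_finite[OF \<rho>])
  have prod: "(\<lambda>x. u (snd x) * p (fst x)) \<in> borel_measurable \<rho>"
    if "u \<in> borel_measurable borel" "p \<in> borel_measurable borel" for u :: "real \<Rightarrow> real" and p :: "real^2 \<Rightarrow> real"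
    using that by (intro pos_measure_on_measurable[OF \<rho>]) (simp add: borel_prod[symmetric])
  have 2: "(\<lambda>n. LINT x|\<rho>. w n (snd x) * \<psi> n (fst x)) \<longlonglongrightarrow> (LINT x|\<rho>. w' (snd x) * \<psi>' (fst x))"
  proof (rule integral_dominated_convergence[where w = "\<lambda>_. A * B"])
    show "integrable \<rho> (\<lambda>_. A * B)" by simp
    show "(\<lambda>x. w' (snd x) * \<psi>' (fst x)) \<in> borel_measurable \<rho>" by (rule prod[OF m])
    show "(\<lambda>x. w n (snd x) * \<psi> n (fst x)) \<in> borel_measurable \<rho>" for n
      by (rule prod[OF borel_measurable_continuous_onI[OF w] tcont_measurable[OF \<psi>]])
    show "AE x in \<rho>. (\<lambda>n. w n (snd x) * \<psi> n (fst x)) \<longlonglongrightarrow> w' (snd x) * \<psi>' (fst x)"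
      using wl \<psi>l pos_measure_on_space[OF \<rho>] by (intro AE_I2 tendsto_mult) (auto simp: QLT_def)
    show "AE x in \<rho>. norm (w n (snd x) * \<psi> n (fst x)) \<le> A * B" for n
      using wb \<psi>b A B pos_measure_on_space[OF \<rho>] by (intro AE_I2) (auto simp: QLT_def abs_mult intro!: mult_mono)
  qed
  show ?thesis using LIMSEQ_unique[OF 1] 2 i unfolding id by (simp add: has_bochner_integral_iff)
qed

lemma weak_tcont:
  assumes w: "smooth w" and \<psi>: "tcont L \<psi>"
  shows "(LINT t|lborel. indicator {-T<..<T} t * (w t * (LINT x|N t. \<psi> x))) = (LINT x|\<rho>. w (snd x) * \<psi> (fst x))"
proof -
  have "\<exists>p. tsmooth L p \<and> (\<forall>x. \<bar>\<psi> x - p x\<bar> < inverse (real (Suc n)))" for n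
    using tsmooth_dense[OF L \<psi>, of "inverse (real (Suc n))"] by simp
  then obtain p where p: "\<And>n. tsmooth L (p n)" "\<And>n x. \<bar>\<psi> x - p n x\<bar> < inverse (real (Suc n))" by metis
  have "continuous_on {-T..T} w" by (rule smooth_continuous[OF w])
  then have "bounded (w ` {-T..T})" by (intro compact_imp_bounded compact_continuous_image compact_Icc)
  then obtain A where "\<forall>y\<in>w ` {-T..T}. norm y \<le> A" unfolding bounded_iff by blast
  then have A: "\<bar>w t\<bar> \<le> A" if "t \<in> {-T..T}" for t using that by auto
  obtain B where B: "\<And>x. x \<in> QL L \<Longrightarrow> \<bar>\<psi> x\<bar> \<le> B" using tcont_bounded[OF \<psi>] by blast
  have "has_bochner_integral lborel (\<lambda>t. indicator {-T<..<T} t * (w t * (LINT x|N t. \<psi> x))) (LINT x|\<rho>. w (snd x) * \<psi> (fst x))"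
  proof (rule weak_limit[where w = "\<lambda>_. w" and \<psi> = p and A = A and B = "B + 1"])
    show "continuous_on UNIV w" by (rule smooth_continuous[OF w])
    show "\<bar>p n x\<bar> \<le> B + 1" if "x \<in> QL L" for n x
    proof -
      have "inverse (real (Suc n)) \<le> 1" by (simp add: field_simps)
      then show ?thesis using p(2)[of x n] B[OF that] by linarith
    qed
    show "(\<lambda>n. p n x) \<longlonglongrightarrow> \<psi> x" for x
    proof (rule LIM_zero_cancel, rule Lim_null_comparison[OF _ LIMSEQ_inverse_real_of_nat])
      show "\<forall>\<^sub>F n in sequentially. norm (p n x - \<psi> x) \<le> inverse (real (Suc n))"
        using p(2)[of x] by (intro always_eventually) (auto simp: abs_minus_commute less_imp_le)
    qed
  qed (use A p(1) w weak tsmooth_tcont tcont_measurable[OF \<psi>] in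
       \<open>auto intro: borel_measurable_continuous_onI smooth_continuous\<close>)
  then show ?thesis by (simp add: has_bochner_integral_iff)
qed

lemma weak_rectangle:
  assumes D: "closed D"
  shows "has_bochner_integral lborel
    (\<lambda>t. indicator {-T<..<T} t * (indicator {a<..<b} t * measure (N t) (torus_map L -` D \<inter> QL L)))
    (measure \<rho> ((torus_map L -` D \<times> {a<..<b}) \<inter> QLT L T))"
proof -
  obtain w where w: "\<And>n. smooth (w n)" "\<And>n t. 0 \<le> w n t \<and> w n t \<le> 1"
    "\<And>t. (\<lambda>n::nat. w n t) \<longlonglongrightarrow> indicator {a<..<b} t"
    using smooth_interval_approx by blast
  define \<psi> where "\<psi> n x = cutoff D n (torus_map L x)" for n x
  have \<psi>: "tcont L (\<psi> n)" for n unfolding \<psi>_def by (intro tcont_torus_map L cutoff_continuous)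
  have Db: "torus_map L -` D \<in> sets borel"
    using measurable_sets[OF torus_map_measurable borel_closed[OF D]] by simp
  have "has_bochner_integral lborel (\<lambda>t. indicator {-T<..<T} t * (indicator {a<..<b} t * (LINT x|N t. indicat_real (torus_map L -` D) x)))
      (LINT x|\<rho>. indicator {a<..<b} (snd x) * indicat_real (torus_map L -` D) (fst x))"
  proof (rule weak_limit[where w = w and \<psi> = \<psi> and A = 1 and B = 1
        and w' = "indicator {a<..<b}" and \<psi>' = "indicator (torus_map L -` D)"])
    show "(\<lambda>n. \<psi> n x) \<longlonglongrightarrow> indicator (torus_map L -` D) x" for x
      unfolding \<psi>_def using cutoff_limit[OF D] by (simp add: indicator_def)
    show "(LINT t|lborel. indicator {-T<..<T} t * (w n t * (LINT x|N t. \<psi> n x))) = (LINT x|\<rho>. w n (snd x) * \<psi> n (fst x))" for n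
      by (rule weak_tcont[OF w(1) \<psi>])
    show "continuous_on UNIV (w n)" for n by (rule smooth_continuous[OF w(1)])
    show "\<bar>\<psi> n x\<bar> \<le> 1" for n x unfolding \<psi>_def using cutoff_bounds[of D n "torus_map L x"] by (simp add: abs_le_iff)
    show "\<bar>w n t\<bar> \<le> 1" for n t using w(2) by simp
  qed (use \<psi> w Db in auto)
  moreover have "indicator {-T<..<T} t * (indicator {a<..<b} t * (LINT x|N t. indicat_real (torus_map L -` D) x))
     = indicator {-T<..<T} t * (indicator {a<..<b} t * measure (N t) (torus_map L -` D \<inter> QL L))" for t
    using pos_measure_on_space[OF N] by (cases "t \<in> {-T<..<T}") auto
  moreover have "(LINT x|\<rho>. indicator {a<..<b} (snd x) * indicat_real (torus_map L -` D) (fst x)) = measure \<rho> ((torus_map L -` D \<times> {a<..<b}) \<inter> QLT L T)"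
  proof -
    have "indicator {a<..<b} (snd x) * indicator (torus_map L -` D) (fst x) = indicat_real (torus_map L -` D \<times> {a<..<b}) x" for x
      by (cases x) (auto simp: indicator_def)
    then show ?thesis using pos_measure_on_space[OF \<rho>] by simp
  qed
  ultimately show ?thesis by (simp only:)
qed

text \<open>The mass of a closed subset of the torus is a pointwise limit of integrals of cutoffs, which are continuous in time; the
  remaining Borel sets follow by a Dynkin class argument.\<close>

lemma kernel_N: "kernel L T N"
  unfolding kernel_def
proof (intro conjI ballI)
  fix t assume "t \<in> {-T<..<T}"
  then show "pos_measure_on (QL L) (N t)" by (intro N) auto
next
  have fin: "finite_measure (N t)" if "t \<in> {-T<..<T}" for t using that by (intro pos_measure_on_finite[OF N]) auto
  have sp: "space (restrict_space borel {-T<..<T}) = {-T<..<T}" by (simp add: space_restrict_space)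
  fix B assume B: "B \<in> sets (restrict_space borel (QL L))"
  have mem: "B \<in> sigma_sets (QL L) (torus_closed L)" using B sets_torus_closed[OF L] by simp
  have "torus_closed L \<subseteq> Pow (QL L)" by (auto simp: torus_closed_def)
  from torus_closed_Int this mem show "(\<lambda>t. emeasure (N t) B) \<in> borel_measurable (restrict_space borel {-T<..<T})"
  proof (induct rule: sigma_sets_induct_disjoint)
    case (basic A)
    then obtain D where D: "closed D" "A = torus_map L -` D \<inter> QL L" by (auto simp: torus_closed_def)
    have "(\<lambda>t. measure (N t) A) \<in> borel_measurable (restrict_space borel {-T<..<T})"
    proof (rule borel_measurable_LIMSEQ_real)
      show "(\<lambda>n. LINT x|N t. cutoff D n (torus_map L x)) \<longlonglongrightarrow> measure (N t) A"
        if "t \<in> space (restrict_space borel {-T<..<T})" for t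
        unfolding D(2) using that sp by (intro torus_cutoff_limit L N D(1)) auto
      show "(\<lambda>t. LINT x|N t. cutoff D n (torus_map L x)) \<in> borel_measurable (restrict_space borel {-T<..<T})" for n
        by (intro borel_measurable_continuous_on_restrict continuous_on_subset[OF cont] tcont_torus_map L cutoff_continuous) auto
    qed
    then have "(\<lambda>t. ennreal (measure (N t) A)) \<in> borel_measurable (restrict_space borel {-T<..<T})" by simp
    then show ?case
      by (rule measurable_cong[THEN iffD1, rotated]) (use fin sp in \<open>auto simp: finite_measure.emeasure_eq_measure\<close>)
  next
    case empty
    show ?case by simp
  next
    case (compl A)
    have A: "A \<in> sets (restrict_space borel (QL L))" using compl(1) sets_torus_closed[OF L] by simp
    have top: "(\<lambda>t. emeasure (N t) (QL L)) \<in> borel_measurable (restrict_space borel {-T<..<T})"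
    proof -
      have "(\<lambda>t. ennreal (LINT x|N t. 1)) \<in> borel_measurable (restrict_space borel {-T<..<T})"
        by (intro measurable_compose[OF _ measurable_ennreal] borel_measurable_continuous_on_restrict continuous_on_subset[OF cont])
           (auto simp: tcont_def periodic_def)
      then show ?thesis
      proof (rule measurable_cong[THEN iffD1, rotated])
        fix t assume "t \<in> space (restrict_space borel {-T<..<T})"
        then have t: "t \<in> {-T<..<T}" using sp by simp
        interpret finite_measure "N t" by (rule fin[OF t])
        show "ennreal (LINT x|N t. 1) = emeasure (N t) (QL L)"
          using pos_measure_on_space[OF N, of t] t by (simp add: emeasure_eq_measure)
      qed
    qed
    have "(\<lambda>t. emeasure (N t) (QL L) - emeasure (N t) A) \<in> borel_measurable (restrict_space borel {-T<..<T})"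
      using top compl(2) by simp
    then show ?case
    proof (rule measurable_cong[THEN iffD1, rotated])
      fix t assume "t \<in> space (restrict_space borel {-T<..<T})"
      then have t: "t \<in> {-T<..<T}" using sp by simp
      interpret finite_measure "N t" by (rule fin[OF t])
      have p: "pos_measure_on (QL L) (N t)" using t by (intro N) auto
      show "emeasure (N t) (QL L) - emeasure (N t) A = emeasure (N t) (QL L - A)"
        using emeasure_compl[of A "N t"] A pos_measure_on_sets[OF p] pos_measure_on_space[OF p] by simp
    qed
  next
    case (union A)
    have A: "A i \<in> sets (restrict_space borel (QL L))" for i using union(2) sets_torus_closed[OF L] by auto
    have "(\<lambda>t. \<Sum>i. emeasure (N t) (A i)) \<in> borel_measurable (restrict_space borel {-T<..<T})"
      using union(3) by simp
    then show ?case
    proof (rule measurable_cong[THEN iffD1, rotated])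
      fix t assume "t \<in> space (restrict_space borel {-T<..<T})"
      then have p: "pos_measure_on (QL L) (N t)" using sp by (intro N) auto
      show "(\<Sum>i. emeasure (N t) (A i)) = emeasure (N t) (\<Union>i. A i)"
        using A union(1) pos_measure_on_sets[OF p] by (intro suminf_emeasure) auto
    qed
  qed
qed

definition cyl_map :: "(real^2) \<times> real \<Rightarrow> (complex \<times> complex) \<times> real" where
  "cyl_map x = (torus_map L (fst x), snd x)"

lemma cyl_map_measurable: "cyl_map \<in> borel \<rightarrow>\<^sub>M (borel \<Otimes>\<^sub>M borel)"
  unfolding cyl_map_def by (intro measurable_Pair measurable_compose[OF _ torus_map_measurable])
    (auto simp: borel_prod[symmetric])

text \<open>Products of a closed subset of the torus with an open interval generate, and are treated by \<open>weak_rectangle\<close>; the sets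
  that satisfy the formula form a Dynkin class.\<close>

lemma emeasure_slices:
  assumes A: "A \<in> sets (borel \<Otimes>\<^sub>M borel)"
  shows "emeasure \<rho> (cyl_map -` A \<inter> QLT L T) =
    (\<integral>\<^sup>+t. emeasure (N t) {x\<in>QL L. (torus_map L x, t) \<in> A} * indicator {-T<..<T} t \<partial>lborel)"
proof -
  interpret \<rho>: finite_measure \<rho> by (rule pos_measure_on_finite[OF \<rho>])
  have Is: "t \<in> {-T..T}" if "t \<in> {-T<..<T}" for t using that by auto
  have fin: "finite_measure (N t)" if "t \<in> {-T<..<T}" for t by (rule pos_measure_on_finite[OF N[OF Is[OF that]]])
  have pre: "cyl_map -` A \<in> sets (borel \<Otimes>\<^sub>M borel)" if "A \<in> sets (borel \<Otimes>\<^sub>M borel)" for A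
    using measurable_sets[OF cyl_map_measurable that] unfolding borel_prod by simp
  have pre\<rho>: "cyl_map -` A \<inter> QLT L T \<in> sets \<rho>" if "A \<in> sets (borel \<Otimes>\<^sub>M borel)" for A
  proof -
    have "cyl_map -` A \<in> sets borel" using pre[OF that] unfolding borel_prod .
    then show ?thesis unfolding pos_measure_on_sets[OF \<rho>] sets_restrict_space by blast
  qed
  have sec: "{x\<in>QL L. (torus_map L x, t) \<in> A} = {x\<in>QL L. (x, t) \<in> cyl_map -` A}" for A t
    by (simp add: cyl_map_def)
  have mes: "(\<lambda>t. emeasure (N t) {x\<in>QL L. (torus_map L x, t) \<in> A} * indicator {-T<..<T} t) \<in> borel_measurable borel"
    if "A \<in> sets (borel \<Otimes>\<^sub>M borel)" for A
    unfolding sec by (rule kernel_section_emeasure_measurable[OF kernel_N pre[OF that]])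
  have secs: "{x\<in>QL L. (torus_map L x, t) \<in> A} \<in> sets (N t)" if "A \<in> sets (borel \<Otimes>\<^sub>M borel)" "t \<in> {-T<..<T}" for A t
  proof -
    have "cyl_map -` A \<in> sets borel" using pre[OF that(1)] unfolding borel_prod .
    then show ?thesis unfolding sec by (rule kernel_section_sets[OF kernel_N _ that(2)])
  qed
  define E :: "((complex \<times> complex) \<times> real) set set"
    where "E = {a \<times> b |a b. a \<in> Collect closed \<and> b \<in> range (\<lambda>(a, b). {a<..<b})}"
  have gen: "sets (borel \<Otimes>\<^sub>M borel) = sigma_sets UNIV E"
  proof -
    have "sets (borel \<Otimes>\<^sub>M borel) = sets (sigma (space borel \<times> space borel) E)"
      unfolding E_def
    proof (rule sets_pair_eq)
      show "sets borel = sigma_sets (space borel) (Collect closed :: (complex \<times> complex) set set)"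
        using borel_eq_closed by (metis sets_measure_of space_borel top_greatest Pow_UNIV)
      have "range (\<lambda>(a, b). box a b) = range (\<lambda>(a, b). {a<..<b::real})" by simp
      then show "sets borel = sigma_sets (space borel) (range (\<lambda>(a, b). {a<..<b::real}))"
        using borel_eq_box[where 'a = real] by (metis sets_measure_of space_borel top_greatest Pow_UNIV)
      show "\<Union>{UNIV :: (complex \<times> complex) set} = space borel" by simp
      have "r \<in> \<Union>(range (\<lambda>n::nat. {- real n<..<real n}))" for r
      proof -
        obtain n where "\<bar>r\<bar> < real n" using reals_Archimedean2 by blast
        then have "r \<in> {- real n<..<real n}" by auto
        then show ?thesis by blast
      qed
      then show "\<Union>(range (\<lambda>n::nat. {- real n<..<real n})) = space borel" by auto
    qed auto
    then show ?thesis by (simp add: E_def sets_measure_of)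
  qed
  have st: "Int_stable E"
  proof (rule Int_stableI)
    fix X Y assume "X \<in> E" "Y \<in> E"
    then obtain a b c d D F where X: "X = D \<times> {a<..<b}" "closed D" and Y: "Y = F \<times> {c<..<d}" "closed F"
      by (auto simp: E_def)
    have "X \<inter> Y = (D \<inter> F) \<times> {max a c<..<min b d}" using X Y by auto
    then show "X \<inter> Y \<in> E" using X Y by (auto simp: E_def)
  qed
  have rect: "emeasure \<rho> (cyl_map -` (D \<times> {a<..<b}) \<inter> QLT L T) =
    (\<integral>\<^sup>+t. emeasure (N t) {x\<in>QL L. (torus_map L x, t) \<in> D \<times> {a<..<b}} * indicator {-T<..<T} t \<partial>lborel)"
    if D: "closed D" for D a b
  proof -
    have "cyl_map -` (D \<times> {a<..<b}) = torus_map L -` D \<times> {a<..<b}" by (auto simp: cyl_map_def)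
    then have "emeasure \<rho> (cyl_map -` (D \<times> {a<..<b}) \<inter> QLT L T) = ennreal (measure \<rho> ((torus_map L -` D \<times> {a<..<b}) \<inter> QLT L T))"
      by (simp add: \<rho>.emeasure_eq_measure)
    also have "\<dots> = (\<integral>\<^sup>+t. ennreal (indicator {-T<..<T} t * (indicator {a<..<b} t * measure (N t) (torus_map L -` D \<inter> QL L))) \<partial>lborel)"
      using weak_rectangle[OF D, of a b] by (subst nn_integral_eq_integral) (auto simp: has_bochner_integral_iff)
    also have "\<dots> = (\<integral>\<^sup>+t. emeasure (N t) {x\<in>QL L. (torus_map L x, t) \<in> D \<times> {a<..<b}} * indicator {-T<..<T} t \<partial>lborel)"
    proof (intro nn_integral_cong)
      fix t
      have s: "{x\<in>QL L. (torus_map L x, t) \<in> D \<times> {a<..<b}} = (if t \<in> {a<..<b} then torus_map L -` D \<inter> QL L else {})"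
        by auto
      show "ennreal (indicator {-T<..<T} t * (indicator {a<..<b} t * measure (N t) (torus_map L -` D \<inter> QL L))) =
        emeasure (N t) {x\<in>QL L. (torus_map L x, t) \<in> D \<times> {a<..<b}} * indicator {-T<..<T} t"
        unfolding s using finite_measure.emeasure_eq_measure[OF fin] by (auto simp: indicator_def)
    qed
    finally show ?thesis .
  qed
  have whole: "emeasure \<rho> (QLT L T) = (\<integral>\<^sup>+t. emeasure (N t) (QL L) * indicator {-T<..<T} t \<partial>lborel)"
  proof -
    have "cyl_map -` (UNIV \<times> {-T<..<T}) \<inter> QLT L T = QLT L T" by (auto simp: cyl_map_def QLT_def)
    moreover have "emeasure (N t) {x\<in>QL L. (torus_map L x, t) \<in> UNIV \<times> {-T<..<T}} * indicator {-T<..<T} t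
       = emeasure (N t) (QL L) * indicator {-T<..<T} t" for t by (cases "t \<in> {-T<..<T}") auto
    ultimately show ?thesis using rect[of UNIV "-T" T] by simp
  qed
  have "E \<subseteq> Pow UNIV" by simp
  from st this A[unfolded gen] show ?thesis
  proof (induct rule: sigma_sets_induct_disjoint)
    case (basic A)
    then obtain D a b where "A = D \<times> {a<..<b}" "closed D" by (auto simp: E_def)
    then show ?case using rect by simp
  next
    case empty
    show ?case by simp
  next
    case (compl A)
    have A: "A \<in> sets (borel \<Otimes>\<^sub>M borel)" using compl(1) gen by simp
    have "emeasure \<rho> (cyl_map -` (UNIV - A) \<inter> QLT L T) = emeasure \<rho> (QLT L T - (cyl_map -` A \<inter> QLT L T))"
      by (rule arg_cong[where f = "emeasure \<rho>"]) auto
    also have "\<dots> = emeasure \<rho> (QLT L T) - emeasure \<rho> (cyl_map -` A \<inter> QLT L T)"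
      using emeasure_compl[OF pre\<rho>[OF A]] pos_measure_on_space[OF \<rho>] by simp
    also have "\<dots> = (\<integral>\<^sup>+t. emeasure (N t) (QL L) * indicator {-T<..<T} t \<partial>lborel) -
       (\<integral>\<^sup>+t. emeasure (N t) {x\<in>QL L. (torus_map L x, t) \<in> A} * indicator {-T<..<T} t \<partial>lborel)"
      using whole compl(2) by simp
    also have "\<dots> = (\<integral>\<^sup>+t. emeasure (N t) (QL L) * indicator {-T<..<T} t - emeasure (N t) {x\<in>QL L. (torus_map L x, t) \<in> A} * indicator {-T<..<T} t \<partial>lborel)"
    proof (rule nn_integral_diff[symmetric])
      show "(\<lambda>t. emeasure (N t) (QL L) * indicator {-T<..<T} t) \<in> borel_measurable lborel"
        using kernel_set_measurable[OF kernel_N QL_borel subset_refl] by simp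
      show "(\<lambda>t. emeasure (N t) {x\<in>QL L. (torus_map L x, t) \<in> A} * indicator {-T<..<T} t) \<in> borel_measurable lborel"
        using mes[OF A] by simp
      show "(\<integral>\<^sup>+t. emeasure (N t) {x\<in>QL L. (torus_map L x, t) \<in> A} * indicator {-T<..<T} t \<partial>lborel) \<noteq> \<infinity>"
        using compl(2)[symmetric] by simp
      show "AE t in lborel. emeasure (N t) {x\<in>QL L. (torus_map L x, t) \<in> A} * indicator {-T<..<T} t \<le> emeasure (N t) (QL L) * indicator {-T<..<T} t"
      proof (intro AE_I2)
        fix t
        show "emeasure (N t) {x\<in>QL L. (torus_map L x, t) \<in> A} * indicator {-T<..<T} t \<le> emeasure (N t) (QL L) * indicator {-T<..<T} t"
        proof (cases "t \<in> {-T<..<T}")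
          case True
          have "QL L \<in> sets (N t)" using pos_measure_on_space[OF N[OF Is[OF True]]] by (metis sets.top)
          then show ?thesis by (intro mult_right_mono emeasure_mono) auto
        qed simp
      qed
    qed
    also have "\<dots> = (\<integral>\<^sup>+t. emeasure (N t) {x\<in>QL L. (torus_map L x, t) \<in> UNIV - A} * indicator {-T<..<T} t \<partial>lborel)"
    proof (intro nn_integral_cong)
      fix t
      show "emeasure (N t) (QL L) * indicator {-T<..<T} t - emeasure (N t) {x\<in>QL L. (torus_map L x, t) \<in> A} * indicator {-T<..<T} t
        = emeasure (N t) {x\<in>QL L. (torus_map L x, t) \<in> UNIV - A} * indicator {-T<..<T} t"
      proof (cases "t \<in> {-T<..<T}")
        case True
        interpret finite_measure "N t" by (rule fin[OF True])
        have "{x\<in>QL L. (torus_map L x, t) \<in> UNIV - A} = QL L - {x\<in>QL L. (torus_map L x, t) \<in> A}" by auto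
        then show ?thesis
          using True emeasure_compl[OF secs[OF A True]] pos_measure_on_space[OF N[OF Is[OF True]]] by simp
      qed simp
    qed
    finally show ?case .
  next
    case (union A)
    have A: "A i \<in> sets (borel \<Otimes>\<^sub>M borel)" for i using union(2) gen by auto
    have "emeasure \<rho> (cyl_map -` (\<Union>i. A i) \<inter> QLT L T) = emeasure \<rho> (\<Union>i. cyl_map -` A i \<inter> QLT L T)"
      by (rule arg_cong[where f = "emeasure \<rho>"]) auto
    also have "\<dots> = (\<Sum>i. emeasure \<rho> (cyl_map -` A i \<inter> QLT L T))"
    proof (rule suminf_emeasure[symmetric])
      show "range (\<lambda>i. cyl_map -` A i \<inter> QLT L T) \<subseteq> sets \<rho>" using pre\<rho>[OF A] by blast
      show "disjoint_family (\<lambda>i. cyl_map -` A i \<inter> QLT L T)"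
        using union(1) unfolding disjoint_family_on_def by blast
    qed
    also have "\<dots> = (\<Sum>i. \<integral>\<^sup>+t. emeasure (N t) {x\<in>QL L. (torus_map L x, t) \<in> A i} * indicator {-T<..<T} t \<partial>lborel)"
      using union(3) by simp
    also have "\<dots> = (\<integral>\<^sup>+t. (\<Sum>i. emeasure (N t) {x\<in>QL L. (torus_map L x, t) \<in> A i} * indicator {-T<..<T} t) \<partial>lborel)"
      using mes[OF A] by (intro nn_integral_suminf[symmetric]) simp
    also have "\<dots> = (\<integral>\<^sup>+t. emeasure (N t) {x\<in>QL L. (torus_map L x, t) \<in> (\<Union>i. A i)} * indicator {-T<..<T} t \<partial>lborel)"
    proof (intro nn_integral_cong)
      fix t
      show "(\<Sum>i. emeasure (N t) {x\<in>QL L. (torus_map L x, t) \<in> A i} * indicator {-T<..<T} t) =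
        emeasure (N t) {x\<in>QL L. (torus_map L x, t) \<in> (\<Union>i. A i)} * indicator {-T<..<T} t"
      proof (cases "t \<in> {-T<..<T}")
        case True
        have "(\<Sum>i. emeasure (N t) {x\<in>QL L. (torus_map L x, t) \<in> A i}) = emeasure (N t) (\<Union>i. {x\<in>QL L. (torus_map L x, t) \<in> A i})"
          using secs[OF A True] union(1) by (intro suminf_emeasure) (auto simp: disjoint_family_on_def)
        also have "(\<Union>i. {x\<in>QL L. (torus_map L x, t) \<in> A i}) = {x\<in>QL L. (torus_map L x, t) \<in> (\<Union>i. A i)}" by auto
        finally show ?thesis using True by simp
      qed simp
    qed
    finally show ?case .
  qed
qed

theorem weakly_continuous: "weakly_continuous_slicing L T \<rho> N"
  unfolding weakly_continuous_slicing_def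
proof (intro conjI allI impI ballI)
  show "disintegrates L T \<rho> N"
    unfolding disintegrates_def
  proof (intro conjI ballI)
    fix A assume "A \<in> sets \<rho>"
    then have A: "A \<in> sets borel" "A \<subseteq> QLT L T"
      using pos_measure_on_sets[OF \<rho>] by (auto simp: sets_restrict_space)
    define coords where "coords y = (torus_coord L (fst y), snd y)" for y :: "(complex \<times> complex) \<times> real"
    have bm: "coords \<in> (borel \<Otimes>\<^sub>M borel) \<rightarrow>\<^sub>M (borel \<Otimes>\<^sub>M borel)"
      unfolding coords_def
      by (intro measurable_Pair measurable_compose[OF _ torus_coord_measurable]) auto
    define A' where "A' = coords -` A"
    have A': "A' \<in> sets (borel \<Otimes>\<^sub>M borel)"
    proof -
      have "A \<in> sets (borel \<Otimes>\<^sub>M borel)" using A(1) unfolding borel_prod .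
      from measurable_sets[OF bm this] show ?thesis by (simp add: A'_def space_pair_measure)
    qed
    have bk: "(torus_map L x, t) \<in> A' \<longleftrightarrow> (x, t) \<in> A" if "x \<in> QL L" for x t
      using torus_coord_map[OF L that] by (simp add: A'_def coords_def)
    have "x \<in> cyl_map -` A' \<inter> QLT L T \<longleftrightarrow> x \<in> A" for x
      using bk[of "fst x" "snd x"] A(2) by (cases "x \<in> QLT L T") (auto simp: cyl_map_def QLT_def mem_Times_iff simp del: split_paired_All)
    then have "cyl_map -` A' \<inter> QLT L T = A" by blast
    moreover have "emeasure (N t) {x\<in>QL L. (torus_map L x, t) \<in> A'} * indicator {-T<..<T} t
       = emeasure (N t) {x. (x, t) \<in> A} * indicator {-T<..<T} t" for t
    proof -
      have "{x\<in>QL L. (torus_map L x, t) \<in> A'} = {x. (x, t) \<in> A}" using bk A(2) by (auto simp: QLT_def)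
      then show ?thesis by simp
    qed
    ultimately show "emeasure \<rho> A = (\<integral>\<^sup>+t\<in>{-T<..<T}. emeasure (N t) {x. (x, t) \<in> A} \<partial>lborel)"
      using emeasure_slices[OF A'] by simp
  qed (use kernel_N in \<open>auto simp: kernel_def\<close>)
qed (use N cont in \<open>auto simp: tcont_def\<close>)

end

section \<open>Conserved perturbations\<close>

lemma density_pos_measure_on:
  assumes M: "pos_measure_on S M" and c: "c \<in> borel_measurable M" "\<And>x. c x \<le> (B::real)"
  shows "pos_measure_on S (density M (\<lambda>x. ennreal (c x)))"
  unfolding pos_measure_on_def
proof
  show "sets (density M (\<lambda>x. ennreal (c x))) = sets (restrict_space borel S)"
    using pos_measure_on_sets[OF M] by simp
  interpret finite_measure M by (rule pos_measure_on_finite[OF M])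
  show "finite_measure (density M (\<lambda>x. ennreal (c x)))"
  proof (rule finite_measureI)
    have "emeasure (density M (\<lambda>x. ennreal (c x))) (space (density M (\<lambda>x. ennreal (c x)))) = (\<integral>\<^sup>+x. ennreal (c x) * indicator (space M) x \<partial>M)"
      using c(1) by (subst emeasure_density) auto
    also have "\<dots> \<le> (\<integral>\<^sup>+x. ennreal B \<partial>M)"
      using c(2) by (intro nn_integral_mono) (auto simp: indicator_def intro!: ennreal_leI)
    also have "\<dots> < \<infinity>" by (simp add: less_top[symmetric] ennreal_mult_eq_top_iff)
    finally show "emeasure (density M (\<lambda>x. ennreal (c x))) (space (density M (\<lambda>x. ennreal (c x)))) \<noteq> \<infinity>" by simp
  qed
qed

text \<open>The bounded function \<open>g\<close> perturbs \<open>\<mu>\<close> to \<open>(1 + g) \<mu>\<close>. Since \<open>g \<mu>\<close>, transported by \<open>v\<close>, has no source even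
  against test functions that do not vanish near \<open>\<plusminus>T\<close>, the perturbed measure has the boundary slices of \<open>\<mu>\<close>.\<close>

locale perturbation =
  fixes L T :: real and \<mu> :: "((real^2) \<times> real) measure" and v :: "(real^2) \<times> real \<Rightarrow> real^2"
    and \<nu> :: "real \<Rightarrow> (real^2) measure" and g :: "(real^2) \<times> real \<Rightarrow> real"
  assumes L: "L > 0" and T: "T > 0" and \<mu>: "pos_measure_on (QLT L T) \<mu>" and v: "integrable \<mu> v"
    and ce: "continuity_eq L T \<mu> v" and w: "weakly_continuous_slicing L T \<mu> \<nu>"
    and g: "g \<in> borel_measurable borel" and gb: "\<bar>g x\<bar> \<le> 1/2"
    and conserved: "cyl_smooth L \<phi> \<Longrightarrow> (LINT x|\<mu>. g x * along \<phi> v x) = 0"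
begin

definition perturbed :: "((real^2) \<times> real) measure" where
  "perturbed = density \<mu> (\<lambda>x. ennreal (1 + g x))"

lemma g_pos: "0 \<le> 1 + g x" "1 + g x \<le> 3/2"
  using gb[of x] by (auto simp: abs_le_iff)

lemma g_measurable: "g \<in> borel_measurable \<mu>"
  by (rule pos_measure_on_measurable[OF \<mu> g])

lemma perturbed_pos: "pos_measure_on (QLT L T) perturbed"
  unfolding perturbed_def by (rule density_pos_measure_on[OF \<mu>, of _ "3/2"]) (use g_measurable g_pos(2) in auto)

lemma integral_perturbed:
  fixes f :: "_ \<Rightarrow> real"
  assumes "integrable \<mu> f"
  shows "integrable perturbed f" "integrable \<mu> (\<lambda>x. g x * f x)"
    "(LINT x|perturbed. f x) = (LINT x|\<mu>. f x) + (LINT x|\<mu>. g x * f x)"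
proof -
  have f: "f \<in> borel_measurable \<mu>" using assms by simp
  show i: "integrable \<mu> (\<lambda>x. g x * f x)"
    by (rule Bochner_Integration.integrable_bound[OF assms])
      (use g_measurable f gb in \<open>auto simp: abs_mult intro!: mult_left_le_one_le order_trans[OF gb]\<close>)
  have "integrable \<mu> (\<lambda>x. (1 + g x) *\<^sub>R f x)" using assms i by (simp add: distrib_right)
  then show "integrable perturbed f"
    unfolding perturbed_def using g_measurable f g_pos by (subst integrable_density) auto
  have "(LINT x|perturbed. f x) = (LINT x|\<mu>. (1 + g x) *\<^sub>R f x)"
    unfolding perturbed_def using g_measurable f g_pos by (subst integral_density) auto
  then show "(LINT x|perturbed. f x) = (LINT x|\<mu>. f x) + (LINT x|\<mu>. g x * f x)"
    using assms i by (simp add: distrib_right)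
qed

lemma perturbed_integrable_vector: "integrable perturbed v"
proof -
  have vm: "v \<in> borel_measurable \<mu>" using v by simp
  have "integrable \<mu> (\<lambda>x. (1 + g x) *\<^sub>R v x)"
  proof (rule Bochner_Integration.integrable_bound[of _ "\<lambda>x. (3/2) *\<^sub>R v x"])
    show "AE x in \<mu>. norm ((1 + g x) *\<^sub>R v x) \<le> norm ((3/2) *\<^sub>R v x)"
    proof (intro AE_I2)
      fix x
      have "norm ((1 + g x) *\<^sub>R v x) = (1 + g x) * norm (v x)" using g_pos(1)[of x] by simp
      also have "\<dots> \<le> 3/2 * norm (v x)" using g_pos(2)[of x] by (intro mult_right_mono) auto
      finally show "norm ((1 + g x) *\<^sub>R v x) \<le> norm ((3/2) *\<^sub>R v x)" by simp
    qed
  qed (use v g_measurable vm in auto)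
  then show ?thesis
    unfolding perturbed_def using g_measurable vm g_pos by (subst integrable_density) auto
qed

lemma test_function_cyl_smooth: "test_function L T \<phi> \<Longrightarrow> cyl_smooth L \<phi>"
  using test_function_smooth by (auto simp: cyl_smooth_def test_function_def)

lemma perturbed_continuity: "continuity_eq L T perturbed v"
  unfolding continuity_eq_along
proof (intro allI impI)
  fix \<phi> assume \<phi>: "test_function L T \<phi>"
  show "(LINT x|perturbed. along \<phi> v x) = 0"
    using integral_perturbed(3)[OF along_integrable[OF \<mu> test_function_smooth[OF \<phi>] v]] ce \<phi>
      conserved[OF test_function_cyl_smooth[OF \<phi>]] by (simp add: continuity_eq_along)
qed

text \<open>The slice of the perturbed measure at time \<open>a\<close>, as a functional: the excess over \<open>\<nu>\<^sub>a\<close> is what \<open>g \<mu>\<close>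
  transports across \<open>{t = a}\<close>.\<close>

definition flow :: "(real^2 \<Rightarrow> real) \<Rightarrow> (real^2) \<times> real \<Rightarrow> real" where
  "flow \<psi> x = g x * along (\<lambda>x. \<psi> (fst x)) v x"

definition slice_functional :: "real \<Rightarrow> (real^2 \<Rightarrow> real) \<Rightarrow> real" where
  "slice_functional a \<psi> = (LINT x|\<nu> a. \<psi> x) - (LINT x|\<mu>. indicator {a<..} (snd x) * flow \<psi> x)"

lemma tsmooth_cyl_smooth: "tsmooth L \<psi> \<Longrightarrow> cyl_smooth L (\<lambda>x. \<psi> (fst x))"
  by (auto simp: tsmooth_def cyl_smooth_def intro: smooth_space_weight)

lemma flow_integrable: "tsmooth L \<psi> \<Longrightarrow> integrable \<mu> (flow \<psi>)"
  unfolding flow_def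
  by (intro integral_perturbed(2) along_integrable[OF \<mu> _ v]) (auto simp: tsmooth_def intro: smooth_space_weight)

lemma bounded_time_flow:
  fixes u :: "real \<Rightarrow> real"
  assumes "tsmooth L \<psi>" "u \<in> borel_measurable borel" "\<And>t. \<bar>u t\<bar> \<le> 1"
  shows "integrable \<mu> (\<lambda>x. u (snd x) * flow \<psi> x)"
  by (rule Bochner_Integration.integrable_bound[OF flow_integrable[OF assms(1)]])
     (use cyl_time_measurable[OF \<mu> assms(2)] flow_integrable[OF assms(1)] assms(3) in
      \<open>auto simp: abs_mult intro!: mult_left_le_one_le\<close>)

lemma weighted_integrable:
  assumes "smooth u" "tcont L \<psi>"
  shows "integrable \<mu> (\<lambda>x. u (snd x) * \<psi> (fst x))"
proof -
  have c: "continuous_on UNIV (\<lambda>x::(real^2) \<times> real. u (snd x) * \<psi> (fst x))"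
    using assms(2) by (intro continuous_on_mult smooth_continuous[OF smooth_time_weight[OF assms(1)]]
        continuous_on_compose2[of UNIV \<psi> UNIV fst] continuous_on_fst continuous_on_id) (auto simp: tcont_def)
  obtain B where "\<forall>x\<in>QL L. \<forall>t\<in>{-T..T}. \<bar>u (snd (x, t)) * \<psi> (fst (x, t))\<bar> \<le> B"
    using continuous_bounded_cylinder[OF c] by blast
  then show ?thesis
    by (intro pos_measure_on_integrable[OF \<mu> continuous_cylinder_measurable[OF c], of B]) (auto simp: QLT_def)
qed

text \<open>Conservation is tested with \<open>U(t) \<psi>(x)\<close> for an antiderivative \<open>U\<close> of the weight \<open>u\<close>: a weighted average of
  \<open>g \<psi>\<close> over time is thereby expressed by the flow of \<open>\<psi>\<close>.\<close>

lemma conserved_weighted: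
  assumes \<psi>: "tsmooth L \<psi>" and U: "smooth U" "\<And>t. (U has_real_derivative u t) (at t)" "smooth u"
  shows "(LINT x|\<mu>. g x * (u (snd x) * \<psi> (fst x))) = - (LINT x|\<mu>. U (snd x) * flow \<psi> x)"
    "integrable \<mu> (\<lambda>x. U (snd x) * flow \<psi> x)"
proof -
  have s: "smooth (\<lambda>x::(real^2) \<times> real. \<psi> (fst x))" using \<psi> by (auto simp: tsmooth_def intro: smooth_space_weight)
  have a: "along (\<lambda>x. U (snd x) * \<psi> (fst x)) v x = U (snd x) * along (\<lambda>x. \<psi> (fst x)) v x + u (snd x) * \<psi> (fst x)" for x
    by (rule along_time_mult[OF s U(2) U(1)])
  have cs: "cyl_smooth L (\<lambda>x. U (snd x) * \<psi> (fst x))"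
    by (rule cyl_smooth_time_mult[OF U(1) tsmooth_cyl_smooth[OF \<psi>]])
  then have i1: "integrable \<mu> (\<lambda>x. g x * along (\<lambda>x. U (snd x) * \<psi> (fst x)) v x)"
    by (intro integral_perturbed(2) along_integrable[OF \<mu> _ v]) (simp add: cyl_smooth_def)
  have i2: "integrable \<mu> (\<lambda>x. g x * (u (snd x) * \<psi> (fst x)))"
    by (intro integral_perturbed(2) weighted_integrable U(3) tsmooth_tcont \<psi>)
  have e: "U (snd x) * flow \<psi> x = g x * along (\<lambda>x. U (snd x) * \<psi> (fst x)) v x - g x * (u (snd x) * \<psi> (fst x))" for x
    unfolding a flow_def by (simp add: algebra_simps)
  show "integrable \<mu> (\<lambda>x. U (snd x) * flow \<psi> x)" unfolding e using i1 i2 by simp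
  show "(LINT x|\<mu>. g x * (u (snd x) * \<psi> (fst x))) = - (LINT x|\<mu>. U (snd x) * flow \<psi> x)"
    unfolding e using i1 i2 conserved[OF cs] by simp
qed

text \<open>By the weighted conservation law, the average of \<open>g \<psi>\<close> over a thin slab above \<open>a\<close> is minus the integral of a smooth
  step times the flow, and these steps converge to the indicator of \<open>{t > a}\<close>.\<close>

lemma slice_functional_limit:
  assumes \<psi>: "tsmooth L \<psi>" and h: "\<And>n. h n > 0" "\<And>n. a + h n \<le> T" "h \<longlonglongrightarrow> 0" and a: "- T \<le> a"
  shows "(\<lambda>n. LINT x|perturbed. kern a (h n) (snd x) * \<psi> (fst x)) \<longlonglongrightarrow> slice_functional a \<psi>"
proof -
  define S where "S n t = step ((t - a) / h n)" for n t
  have S: "smooth (S n)" "\<And>t. (S n has_real_derivative kern a (h n) t) (at t)" for n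
    unfolding S_def by (intro smooth_affine smooth_step kern_step h)+
  have eq: "(LINT x|perturbed. kern a (h n) (snd x) * \<psi> (fst x)) =
     (LINT x|\<mu>. kern a (h n) (snd x) * \<psi> (fst x)) - (LINT x|\<mu>. S n (snd x) * flow \<psi> x)" for n
    using integral_perturbed(3)[OF weighted_integrable[OF kern_smooth tsmooth_tcont[OF \<psi>]]]
      conserved_weighted(1)[OF \<psi> S kern_smooth] by simp
  have "(\<lambda>n. LINT x|\<mu>. kern a (h n) (snd x) * \<psi> (fst x)) \<longlonglongrightarrow> (LINT x|\<nu> a. \<psi> (fst (x, a)))"
    by (rule slice_bump_limit[OF w \<mu> cyl_smooth_cont[OF tsmooth_cyl_smooth[OF \<psi>]]]) (use h a in auto)
  moreover have "(\<lambda>n. LINT x|\<mu>. S n (snd x) * flow \<psi> x) \<longlonglongrightarrow> (LINT x|\<mu>. indicator {a<..} (snd x) * flow \<psi> x)"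
  proof (rule integral_dominated_convergence[where w = "\<lambda>x. \<bar>flow \<psi> x\<bar>"])
    show "(\<lambda>x. indicator {a<..} (snd x) * flow \<psi> x) \<in> borel_measurable \<mu>"
      by (rule borel_measurable_integrable, rule bounded_time_flow[OF \<psi>]) (auto simp: indicator_le_1)
    show "(\<lambda>x. S n (snd x) * flow \<psi> x) \<in> borel_measurable \<mu>" for n
      by (intro borel_measurable_integrable conserved_weighted(2)[OF \<psi> S kern_smooth])
    show "integrable \<mu> (\<lambda>x. \<bar>flow \<psi> x\<bar>)" using flow_integrable[OF \<psi>] by simp
    show "AE x in \<mu>. norm (S n (snd x) * flow \<psi> x) \<le> \<bar>flow \<psi> x\<bar>" for n
      using step_bounds by (auto simp: S_def abs_mult intro!: mult_left_le_one_le)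
    show "AE x in \<mu>. (\<lambda>n. S n (snd x) * flow \<psi> x) \<longlonglongrightarrow> indicator {a<..} (snd x) * flow \<psi> x"
    proof (intro AE_I2 tendsto_mult tendsto_const)
      fix x :: "(real^2) \<times> real"
      show "(\<lambda>n. S n (snd x)) \<longlonglongrightarrow> indicator {a<..} (snd x)"
      proof (cases "a < snd x")
        case True
        then have "\<forall>\<^sub>F n in sequentially. h n < snd x - a" using order_tendstoD(2)[OF h(3)] by simp
        then have "\<forall>\<^sub>F n in sequentially. S n (snd x) = 1"
        proof eventually_elim
          case (elim n)
          then have "(snd x - a) / h n \<ge> 1" using h(1)[of n] by simp
          then show ?case by (simp add: S_def step_1)
        qed
        then show ?thesis using True by (simp add: tendsto_eventually)
      next
        case False
        then have "(snd x - a) / h n \<le> 0" for n using h(1)[of n] by (simp add: divide_nonpos_pos)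
        then show ?thesis using False by (simp add: S_def step_0)
      qed
    qed
  qed
  ultimately show ?thesis unfolding eq slice_functional_def fst_conv by (rule tendsto_diff)
qed

lemma slice_functional_end: "tsmooth L \<psi> \<Longrightarrow> slice_functional T \<psi> = (LINT x|\<nu> T. \<psi> x)"
proof -
  have "(LINT x|\<mu>. indicator {T<..} (snd x) * flow \<psi> x) = (LINT x|\<mu>. 0)"
    by (rule Bochner_Integration.integral_cong) (auto simp: pos_measure_on_space[OF \<mu>] QLT_def)
  then show ?thesis by (simp add: slice_functional_def)
qed

lemma slice_functional_start:
  assumes "tsmooth L \<psi>"
  shows "slice_functional (-T) \<psi> = (LINT x|\<nu> (-T). \<psi> x)"
proof -
  have "(LINT x|\<mu>. indicator {-T<..} (snd x) * flow \<psi> x) = (LINT x|\<mu>. flow \<psi> x)"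
    by (rule Bochner_Integration.integral_cong) (auto simp: pos_measure_on_space[OF \<mu>] QLT_def)
  then show ?thesis
    using conserved[OF tsmooth_cyl_smooth[OF assms]] by (simp add: slice_functional_def flow_def)
qed

text \<open>The averages of the perturbed measure over thin slabs inherit positivity and the factor \<open>1 + g \<le> 3/2\<close>, and they
  converge to the slice functional. At \<open>a = T\<close> there is no slab above \<open>a\<close>, but the functional is that of \<open>\<nu>\<^sub>T\<close>.\<close>

lemma slice_functional_bound:
  assumes \<psi>: "tsmooth L \<psi>" and a: "a \<in> {-T..T}"
  shows "slice_functional a \<psi> \<le> 3/2 * (LINT x|\<nu> a. max 0 (\<psi> x))"
proof -
  define \<psi>p where "\<psi>p = (\<lambda>x. max 0 (\<psi> x))"
  have \<psi>p: "tcont L \<psi>p"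
    unfolding \<psi>p_def by (rule tcont_compose[OF tsmooth_tcont[OF \<psi>]]) (intro continuous_intros)
  note wp = wcs_pos[OF w a]
  interpret finite_measure "\<nu> a" by (rule pos_measure_on_finite[OF wp])
  show ?thesis
  proof (cases "a = T")
    case True
    have "(LINT x|\<nu> a. \<psi> x) \<le> (LINT x|\<nu> a. \<psi>p x)"
      using tcont_integrable[OF wp] \<psi>p tsmooth_tcont[OF \<psi>] by (intro integral_mono) (auto simp: \<psi>p_def)
    moreover have "0 \<le> (LINT x|\<nu> a. \<psi>p x)" by (intro integral_nonneg_AE) (auto simp: \<psi>p_def)
    ultimately have "slice_functional a \<psi> \<le> 3/2 * (LINT x|\<nu> a. \<psi>p x)"
      using slice_functional_end[OF \<psi>] unfolding True by linarith
    then show ?thesis by (simp add: \<psi>p_def)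
  next
    case False
    then have aT: "a < T" using a by simp
    define h where "h n = (T - a) * inverse (real (Suc n))" for n
    have hl: "h \<longlonglongrightarrow> 0" unfolding h_def using tendsto_mult_right_zero[OF LIMSEQ_inverse_real_of_nat] by auto
    have h0: "h n > 0" for n using aT by (simp add: h_def)
    have h1: "a + h n \<le> T" for n
    proof -
      have "(T - a) * inverse (real (Suc n)) \<le> (T - a) * 1"
        using aT by (intro mult_left_mono) (auto simp: field_simps)
      then show ?thesis by (simp add: h_def)
    qed
    have cyl: "cyl_cont L (\<lambda>x. \<psi>p (fst x))"
      using \<psi>p by (auto simp: cyl_cont_def tcont_def intro!: continuous_on_compose2[of UNIV \<psi>p UNIV fst] continuous_on_fst continuous_on_id)
    have l: "(\<lambda>n. 3/2 * (LINT x|\<mu>. kern a (h n) (snd x) * \<psi>p (fst x))) \<longlonglongrightarrow> 3/2 * (LINT x|\<nu> a. \<psi>p (fst (x, a)))"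
      by (intro tendsto_mult tendsto_const slice_bump_limit[OF w \<mu> cyl]) (use h0 h1 hl a in auto)
    have le: "(LINT x|perturbed. kern a (h n) (snd x) * \<psi> (fst x)) \<le> 3/2 * (LINT x|\<mu>. kern a (h n) (snd x) * \<psi>p (fst x))" for n
    proof -
      have i: "integrable \<mu> (\<lambda>x. kern a (h n) (snd x) * p (fst x))" if "tcont L p" for p
        by (rule weighted_integrable[OF kern_smooth that])
      note i1 = i[OF tsmooth_tcont[OF \<psi>]]
      have "(LINT x|perturbed. kern a (h n) (snd x) * \<psi> (fst x)) =
         (LINT x|\<mu>. kern a (h n) (snd x) * \<psi> (fst x) + g x * (kern a (h n) (snd x) * \<psi> (fst x)))"
        using integral_perturbed(2,3)[OF i1] i1 by simp
      also have "\<dots> \<le> (LINT x|\<mu>. 3/2 * (kern a (h n) (snd x) * \<psi>p (fst x)))"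
      proof (rule integral_mono)
        fix x
        have "(1 + g x) * \<psi> (fst x) \<le> (1 + g x) * \<psi>p (fst x)"
          using g_pos(1)[of x] by (intro mult_left_mono) (auto simp: \<psi>p_def)
        also have "\<dots> \<le> 3/2 * \<psi>p (fst x)" using g_pos(2)[of x] by (intro mult_right_mono) (auto simp: \<psi>p_def)
        finally have "kern a (h n) (snd x) * ((1 + g x) * \<psi> (fst x)) \<le> kern a (h n) (snd x) * (3/2 * \<psi>p (fst x))"
          using kern_nonneg[OF h0] by (intro mult_left_mono) auto
        then show "kern a (h n) (snd x) * \<psi> (fst x) + g x * (kern a (h n) (snd x) * \<psi> (fst x)) \<le> 3/2 * (kern a (h n) (snd x) * \<psi>p (fst x))"
          by (simp add: algebra_simps)
      qed (use i1 i[OF \<psi>p] integral_perturbed(2)[OF i1] in auto)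
      finally show ?thesis by simp
    qed
    have "slice_functional a \<psi> \<le> 3/2 * (LINT x|\<nu> a. \<psi>p (fst (x, a)))"
      by (rule LIMSEQ_le[OF slice_functional_limit[OF \<psi> h0 h1 hl] l]) (use le a in auto)
    then show ?thesis by (simp add: \<psi>p_def)
  qed
qed

text \<open>The bound makes the slice functional integration against a density with respect to \<open>\<nu>\<^sub>a\<close>.\<close>

lemma slice_exists:
  assumes a: "a \<in> {-T..T}"
  shows "\<exists>M. pos_measure_on (QL L) M \<and> (\<forall>\<psi>. tsmooth L \<psi> \<longrightarrow> (LINT x|M. \<psi> x) = slice_functional a \<psi>)"
proof -
  note wp = wcs_pos[OF w a]
  interpret fm: finite_measure "\<nu> a" by (rule pos_measure_on_finite[OF wp])
  define G where "G = {(\<psi>, slice_functional a \<psi>) |\<psi>. tsmooth L \<psi>}"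
  have it: "integrable (\<nu> a) \<psi>" if "tsmooth L \<psi>" for \<psi> by (rule tcont_integrable[OF wp tsmooth_tcont[OF that]])
  have il: "integrable \<mu> (\<lambda>x. indicator {a<..} (snd x) * flow \<psi> x)" if "tsmooth L \<psi>" for \<psi>
    by (rule bounded_time_flow[OF that]) (auto simp: indicator_le_1)
  have s1: "smooth (\<lambda>x::(real^2) \<times> real. \<psi> (fst x))" if "tsmooth L \<psi>" for \<psi>
    using that by (auto simp: tsmooth_def intro: smooth_space_weight)
  interpret dominated_graph "\<nu> a" "3/2" G
  proof unfold_locales
    have z: "tsmooth L (\<lambda>_. 0)" by (simp add: tsmooth_def periodic_def smooth_const)
    have "along (\<lambda>x. 0) v x = 0" for x by (simp add: along_def)
    then have "slice_functional a (\<lambda>_. 0) = 0" by (simp add: slice_functional_def flow_def)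
    then show "(\<lambda>_. 0, 0) \<in> G" unfolding G_def using z by force
  next
    fix \<psi> r assume "(\<psi>, r) \<in> G"
    then have \<psi>: "tsmooth L \<psi>" "r = slice_functional a \<psi>" by (auto simp: G_def)
    show "integrable (\<nu> a) \<psi>" by (rule it[OF \<psi>(1)])
    show "r \<le> 3/2 * (LINT x|\<nu> a. max 0 (\<psi> x))" using slice_functional_bound[OF \<psi>(1) a] \<psi>(2) by simp
    show "(\<lambda>x. c * \<psi> x, c * r) \<in> G" for c
    proof -
      have t: "tsmooth L (\<lambda>x. c * \<psi> x)" using \<psi> by (auto simp: tsmooth_def periodic_def intro: smooth_cmult)
      have "flow (\<lambda>x. c * \<psi> x) x = c * flow \<psi> x" for x
        unfolding flow_def along_cmult[OF s1[OF \<psi>(1)]] by simp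
      then have "slice_functional a (\<lambda>x. c * \<psi> x) = c * r"
        unfolding \<psi>(2) slice_functional_def by (simp add: right_diff_distrib mult.left_commute)
      then show ?thesis using t unfolding G_def by force
    qed
    fix \<psi>' r' assume "(\<psi>', r') \<in> G"
    then have \<psi>': "tsmooth L \<psi>'" "r' = slice_functional a \<psi>'" by (auto simp: G_def)
    have t: "tsmooth L (\<lambda>x. \<psi> x + \<psi>' x)" using \<psi> \<psi>' by (auto simp: tsmooth_def periodic_def intro: smooth_add)
    have "flow (\<lambda>x. \<psi> x + \<psi>' x) x = flow \<psi> x + flow \<psi>' x" for x
      unfolding flow_def along_add[OF s1[OF \<psi>(1)] s1[OF \<psi>'(1)]] by (simp add: distrib_left)
    then have "slice_functional a (\<lambda>x. \<psi> x + \<psi>' x) = r + r'"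
      unfolding \<psi>(2) \<psi>'(2) slice_functional_def
      using it[OF \<psi>(1)] it[OF \<psi>'(1)] il[OF \<psi>(1)] il[OF \<psi>'(1)] by (simp add: distrib_left)
    then show "(\<lambda>x. \<psi> x + \<psi>' x, r + r') \<in> G" using t unfolding G_def by force
  qed simp
  obtain f where f: "f \<in> borel_measurable (\<nu> a)" "\<And>x. 0 \<le> f x \<and> f x \<le> 3/2"
    "\<And>\<psi> r. (\<psi>, r) \<in> G \<Longrightarrow> (LINT x|\<nu> a. f x * \<psi> x) = r"
    using density_exists by blast
  define M where "M = density (\<nu> a) (\<lambda>x. ennreal (f x))"
  have "pos_measure_on (QL L) M"
    unfolding pos_measure_on_def
  proof
    show "sets M = sets (restrict_space borel (QL L))" using pos_measure_on_sets[OF wp] by (simp add: M_def)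
    show "finite_measure M"
    proof (rule finite_measureI)
      have "emeasure M (space M) = (\<integral>\<^sup>+x. ennreal (f x) * indicator (space (\<nu> a)) x \<partial>\<nu> a)"
        unfolding M_def using f(1) by (subst emeasure_density) auto
      also have "\<dots> \<le> (\<integral>\<^sup>+x. ennreal (3/2) \<partial>\<nu> a)"
        using f(2) by (intro nn_integral_mono) (auto simp: indicator_def intro!: ennreal_leI)
      also have "\<dots> < \<infinity>" by (simp add: less_top[symmetric] ennreal_mult_eq_top_iff)
      finally show "emeasure M (space M) \<noteq> \<infinity>" by simp
    qed
  qed
  moreover have "(LINT x|M. \<psi> x) = slice_functional a \<psi>" if "tsmooth L \<psi>" for \<psi>
  proof -
    have "(LINT x|M. \<psi> x) = (LINT x|\<nu> a. f x *\<^sub>R \<psi> x)"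
      unfolding M_def using f it[OF that] by (subst integral_density) auto
    then show ?thesis using f(3)[of \<psi> "slice_functional a \<psi>"] that by (auto simp: G_def)
  qed
  ultimately show ?thesis by blast
qed

definition perturbed_slice :: "real \<Rightarrow> (real^2) measure" where
  "perturbed_slice a = (SOME M. pos_measure_on (QL L) M \<and> (\<forall>\<psi>. tsmooth L \<psi> \<longrightarrow> (LINT x|M. \<psi> x) = slice_functional a \<psi>))"

lemma perturbed_slice:
  assumes "a \<in> {-T..T}"
  shows "pos_measure_on (QL L) (perturbed_slice a)"
    "tsmooth L \<psi> \<Longrightarrow> (LINT x|perturbed_slice a. \<psi> x) = slice_functional a \<psi>"
  using someI_ex[OF slice_exists[OF assms]] unfolding perturbed_slice_def by auto

lemma perturbed_slice_ends: "perturbed_slice T = \<nu> T" "perturbed_slice (-T) = \<nu> (-T)"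
proof -
  have a: "T \<in> {-T..T}" "- T \<in> {-T..T}" using T by auto
  show "perturbed_slice T = \<nu> T"
    by (rule torus_measure_eqI[OF L perturbed_slice(1)[OF a(1)] wcs_pos[OF w a(1)]])
       (simp add: perturbed_slice(2)[OF a(1)] slice_functional_end)
  show "perturbed_slice (-T) = \<nu> (-T)"
    by (rule torus_measure_eqI[OF L perturbed_slice(1)[OF a(2)] wcs_pos[OF w a(2)]])
       (simp add: perturbed_slice(2)[OF a(2)] slice_functional_start)
qed

lemma time_slice_null: "AE x in \<mu>. snd x \<noteq> a"
proof -
  have m: "(\<lambda>x. indicator {a} (snd x) :: ennreal) \<in> borel_measurable borel"
    by (rule measurable_compose[of snd _ borel])
      (auto intro!: borel_measurable_continuous_onI continuous_on_snd continuous_on_id)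
  have "(\<integral>\<^sup>+x. indicator {a} (snd x) \<partial>\<mu>) = (\<integral>\<^sup>+t\<in>{-T<..<T}. (\<integral>\<^sup>+x. indicator {a} (snd (x, t)) \<partial>\<nu> t) \<partial>lborel)"
    by (rule disintegrates_nn_integral[OF wcs_disintegrates[OF w] \<mu> m])
  also have "\<dots> = (\<integral>\<^sup>+(t::real). 0 \<partial>lborel)"
    by (rule nn_integral_cong_AE) (use AE_lborel_singleton[of a] in \<open>eventually_elim, auto\<close>)
  finally have "(\<integral>\<^sup>+x. indicator {a} (snd x) \<partial>\<mu>) = 0" by simp
  then have "AE x in \<mu>. indicator {a} (snd x) = (0::ennreal)"
    using nn_integral_0_iff_AE[OF pos_measure_on_measurable[OF \<mu> m]] by simp
  then show ?thesis by eventually_elim (auto simp: indicator_def split: if_splits)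
qed

text \<open>A slab of small height carries little of the flow because single heights are null sets of \<open>\<mu>\<close>.\<close>

lemma slice_functional_continuous:
  assumes \<psi>: "tsmooth L \<psi>"
  shows "continuous_on {-T..T} (\<lambda>a. slice_functional a \<psi>)"
  unfolding slice_functional_def
proof (rule continuous_on_diff[OF wcs_continuous[OF w tsmooth_tcont[OF \<psi>]]])
  show "continuous_on {-T..T} (\<lambda>a. LINT x|\<mu>. indicator {a<..} (snd x) * flow \<psi> x)"
    unfolding continuous_on_sequentially comp_def
  proof (intro allI ballI impI, elim conjE)
    fix X :: "nat \<Rightarrow> real" and a assume X: "X \<longlonglongrightarrow> a"
    show "(\<lambda>n. LINT x|\<mu>. indicator {X n<..} (snd x) * flow \<psi> x) \<longlonglongrightarrow> (LINT x|\<mu>. indicator {a<..} (snd x) * flow \<psi> x)"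
    proof (rule integral_dominated_convergence[where w = "\<lambda>x. \<bar>flow \<psi> x\<bar>"])
      show "(\<lambda>x. indicator {b<..} (snd x) * flow \<psi> x) \<in> borel_measurable \<mu>" for b
        by (rule borel_measurable_integrable, rule bounded_time_flow[OF \<psi>]) (auto simp: indicator_le_1)
      then show "(\<lambda>x. indicator {X n<..} (snd x) * flow \<psi> x) \<in> borel_measurable \<mu>" for n .
      show "integrable \<mu> (\<lambda>x. \<bar>flow \<psi> x\<bar>)" using flow_integrable[OF \<psi>] by simp
      show "AE x in \<mu>. norm (indicator {X n<..} (snd x) * flow \<psi> x) \<le> \<bar>flow \<psi> x\<bar>" for n
        by (auto simp: indicator_def)
      show "AE x in \<mu>. (\<lambda>n. indicator {X n<..} (snd x) * flow \<psi> x) \<longlonglongrightarrow> indicator {a<..} (snd x) * flow \<psi> x"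
        using time_slice_null[of a]
      proof eventually_elim
        case (elim x)
        have "\<forall>\<^sub>F n in sequentially. indicat_real {X n<..} (snd x) = indicator {a<..} (snd x)"
        proof (cases "a < snd x")
          case True
          from order_tendstoD(2)[OF X True] show ?thesis by eventually_elim (use True in simp)
        next
          case False
          then have "snd x < a" using elim by simp
          from order_tendstoD(1)[OF X this] show ?thesis by eventually_elim (use False in simp)
        qed
        then have "(\<lambda>n. indicat_real {X n<..} (snd x)) \<longlonglongrightarrow> indicator {a<..} (snd x)" by (rule tendsto_eventually)
        then show ?case by (intro tendsto_mult tendsto_const)
      qed
    qed
  qed
qed

lemma perturbed_slice_continuous:
  assumes \<psi>: "tcont L \<psi>"
  shows "continuous_on {-T..T} (\<lambda>t. LINT x|perturbed_slice t. \<psi> x)"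
proof -
  note N = perturbed_slice(1)
  have sm: "continuous_on {-T..T} (\<lambda>t. LINT x|perturbed_slice t. p x)" if p: "tsmooth L p" for p
    using slice_functional_continuous[OF p] by (rule continuous_on_eq) (simp add: perturbed_slice(2)[OF _ p])
  have one: "tsmooth L (\<lambda>x. 1)" by (simp add: tsmooth_def periodic_def smooth_const)
  have "compact ((\<lambda>t. LINT x|perturbed_slice t. 1 :: real) ` {-T..T})"
    by (intro compact_continuous_image sm[OF one] compact_Icc)
  then have "bounded ((\<lambda>t. LINT x|perturbed_slice t. 1 :: real) ` {-T..T})" by (rule compact_imp_bounded)
  then obtain M0 where M0: "\<forall>y\<in>(\<lambda>t. LINT x|perturbed_slice t. 1 :: real) ` {-T..T}. norm y \<le> M0"
    unfolding bounded_iff by blast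
  define M where "M = max M0 1"
  have M: "measure (perturbed_slice t) (space (perturbed_slice t)) \<le> M" if "t \<in> {-T..T}" for t
  proof -
    have "norm (LINT x|perturbed_slice t. 1 :: real) \<le> M0" by (rule bspec[OF M0 imageI[OF that]])
    then show ?thesis by (simp add: M_def)
  qed
  have "\<exists>p. tsmooth L p \<and> (\<forall>x. \<bar>\<psi> x - p x\<bar> < inverse (real (Suc n)))" for n
    using tsmooth_dense[OF L \<psi>, of "inverse (real (Suc n))"] by simp
  then obtain p where p: "\<And>n. tsmooth L (p n)" "\<And>n x. \<bar>\<psi> x - p n x\<bar> < inverse (real (Suc n))" by metis
  have d: "\<bar>(LINT x|perturbed_slice t. p n x) - (LINT x|perturbed_slice t. \<psi> x)\<bar> \<le> M * inverse (real (Suc n))"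
    if t: "t \<in> {-T..T}" for n t
  proof -
    interpret fm: finite_measure "perturbed_slice t" by (rule pos_measure_on_finite[OF N[OF t]])
    have i: "integrable (perturbed_slice t) \<psi>" "integrable (perturbed_slice t) (p n)"
      using tcont_integrable[OF N[OF t]] \<psi> tsmooth_tcont[OF p(1)] by auto
    have "\<bar>(LINT x|perturbed_slice t. p n x) - (LINT x|perturbed_slice t. \<psi> x)\<bar> = \<bar>LINT x|perturbed_slice t. p n x - \<psi> x\<bar>"
      using i by simp
    also have "\<dots> \<le> (LINT x|perturbed_slice t. inverse (real (Suc n)))"
      using i p(2) by (intro integral_abs_bound_integral) (auto simp: abs_minus_commute less_imp_le)
    also have "\<dots> = measure (perturbed_slice t) (space (perturbed_slice t)) * inverse (real (Suc n))" by simp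
    also have "\<dots> \<le> M * inverse (real (Suc n))" using M[OF t] by (intro mult_right_mono) auto
    finally show ?thesis .
  qed
  show ?thesis
  proof (rule uniform_limit_theorem[where F = sequentially])
    show "\<forall>\<^sub>F n in sequentially. continuous_on {-T..T} (\<lambda>t. LINT x|perturbed_slice t. p n x)"
      using sm[OF p(1)] by simp
    show "uniform_limit {-T..T} (\<lambda>n t. LINT x|perturbed_slice t. p n x) (\<lambda>t. LINT x|perturbed_slice t. \<psi> x) sequentially"
    proof (rule uniform_limitI)
      fix e :: real assume e: "e > 0"
      have "(\<lambda>n. M * inverse (real (Suc n))) \<longlonglongrightarrow> 0"
        using tendsto_mult_right_zero[OF LIMSEQ_inverse_real_of_nat] by auto
      from order_tendstoD(2)[OF this e]
      show "\<forall>\<^sub>F n in sequentially. \<forall>t\<in>{-T..T}. dist (LINT x|perturbed_slice t. p n x) (LINT x|perturbed_slice t. \<psi> x) < e"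
      proof eventually_elim
        case (elim n)
        then show ?case using d[of _ n] unfolding dist_real_def by (meson order_le_less_trans)
      qed
    qed
  qed simp
qed

text \<open>Integrating \<open>u(t)\<close> against the indicator of \<open>{t < x\<^sub>3}\<close> in time produces an antiderivative of \<open>u\<close> at \<open>x\<^sub>3\<close>, so that
  exchanging the two integrals leads back to \<open>conserved_weighted\<close>. The constant of integration is
  annihilated since the total flow vanishes.\<close>

lemma perturbed_slice_weak:
  assumes u: "smooth u" and \<psi>: "tsmooth L \<psi>"
  shows "(LINT t|lborel. indicator {-T<..<T} t * (u t * (LINT x|perturbed_slice t. \<psi> x))) = (LINT x|perturbed. u (snd x) * \<psi> (fst x))"
proof -
  obtain U where U: "smooth U" "\<And>t. (U has_real_derivative u t) (at t)" using smooth_antiderivative[OF u] by blast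
  have um: "u \<in> borel_measurable borel" by (intro borel_measurable_continuous_onI smooth_continuous u)
  have "bounded (u ` {-T..T})" by (intro compact_imp_bounded compact_continuous_image compact_Icc smooth_continuous u)
  then obtain A where "\<forall>y\<in>u ` {-T..T}. norm y \<le> A" unfolding bounded_iff by blast
  then have A: "\<bar>u t\<bar> \<le> A" if "t \<in> {-T<..<T}" for t using that by auto
  have A0: "A \<ge> 0" using A[of 0] T by auto
  define f where "f t x = indicator {-T<..<T} t * u t * (indicator {t<..} (snd x) * flow \<psi> x)" for t and x :: "(real^2) \<times> real"
  interpret \<mu>: finite_measure \<mu> by (rule pos_measure_on_finite[OF \<mu>])
  interpret P: pair_sigma_finite lborel \<mu> ..
  have fl: "flow \<psi> \<in> borel_measurable \<mu>" using flow_integrable[OF \<psi>] by simp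
  have sm: "snd \<in> borel_measurable \<mu>" using cyl_time_measurable[OF \<mu>, of "\<lambda>t. t"] by simp
  have fm: "(\<lambda>p. f (fst p) (snd p)) \<in> borel_measurable (lborel \<Otimes>\<^sub>M \<mu>)"
  proof -
    have e: "indicat_real {fst p<..} (snd (snd p)) = (if fst p < snd (snd p) then 1 else 0)"
      for p :: "real \<times> (real^2) \<times> real" by (simp add: indicator_def)
    have m1: "(\<lambda>p. indicat_real {fst p<..} (snd (snd p))) \<in> borel_measurable (lborel \<Otimes>\<^sub>M \<mu>)"
      unfolding e using sm by measurable
    have m2: "(\<lambda>p. flow \<psi> (snd p)) \<in> borel_measurable (lborel \<Otimes>\<^sub>M \<mu>)" using fl by measurable
    have m3: "(\<lambda>p. indicator {-T<..<T} (fst p) * u (fst p)) \<in> borel_measurable (lborel \<Otimes>\<^sub>M \<mu>)"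
      using um by measurable
    show ?thesis unfolding f_def by (rule borel_measurable_times[OF m3 borel_measurable_times[OF m1 m2]])
  qed
  have fx: "integrable \<mu> (f t)" for t
    unfolding f_def
    by (rule integrable_mult_right, rule bounded_time_flow[OF \<psi>]) (auto simp: indicator_le_1)
  have finn: "\<bar>LINT x|\<mu>. norm (f t x)\<bar> \<le> indicator {-T<..<T} t * (A * (LINT x|\<mu>. \<bar>flow \<psi> x\<bar>))" for t
  proof (cases "t \<in> {-T<..<T}")
    case True
    have "(LINT x|\<mu>. norm (f t x)) \<le> (LINT x|\<mu>. A * \<bar>flow \<psi> x\<bar>)"
    proof (rule integral_mono)
      show "norm (f t x) \<le> A * \<bar>flow \<psi> x\<bar>" for x
        using True A[OF True] A0 by (auto simp: f_def abs_mult indicator_def intro!: mult_right_mono)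
    qed (use fx flow_integrable[OF \<psi>] in auto)
    then show ?thesis using True by (simp add: abs_of_nonneg integral_nonneg_AE)
  qed (simp add: f_def)
  have "integrable (lborel \<Otimes>\<^sub>M \<mu>) (\<lambda>p. f (fst p) (snd p))"
  proof (rule P.Fubini_integrable[OF fm])
    show "integrable lborel (\<lambda>t. LINT x|\<mu>. norm (f (fst (t, x)) (snd (t, x))))"
    proof (rule Bochner_Integration.integrable_bound)
      show "integrable lborel (\<lambda>t. indicator {-T<..<T} t * (A * (LINT x|\<mu>. \<bar>flow \<psi> x\<bar>)))"
        using T by (intro integrable_mult_left integrable_real_indicator) (auto simp: emeasure_lborel_Ioo)
      show "(\<lambda>t. LINT x|\<mu>. norm (f (fst (t, x)) (snd (t, x)))) \<in> borel_measurable lborel"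
        using fm by measurable
      show "AE t in lborel. norm (LINT x|\<mu>. norm (f (fst (t, x)) (snd (t, x)))) \<le> norm (indicator {-T<..<T} t * (A * (LINT x|\<mu>. \<bar>flow \<psi> x\<bar>)))"
        using finn by (auto intro: order_trans[OF _ abs_ge_self])
    qed
    show "AE t in lborel. integrable \<mu> (\<lambda>x. f (fst (t, x)) (snd (t, x)))" using fx by simp
  qed
  then have fi: "integrable (lborel \<Otimes>\<^sub>M \<mu>) (case_prod f)" by (simp add: case_prod_beta')
  have inner: "(LINT t|lborel. f t x) = (U (snd x) - U (- T)) * flow \<psi> x" if x: "x \<in> space \<mu>" for x
  proof -
    have s: "snd x \<in> {-T<..<T}" using x pos_measure_on_space[OF \<mu>] by (auto simp: QLT_def)
    have "has_bochner_integral lborel (\<lambda>t. u t * indicator {-T..snd x} t) (U (snd x) - U (- T))"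
    proof (rule has_bochner_integral_FTC_Icc_real[where F = U and f = u])
      show "isCont u t" for t using smooth_continuous[OF u, of UNIV] by (simp add: continuous_on_eq_continuous_at)
    qed (use U s in auto)
    then have "(LINT t|lborel. u t * indicator {-T..snd x} t * flow \<psi> x) = (U (snd x) - U (- T)) * flow \<psi> x"
      by (simp add: has_bochner_integral_iff)
    moreover have "(LINT t|lborel. f t x) = (LINT t|lborel. u t * indicator {-T..snd x} t * flow \<psi> x)"
    proof (rule integral_cong_AE)
      show "AE t in lborel. f t x = u t * indicator {-T..snd x} t * flow \<psi> x"
        using AE_lborel_singleton[of "- T"] AE_lborel_singleton[of "snd x"]
        by eventually_elim (use s in \<open>auto simp: f_def indicator_def\<close>)
      have "(\<lambda>t. indicat_real {t<..} (snd x)) = indicator {..<snd x}" by (auto simp: indicator_def)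
      then have m: "(\<lambda>t. indicat_real {t<..} (snd x)) \<in> borel_measurable borel" by simp
      show "(\<lambda>t. f t x) \<in> borel_measurable lborel" unfolding f_def using um m by simp
    qed (use um in simp)
    ultimately show ?thesis by simp
  qed
  have i1: "integrable \<mu> (\<lambda>x. U (snd x) * flow \<psi> x)" by (rule conserved_weighted(2)[OF \<psi> U u])
  have "(LINT t|lborel. LINT x|\<mu>. f t x) = (LINT x|\<mu>. LINT t|lborel. f t x)"
    by (rule P.Fubini_integral[OF fi, symmetric])
  also have "\<dots> = (LINT x|\<mu>. U (snd x) * flow \<psi> x - U (- T) * flow \<psi> x)"
    by (rule Bochner_Integration.integral_cong) (auto simp: inner left_diff_distrib)
  also have "\<dots> = (LINT x|\<mu>. U (snd x) * flow \<psi> x) - U (- T) * (LINT x|\<mu>. flow \<psi> x)"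
    using i1 flow_integrable[OF \<psi>] by simp
  also have "(LINT x|\<mu>. flow \<psi> x) = 0"
    using conserved[OF tsmooth_cyl_smooth[OF \<psi>]] by (simp add: flow_def)
  finally have f2: "(LINT t|lborel. LINT x|\<mu>. f t x) = - (LINT x|\<mu>. g x * (u (snd x) * \<psi> (fst x)))"
    using conserved_weighted(1)[OF \<psi> U u] by simp
  have f_int: "integrable lborel (\<lambda>t. LINT x|\<mu>. f t x)" by (rule P.integrable_fst'[OF fi, simplified])
  have c: "continuous_on UNIV (\<lambda>x::(real^2) \<times> real. u (snd x) * \<psi> (fst x))"
    using \<psi> by (intro smooth_continuous smooth_mult smooth_time_weight smooth_space_weight u) (simp add: tsmooth_def)
  obtain B where B: "\<forall>x\<in>QL L. \<forall>t\<in>{-T..T}. \<bar>u (snd (x, t)) * \<psi> (fst (x, t))\<bar> \<le> B"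
    using continuous_bounded_cylinder[OF c] by blast
  have h1: "has_bochner_integral lborel (\<lambda>t. indicator {-T<..<T} t * (LINT x|\<nu> t. u (snd (x, t)) * \<psi> (fst (x, t))))
      (LINT x|\<mu>. u (snd x) * \<psi> (fst x))"
    by (rule disintegrates_integral[OF wcs_disintegrates[OF w] \<mu> continuous_cylinder_measurable[OF c], of B]) (use B in auto)
  have split: "indicator {-T<..<T} t * (u t * (LINT x|perturbed_slice t. \<psi> x)) =
      indicator {-T<..<T} t * (LINT x|\<nu> t. u (snd (x, t)) * \<psi> (fst (x, t))) - (LINT x|\<mu>. f t x)" for t
  proof (cases "t \<in> {-T<..<T}")
    case True
    then have t: "t \<in> {-T..T}" by auto
    show ?thesis
      unfolding perturbed_slice(2)[OF t \<psi>] slice_functional_def f_def using True by (simp add: right_diff_distrib)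
  qed (simp add: f_def)
  have "(LINT t|lborel. indicator {-T<..<T} t * (u t * (LINT x|perturbed_slice t. \<psi> x))) =
     (LINT x|\<mu>. u (snd x) * \<psi> (fst x)) - (LINT t|lborel. LINT x|\<mu>. f t x)"
    unfolding split using h1 f_int by (subst Bochner_Integration.integral_diff) (auto simp: has_bochner_integral_iff)
  also have "\<dots> = (LINT x|perturbed. u (snd x) * \<psi> (fst x))"
    using f2 integral_perturbed(3)[OF weighted_integrable[OF u tsmooth_tcont[OF \<psi>]]] by simp
  finally show ?thesis .
qed

theorem perturbed_slicing: "weakly_continuous_slicing L T perturbed perturbed_slice"
proof -
  interpret slice_family L T perturbed perturbed_slice
    by unfold_locales (use L T perturbed_pos perturbed_slice(1) perturbed_slice_continuous perturbed_slice_weak in auto)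
  show ?thesis by (rule weakly_continuous)
qed

end

section \<open>Minimizers admit no conserved perturbation\<close>

text \<open>As a supremum over simple minorants, the integral is superadditive without any measurability. This settles the integrals
  over time below, where the sum of the square roots of the masses of the atoms occurs as a function of time.\<close>

lemma nn_integral_superadditive:
  "(\<integral>\<^sup>+x. f x \<partial>M) + (\<integral>\<^sup>+x. g x \<partial>M) \<le> (\<integral>\<^sup>+x. f x + g x \<partial>M)"
proof -
  define F where "F = {u. simple_function M u \<and> u \<le> f}"
  define G where "G = {u. simple_function M u \<and> u \<le> g}"
  have ne: "F \<noteq> {}" "G \<noteq> {}"
    unfolding F_def G_def by (auto simp: le_fun_def intro!: exI[of _ "\<lambda>_. 0"])
  have le: "integral\<^sup>S M u + integral\<^sup>S M w \<le> (\<integral>\<^sup>+x. f x + g x \<partial>M)" if "u \<in> F" "w \<in> G" for u w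
  proof -
    have uw: "simple_function M u" "simple_function M w" "u \<le> f" "w \<le> g" using that by (auto simp: F_def G_def)
    have "integral\<^sup>S M u + integral\<^sup>S M w = (\<integral>\<^sup>+x. u x + w x \<partial>M)"
      using uw by (simp add: nn_integral_add nn_integral_eq_simple_integral borel_measurable_simple_function)
    also have "\<dots> \<le> (\<integral>\<^sup>+x. f x + g x \<partial>M)"
      using uw by (intro nn_integral_mono add_mono) (auto simp: le_fun_def)
    finally show ?thesis .
  qed
  have "(SUP u\<in>F. integral\<^sup>S M u) + (SUP w\<in>G. integral\<^sup>S M w) = (SUP u\<in>F. integral\<^sup>S M u + (SUP w\<in>G. integral\<^sup>S M w))"
    by (rule ennreal_SUP_add_left[OF ne(1), symmetric])
  also have "\<dots> = (SUP u\<in>F. SUP w\<in>G. integral\<^sup>S M u + integral\<^sup>S M w)"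
    using ennreal_SUP_add_right[OF ne(2)] by simp
  also have "\<dots> \<le> (\<integral>\<^sup>+x. f x + g x \<partial>M)"
    using le by (intro SUP_least) auto
  finally show ?thesis by (simp add: nn_integral_def F_def G_def)
qed

lemma ennreal_half_add: "x / 2 + x / 2 = (x::ennreal)"
proof -
  have "x / 2 + x / 2 = (x + x) / 2" by (rule add_divide_distrib_ennreal[symmetric])
  also have "x + x = x * 2" by (rule mult_2_right[symmetric])
  also have "x * 2 / 2 = x" by (rule mult_divide_eq_ennreal) auto
  finally show ?thesis .
qed

text \<open>The opposite inequality for two equal summands: half of a simple minorant of \<open>2 s\<close> is a simple minorant of \<open>s\<close>.\<close>

lemma nn_integral_double: "(\<integral>\<^sup>+x. s x + s x \<partial>M) \<le> (\<integral>\<^sup>+x. s x \<partial>M) + (\<integral>\<^sup>+x. s x \<partial>M)"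
proof -
  have "integral\<^sup>S M u \<le> (\<integral>\<^sup>+x. s x \<partial>M) + (\<integral>\<^sup>+x. s x \<partial>M)"
    if u: "simple_function M u" "u \<le> (\<lambda>x. s x + s x)" for u
  proof -
    have m: "(\<lambda>x. u x / 2) \<in> borel_measurable M" using borel_measurable_simple_function[OF u(1)] by simp
    have "integral\<^sup>S M u = (\<integral>\<^sup>+x. u x / 2 + u x / 2 \<partial>M)"
      using u(1) by (simp add: nn_integral_eq_simple_integral ennreal_half_add)
    also have "\<dots> = (\<integral>\<^sup>+x. u x / 2 \<partial>M) + (\<integral>\<^sup>+x. u x / 2 \<partial>M)" by (rule nn_integral_add[OF m m])
    also have "\<dots> \<le> (\<integral>\<^sup>+x. s x \<partial>M) + (\<integral>\<^sup>+x. s x \<partial>M)"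
    proof (intro add_mono nn_integral_mono)
      fix x
      have "u x / 2 \<le> (s x + s x) / 2" using u(2) by (intro divide_right_mono_ennreal) (simp add: le_fun_def)
      also have "\<dots> = s x" using ennreal_half_add[of "s x"] by (simp add: add_divide_distrib_ennreal)
      finally show "u x / 2 \<le> s x" .
      then show "u x / 2 \<le> s x" .
    qed
    finally show ?thesis .
  qed
  then show ?thesis unfolding nn_integral_def[of M "\<lambda>x. s x + s x"] by (intro SUP_least) auto
qed

text \<open>Strict concavity of the square root, made quantitative. The bound \<open>m\<close> on the mass \<open>a\<close> replaces the natural gain
  \<open>sqrt a * c\<^sup>2 / 4\<close> by one that is linear in \<open>a\<close>, and hence sums up to an integral over the atoms.\<close>

lemma sqrt_concave_gap:
  fixes a c m :: real
  assumes a: "0 \<le> a" "a \<le> m" and c: "\<bar>c\<bar> \<le> 1/2" and m: "m > 0"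
  shows "sqrt ((1 + c) * a) + sqrt ((1 - c) * a) + 1 / (4 * sqrt m) * (a * c\<^sup>2) \<le> sqrt a + sqrt a"
proof -
  have c2: "c\<^sup>2 \<le> 1" using c by (simp add: abs_square_le_1)
  have "sqrt (1 + c) + sqrt (1 - c) \<le> 2 - c\<^sup>2 / 4"
  proof (rule power2_le_imp_le)
    have s: "sqrt (1 + c) * sqrt (1 - c) \<le> 1 - c\<^sup>2 / 2"
    proof -
      have "sqrt (1 + c) * sqrt (1 - c) = sqrt (1 - c\<^sup>2)"
        by (simp add: real_sqrt_mult[symmetric] power2_eq_square algebra_simps)
      also have "\<dots> \<le> sqrt ((1 - c\<^sup>2 / 2)\<^sup>2)"
      proof (rule real_sqrt_le_mono)
        have "(1 - c\<^sup>2 / 2)\<^sup>2 = 1 - c\<^sup>2 + (c\<^sup>2 / 2)\<^sup>2" by (simp add: power2_diff)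
        then show "1 - c\<^sup>2 \<le> (1 - c\<^sup>2 / 2)\<^sup>2" using zero_le_power2[of "c\<^sup>2 / 2"] by linarith
      qed
      also have "\<dots> = 1 - c\<^sup>2 / 2" using c2 by (intro real_sqrt_unique) auto
      finally show ?thesis .
    qed
    have "(sqrt (1 + c) + sqrt (1 - c))\<^sup>2 = (1 + c) + (1 - c) + 2 * (sqrt (1 + c) * sqrt (1 - c))"
      using c by (simp add: power2_sum abs_le_iff)
    also have "\<dots> \<le> 4 - c\<^sup>2" using s by simp
    also have "\<dots> \<le> (2 - c\<^sup>2 / 4)\<^sup>2" by (simp add: power2_diff)
    finally show "(sqrt (1 + c) + sqrt (1 - c))\<^sup>2 \<le> (2 - c\<^sup>2 / 4)\<^sup>2" .
    show "0 \<le> 2 - c\<^sup>2 / 4" using c2 by simp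
  qed
  then have 1: "sqrt a * (sqrt (1 + c) + sqrt (1 - c)) \<le> sqrt a * (2 - c\<^sup>2 / 4)"
    using a by (intro mult_left_mono) auto
  have "a = sqrt a * sqrt a" using a by simp
  also have "\<dots> \<le> sqrt a * sqrt m" using a by (intro mult_left_mono) auto
  finally have "a / sqrt m \<le> sqrt a" using m by (simp add: pos_divide_le_eq)
  then have "a / sqrt m * (c\<^sup>2 / 4) \<le> sqrt a * (c\<^sup>2 / 4)" by (intro mult_right_mono) auto
  then have 2: "1 / (4 * sqrt m) * (a * c\<^sup>2) \<le> sqrt a * (c\<^sup>2 / 4)" by (simp add: field_simps)
  have 3: "sqrt ((1 + c) * a) + sqrt ((1 - c) * a) = sqrt a * (sqrt (1 + c) + sqrt (1 - c))"
    unfolding real_sqrt_mult by (simp add: distrib_left mult.commute)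
  have "sqrt a * (2 - c\<^sup>2 / 4) = sqrt a + sqrt a - sqrt a * (c\<^sup>2 / 4)" by (simp add: algebra_simps)
  then show ?thesis using 1 2 unfolding 3 by linarith
qed

definition sqrt_mass :: "real \<Rightarrow> (real^2) measure \<Rightarrow> ennreal" where
  "sqrt_mass L M = (\<integral>\<^sup>+X. ennreal (sqrt (measure M {X})) \<partial>count_space (QL L))"

lemma purely_atomic_nn_integral:
  assumes M: "pos_measure_on (QL L) M" and S: "S \<subseteq> QL L" "\<And>X. X \<in> S \<Longrightarrow> \<phi> X > (0::real)"
    and at: "\<And>A. A \<in> sets M \<Longrightarrow> emeasure M A = (\<integral>\<^sup>+X. ennreal (\<phi> X) * indicator A X \<partial>count_space S)"
    and f: "f \<in> borel_measurable M"
  shows "(\<integral>\<^sup>+x. f x \<partial>M) = (\<integral>\<^sup>+X. ennreal (\<phi> X) * f X \<partial>count_space S)"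
proof -
  define D where "D = density (count_space S) (\<lambda>X. ennreal (\<phi> X))"
  have sp: "space M = QL L" by (rule pos_measure_on_space[OF M])
  have id: "(\<lambda>x. x) \<in> D \<rightarrow>\<^sub>M M" using S sp by (auto simp: D_def)
  have "M = distr D M (\<lambda>x. x)"
  proof (rule measure_eqI)
    fix A assume A: "A \<in> sets M"
    have "emeasure (distr D M (\<lambda>x. x)) A = emeasure D (A \<inter> S)"
      using emeasure_distr[OF id A] by (simp add: D_def Int_commute)
    also have "\<dots> = (\<integral>\<^sup>+X. ennreal (\<phi> X) * indicator (A \<inter> S) X \<partial>count_space S)"
      unfolding D_def by (rule emeasure_density) auto
    also have "\<dots> = (\<integral>\<^sup>+X. ennreal (\<phi> X) * indicator A X \<partial>count_space S)"
      by (intro nn_integral_cong) (auto simp: indicator_def)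
    finally show "emeasure M A = emeasure (distr D M (\<lambda>x. x)) A" using at[OF A] by simp
  qed simp
  then have "(\<integral>\<^sup>+x. f x \<partial>M) = (\<integral>\<^sup>+x. f x \<partial>distr D M (\<lambda>x. x))" by simp
  also have "\<dots> = (\<integral>\<^sup>+x. f x \<partial>D)" using nn_integral_distr[OF id, of f] f by simp
  also have "\<dots> = (\<integral>\<^sup>+X. ennreal (\<phi> X) * f X \<partial>count_space S)"
    unfolding D_def by (rule nn_integral_density) auto
  finally show ?thesis .
qed

lemma singleton_QL: "pos_measure_on (QL L) M \<Longrightarrow> X \<in> QL L \<Longrightarrow> {X} \<in> sets M"
  by (simp add: pos_measure_on_sets sets_restrict_space_iff)

lemma measure_density_singleton:
  assumes M: "pos_measure_on (QL L) M" and c: "c \<in> borel_measurable borel" "\<And>x. 0 \<le> (c x :: real)" and X: "X \<in> QL L"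
  shows "measure (density M (\<lambda>x. ennreal (c x))) {X} = c X * measure M {X}"
proof -
  note sX = singleton_QL[OF M X]
  have "emeasure (density M (\<lambda>x. ennreal (c x))) {X} = (\<integral>\<^sup>+x. ennreal (c x) * indicator {X} x \<partial>M)"
    using pos_measure_on_measurable[OF M c(1)] sX by (intro emeasure_density) auto
  also have "\<dots> = (\<integral>\<^sup>+x. ennreal (c X) * indicator {X} x \<partial>M)"
    by (intro nn_integral_cong) (auto simp: indicator_def)
  also have "\<dots> = ennreal (c X) * emeasure M {X}" using sX by (simp add: nn_integral_cmult)
  finally show ?thesis using c(2) by (simp add: measure_def enn2real_mult)
qed

text \<open>The gap is summed over the atoms. Since there is no diffuse part, the gain is a multiple of the integral of \<open>c\<^sup>2\<close>, which
  vanishes only if \<open>c\<close> does almost everywhere.\<close>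

lemma sqrt_mass_gap:
  assumes M: "pos_measure_on (QL L) M" and at: "purely_atomic L M"
    and c: "c \<in> borel_measurable borel" "\<And>x. \<bar>c x\<bar> \<le> 1/2" and m: "measure M (space M) \<le> m" "m > 0"
  shows "sqrt_mass L (density M (\<lambda>x. ennreal (1 + c x))) + sqrt_mass L (density M (\<lambda>x. ennreal (1 + - c x))) +
     ennreal (1 / (4 * sqrt m)) * (\<integral>\<^sup>+x. ennreal ((c x)\<^sup>2) \<partial>M) \<le> sqrt_mass L M + sqrt_mass L M"
proof -
  interpret finite_measure M by (rule pos_measure_on_finite[OF M])
  obtain S \<phi> where S: "S \<subseteq> QL L" "\<And>X. X \<in> S \<Longrightarrow> \<phi> X > (0::real)"
    and e: "\<And>A. A \<in> sets M \<Longrightarrow> emeasure M A = (\<integral>\<^sup>+X. ennreal (\<phi> X) * indicator A X \<partial>count_space S)"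
    using at unfolding purely_atomic_def by blast
  have cb: "0 \<le> 1 + c x" "0 \<le> 1 - c x" for x using c(2)[of x] by (auto simp: abs_le_iff)
  have "(\<integral>\<^sup>+x. ennreal ((c x)\<^sup>2) \<partial>M) = (\<integral>\<^sup>+X. ennreal (\<phi> X) * ennreal ((c X)\<^sup>2) \<partial>count_space S)"
    using pos_measure_on_measurable[OF M c(1)] by (intro purely_atomic_nn_integral[OF M S e]) auto
  also have "\<dots> = (\<integral>\<^sup>+X. ennreal (measure M {X} * (c X)\<^sup>2) \<partial>count_space S)"
  proof (intro nn_integral_cong)
    fix X assume "X \<in> space (count_space S)"
    then have X: "X \<in> S" by simp
    have "emeasure M {X} = (\<integral>\<^sup>+Y. ennreal (\<phi> Y) * indicator {X} Y \<partial>count_space S)"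
      using e[OF singleton_QL[OF M]] X S by blast
    also have "\<dots> = (\<integral>\<^sup>+Y. ennreal (\<phi> X) * indicator {X} Y \<partial>count_space S)"
      by (intro nn_integral_cong) (auto simp: indicator_def)
    also have "\<dots> = ennreal (\<phi> X)" using X by (simp add: nn_integral_cmult)
    finally have "measure M {X} = \<phi> X" using S(2)[OF X] by (simp add: measure_def)
    then show "ennreal (\<phi> X) * ennreal ((c X)\<^sup>2) = ennreal (measure M {X} * (c X)\<^sup>2)"
      using S(2)[OF X] by (simp add: ennreal_mult)
  qed
  also have "\<dots> \<le> (\<integral>\<^sup>+X. ennreal (measure M {X} * (c X)\<^sup>2) \<partial>count_space (QL L))"
    using S(1) by (subst (1 2) nn_integral_count_space_indicator) (auto intro!: nn_integral_mono simp: indicator_def)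
  finally have 1: "(\<integral>\<^sup>+x. ennreal ((c x)\<^sup>2) \<partial>M) \<le> (\<integral>\<^sup>+X. ennreal (measure M {X} * (c X)\<^sup>2) \<partial>count_space (QL L))" .
  have "sqrt_mass L (density M (\<lambda>x. ennreal (1 + c x))) + sqrt_mass L (density M (\<lambda>x. ennreal (1 + - c x))) +
     ennreal (1 / (4 * sqrt m)) * (\<integral>\<^sup>+x. ennreal ((c x)\<^sup>2) \<partial>M)
    \<le> sqrt_mass L (density M (\<lambda>x. ennreal (1 + c x))) + sqrt_mass L (density M (\<lambda>x. ennreal (1 + - c x))) +
     (\<integral>\<^sup>+X. ennreal (1 / (4 * sqrt m)) * ennreal (measure M {X} * (c X)\<^sup>2) \<partial>count_space (QL L))"
    using 1 by (subst nn_integral_cmult) (auto intro!: add_left_mono mult_left_mono)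
  also have "\<dots> = (\<integral>\<^sup>+X. ennreal (sqrt (measure (density M (\<lambda>x. ennreal (1 + c x))) {X})) + ennreal (sqrt (measure (density M (\<lambda>x. ennreal (1 + - c x))) {X}))
      + ennreal (1 / (4 * sqrt m)) * ennreal (measure M {X} * (c X)\<^sup>2) \<partial>count_space (QL L))"
    unfolding sqrt_mass_def by (simp add: nn_integral_add)
  also have "\<dots> \<le> (\<integral>\<^sup>+X. ennreal (sqrt (measure M {X})) + ennreal (sqrt (measure M {X})) \<partial>count_space (QL L))"
  proof (intro nn_integral_mono)
    fix X assume "X \<in> space (count_space (QL L))"
    then have X: "X \<in> QL L" by simp
    have d1: "measure (density M (\<lambda>x. ennreal (1 + c x))) {X} = (1 + c X) * measure M {X}"
      using c cb by (intro measure_density_singleton[OF M _ _ X]) auto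
    have d2: "measure (density M (\<lambda>x. ennreal (1 + - c x))) {X} = (1 - c X) * measure M {X}"
      using measure_density_singleton[OF M _ _ X, of "\<lambda>x. 1 + - c x"] c cb by simp
    have "measure M {X} \<le> m" using bounded_measure[of "{X}"] m by simp
    from sqrt_concave_gap[OF measure_nonneg this c(2)[of X] m(2)]
    have "ennreal (sqrt ((1 + c X) * measure M {X}) + sqrt ((1 - c X) * measure M {X}) + 1 / (4 * sqrt m) * (measure M {X} * (c X)\<^sup>2))
      \<le> ennreal (sqrt (measure M {X}) + sqrt (measure M {X}))" by (rule ennreal_leI)
    moreover have "ennreal (sqrt ((1 + c X) * measure M {X}) + sqrt ((1 - c X) * measure M {X}) + 1 / (4 * sqrt m) * (measure M {X} * (c X)\<^sup>2))
      = ennreal (sqrt ((1 + c X) * measure M {X})) + ennreal (sqrt ((1 - c X) * measure M {X})) + ennreal (1 / (4 * sqrt m)) * ennreal (measure M {X} * (c X)\<^sup>2)"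
    proof -
      have "0 \<le> sqrt ((1 + c X) * measure M {X})" "0 \<le> sqrt ((1 - c X) * measure M {X})" using cb by auto
      moreover have "0 \<le> 1 / (4 * sqrt m)" "0 \<le> measure M {X} * (c X)\<^sup>2" using m by auto
      ultimately show ?thesis by (simp only: ennreal_plus ennreal_mult add_nonneg_nonneg mult_nonneg_nonneg)
    qed
    moreover have "ennreal (sqrt (measure M {X}) + sqrt (measure M {X})) = ennreal (sqrt (measure M {X})) + ennreal (sqrt (measure M {X}))"
      by (rule ennreal_plus) auto
    ultimately show "ennreal (sqrt (measure (density M (\<lambda>x. ennreal (1 + c x))) {X})) + ennreal (sqrt (measure (density M (\<lambda>x. ennreal (1 + - c x))) {X}))
      + ennreal (1 / (4 * sqrt m)) * ennreal (measure M {X} * (c X)\<^sup>2) \<le> ennreal (sqrt (measure M {X})) + ennreal (sqrt (measure M {X}))"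
      unfolding d1 d2 by (simp only:)
  qed
  also have "\<dots> = sqrt_mass L M + sqrt_mass L M" unfolding sqrt_mass_def by (simp add: nn_integral_add)
  finally show ?thesis .
qed

lemma purely_atomic_density:
  assumes M: "pos_measure_on (QL L) M" and at: "purely_atomic L M"
    and c: "c \<in> borel_measurable borel" "\<And>x. 0 < (c x :: real)"
  shows "purely_atomic L (density M (\<lambda>x. ennreal (c x)))"
proof -
  obtain S \<phi> where S: "countable S" "S \<subseteq> QL L" "\<And>X. X \<in> S \<Longrightarrow> \<phi> X > (0::real)"
    and e: "\<And>A. A \<in> sets M \<Longrightarrow> emeasure M A = (\<integral>\<^sup>+X. ennreal (\<phi> X) * indicator A X \<partial>count_space S)"
    using at unfolding purely_atomic_def by blast
  note cm = pos_measure_on_measurable[OF M c(1)]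
  have "emeasure (density M (\<lambda>x. ennreal (c x))) A = (\<integral>\<^sup>+X. ennreal (\<phi> X * c X) * indicator A X \<partial>count_space S)"
    if A: "A \<in> sets (density M (\<lambda>x. ennreal (c x)))" for A
  proof -
    have A': "A \<in> sets M" using A by simp
    have "emeasure (density M (\<lambda>x. ennreal (c x))) A = (\<integral>\<^sup>+x. ennreal (c x) * indicator A x \<partial>M)"
      using cm A' by (intro emeasure_density) auto
    also have "\<dots> = (\<integral>\<^sup>+X. ennreal (\<phi> X) * (ennreal (c X) * indicator A X) \<partial>count_space S)"
      using cm A' by (intro purely_atomic_nn_integral[OF M S(2,3) e]) auto
    also have "\<dots> = (\<integral>\<^sup>+X. ennreal (\<phi> X * c X) * indicator A X \<partial>count_space S)"
      using S(3) c(2) by (intro nn_integral_cong) (auto simp: ennreal_mult less_imp_le mult.assoc)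
    finally show ?thesis .
  qed
  moreover have "\<forall>X\<in>S. 0 < \<phi> X * c X" using S(3) c(2) by simp
  ultimately show ?thesis
    unfolding purely_atomic_def using S(1,2) by (intro exI[of _ S] exI[of _ "\<lambda>X. \<phi> X * c X"]) auto
qed

lemma disintegration_disintegrates: "disintegrates L T \<mu> \<eta> \<Longrightarrow> disintegrates L T \<mu> (disintegration L T \<mu>)"
  unfolding disintegration_def using someI[of "disintegrates L T \<mu>" \<eta>] by simp

text \<open>The energy refers to a chosen disintegration; any other one agrees with it for almost every \<open>t\<close>.\<close>

lemma energy_pair_sqrt_mass:
  assumes \<mu>: "pos_measure_on (QLT L T) \<mu>" and d: "disintegrates L T \<mu> \<eta>"
  shows "energy_pair L T \<mu> m = ennreal (Kstar / L^2) * (\<integral>\<^sup>+t\<in>{-T<..<T}. sqrt_mass L (\<eta> t) \<partial>lborel)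
    + ennreal (1 / L^2) * (\<integral>\<^sup>+x. ennreal ((norm (vderiv m \<mu> x))^2) \<partial>\<mu>)"
proof -
  have "(\<integral>\<^sup>+t\<in>{-T<..<T}. sqrt_mass L (disintegration L T \<mu> t) \<partial>lborel) = (\<integral>\<^sup>+t\<in>{-T<..<T}. sqrt_mass L (\<eta> t) \<partial>lborel)"
  proof (rule nn_integral_cong_AE)
    show "AE t in lborel. sqrt_mass L (disintegration L T \<mu> t) * indicator {-T<..<T} t = sqrt_mass L (\<eta> t) * indicator {-T<..<T} t"
      using disintegrates_unique[OF disintegration_disintegrates[OF d] d \<mu>]
      by eventually_elim (auto simp: indicator_def)
  qed
  then show ?thesis by (simp add: energy_pair_def sqrt_mass_def)
qed

context perturbation
begin

lemma perturbed_disintegrates: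
  assumes d: "disintegrates L T \<mu> \<eta>"
  shows "disintegrates L T perturbed (\<lambda>t. density (\<eta> t) (\<lambda>x. ennreal (1 + g (x, t))))"
  unfolding disintegrates_def
proof (intro conjI ballI)
  note k = disintegrates_kernel[OF d]
  have gm: "(\<lambda>x. g (x, t)) \<in> borel_measurable borel" for t by (rule section_measurable[OF g])
  have gn: "(\<lambda>x. ennreal (1 + g (x, t))) \<in> borel_measurable (\<eta> t)" if "t \<in> {-T<..<T}" for t
    using pos_measure_on_measurable[OF kernel_pos[OF k that] gm] by simp
  show "pos_measure_on (QL L) (density (\<eta> t) (\<lambda>x. ennreal (1 + g (x, t))))" if "t \<in> {-T<..<T}" for t
    by (rule density_pos_measure_on[OF kernel_pos[OF k that], of _ "3/2"])
       (use pos_measure_on_measurable[OF kernel_pos[OF k that] gm] g_pos in auto)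
  fix B assume B: "B \<in> sets (restrict_space borel (QL L))"
  then have Bb: "B \<in> sets borel" "B \<subseteq> QL L" by (auto simp: sets_restrict_space)
  have f: "(\<lambda>x. ennreal (1 + g x) * indicator B (fst x)) \<in> borel_measurable borel"
    using g Bb(1) by (simp add: borel_prod[symmetric])
  have "emeasure (density (\<eta> t) (\<lambda>x. ennreal (1 + g (x, t)))) B * indicator {-T<..<T} t
    = (\<integral>\<^sup>+x. ennreal (1 + g (x, t)) * indicator B (fst (x, t)) \<partial>\<eta> t) * indicator {-T<..<T} t" for t
  proof (cases "t \<in> {-T<..<T}")
    case True
    have "B \<in> sets (\<eta> t)" using B pos_measure_on_sets[OF kernel_pos[OF k True]] by simp
    then show ?thesis using gn[OF True] by (simp add: emeasure_density)
  qed simp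
  then show "(\<lambda>t. emeasure (density (\<eta> t) (\<lambda>x. ennreal (1 + g (x, t)))) B) \<in> borel_measurable (restrict_space borel {-T<..<T})"
    using kernel_nn_integral_measurable[OF k f] by (subst borel_measurable_restrict_space_iff_ennreal) auto
next
  note k = disintegrates_kernel[OF d]
  have gm: "(\<lambda>x. g (x, t)) \<in> borel_measurable borel" for t by (rule section_measurable[OF g])
  fix A assume A: "A \<in> sets perturbed"
  then have A\<mu>: "A \<in> sets \<mu>" by (simp add: perturbed_def)
  then have Ab: "A \<in> sets borel" "A \<subseteq> QLT L T" using pos_measure_on_sets[OF \<mu>] by (auto simp: sets_restrict_space)
  have f: "(\<lambda>x. ennreal (1 + g x) * indicator A x) \<in> borel_measurable borel" using g Ab(1) by simp
  have "emeasure perturbed A = (\<integral>\<^sup>+x. ennreal (1 + g x) * indicator A x \<partial>\<mu>)"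
    unfolding perturbed_def using g_measurable A\<mu> by (intro emeasure_density) auto
  also have "\<dots> = (\<integral>\<^sup>+t\<in>{-T<..<T}. (\<integral>\<^sup>+x. ennreal (1 + g (x, t)) * indicator A (x, t) \<partial>\<eta> t) \<partial>lborel)"
    by (rule disintegrates_nn_integral[OF d \<mu> f])
  also have "\<dots> = (\<integral>\<^sup>+t\<in>{-T<..<T}. emeasure (density (\<eta> t) (\<lambda>x. ennreal (1 + g (x, t)))) {x. (x, t) \<in> A} \<partial>lborel)"
  proof (intro nn_integral_cong)
    fix t
    show "(\<integral>\<^sup>+x. ennreal (1 + g (x, t)) * indicator A (x, t) \<partial>\<eta> t) * indicator {-T<..<T} t =
      emeasure (density (\<eta> t) (\<lambda>x. ennreal (1 + g (x, t)))) {x. (x, t) \<in> A} * indicator {-T<..<T} t"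
    proof (cases "t \<in> {-T<..<T}")
      case True
      have "{x. (x, t) \<in> A} = {x\<in>QL L. (x, t) \<in> A}" using Ab(2) by (auto simp: QLT_def)
      then have s: "{x. (x, t) \<in> A} \<in> sets (\<eta> t)" using kernel_section_sets[OF k Ab(1) True] by simp
      have gt: "(\<lambda>x. ennreal (1 + g (x, t))) \<in> borel_measurable (\<eta> t)"
        using pos_measure_on_measurable[OF kernel_pos[OF k True] gm] by simp
      have "indicator A (x, t) = (indicator {x. (x, t) \<in> A} x :: ennreal)" for x by (simp add: indicator_def)
      then show ?thesis using emeasure_density[OF gt s] by simp
    qed simp
  qed
  finally show "emeasure perturbed A = (\<integral>\<^sup>+t\<in>{-T<..<T}. emeasure (density (\<eta> t) (\<lambda>x. ennreal (1 + g (x, t)))) {x. (x, t) \<in> A} \<partial>lborel)" .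
qed

lemma perturbed_admissible:
  assumes "admissible L T \<mu>"
  shows "admissible L T perturbed"
proof -
  obtain \<eta> where \<eta>: "disintegrates L T \<mu> \<eta>" "AE t in lborel. t \<in> {-T<..<T} \<longrightarrow> purely_atomic L (\<eta> t)"
    using assms by (auto simp: admissible_def admissible_pair_def)
  have p: "0 < 1 + g x" for x using gb[of x] by (auto simp: abs_le_iff)
  have gm: "(\<lambda>x. 1 + g (x, t)) \<in> borel_measurable borel" for t using section_measurable[OF g] by simp
  have at: "AE t in lborel. t \<in> {-T<..<T} \<longrightarrow> purely_atomic L (density (\<eta> t) (\<lambda>x. ennreal (1 + g (x, t))))"
    using \<eta>(2)
  proof (rule AE_mp, intro AE_I2 impI)
    fix t assume "t \<in> {-T<..<T} \<longrightarrow> purely_atomic L (\<eta> t)" and t: "t \<in> {-T<..<T}"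
    then have a: "purely_atomic L (\<eta> t)" by simp
    show "purely_atomic L (density (\<eta> t) (\<lambda>x. ennreal (1 + g (x, t))))"
      by (rule purely_atomic_density[OF kernel_pos[OF disintegrates_kernel[OF \<eta>(1)] t] a gm p])
  qed
  have "admissible_pair L T perturbed (density_flux perturbed v)"
    unfolding admissible_pair_def
    using perturbed_pos flux_of_density(1)[OF perturbed_pos perturbed_integrable_vector perturbed_continuity]
      perturbed_disintegrates[OF \<eta>(1)] at by blast
  then show ?thesis unfolding admissible_def by blast
qed

lemma perturbed_competitor:
  assumes "competitor L T \<mu>m \<mu>p \<mu>"
  shows "competitor L T \<mu>m \<mu>p perturbed"
proof -
  have e: "M = \<nu> a" if "is_slice L T \<mu> a M" "a \<in> {-T..T}" for a M
    using that wcs_unique[OF L T \<mu> _ w] by (auto simp: is_slice_def)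
  have c: "admissible L T \<mu>" "is_slice L T \<mu> (-T) \<mu>m" "is_slice L T \<mu> T \<mu>p"
    using assms unfolding competitor_def by simp_all
  have "perturbed_slice (-T) = \<mu>m" "perturbed_slice T = \<mu>p"
    using e[OF c(2)] e[OF c(3)] T perturbed_slice_ends by simp_all
  then have "is_slice L T perturbed (-T) \<mu>m" "is_slice L T perturbed T \<mu>p"
    using perturbed_slicing unfolding is_slice_def by (intro exI[of _ perturbed_slice] conjI; simp)+
  then show ?thesis using perturbed_admissible[OF c(1)] unfolding competitor_def by simp
qed

text \<open>The perturbed measure keeps its velocity \<open>v\<close>, though this need not be optimal for it; hence an inequality.\<close>

lemma perturbed_energy:
  assumes d: "disintegrates L T \<mu> \<eta>"
  shows "energy L T perturbed \<le>
    ennreal (Kstar / L^2) * (\<integral>\<^sup>+t\<in>{-T<..<T}. sqrt_mass L (density (\<eta> t) (\<lambda>x. ennreal (1 + g (x, t)))) \<partial>lborel)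
    + ennreal (1 / L^2) * (\<integral>\<^sup>+x. ennreal (1 + g x) * ennreal ((norm (v x))^2) \<partial>\<mu>)"
proof -
  note fl = flux_of_density[OF perturbed_pos perturbed_integrable_vector perturbed_continuity]
  have "energy L T perturbed \<le> energy_pair L T perturbed (density_flux perturbed v)"
    unfolding energy_def by (rule INF_lower) (use fl in simp)
  also have "\<dots> = ennreal (Kstar / L^2) * (\<integral>\<^sup>+t\<in>{-T<..<T}. sqrt_mass L (density (\<eta> t) (\<lambda>x. ennreal (1 + g (x, t)))) \<partial>lborel)
    + ennreal (1 / L^2) * (\<integral>\<^sup>+x. ennreal ((norm (vderiv (density_flux perturbed v) perturbed x))^2) \<partial>perturbed)"
    by (rule energy_pair_sqrt_mass[OF perturbed_pos perturbed_disintegrates[OF d]])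
  also have "(\<integral>\<^sup>+x. ennreal ((norm (vderiv (density_flux perturbed v) perturbed x))^2) \<partial>perturbed) = (\<integral>\<^sup>+x. ennreal ((norm (v x))^2) \<partial>perturbed)"
    by (rule nn_integral_cong_AE) (use fl(2) in \<open>eventually_elim, simp\<close>)
  also have "\<dots> = (\<integral>\<^sup>+x. ennreal (1 + g x) * ennreal ((norm (v x))^2) \<partial>\<mu>)"
    unfolding perturbed_def using g_measurable v by (intro nn_integral_density) auto
  finally show ?thesis .
qed

lemma perturbation_uminus: "perturbation L T \<mu> v \<nu> (\<lambda>x. - g x)"
  by unfold_locales (use L T \<mu> v ce w g gb conserved in auto)

end

text \<open>Perturbing in both directions, the kinetic terms average out, being linear in \<open>g\<close> for a fixed velocity, while the
  square roots lose a multiple of the integral of \<open>g\<^sup>2\<close> by strict concavity. Since the energy is finite, these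
  terms may be cancelled, and minimality leaves no room for a loss.\<close>

theorem minimizer_rigid:
  assumes p: "perturbation L T \<mu> v \<nu> g" and min: "minimizer L T \<mu>m \<mu>p \<mu>"
    and m: "optimal_flux L T \<mu> m" and v: "v = vderiv m \<mu>" and fin: "energy L T \<mu> < \<infinity>"
  shows "AE x in \<mu>. g x = 0"
proof -
  interpret P: perturbation L T \<mu> v \<nu> g by (rule p)
  interpret N: perturbation L T \<mu> v \<nu> "\<lambda>x. - g x" by (rule P.perturbation_uminus)
  have comp: "competitor L T \<mu>m \<mu>p \<mu>" using min by (simp add: minimizer_def)
  obtain \<eta> where \<eta>: "disintegrates L T \<mu> \<eta>" "AE t in lborel. t \<in> {-T<..<T} \<longrightarrow> purely_atomic L (\<eta> t)"
    using comp by (auto simp: competitor_def admissible_def admissible_pair_def)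
  note k = disintegrates_kernel[OF \<eta>(1)]
  define A where "A = (\<integral>\<^sup>+t\<in>{-T<..<T}. sqrt_mass L (\<eta> t) \<partial>lborel)"
  define Ap where "Ap = (\<integral>\<^sup>+t\<in>{-T<..<T}. sqrt_mass L (density (\<eta> t) (\<lambda>x. ennreal (1 + g (x, t)))) \<partial>lborel)"
  define An where "An = (\<integral>\<^sup>+t\<in>{-T<..<T}. sqrt_mass L (density (\<eta> t) (\<lambda>x. ennreal (1 + - g (x, t)))) \<partial>lborel)"
  define Q where "Q = (\<integral>\<^sup>+x. ennreal ((norm (v x))^2) \<partial>\<mu>)"
  define Qp where "Qp = (\<integral>\<^sup>+x. ennreal (1 + g x) * ennreal ((norm (v x))^2) \<partial>\<mu>)"
  define Qn where "Qn = (\<integral>\<^sup>+x. ennreal (1 + - g x) * ennreal ((norm (v x))^2) \<partial>\<mu>)"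
  define c1 where "c1 = ennreal (Kstar / L^2)"
  define c2 where "c2 = ennreal (1 / L^2)"
  have c1: "c1 > 0" "c1 < \<infinity>" using P.L by (auto simp: c1_def Kstar_def)
  have c2: "c2 > 0" "c2 < \<infinity>" using P.L by (auto simp: c2_def)
  have E: "energy L T \<mu> = c1 * A + c2 * Q"
    using m energy_pair_sqrt_mass[OF P.\<mu> \<eta>(1), of m] by (simp add: optimal_flux_def A_def Q_def c1_def c2_def v)
  have Ep: "c1 * A + c2 * Q \<le> c1 * Ap + c2 * Qp"
  proof -
    have "energy L T \<mu> \<le> energy L T P.perturbed"
      using min P.perturbed_competitor[OF comp] unfolding minimizer_def by simp
    also note P.perturbed_energy[OF \<eta>(1)]
    finally show ?thesis unfolding E Ap_def Qp_def c1_def c2_def .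
  qed
  have En: "c1 * A + c2 * Q \<le> c1 * An + c2 * Qn"
  proof -
    have "energy L T \<mu> \<le> energy L T N.perturbed"
      using min N.perturbed_competitor[OF comp] unfolding minimizer_def by simp
    also note N.perturbed_energy[OF \<eta>(1)]
    finally show ?thesis unfolding E An_def Qn_def c1_def c2_def .
  qed
  have f: "c1 * A < \<infinity>" "c2 * Q < \<infinity>" using fin unfolding E by (auto simp: less_top[symmetric])
  have Af: "A < \<infinity>" using f(1) c1 by (auto simp: less_top[symmetric] ennreal_mult_eq_top_iff)
  have QQ: "Qp + Qn = Q + Q"
  proof -
    have gm: "g \<in> borel_measurable \<mu>" "v \<in> borel_measurable \<mu>" using P.g_measurable P.v by auto
    have "Qp + Qn = (\<integral>\<^sup>+x. ennreal (1 + g x) * ennreal ((norm (v x))^2) + ennreal (1 + - g x) * ennreal ((norm (v x))^2) \<partial>\<mu>)"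
      unfolding Qp_def Qn_def using gm by (intro nn_integral_add[symmetric]) auto
    also have "\<dots> = (\<integral>\<^sup>+x. ennreal ((norm (v x))^2) + ennreal ((norm (v x))^2) \<partial>\<mu>)"
    proof (intro nn_integral_cong)
      fix x
      have "ennreal (1 + g x) + ennreal (1 + - g x) = 2"
        using P.g_pos(1)[of x] N.g_pos(1)[of x] by (subst ennreal_plus[symmetric]) auto
      then show "ennreal (1 + g x) * ennreal ((norm (v x))^2) + ennreal (1 + - g x) * ennreal ((norm (v x))^2) = ennreal ((norm (v x))^2) + ennreal ((norm (v x))^2)"
        by (metis distrib_right mult_2)
    qed
    also have "\<dots> = Q + Q" unfolding Q_def using gm by (intro nn_integral_add) auto
    finally show ?thesis .
  qed
  have "c1 * (A + A) + c2 * (Q + Q) \<le> c1 * (Ap + An) + c2 * (Q + Q)"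
  proof -
    have "c1 * (A + A) + c2 * (Q + Q) = (c1 * A + c2 * Q) + (c1 * A + c2 * Q)" by (simp add: distrib_left ac_simps)
    also have "\<dots> \<le> (c1 * Ap + c2 * Qp) + (c1 * An + c2 * Qn)" by (rule add_mono[OF Ep En])
    also have "\<dots> = c1 * (Ap + An) + c2 * (Qp + Qn)" by (simp add: distrib_left ac_simps)
    finally show ?thesis unfolding QQ .
  qed
  moreover have "c2 * (Q + Q) < \<infinity>" using f(2) by (simp add: distrib_left less_top[symmetric])
  ultimately have "c1 * (A + A) \<le> c1 * (Ap + An)"
    using ennreal_add_left_cancel_le[of "c2 * (Q + Q)" "c1 * (A + A)" "c1 * (Ap + An)"] by (auto simp: add.commute)
  then have AA: "A + A \<le> Ap + An"
    using c1 ennreal_mult_le_mult_iff[of c1 "A + A" "Ap + An"] by auto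
  interpret slices: slice_family L T \<mu> \<nu>
  proof unfold_locales
    fix u :: "real \<Rightarrow> real" and \<psi> assume u: "smooth u" and \<psi>: "tsmooth L \<psi>"
    have c: "continuous_on UNIV (\<lambda>x::(real^2) \<times> real. u (snd x) * \<psi> (fst x))"
      using \<psi> by (intro smooth_continuous smooth_mult smooth_time_weight smooth_space_weight u) (simp add: tsmooth_def)
    obtain B where B: "\<forall>x\<in>QL L. \<forall>t\<in>{-T..T}. \<bar>u (snd (x, t)) * \<psi> (fst (x, t))\<bar> \<le> B"
      using continuous_bounded_cylinder[OF c] by blast
    have "has_bochner_integral lborel (\<lambda>t. indicator {-T<..<T} t * (LINT x|\<nu> t. u (snd (x, t)) * \<psi> (fst (x, t))))
        (LINT x|\<mu>. u (snd x) * \<psi> (fst x))"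
      by (rule disintegrates_integral[OF wcs_disintegrates[OF P.w] P.\<mu> continuous_cylinder_measurable[OF c], of B]) (use B in auto)
    then show "(LINT t|lborel. indicator {-T<..<T} t * (u t * (LINT x|\<nu> t. \<psi> x))) = (LINT x|\<mu>. u (snd x) * \<psi> (fst x))"
      by (simp add: has_bochner_integral_iff)
  qed (use P.L P.T P.\<mu> wcs_pos[OF P.w] wcs_continuous[OF P.w] in auto)
  \<comment> \<open>The gain from concavity is uniform because the masses of the slices are bounded, by weak continuity in time.\<close>
  obtain M0 where M0: "M0 \<ge> 0" "\<forall>t\<in>{-T..T}. measure (\<nu> t) (space (\<nu> t)) \<le> M0" using slices.mass_bounded by blast
  define M where "M = M0 + 1"
  have M: "M > 0" using M0 by (simp add: M_def)
  define c3 where "c3 = ennreal (1 / (4 * sqrt M))"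
  have c3: "c3 > 0" using M by (simp add: c3_def)
  define \<kappa> where "\<kappa> t = c3 * (\<integral>\<^sup>+x. ennreal ((g (x, t))\<^sup>2) \<partial>\<eta> t)" for t
  define k where "k = (\<integral>\<^sup>+t\<in>{-T<..<T}. \<kappa> t \<partial>lborel)"
  have gsq: "(\<lambda>x. ennreal ((g x)\<^sup>2)) \<in> borel_measurable borel" using P.g by simp
  have kk: "k = c3 * (\<integral>\<^sup>+x. ennreal ((g x)\<^sup>2) \<partial>\<mu>)"
  proof -
    have "k = (\<integral>\<^sup>+t. c3 * ((\<integral>\<^sup>+x. ennreal ((g (x, t))\<^sup>2) \<partial>\<eta> t) * indicator {-T<..<T} t) \<partial>lborel)"
      unfolding k_def \<kappa>_def by (simp add: mult.assoc)
    also have "\<dots> = c3 * (\<integral>\<^sup>+t\<in>{-T<..<T}. (\<integral>\<^sup>+x. ennreal ((g (x, t))\<^sup>2) \<partial>\<eta> t) \<partial>lborel)"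
      using kernel_nn_integral_measurable[OF k gsq] by (intro nn_integral_cmult) simp
    also have "\<dots> = c3 * (\<integral>\<^sup>+x. ennreal ((g x)\<^sup>2) \<partial>\<mu>)"
      using disintegrates_nn_integral[OF \<eta>(1) P.\<mu> gsq] by simp
    finally show ?thesis .
  qed
  have gap: "AE t in lborel. sqrt_mass L (density (\<eta> t) (\<lambda>x. ennreal (1 + g (x, t)))) * indicator {-T<..<T} t
      + sqrt_mass L (density (\<eta> t) (\<lambda>x. ennreal (1 + - g (x, t)))) * indicator {-T<..<T} t + \<kappa> t * indicator {-T<..<T} t
     \<le> sqrt_mass L (\<eta> t) * indicator {-T<..<T} t + sqrt_mass L (\<eta> t) * indicator {-T<..<T} t"
    using \<eta>(2) disintegrates_unique[OF \<eta>(1) wcs_disintegrates[OF P.w] P.\<mu>]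
  proof eventually_elim
    case (elim t)
    show ?case
    proof (cases "t \<in> {-T<..<T}")
      case True
      have "t \<in> {-T..T}" using True by simp
      then have "measure (\<nu> t) (space (\<nu> t)) \<le> M0" using M0(2) by blast
      then have "measure (\<eta> t) (space (\<eta> t)) \<le> M" using elim True by (simp add: M_def)
      from sqrt_mass_gap[OF kernel_pos[OF k True] _ section_measurable[OF P.g] P.gb this M] elim True
      show ?thesis by (simp add: \<kappa>_def c3_def)
    qed simp
  qed
  have "Ap + An + k \<le> (\<integral>\<^sup>+t. sqrt_mass L (density (\<eta> t) (\<lambda>x. ennreal (1 + g (x, t)))) * indicator {-T<..<T} t
      + sqrt_mass L (density (\<eta> t) (\<lambda>x. ennreal (1 + - g (x, t)))) * indicator {-T<..<T} t \<partial>lborel) + k"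
    unfolding Ap_def An_def by (intro add_right_mono nn_integral_superadditive)
  also have "\<dots> \<le> (\<integral>\<^sup>+t. (sqrt_mass L (density (\<eta> t) (\<lambda>x. ennreal (1 + g (x, t)))) * indicator {-T<..<T} t
      + sqrt_mass L (density (\<eta> t) (\<lambda>x. ennreal (1 + - g (x, t)))) * indicator {-T<..<T} t) + \<kappa> t * indicator {-T<..<T} t \<partial>lborel)"
    unfolding k_def by (rule nn_integral_superadditive)
  also have "\<dots> \<le> (\<integral>\<^sup>+t. sqrt_mass L (\<eta> t) * indicator {-T<..<T} t + sqrt_mass L (\<eta> t) * indicator {-T<..<T} t \<partial>lborel)"
    by (rule nn_integral_mono_AE[OF gap])
  also have "\<dots> \<le> A + A" unfolding A_def by (rule nn_integral_double)
  finally have F: "Ap + An + k \<le> A + A" .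
  have "(A + A) + k \<le> (A + A) + 0" using order_trans[OF add_right_mono[OF AA, of k] F] by simp
  then have "k \<le> 0" using Af by (auto simp: ennreal_add_left_cancel_le less_top[symmetric])
  then have "(\<integral>\<^sup>+x. ennreal ((g x)\<^sup>2) \<partial>\<mu>) = 0" using kk c3 by auto
  then have "AE x in \<mu>. ennreal ((g x)\<^sup>2) = 0"
    using nn_integral_0_iff_AE[OF pos_measure_on_measurable[OF P.\<mu> gsq]] by simp
  then show ?thesis by eventually_elim simp
qed

section \<open>Routing mass through a subsystem\<close>

lemma dominated_measure:
  assumes \<mu>: "pos_measure_on S \<mu>" and \<mu>': "pos_measure_on S \<mu>'" and le: "\<And>A. A \<in> sets \<mu> \<Longrightarrow> emeasure \<mu>' A \<le> emeasure \<mu> A"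
  shows "sets \<mu>' = sets \<mu>" "(\<integral>\<^sup>+x. f x \<partial>\<mu>') \<le> (\<integral>\<^sup>+x. f x \<partial>\<mu>)" "(AE x in \<mu>. P x) \<Longrightarrow> (AE x in \<mu>'. P x)"
proof -
  show s: "sets \<mu>' = sets \<mu>" using pos_measure_on_sets[OF \<mu>] pos_measure_on_sets[OF \<mu>'] by simp
  have "\<mu>' \<le> \<mu>" using le s by (subst le_measure) auto
  then show "(\<integral>\<^sup>+x. f x \<partial>\<mu>') \<le> (\<integral>\<^sup>+x. f x \<partial>\<mu>)" using s by (intro nn_integral_mono_measure) auto
  show "(AE x in \<mu>. P x) \<Longrightarrow> (AE x in \<mu>'. P x)"
  proof (elim AE_E)
    fix N assume N: "{x \<in> space \<mu>. \<not> P x} \<subseteq> N" "emeasure \<mu> N = 0" "N \<in> sets \<mu>"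
    have "emeasure \<mu>' N = 0" using le[OF N(3)] N(2) by simp
    then show "AE x in \<mu>'. P x" using N s sets_eq_imp_space_eq[OF s] by (intro AE_I[of _ _ N]) auto
  qed
qed

lemma dominated_integrable:
  fixes f :: "_ \<Rightarrow> 'b::{banach, second_countable_topology}"
  assumes \<mu>: "pos_measure_on S \<mu>" and \<mu>': "pos_measure_on S \<mu>'" and le: "\<And>A. A \<in> sets \<mu> \<Longrightarrow> emeasure \<mu>' A \<le> emeasure \<mu> A"
    and f: "integrable \<mu> f"
  shows "integrable \<mu>' f"
proof -
  note d = dominated_measure[OF \<mu> \<mu>' le]
  have "f \<in> borel_measurable \<mu>'"
    using borel_measurable_integrable[OF f] by (simp only: measurable_cong_sets[OF d(1) refl])
  moreover have "(\<integral>\<^sup>+x. norm (f x) \<partial>\<mu>') < \<infinity>"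
    by (rule order_le_less_trans[OF d(2)]) (use f in \<open>simp_all add: integrable_iff_bounded\<close>)
  ultimately show ?thesis by (simp add: integrable_iff_bounded)
qed

text \<open>Densities are extended by 0 to all of space, so that they can be composed and sliced as Borel functions.\<close>

lemma borel_extension:
  fixes f :: "'a::topological_space \<Rightarrow> real"
  assumes \<mu>: "pos_measure_on S \<mu>" and S: "S \<in> sets borel" and f: "f \<in> borel_measurable \<mu>"
  shows "(\<lambda>x. indicator S x * f x) \<in> borel_measurable borel"
proof -
  have "f \<in> borel_measurable (restrict_space borel S)"
    using f measurable_cong_sets[OF pos_measure_on_sets[OF \<mu>] refl, of borel] by auto
  then have "(\<lambda>x. indicator S x *\<^sub>R f x) \<in> borel_measurable borel"
    using S by (subst (asm) borel_measurable_restrict_space_iff) auto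
  then show ?thesis by simp
qed

text \<open>Integration against \<open>\<mu>'\<close> is dominated by \<open>\<integral> w\<^sup>+ d\<mu>\<close>.\<close>

lemma dominated_density:
  assumes \<mu>: "pos_measure_on S \<mu>" and \<mu>': "pos_measure_on S \<mu>'" and le: "\<And>A. A \<in> sets \<mu> \<Longrightarrow> emeasure \<mu>' A \<le> emeasure \<mu> A"
    and S: "S \<in> sets borel"
  shows "\<exists>h\<in>borel_measurable borel. (\<forall>x. 0 \<le> h x \<and> h x \<le> 1) \<and> (\<forall>f. integrable \<mu> f \<longrightarrow> (LINT x|\<mu>. h x * f x) = (LINT x|\<mu>'. f x :: real))"
proof -
  note d = dominated_measure[OF \<mu> \<mu>' le]
  define G where "G = {(w, LINT x|\<mu>'. w x) |w :: _ \<Rightarrow> real. integrable \<mu> w}"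
  interpret fm: finite_measure \<mu> by (rule pos_measure_on_finite[OF \<mu>])
  have i: "integrable \<mu>' w" if "integrable \<mu> w" for w :: "_ \<Rightarrow> real" by (rule dominated_integrable[OF \<mu> \<mu>' le that])
  interpret dominated_graph \<mu> 1 G
  proof unfold_locales
    show "(\<lambda>_. 0, 0) \<in> G" unfolding G_def by force
    fix w r assume "(w, r) \<in> G"
    then have w: "integrable \<mu> w" "r = (LINT x|\<mu>'. w x)" by (auto simp: G_def)
    show "integrable \<mu> w" by (rule w)
    have "integrable \<mu> (\<lambda>x. c * w x)" for c using w by simp
    moreover have "(LINT x|\<mu>'. c * w x) = c * r" for c using w by simp
    ultimately show "(\<lambda>x. c * w x, c * r) \<in> G" for c unfolding G_def by force
    have p: "integrable \<mu> (\<lambda>x. max 0 (w x))" using w(1) by simp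
    have "ennreal (LINT x|\<mu>'. max 0 (w x)) = (\<integral>\<^sup>+x. ennreal (max 0 (w x)) \<partial>\<mu>')"
      by (rule nn_integral_eq_integral[OF i[OF p], symmetric]) simp
    also have "\<dots> \<le> (\<integral>\<^sup>+x. ennreal (max 0 (w x)) \<partial>\<mu>)" by (rule d(2))
    also have "\<dots> = ennreal (LINT x|\<mu>. max 0 (w x))" by (rule nn_integral_eq_integral[OF p]) simp
    finally have "(LINT x|\<mu>'. max 0 (w x)) \<le> (LINT x|\<mu>. max 0 (w x))"
      by (subst (asm) ennreal_le_iff) (auto intro!: integral_nonneg_AE)
    moreover have "r \<le> (LINT x|\<mu>'. max 0 (w x))" unfolding w(2) using i[OF w(1)] by (intro integral_mono) auto
    ultimately show "r \<le> 1 * (LINT x|\<mu>. max 0 (w x))" by simp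
    fix w' r' assume "(w', r') \<in> G"
    then have w': "integrable \<mu> w'" "r' = (LINT x|\<mu>'. w' x)" by (auto simp: G_def)
    have "integrable \<mu> (\<lambda>x. w x + w' x)" using w w' by simp
    moreover have "(LINT x|\<mu>'. w x + w' x) = r + r'" using i w w' by simp
    ultimately show "(\<lambda>x. w x + w' x, r + r') \<in> G" unfolding G_def by force
  qed simp
  obtain h where h: "h \<in> borel_measurable \<mu>" "\<And>x. 0 \<le> h x \<and> h x \<le> 1" "\<And>w r. (w, r) \<in> G \<Longrightarrow> (LINT x|\<mu>. h x * w x) = r"
    using density_exists by blast
  show ?thesis
  proof (intro bexI[of _ "\<lambda>x. indicator S x * h x"] conjI allI impI)
    show "(\<lambda>x. indicator S x * h x) \<in> borel_measurable borel" by (rule borel_extension[OF \<mu> S h(1)])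
    show "0 \<le> indicator S x * h x" "indicator S x * h x \<le> 1" for x using h(2)[of x] by (auto simp: indicator_def)
    fix f :: "_ \<Rightarrow> real" assume f: "integrable \<mu> f"
    have "(LINT x|\<mu>. indicator S x * h x * f x) = (LINT x|\<mu>. h x * f x)"
      using pos_measure_on_space[OF \<mu>] by (intro Bochner_Integration.integral_cong) auto
    also have "\<dots> = (LINT x|\<mu>'. f x)" using h(3)[of f "LINT x|\<mu>'. f x"] f by (auto simp: G_def)
    finally show "(LINT x|\<mu>. indicator S x * h x * f x) = (LINT x|\<mu>'. f x)" .
  qed
qed

lemma along_const: "along (\<lambda>x. c) v x = 0"
  by (simp add: along_def)

locale flow_from_point =
  fixes L T :: real and \<mu> :: "((real^2) \<times> real) measure" and v :: "(real^2) \<times> real \<Rightarrow> real^2"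
    and \<nu> :: "real \<Rightarrow> (real^2) measure" and X :: "real^2" and s :: real
  assumes L: "L > 0" and T: "T > 0" and \<mu>: "pos_measure_on (QLT L T) \<mu>" and v: "integrable \<mu> v"
    and ce: "continuity_eq L T \<mu> v" and w: "weakly_continuous_slicing L T \<mu> \<nu>"
    and s: "s \<in> {-T<..<T}" and dirac: "AE x in \<nu> s. x = X"
begin

lemma dirac_integral: "(LINT x|\<nu> s. f x) = measure (\<nu> s) (space (\<nu> s)) * (f X :: real)"
  if "f \<in> borel_measurable borel"
proof -
  have p: "pos_measure_on (QL L) (\<nu> s)" using s by (intro wcs_pos[OF w]) auto
  interpret finite_measure "\<nu> s" by (rule pos_measure_on_finite[OF p])
  have "(LINT x|\<nu> s. f x) = (LINT x|\<nu> s. f X)"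
    by (rule integral_cong_AE) (use pos_measure_on_measurable[OF p that] dirac in auto)
  then show ?thesis by simp
qed

text \<open>The continuity equation for a truncation of \<open>\<phi>\<close>. The factor from the chain rule lies in \<open>(0, 1)\<close> and is absorbed by
  passing to the positive part.\<close>

lemma softplus_slab:
  assumes \<phi>: "cyl_smooth L \<phi>" and e: "\<epsilon> > 0" and ab: "- T \<le> a" "a < b" "b \<le> T"
  shows "(LINT x|\<nu> b. softplus \<epsilon> (\<phi> (x, b))) - (LINT x|\<nu> a. softplus \<epsilon> (\<phi> (x, a)))
    \<le> (LINT x|\<mu>. indicator {a<..<b} (snd x) * max 0 (along \<phi> v x))"
proof -
  have sm: "smooth \<phi>" using \<phi> by (simp add: cyl_smooth_def)
  have cs: "cyl_smooth L (\<lambda>x. softplus \<epsilon> (\<phi> x))"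
    using \<phi> smooth_compose[OF smooth_softplus[OF e]] by (auto simp: cyl_smooth_def periodic_def)
  have al: "along (\<lambda>x. softplus \<epsilon> (\<phi> x)) v x = logistic (\<phi> x / \<epsilon>) * along \<phi> v x" for x
    by (rule along_compose[OF sm softplus_deriv[OF e] smooth_softplus[OF e]])
  have i: "integrable \<mu> (along \<phi> v)" by (rule along_integrable[OF \<mu> sm v])
  have i': "integrable \<mu> (along (\<lambda>x. softplus \<epsilon> (\<phi> x)) v)"
    using cs by (intro along_integrable[OF \<mu> _ v]) (simp add: cyl_smooth_def)
  have tm: "(\<lambda>x. indicat_real {a<..<b} (snd x)) \<in> borel_measurable \<mu>"
    by (rule cyl_time_measurable[OF \<mu>]) simp
  have ii: "integrable \<mu> (\<lambda>x. indicator {a<..<b} (snd x) * f x)" if "integrable \<mu> f" for f :: "_ \<Rightarrow> real"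
    by (rule Bochner_Integration.integrable_bound[OF that]) (use that tm in \<open>auto simp: indicator_def\<close>)
  have "(LINT x|\<nu> b. softplus \<epsilon> (\<phi> (x, b))) - (LINT x|\<nu> a. softplus \<epsilon> (\<phi> (x, a)))
     = (LINT x|\<mu>. indicator {a<..<b} (snd x) * along (\<lambda>x. softplus \<epsilon> (\<phi> x)) v x)"
    by (rule slab_identity[OF \<mu> v ce w cs ab, symmetric])
  also have "\<dots> \<le> (LINT x|\<mu>. indicator {a<..<b} (snd x) * max 0 (along \<phi> v x))"
  proof (rule integral_mono)
    fix x
    have "logistic (\<phi> x / \<epsilon>) * along \<phi> v x \<le> logistic (\<phi> x / \<epsilon>) * max 0 (along \<phi> v x)"
      using logistic_bounds(1)[of "\<phi> x / \<epsilon>"] by (intro mult_left_mono) auto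
    also have "\<dots> \<le> 1 * max 0 (along \<phi> v x)"
      using logistic_bounds(2)[of "\<phi> x / \<epsilon>"] by (intro mult_right_mono) auto
    finally have "along (\<lambda>x. softplus \<epsilon> (\<phi> x)) v x \<le> max 0 (along \<phi> v x)" unfolding al by simp
    then show "indicator {a<..<b} (snd x) * along (\<lambda>x. softplus \<epsilon> (\<phi> x)) v x \<le> indicator {a<..<b} (snd x) * max 0 (along \<phi> v x)"
      by (intro mult_left_mono) auto
  qed (use ii i i' in auto)
  finally show ?thesis .
qed

lemma atom_lower_bound:
  assumes t: "t \<in> {-T..T}" and f: "tcont L f" "\<And>x. 0 \<le> f x" and Y: "Y \<in> QL L"
  shows "measure (\<nu> t) {Y} * f Y \<le> (LINT x|\<nu> t. f x)"
proof -
  note p = wcs_pos[OF w t]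
  interpret finite_measure "\<nu> t" by (rule pos_measure_on_finite[OF p])
  note sY = singleton_QL[OF p Y]
  have "measure (\<nu> t) {Y} * f Y = (LINT x|\<nu> t. indicator {Y} x * f Y)"
    using sY sets.sets_into_space[OF sY] by (simp add: Int_absorb2)
  also have "\<dots> \<le> (LINT x|\<nu> t. f x)"
  proof (rule integral_mono)
    show "integrable (\<nu> t) (\<lambda>x. indicator {Y} x * f Y)"
      using sY by (intro integrable_mult_left integrable_real_indicator) (auto simp: emeasure_eq_measure)
    show "integrable (\<nu> t) f" by (rule tcont_integrable[OF p f(1)])
    show "indicator {Y} x * f Y \<le> f x" for x using f(2)[of x] by (auto simp: indicator_def)
  qed
  finally show ?thesis .
qed

text \<open>The truncated \<open>\<phi>\<close> starts at height \<open>s\<close> with at most \<open>\<epsilon> ln 2\<close> per unit mass, because the slice there is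
  concentrated at a zero of \<open>\<phi>\<close>. Its integral at height \<open>b\<close> bounds the contribution of any single atom, the truncation being
  nonnegative.\<close>

lemma forward_bound:
  assumes \<phi>: "cyl_smooth L \<phi>" and z: "\<phi> (X, s) = 0" and b: "s < b" "b \<le> T" and Y: "Y \<in> QL L"
  shows "measure (\<nu> b) {Y} * \<phi> (Y, b) \<le> (LINT x|\<mu>. indicator {s<..<b} (snd x) * max 0 (along \<phi> v x))"
proof (rule field_le_epsilon)
  fix e :: real assume e: "e > 0"
  define M where "M = measure (\<nu> s) (space (\<nu> s))"
  define \<epsilon> where "\<epsilon> = e / (M * ln 2 + 1)"
  have M: "M \<ge> 0" by (simp add: M_def)
  have d: "M * ln 2 + 1 > 0" using M by (intro add_nonneg_pos mult_nonneg_nonneg) auto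
  have \<epsilon>: "\<epsilon> > 0" using e d by (simp add: \<epsilon>_def)
  have tc: "tcont L (\<lambda>x. softplus \<epsilon> (\<phi> (x, t)))" for t
    by (rule tcont_compose[OF cyl_cont_tcont[OF cyl_smooth_cont[OF \<phi>]] smooth_continuous[OF smooth_softplus[OF \<epsilon>]]])
  have "measure (\<nu> b) {Y} * \<phi> (Y, b) \<le> measure (\<nu> b) {Y} * softplus \<epsilon> (\<phi> (Y, b))"
    using softplus_ge(2)[OF \<epsilon>] by (intro mult_left_mono) auto
  also have "\<dots> \<le> (LINT x|\<nu> b. softplus \<epsilon> (\<phi> (x, b)))"
    using s b softplus_ge(1)[OF \<epsilon>] by (intro atom_lower_bound tc Y) auto
  also have "\<dots> \<le> (LINT x|\<mu>. indicator {s<..<b} (snd x) * max 0 (along \<phi> v x)) + (LINT x|\<nu> s. softplus \<epsilon> (\<phi> (x, s)))"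
    using softplus_slab[OF \<phi> \<epsilon>, of s b] s b by auto
  also have "(LINT x|\<nu> s. softplus \<epsilon> (\<phi> (x, s))) = M * (\<epsilon> * ln 2)"
    using dirac_integral[OF tcont_measurable[OF tc[of s]]] z softplus_ge(3)[OF \<epsilon>] by (simp add: M_def)
  also have "M * (\<epsilon> * ln 2) \<le> e"
  proof -
    have "\<epsilon> * (M * ln 2) \<le> \<epsilon> * (M * ln 2 + 1)" using \<epsilon> by (intro mult_left_mono) auto
    also have "\<dots> = e" using d by (simp add: \<epsilon>_def)
    finally show ?thesis by (simp add: mult_ac)
  qed
  finally show "measure (\<nu> b) {Y} * \<phi> (Y, b) \<le> (LINT x|\<mu>. indicator {s<..<b} (snd x) * max 0 (along \<phi> v x)) + e" by simp
qed

text \<open>The same argument below \<open>s\<close>, with \<open>- \<phi>\<close> and time reversed.\<close>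

lemma backward_bound:
  assumes \<phi>: "cyl_smooth L \<phi>" and z: "\<phi> (X, s) = 0" and a: "- T \<le> a" "a < s" and Y: "Y \<in> QL L"
  shows "measure (\<nu> a) {Y} * - \<phi> (Y, a) \<le> (LINT x|\<mu>. indicator {a<..<s} (snd x) * max 0 (along \<phi> v x))"
proof (rule field_le_epsilon)
  fix e :: real assume e: "e > 0"
  define M where "M = measure (\<nu> s) (space (\<nu> s))"
  define \<epsilon> where "\<epsilon> = e / (M * ln 2 + 1)"
  have M: "M \<ge> 0" by (simp add: M_def)
  have d: "M * ln 2 + 1 > 0" using M by (intro add_nonneg_pos mult_nonneg_nonneg) auto
  have \<epsilon>: "\<epsilon> > 0" using e d by (simp add: \<epsilon>_def)
  have sm: "smooth \<phi>" using \<phi> by (simp add: cyl_smooth_def)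
  define \<theta> where "\<theta> = (\<lambda>x. softplus \<epsilon> (- 1 * \<phi> x))"
  have \<phi>': "smooth (\<lambda>x. - 1 * \<phi> x)" by (rule smooth_cmult[OF sm])
  have cs: "cyl_smooth L \<theta>"
    unfolding \<theta>_def using \<phi> smooth_compose[OF smooth_softplus[OF \<epsilon>] \<phi>'] by (auto simp: cyl_smooth_def periodic_def)
  have tc: "tcont L (\<lambda>x. \<theta> (x, t))" for t by (rule cyl_cont_tcont[OF cyl_smooth_cont[OF cs]])
  have al: "along \<theta> v x = logistic (- 1 * \<phi> x / \<epsilon>) * (- 1 * along \<phi> v x)" for x
    unfolding \<theta>_def along_compose[OF \<phi>' softplus_deriv[OF \<epsilon>] smooth_softplus[OF \<epsilon>]] along_cmult[OF sm] ..
  have i: "integrable \<mu> (along \<phi> v)" by (rule along_integrable[OF \<mu> sm v])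
  have i': "integrable \<mu> (along \<theta> v)" using cs by (intro along_integrable[OF \<mu> _ v]) (simp add: cyl_smooth_def)
  have tm: "(\<lambda>x. indicat_real {a<..<s} (snd x)) \<in> borel_measurable \<mu>"
    by (rule cyl_time_measurable[OF \<mu>]) simp
  have ii: "integrable \<mu> (\<lambda>x. indicator {a<..<s} (snd x) * f x)" if "integrable \<mu> f" for f :: "_ \<Rightarrow> real"
    by (rule Bochner_Integration.integrable_bound[OF that]) (use that tm in \<open>auto simp: indicator_def\<close>)
  have "measure (\<nu> a) {Y} * - \<phi> (Y, a) \<le> measure (\<nu> a) {Y} * \<theta> (Y, a)"
    using softplus_ge(2)[OF \<epsilon>, of "- \<phi> (Y, a)"] unfolding \<theta>_def by (intro mult_left_mono) auto
  also have "\<dots> \<le> (LINT x|\<nu> a. \<theta> (x, a))"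
    using s a softplus_ge(1)[OF \<epsilon>] by (intro atom_lower_bound tc Y) (auto simp: \<theta>_def)
  also have "\<dots> = (LINT x|\<nu> s. \<theta> (x, s)) - (LINT x|\<mu>. indicator {a<..<s} (snd x) * along \<theta> v x)"
    using slab_identity[OF \<mu> v ce w cs, of a s] s a by auto
  also have "(LINT x|\<nu> s. \<theta> (x, s)) = M * (\<epsilon> * ln 2)"
    using dirac_integral[OF tcont_measurable[OF tc[of s]]] z softplus_ge(3)[OF \<epsilon>] by (simp add: M_def \<theta>_def)
  also have "M * (\<epsilon> * ln 2) - (LINT x|\<mu>. indicator {a<..<s} (snd x) * along \<theta> v x)
    \<le> e + (LINT x|\<mu>. indicator {a<..<s} (snd x) * max 0 (along \<phi> v x))"
  proof -
    have "\<epsilon> * (M * ln 2) \<le> \<epsilon> * (M * ln 2 + 1)" using \<epsilon> by (intro mult_left_mono) auto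
    also have "\<dots> = e" using d by (simp add: \<epsilon>_def)
    finally have 1: "M * (\<epsilon> * ln 2) \<le> e" by (simp add: mult_ac)
    have "(LINT x|\<mu>. - 1 * (indicator {a<..<s} (snd x) * along \<theta> v x)) \<le> (LINT x|\<mu>. indicator {a<..<s} (snd x) * max 0 (along \<phi> v x))"
    proof (rule integral_mono)
      fix x
      have "logistic (- 1 * \<phi> x / \<epsilon>) * along \<phi> v x \<le> logistic (- 1 * \<phi> x / \<epsilon>) * max 0 (along \<phi> v x)"
        using logistic_bounds(1)[of "- 1 * \<phi> x / \<epsilon>"] by (intro mult_left_mono) auto
      also have "\<dots> \<le> 1 * max 0 (along \<phi> v x)"
        using logistic_bounds(2)[of "- 1 * \<phi> x / \<epsilon>"] by (intro mult_right_mono) auto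
      finally have "- along \<theta> v x \<le> max 0 (along \<phi> v x)" unfolding al by simp
      then have "indicat_real {a<..<s} (snd x) * - along \<theta> v x \<le> indicator {a<..<s} (snd x) * max 0 (along \<phi> v x)"
        by (intro mult_left_mono) auto
      then show "- 1 * (indicator {a<..<s} (snd x) * along \<theta> v x) \<le> indicator {a<..<s} (snd x) * max 0 (along \<phi> v x)" by simp
    qed (use ii i ii[OF i'] in auto)
    then show ?thesis using 1 by simp
  qed
  finally show "measure (\<nu> a) {Y} * - \<phi> (Y, a) \<le> (LINT x|\<mu>. indicator {a<..<s} (snd x) * max 0 (along \<phi> v x)) + e" by simp
qed

text \<open>The easy direction of the duality between flows and cuts would derive this from a flow of value \<open>\<beta>\<close>; here it is
  the condition under which one exists. As all mass passes through \<open>X\<close> at height \<open>s\<close>, subtracting the constant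
  \<open>\<phi> (X, s)\<close> decouples the parts below and above \<open>s\<close>.\<close>

lemma cut_bound:
  assumes \<phi>: "cyl_smooth L \<phi>" and ab: "- T \<le> a" "a < s" "s < b" "b \<le> T" and Y: "Ym \<in> QL L" "Yp \<in> QL L"
    and \<beta>: "\<beta> > 0" "\<beta> \<le> measure (\<nu> a) {Ym}" "\<beta> \<le> measure (\<nu> b) {Yp}"
  shows "\<phi> (Yp, b) - \<phi> (Ym, a) \<le> 1 / \<beta> * (LINT x|\<mu>. max 0 (indicator {a<..<b} (snd x) * along \<phi> v x))"
proof -
  have sm: "smooth \<phi>" using \<phi> by (simp add: cyl_smooth_def)
  define \<psi> where "\<psi> = (\<lambda>x. \<phi> x + - \<phi> (X, s))"
  have \<psi>: "cyl_smooth L \<psi>"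
    using \<phi> smooth_add[OF sm smooth_const, of "- \<phi> (X, s)"] by (auto simp: \<psi>_def cyl_smooth_def periodic_def)
  have \<psi>0: "\<psi> (X, s) = 0" by (simp add: \<psi>_def)
  have al: "along \<psi> v x = along \<phi> v x" for x
    unfolding \<psi>_def along_add[OF sm smooth_const] along_const by simp
  have i: "integrable \<mu> (\<lambda>x. max 0 (along \<phi> v x))" using along_integrable[OF \<mu> sm v] by simp
  have tm: "(\<lambda>x. indicat_real J (snd x)) \<in> borel_measurable \<mu>" if "J \<in> sets borel" for J
    by (rule cyl_time_measurable[OF \<mu>]) (use that in simp)
  have ii: "integrable \<mu> (\<lambda>x. indicator J (snd x) * max 0 (along \<phi> v x))" if "J \<in> sets borel" for J
    by (rule Bochner_Integration.integrable_bound[OF i]) (use i tm[OF that] in \<open>auto simp: indicator_def\<close>)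
  define P where "P = (LINT x|\<mu>. indicator {s<..<b} (snd x) * max 0 (along \<phi> v x))"
  define N where "N = (LINT x|\<mu>. indicator {a<..<s} (snd x) * max 0 (along \<phi> v x))"
  have P0: "0 \<le> P" "0 \<le> N" unfolding P_def N_def by (auto intro!: integral_nonneg_AE)
  have "\<beta> * \<psi> (Yp, b) \<le> P"
  proof (cases "\<psi> (Yp, b) \<ge> 0")
    case True
    then have "\<beta> * \<psi> (Yp, b) \<le> measure (\<nu> b) {Yp} * \<psi> (Yp, b)" using \<beta> by (intro mult_right_mono)
    also have "\<dots> \<le> P" using forward_bound[OF \<psi> \<psi>0 ab(3,4) Y(2)] by (simp add: P_def al)
    finally show ?thesis .
  next
    case False
    then have "\<beta> * \<psi> (Yp, b) \<le> 0" using \<beta> by (simp add: mult_nonneg_nonpos)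
    then show ?thesis using P0 by simp
  qed
  moreover have "\<beta> * - \<psi> (Ym, a) \<le> N"
  proof (cases "- \<psi> (Ym, a) \<ge> 0")
    case True
    then have "\<beta> * - \<psi> (Ym, a) \<le> measure (\<nu> a) {Ym} * - \<psi> (Ym, a)" using \<beta> by (intro mult_right_mono)
    also have "\<dots> \<le> N" using backward_bound[OF \<psi> \<psi>0 ab(1,2) Y(1)] by (simp add: N_def al)
    finally show ?thesis .
  next
    case False
    then have "\<beta> * - \<psi> (Ym, a) \<le> 0" using \<beta> by (intro mult_nonneg_nonpos) auto
    then show ?thesis using P0 by simp
  qed
  moreover have "P + N \<le> (LINT x|\<mu>. max 0 (indicator {a<..<b} (snd x) * along \<phi> v x))"
  proof -
    have "P + N = (LINT x|\<mu>. indicator {s<..<b} (snd x) * max 0 (along \<phi> v x) + indicator {a<..<s} (snd x) * max 0 (along \<phi> v x))"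
      unfolding P_def N_def using ii by simp
    also have "\<dots> \<le> (LINT x|\<mu>. indicator {a<..<b} (snd x) * max 0 (along \<phi> v x))"
    proof (rule integral_mono)
      show "indicator {s<..<b} (snd x) * max 0 (along \<phi> v x) + indicator {a<..<s} (snd x) * max 0 (along \<phi> v x)
        \<le> indicator {a<..<b} (snd x) * max 0 (along \<phi> v x)" for x
        using ab by (auto simp: indicator_def)
    qed (use ii in auto)
    also have "\<dots> = (LINT x|\<mu>. max 0 (indicator {a<..<b} (snd x) * along \<phi> v x))"
      by (rule Bochner_Integration.integral_cong) (auto simp: indicator_def)
    finally show ?thesis .
  qed
  ultimately have "\<beta> * (\<phi> (Yp, b) - \<phi> (Ym, a)) \<le> (LINT x|\<mu>. max 0 (indicator {a<..<b} (snd x) * along \<phi> v x))"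
    by (simp add: \<psi>_def algebra_simps)
  then show ?thesis using \<beta>(1) by (simp add: pos_le_divide_eq mult.commute)
qed

text \<open>The functional sending the derivative of \<open>\<phi>\<close> along the flow to \<open>\<phi> (Yp, b) - \<phi> (Ym, a)\<close> is dominated by the cut bound,
  and the density representing it is a unit flow between the two points.\<close>

lemma routed_density:
  assumes ab: "- T \<le> a" "a < s" "s < b" "b \<le> T" and Y: "Ym \<in> QL L" "Yp \<in> QL L"
    and pos: "measure (\<nu> a) {Ym} > 0" "measure (\<nu> b) {Yp} > 0"
  shows "\<exists>C f. f \<in> borel_measurable borel \<and> (\<forall>x. 0 \<le> f x \<and> f x \<le> C) \<and>
    (\<forall>\<phi>. cyl_smooth L \<phi> \<longrightarrow> (LINT x|\<mu>. f x * along \<phi> v x) = \<phi> (Yp, b) - \<phi> (Ym, a))"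
proof -
  define \<beta> where "\<beta> = min (measure (\<nu> a) {Ym}) (measure (\<nu> b) {Yp})"
  have \<beta>: "\<beta> > 0" "\<beta> \<le> measure (\<nu> a) {Ym}" "\<beta> \<le> measure (\<nu> b) {Yp}" using pos by (auto simp: \<beta>_def)
  define W where "W \<phi> x = indicator {a<..<b} (snd x) * along \<phi> v x" for \<phi> x
  define G where "G = {(W \<phi>, \<phi> (Yp, b) - \<phi> (Ym, a)) |\<phi>. cyl_smooth L \<phi>}"
  have tm: "(\<lambda>x. indicat_real {a<..<b} (snd x)) \<in> borel_measurable \<mu>"
    by (rule cyl_time_measurable[OF \<mu>]) simp
  have Wi: "integrable \<mu> (W \<phi>)" if "cyl_smooth L \<phi>" for \<phi>
  proof -
    have i: "integrable \<mu> (along \<phi> v)" using that by (intro along_integrable[OF \<mu> _ v]) (simp add: cyl_smooth_def)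
    show ?thesis unfolding W_def
      by (rule Bochner_Integration.integrable_bound[OF i]) (use i tm in \<open>auto simp: indicator_def\<close>)
  qed
  interpret fm: finite_measure \<mu> by (rule pos_measure_on_finite[OF \<mu>])
  interpret dominated_graph \<mu> "1 / \<beta>" G
  proof unfold_locales
    show "0 \<le> 1 / \<beta>" using \<beta> by simp
    have "cyl_smooth L (\<lambda>x. 0)" by (simp add: cyl_smooth_def smooth_const periodic_def)
    moreover have "W (\<lambda>x. 0) = (\<lambda>x. 0)" by (simp add: W_def along_const fun_eq_iff)
    ultimately show "(\<lambda>_. 0, 0) \<in> G" unfolding G_def by force
    fix u r assume "(u, r) \<in> G"
    then obtain \<phi> where \<phi>: "cyl_smooth L \<phi>" "u = W \<phi>" "r = \<phi> (Yp, b) - \<phi> (Ym, a)" by (auto simp: G_def)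
    have sm: "smooth \<phi>" using \<phi>(1) by (simp add: cyl_smooth_def)
    show "integrable \<mu> u" using Wi \<phi> by simp
    show "r \<le> 1 / \<beta> * (LINT x|\<mu>. max 0 (u x))"
      unfolding \<phi>(2,3) W_def by (rule cut_bound[OF \<phi>(1) ab Y \<beta>])
    show "(\<lambda>x. c * u x, c * r) \<in> G" for c
    proof -
      have "cyl_smooth L (\<lambda>x. c * \<phi> x)" using \<phi>(1) smooth_cmult[OF sm] by (auto simp: cyl_smooth_def periodic_def)
      moreover have "W (\<lambda>x. c * \<phi> x) = (\<lambda>x. c * u x)" unfolding \<phi>(2) by (simp add: W_def along_cmult[OF sm] fun_eq_iff)
      moreover have "c * \<phi> (Yp, b) - c * \<phi> (Ym, a) = c * r" unfolding \<phi>(3) by (simp add: right_diff_distrib)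
      ultimately show ?thesis unfolding G_def by (intro CollectI exI[of _ "\<lambda>x. c * \<phi> x"]) simp
    qed
    fix u' r' assume "(u', r') \<in> G"
    then obtain \<phi>' where \<phi>': "cyl_smooth L \<phi>'" "u' = W \<phi>'" "r' = \<phi>' (Yp, b) - \<phi>' (Ym, a)" by (auto simp: G_def)
    have sm': "smooth \<phi>'" using \<phi>'(1) by (simp add: cyl_smooth_def)
    have "cyl_smooth L (\<lambda>x. \<phi> x + \<phi>' x)" using \<phi>(1) \<phi>'(1) smooth_add[OF sm sm'] by (auto simp: cyl_smooth_def periodic_def)
    moreover have "W (\<lambda>x. \<phi> x + \<phi>' x) = (\<lambda>x. u x + u' x)"
      unfolding \<phi>(2) \<phi>'(2) by (simp add: W_def along_add[OF sm sm'] fun_eq_iff distrib_left)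
    moreover have "(\<phi> (Yp, b) + \<phi>' (Yp, b)) - (\<phi> (Ym, a) + \<phi>' (Ym, a)) = r + r'" unfolding \<phi>(3) \<phi>'(3) by simp
    ultimately show "(\<lambda>x. u x + u' x, r + r') \<in> G" unfolding G_def by (intro CollectI exI[of _ "\<lambda>x. \<phi> x + \<phi>' x"]) simp
  qed
  obtain f where f: "f \<in> borel_measurable \<mu>" "\<And>x. 0 \<le> f x \<and> f x \<le> 1 / \<beta>" "\<And>w r. (w, r) \<in> G \<Longrightarrow> (LINT x|\<mu>. f x * w x) = r"
    using density_exists by blast
  define f' where "f' x = indicator (QLT L T) x * (indicator {a<..<b} (snd x) * f x)" for x
  have "f' \<in> borel_measurable borel"
    unfolding f'_def by (intro borel_extension[OF \<mu> QLT_borel]) (use tm f(1) in measurable)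
  moreover have "0 \<le> f' x \<and> f' x \<le> 1 / \<beta>" for x using f(2)[of x] \<beta>(1) by (auto simp: f'_def indicator_def)
  moreover have "(LINT x|\<mu>. f' x * along \<phi> v x) = \<phi> (Yp, b) - \<phi> (Ym, a)" if "cyl_smooth L \<phi>" for \<phi>
  proof -
    have "(LINT x|\<mu>. f' x * along \<phi> v x) = (LINT x|\<mu>. f x * W \<phi> x)"
      by (rule Bochner_Integration.integral_cong) (auto simp: f'_def W_def pos_measure_on_space[OF \<mu>])
    then show ?thesis using f(3)[of "W \<phi>" "\<phi> (Yp, b) - \<phi> (Ym, a)"] that by (auto simp: G_def)
  qed
  ultimately show ?thesis by blast
qed

end

lemma AE_dirac:
  assumes M: "pos_measure_on (QL L) M" and e: "M = scale_measure a (return (restrict_space borel (QL L)) X)" and X: "X \<in> QL L"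
  shows "AE x in M. x = X"
proof (rule AE_I)
  show "{x \<in> space M. x \<noteq> X} \<subseteq> QL L - {X}" using pos_measure_on_space[OF M] by auto
  have s: "QL L - {X} \<in> sets (restrict_space borel (QL L))" by (simp add: sets_restrict_space_iff)
  then show "QL L - {X} \<in> sets M" using pos_measure_on_sets[OF M] by simp
  show "emeasure M (QL L - {X}) = 0" unfolding e using s by (simp add: emeasure_return)
qed

text \<open>The unit flow inside the subsystem is rewritten with a density \<open>g\<close> with respect to \<open>\<mu>\<close>. The last conclusion records that
  it stays below a multiple of the subsystem, whose slice at height \<open>s\<close> is a single Dirac. The velocity given with the
  subsystem is \<open>v\<close> because the optimal flux is unique.\<close>

lemma routed_perturbation:
  assumes L: "L > 0" and T: "T > 0" and \<mu>: "pos_measure_on (QLT L T) \<mu>" and v: "integrable \<mu> v" "v = vderiv m \<mu>"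
    and m: "optimal_flux L T \<mu> m" and w: "weakly_continuous_slicing L T \<mu> \<nu>"
    and s: "s \<in> {-T<..<T}" and X: "X \<in> QL L" and sub: "subsystem L T \<mu> X s \<mu>'"
    and Y: "Xp \<in> QL L" "Xm \<in> QL L" and z: "- T \<le> zm" "zm < s" "s < zp" "zp \<le> T"
    and at: "emeasure (slice L T \<mu>' zp) {Xp} > 0" "emeasure (slice L T \<mu>' zm) {Xm} > 0"
  shows "\<exists>C g \<nu>'. g \<in> borel_measurable borel \<and> (\<forall>x. 0 \<le> g x \<and> g x \<le> C) \<and>
    (\<forall>\<phi>. cyl_smooth L \<phi> \<longrightarrow> (LINT x|\<mu>. g x * along \<phi> v x) = \<phi> (Xp, zp) - \<phi> (Xm, zm)) \<and>
    pos_measure_on (QLT L T) \<mu>' \<and> weakly_continuous_slicing L T \<mu>' \<nu>' \<and> (AE x in \<nu>' s. x = X) \<and>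
    (\<forall>f. integrable \<mu> f \<longrightarrow> (\<forall>x. 0 \<le> f x) \<longrightarrow> (LINT x|\<mu>. g x * f x) \<le> C * (LINT x|\<mu>'. f x))"
proof -
  have fin: "energy L T \<mu> < \<infinity>" and adm: "admissible L T \<mu>'" and le: "\<And>A. A \<in> sets \<mu> \<Longrightarrow> emeasure \<mu>' A \<le> emeasure \<mu> A"
    and sl: "is_slice L T \<mu>' s (scale_measure (emeasure (slice L T \<mu> s) {X}) (return (restrict_space borel (QL L)) X))"
    using sub by (auto simp: subsystem_def)
  obtain m' where m': "optimal_flux L T \<mu> m'" "continuity_eq L T \<mu>' (vderiv m' \<mu>)" using sub by (auto simp: subsystem_def)
  have \<mu>': "pos_measure_on (QLT L T) \<mu>'" using adm by (auto simp: admissible_def admissible_pair_def)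
  obtain \<nu>' where w': "weakly_continuous_slicing L T \<mu>' \<nu>'"
    and \<nu>s: "\<nu>' s = scale_measure (emeasure (slice L T \<mu> s) {X}) (return (restrict_space borel (QL L)) X)"
    using sl by (auto simp: is_slice_def)
  have sT: "s \<in> {-T..T}" "zp \<in> {-T..T}" "zm \<in> {-T..T}" using s z by auto
  have dirac: "AE x in \<nu>' s. x = X" by (rule AE_dirac[OF wcs_pos[OF w' sT(1)] \<nu>s X])
  have v': "integrable \<mu>' v" by (rule dominated_integrable[OF \<mu> \<mu>' le v(1)])
  have vm: "integrable \<mu> (vderiv m' \<mu>)" using flux_density(1)[OF \<mu>] m'(1) by (simp add: optimal_flux_def)
  have vm': "integrable \<mu>' (vderiv m' \<mu>)" by (rule dominated_integrable[OF \<mu> \<mu>' le vm])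
  have ae: "AE x in \<mu>'. vderiv m' \<mu> x = v x"
    unfolding v(2) by (rule dominated_measure(3)[OF \<mu> \<mu>' le optimal_flux_unique[OF L \<mu> fin m'(1) m]])
  have ce: "continuity_eq L T \<mu>' v"
    by (rule continuity_eq_cong_AE[OF \<mu>' _ _ ae m'(2)]) (use v' vm' in auto)
  have pos: "measure (\<nu>' t) {Y} > 0" if "t \<in> {-T..T}" "emeasure (slice L T \<mu>' t) {Y} > 0" for t Y
  proof -
    interpret finite_measure "\<nu>' t" by (rule pos_measure_on_finite[OF wcs_pos[OF w' that(1)]])
    show ?thesis using that(2) slice_eq[OF L T \<mu>' w' that(1)] by (simp add: emeasure_eq_measure)
  qed
  interpret F: flow_from_point L T \<mu>' v \<nu>' X s
    by unfold_locales (use L T \<mu>' v' ce w' s dirac in auto)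
  obtain C f where f: "f \<in> borel_measurable borel" "\<And>x. 0 \<le> f x \<and> f x \<le> C"
    "\<And>\<phi>. cyl_smooth L \<phi> \<Longrightarrow> (LINT x|\<mu>'. f x * along \<phi> v x) = \<phi> (Xp, zp) - \<phi> (Xm, zm)"
    using F.routed_density[OF z Y(2,1) pos[OF sT(3) at(2)] pos[OF sT(2) at(1)]] by blast
  obtain h where h: "h \<in> borel_measurable borel" "\<And>x. 0 \<le> h x \<and> h x \<le> 1"
    "\<And>f. integrable \<mu> f \<Longrightarrow> (LINT x|\<mu>. h x * f x) = (LINT x|\<mu>'. f x :: real)"
    using dominated_density[OF \<mu> \<mu>' le QLT_borel] by blast
  have C: "C \<ge> 0" using f(2)[of 0] by linarith
  have fi: "integrable \<mu> (\<lambda>x. f x * u x)" if "integrable \<mu> u" for u :: "_ \<Rightarrow> real"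
    by (rule Bochner_Integration.integrable_bound[of _ "\<lambda>x. C * u x"])
       (use that f(2) C pos_measure_on_measurable[OF \<mu> f(1)] in \<open>auto simp: abs_mult intro!: mult_right_mono\<close>)
  have hf: "(LINT x|\<mu>. h x * f x * u x) = (LINT x|\<mu>'. f x * u x)" if "integrable \<mu> u" for u :: "_ \<Rightarrow> real"
    using h(3)[OF fi[OF that]] by (simp add: mult.assoc)
  show ?thesis
  proof (intro exI conjI allI impI)
    show "(\<lambda>x. h x * f x) \<in> borel_measurable borel" using h(1) f(1) by simp
    show "0 \<le> h x * f x" for x using h(2) f(2) by simp
    show "h x * f x \<le> C" for x using mult_mono[of "h x" 1 "f x" C] h(2)[of x] f(2)[of x] by simp
    show "(LINT x|\<mu>. h x * f x * along \<phi> v x) = \<phi> (Xp, zp) - \<phi> (Xm, zm)" if "cyl_smooth L \<phi>" for \<phi>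
    proof -
      have "integrable \<mu> (along \<phi> v)" using that by (intro along_integrable[OF \<mu> _ v(1)]) (simp add: cyl_smooth_def)
      then show ?thesis using hf f(3)[OF that] by simp
    qed
    show "(LINT x|\<mu>. h x * f x * u x) \<le> C * (LINT x|\<mu>'. u x)" if u: "integrable \<mu> u" "\<forall>x. 0 \<le> u x" for u
    proof -
      have i: "integrable \<mu>' u" "integrable \<mu>' (\<lambda>x. f x * u x)"
        using dominated_integrable[OF \<mu> \<mu>' le] u(1) fi[OF u(1)] by blast+
      have "(LINT x|\<mu>'. f x * u x) \<le> (LINT x|\<mu>'. C * u x)"
        using i f(2) u(2) by (intro integral_mono) (auto intro!: mult_right_mono)
      then show ?thesis unfolding hf[OF u(1)] using i by simp
    qed
  qed (use \<mu>' w' dirac in auto)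
qed

section \<open>No loops\<close>

theorem lemma5p8:
  fixes L T s zm zp :: real
    and \<mu>m \<mu>p :: "(real^2) measure"
    and \<mu> \<mu>1 \<mu>2 :: "((real^2) \<times> real) measure"
    and X1 X2 Xp Xm :: "real^2"
  assumes "L > 0" and "T > 0"
    and "pos_measure_on (QL L) \<mu>p" and "pos_measure_on (QL L) \<mu>m"
    and "emeasure \<mu>p (QL L) = emeasure \<mu>m (QL L)"
    and "minimizer L T \<mu>m \<mu>p \<mu>"
    and "s \<in> {-T<..<T}"
    and "X1 \<in> QL L" and "X2 \<in> QL L"
    and "subsystem L T \<mu> X1 s \<mu>1" and "subsystem L T \<mu> X2 s \<mu>2"
    and "Xp \<in> QL L" and "Xm \<in> QL L"
    and "- T \<le> zm" and "zm < s" and "s < zp" and "zp \<le> T"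
    and "emeasure (slice L T \<mu>1 zp) {Xp} > 0" and "emeasure (slice L T \<mu>2 zp) {Xp} > 0"
    and "emeasure (slice L T \<mu>1 zm) {Xm} > 0" and "emeasure (slice L T \<mu>2 zm) {Xm} > 0"
  shows "X1 = X2"
proof (rule ccontr)
  assume ne: "X1 \<noteq> X2"
  note L = \<open>L > 0\<close> and T = \<open>T > 0\<close> and min = \<open>minimizer L T \<mu>m \<mu>p \<mu>\<close> and s = \<open>s \<in> {-T<..<T}\<close>
  note z = \<open>- T \<le> zm\<close> \<open>zm < s\<close> \<open>s < zp\<close> \<open>zp \<le> T\<close>
  have comp: "admissible L T \<mu>" "is_slice L T \<mu> T \<mu>p" using min by (auto simp: minimizer_def competitor_def)
  have \<mu>: "pos_measure_on (QLT L T) \<mu>" using comp(1) by (auto simp: admissible_def admissible_pair_def)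
  obtain \<nu> where w: "weakly_continuous_slicing L T \<mu> \<nu>" using comp(2) by (auto simp: is_slice_def)
  have fin: "energy L T \<mu> < \<infinity>" using \<open>subsystem L T \<mu> X1 s \<mu>1\<close> by (simp add: subsystem_def)
  obtain m where m: "optimal_flux L T \<mu> m" using \<open>subsystem L T \<mu> X1 s \<mu>1\<close> by (auto simp: subsystem_def)
  define v where "v = vderiv m \<mu>"
  have fl: "flux L T \<mu> m" using m by (simp add: optimal_flux_def)
  have v: "integrable \<mu> v" unfolding v_def by (rule flux_density(1)[OF \<mu> fl])
  have ce: "continuity_eq L T \<mu> v" using fl by (simp add: flux_def v_def)
  \<comment> \<open>Two unit flows with the same source and the same sink, one inside each subsystem.\<close>
  obtain C1 g1 \<nu>1 where g1: "g1 \<in> borel_measurable borel" "\<And>x. 0 \<le> g1 x \<and> g1 x \<le> C1"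
    "\<And>\<phi>. cyl_smooth L \<phi> \<Longrightarrow> (LINT x|\<mu>. g1 x * along \<phi> v x) = \<phi> (Xp, zp) - \<phi> (Xm, zm)"
    "pos_measure_on (QLT L T) \<mu>1" "weakly_continuous_slicing L T \<mu>1 \<nu>1" "AE x in \<nu>1 s. x = X1"
    "\<And>f. integrable \<mu> f \<Longrightarrow> \<forall>x. 0 \<le> f x \<Longrightarrow> (LINT x|\<mu>. g1 x * f x) \<le> C1 * (LINT x|\<mu>1. f x)"
    using routed_perturbation[OF L T \<mu> v v_def m w s \<open>X1 \<in> QL L\<close> \<open>subsystem L T \<mu> X1 s \<mu>1\<close> \<open>Xp \<in> QL L\<close> \<open>Xm \<in> QL L\<close> z
        \<open>emeasure (slice L T \<mu>1 zp) {Xp} > 0\<close> \<open>emeasure (slice L T \<mu>1 zm) {Xm} > 0\<close>]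
    by (elim exE conjE) blast
  obtain C2 g2 \<nu>2 where g2: "g2 \<in> borel_measurable borel" "\<And>x. 0 \<le> g2 x \<and> g2 x \<le> C2"
    "\<And>\<phi>. cyl_smooth L \<phi> \<Longrightarrow> (LINT x|\<mu>. g2 x * along \<phi> v x) = \<phi> (Xp, zp) - \<phi> (Xm, zm)"
    "pos_measure_on (QLT L T) \<mu>2" "weakly_continuous_slicing L T \<mu>2 \<nu>2" "AE x in \<nu>2 s. x = X2"
    "\<And>f. integrable \<mu> f \<Longrightarrow> \<forall>x. 0 \<le> f x \<Longrightarrow> (LINT x|\<mu>. g2 x * f x) \<le> C2 * (LINT x|\<mu>2. f x)"
    using routed_perturbation[OF L T \<mu> v v_def m w s \<open>X2 \<in> QL L\<close> \<open>subsystem L T \<mu> X2 s \<mu>2\<close> \<open>Xp \<in> QL L\<close> \<open>Xm \<in> QL L\<close> z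
        \<open>emeasure (slice L T \<mu>2 zp) {Xp} > 0\<close> \<open>emeasure (slice L T \<mu>2 zm) {Xm} > 0\<close>]
    by (elim exE conjE) blast
  have gi: "integrable \<mu> (\<lambda>x. h x * u x)" if "h \<in> borel_measurable borel" "\<And>x. 0 \<le> h x \<and> h x \<le> C" "integrable \<mu> u"
    for h u :: "(real^2) \<times> real \<Rightarrow> real" and C
  proof (rule Bochner_Integration.integrable_bound[of _ "\<lambda>x. C * u x"])
    have "C \<ge> 0" using that(2)[of 0] by linarith
    then show "AE x in \<mu>. norm (h x * u x) \<le> norm (C * u x)"
      using that(2) by (intro AE_I2) (auto simp: abs_mult intro!: mult_right_mono)
  qed (use that pos_measure_on_measurable[OF \<mu> that(1)] in auto)
  define C where "C = C1 + C2 + 1"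
  have C: "C > 0" "C1 \<le> C" "C2 \<le> C" using g1(2)[of 0] g2(2)[of 0] by (auto simp: C_def)
  \<comment> \<open>The boundary terms of the two flows cancel; the factor makes the perturbation at most 1/2 in absolute value.\<close>
  define g where "g x = (g1 x - g2 x) / (2 * C)" for x
  have pert: "perturbation L T \<mu> v \<nu> g"
  proof
    show "g \<in> borel_measurable borel" unfolding g_def using g1(1) g2(1) by simp
    show "\<bar>g x\<bar> \<le> 1/2" for x
    proof -
      have "\<bar>g1 x - g2 x\<bar> \<le> C" using g1(2)[of x] g2(2)[of x] C by (auto simp: abs_le_iff)
      then show ?thesis using C(1) by (simp add: g_def abs_divide pos_divide_le_eq)
    qed
    show "(LINT x|\<mu>. g x * along \<phi> v x) = 0" if \<phi>: "cyl_smooth L \<phi>" for \<phi>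
    proof -
      have i: "integrable \<mu> (along \<phi> v)" using \<phi> by (intro along_integrable[OF \<mu> _ v]) (simp add: cyl_smooth_def)
      have "(LINT x|\<mu>. g x * along \<phi> v x) = (LINT x|\<mu>. 1 / (2 * C) * (g1 x * along \<phi> v x - g2 x * along \<phi> v x))"
        by (rule Bochner_Integration.integral_cong) (auto simp: g_def left_diff_distrib)
      also have "\<dots> = 1 / (2 * C) * ((LINT x|\<mu>. g1 x * along \<phi> v x) - (LINT x|\<mu>. g2 x * along \<phi> v x))"
        using gi[OF g1(1,2) i] gi[OF g2(1,2) i] by simp
      finally show ?thesis using g1(3)[OF \<phi>] g2(3)[OF \<phi>] by simp
    qed
  qed (use L T \<mu> v ce w in auto)
  have "AE x in \<mu>. g x = 0" by (rule minimizer_rigid[OF pert min m v_def fin])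
  then have eq: "AE x in \<mu>. g1 x = g2 x" by eventually_elim (use C(1) in \<open>auto simp: g_def\<close>)
  \<comment> \<open>A distance to \<open>Y\<close> on the torus, which is continuous and periodic.\<close>
  define \<psi> where "\<psi> Y x = dist (torus_map L x) (torus_map L Y)" for Y x
  have \<psi>: "tcont L (\<psi> Y)" for Y
    unfolding \<psi>_def using tcont_torus_map[OF L, of "\<lambda>p. dist p (torus_map L Y)"] by (simp add: continuous_intros)
  have cyl: "cyl_cont L (\<lambda>x. \<psi> Y (fst x))" for Y
    using \<psi>[of Y] by (auto simp: cyl_cont_def tcont_def intro!: continuous_on_compose2[of UNIV "\<psi> Y" UNIV fst] continuous_on_fst continuous_on_id)
  define \<delta> where "\<delta> = dist (torus_map L X1) (torus_map L X2)"
  have \<delta>: "\<delta> > 0" using torus_map_inj[OF L \<open>X1 \<in> QL L\<close> \<open>X2 \<in> QL L\<close>] ne by (auto simp: \<delta>_def)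
  have tri: "\<delta> \<le> \<psi> X1 x + \<psi> X2 x" for x
    unfolding \<psi>_def \<delta>_def by (metis dist_commute dist_triangle)
  define h where "h n = (zp - s) * inverse (real (Suc n))" for n
  have h0: "h n > 0" for n using z by (simp add: h_def)
  have h1: "s + h n \<le> zp" for n
  proof -
    have "(zp - s) * inverse (real (Suc n)) \<le> (zp - s) * 1" using z by (intro mult_left_mono) (auto simp: field_simps)
    then show ?thesis by (simp add: h_def)
  qed
  have hl: "h \<longlonglongrightarrow> 0" unfolding h_def using tendsto_mult_right_zero[OF LIMSEQ_inverse_real_of_nat] by auto
  have hT: "- T \<le> s" "s + h n \<le> T" for n using s h1[of n] z by auto
  have ki: "integrable \<mu> (\<lambda>x. kern s (h n) (snd x) * p (fst x))" if "tcont L p" for n p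
    by (rule perturbation.weighted_integrable[OF pert kern_smooth that])
  \<comment> \<open>A unit flow carries unit mass across each height between \<open>zm\<close> and \<open>zp\<close>.\<close>
  have one: "(LINT x|\<mu>. g1 x * kern s (h n) (snd x)) = 1" for n
  proof -
    define U where "U t = step ((t - s) / h n)" for t
    have U: "smooth U" "\<And>t. (U has_real_derivative kern s (h n) t) (at t)"
      unfolding U_def by (intro smooth_affine smooth_step kern_step h0)+
    have c1: "cyl_smooth L (\<lambda>x. 1)" by (simp add: cyl_smooth_def smooth_const periodic_def)
    have al: "along (\<lambda>x. U (snd x) * 1) v x = kern s (h n) (snd x)" for x
      using along_time_mult[OF smooth_const U(2) U(1), of 1 v] by (simp add: along_const)
    have "(LINT x|\<mu>. g1 x * along (\<lambda>x. U (snd x) * 1) v x) = U zp - U zm"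
      using g1(3)[OF cyl_smooth_time_mult[OF U(1) c1]] by simp
    moreover have "U zp = 1" unfolding U_def using h0[of n] h1[of n] by (intro step_1) (simp add: pos_le_divide_eq)
    moreover have "U zm = 0" unfolding U_def using h0[of n] z by (intro step_0) (simp add: divide_nonpos_pos)
    ultimately show ?thesis unfolding al by simp
  qed
  \<comment> \<open>The common density \<open>g1 = g2\<close> is estimated by \<open>\<mu>1\<close> in the distance to \<open>X1\<close> and by \<open>\<mu>2\<close> in the distance to \<open>X2\<close>;
       these distances add up to at least \<open>\<delta>\<close>.\<close>
  have bound: "\<delta> \<le> C1 * (LINT x|\<mu>1. kern s (h n) (snd x) * \<psi> X1 (fst x)) + C2 * (LINT x|\<mu>2. kern s (h n) (snd x) * \<psi> X2 (fst x))" for n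
  proof -
    let ?k = "\<lambda>x. kern s (h n) (snd x)"
    have k0: "0 \<le> kern s (h n) t" for t by (rule kern_nonneg[OF h0])
    have c1: "tcont L (\<lambda>x. \<delta>)" by (simp add: tcont_def periodic_def)
    note ik = gi[OF g1(1,2) ki[OF c1]] and i1 = gi[OF g1(1,2) ki[OF \<psi>]] and i2 = gi[OF g2(1,2) ki[OF \<psi>]]
    have "\<delta> = \<delta> * (LINT x|\<mu>. g1 x * ?k x)" using one by simp
    also have "\<dots> = (LINT x|\<mu>. g1 x * (?k x * \<delta>))" by (simp add: mult_ac flip: integral_mult_right_zero)
    also have "\<dots> \<le> (LINT x|\<mu>. g1 x * (?k x * \<psi> X1 (fst x)) + g1 x * (?k x * \<psi> X2 (fst x)))"
    proof (rule integral_mono)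
      fix x
      have "g1 x * (?k x * \<delta>) \<le> g1 x * (?k x * (\<psi> X1 (fst x) + \<psi> X2 (fst x)))"
        using g1(2)[of x] k0 tri by (intro mult_left_mono) auto
      then show "g1 x * (?k x * \<delta>) \<le> g1 x * (?k x * \<psi> X1 (fst x)) + g1 x * (?k x * \<psi> X2 (fst x))"
        by (simp add: distrib_left)
    qed (use ik i1 in auto)
    also have "\<dots> = (LINT x|\<mu>. g1 x * (?k x * \<psi> X1 (fst x))) + (LINT x|\<mu>. g1 x * (?k x * \<psi> X2 (fst x)))"
      using i1 by simp
    also have "(LINT x|\<mu>. g1 x * (?k x * \<psi> X2 (fst x))) = (LINT x|\<mu>. g2 x * (?k x * \<psi> X2 (fst x)))"
      by (rule integral_cong_AE) (use i1 i2 eq in \<open>auto elim: eventually_mono\<close>)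
    also have "(LINT x|\<mu>. g1 x * (?k x * \<psi> X1 (fst x))) \<le> C1 * (LINT x|\<mu>1. ?k x * \<psi> X1 (fst x))"
      by (rule g1(7)[OF ki[OF \<psi>]]) (use k0 in \<open>auto simp: \<psi>_def\<close>)
    also have "(LINT x|\<mu>. g2 x * (?k x * \<psi> X2 (fst x))) \<le> C2 * (LINT x|\<mu>2. ?k x * \<psi> X2 (fst x))"
      by (rule g2(7)[OF ki[OF \<psi>]]) (use k0 in \<open>auto simp: \<psi>_def\<close>)
    finally show ?thesis by simp
  qed
  \<comment> \<open>In the limit only the Diracs at height \<open>s\<close> remain, where the distances vanish.\<close>
  have vanish: "(\<lambda>n. LINT x|\<rho>. kern s (h n) (snd x) * \<psi> Y (fst x)) \<longlonglongrightarrow> 0"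
    if \<rho>: "pos_measure_on (QLT L T) \<rho>" "weakly_continuous_slicing L T \<rho> \<eta>" "AE x in \<eta> s. x = Y" for \<rho> \<eta> Y
  proof -
    have "(\<lambda>n. LINT x|\<rho>. kern s (h n) (snd x) * \<psi> Y (fst x)) \<longlonglongrightarrow> (LINT x|\<eta> s. \<psi> Y (fst (x, s)))"
      by (rule slice_bump_limit[OF \<rho>(2,1) cyl h0 hT hl tendsto_const])
    moreover have "(LINT x|\<eta> s. \<psi> Y (fst (x, s))) = (LINT x|\<eta> s. 0)"
    proof (rule integral_cong_AE)
      have "pos_measure_on (QL L) (\<eta> s)" using s by (intro wcs_pos[OF \<rho>(2)]) auto
      then show "(\<lambda>x. \<psi> Y (fst (x, s))) \<in> borel_measurable (\<eta> s)"
        using pos_measure_on_measurable tcont_measurable[OF \<psi>] by auto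
      show "AE x in \<eta> s. \<psi> Y (fst (x, s)) = 0" using \<rho>(3) by eventually_elim (simp add: \<psi>_def)
    qed simp
    ultimately show ?thesis by simp
  qed
  have "(\<lambda>n. C1 * (LINT x|\<mu>1. kern s (h n) (snd x) * \<psi> X1 (fst x)) + C2 * (LINT x|\<mu>2. kern s (h n) (snd x) * \<psi> X2 (fst x)))
      \<longlonglongrightarrow> C1 * 0 + C2 * 0"
    by (intro tendsto_add tendsto_mult tendsto_const vanish[OF g1(4,5,6)] vanish[OF g2(4,5,6)])
  then have "\<delta> \<le> C1 * 0 + C2 * 0" by (rule LIMSEQ_le_const) (use bound in auto)
  then show False using \<delta> by simp
qed

end
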